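(* There is an equality of generating functions $$\sum_{n\ge 0}\ \sum_{\substack{\lambda\vdash n\\ \mu\vdash n}}\mathbf{y}_\lambda\mathbf{z}_\mu\cdot\mathrm{ch}\big(E_\lambda\,\mathbb{C}\mathcal{F}_n\,E_\mu\big)=\prod_{\substack{\text{Lyndon words }w}}\ \sum_{\text{partitions }\rho}\mathbf{y}_{\rho\cdot|w|}\,\mathbf{z}_{w^{|\rho|}}\,L_\rho[h_w].$$
   Context: **Face algebra.** $\mathcal{F}_n$ is the monoid of ordered set partitions of $[n]=\{1,\dots,n\}$ (faces of the braid arrangement) with product $(P_1,\dots,P_k)\cdot(Q_1,\dots,Q_\ell)=(P_1\cap Q_1,P_1\cap Q_2,\dots,P_1\cap Q_\ell,P_2\cap Q_1,\dots,P_k\cap Q_\ell)$ with empty sets removed; $\mathbb{C}\mathcal{F}_n$ is its monoid algebra. $S_n$ acts by $\pi(P_1,\dots,P_k)=(\pi(P_1),\dots,\pi(P_k))$, extended linearly; $(\mathbb{C}\mathcal{F}_n)^{S_n}$ is the invariant subalgebra. $\Pi_n$ is the lattice of set partitions of $[n]$ ordered by refinement ($X\le Y$ iff $X$ refines $Y$; the one-block partition is the maximum), with its natural $S_n$-action; $\sigma:\mathcal{F}_n\to\Pi_n$ forgets the order of the blocks. For $\lambda\vdash n$, $X\in\lambda$ means that the block sizes of $X$ are the parts of $\lambda$. For $n=0$ the only partition is the empty one and the corresponding term of the left-hand side is $1$. **Idempotents.** A cfpoi of an algebra is a complete family of primitive orthogonal idempotents (nonzero idempotents summing to $1$, with pairwise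 products $0$, none a sum of two nonzero orthogonal idempotents). For each $n$ fix (following Saliola) a cfpoi $\{\widehat E_X:X\in\Pi_n\}$ of $\mathbb{C}\mathcal{F}_n$ with $\pi(\widehat E_X)=\widehat E_{\pi(X)}$ for $\pi\in S_n$ such that: $f\widehat E_X=0$ for $f\in\mathcal{F}_n$ with $\sigma(f)\not\ge X$; $\widehat E_X\in\mathrm{span}_{\mathbb{C}}\{f:\sigma(f)\le X\}$; and the coefficients in $\widehat E_X$ of the faces $f$ with $\sigma(f)=X$ sum to $1$ (such families exist). $\{E_\lambda:\lambda\vdash n\}$ is an arbitrary fixed cfpoi of $(\mathbb{C}\mathcal{F}_n)^{S_n}$, indexed so that for some invertible $u\in(\mathbb{C}\mathcal{F}_n)^{S_n}$ one has $E_\lambda=u\big(\sum_{X\in\lambda}\widehat E_X\big)u^{-1}$ for all $\lambda$ (every cfpoi of $(\mathbb{C}\mathcal{F}_n)^{S_n}$ has this form). Since $E_\lambda,E_\mu$ are $S_n$-invariant, $E_\lambda\mathbb{C}\mathcal{F}_nE_\mu$ is an $S_n$-representation. **Symmetric functions.** $\mathrm{ch}$ is the Frobenius characteristic, $h_\alpha=h_{\alpha_1}h_{\alpha_2}\cdots$ (for $\alpha$ a composition, partition or word), $f[g]$ plethysm. $L_m=\mathrm{ch}(\tilde H_{m-3}(\Pi_m)\otimes\mathrm{sgn}_{S_m})$ where $\tilde H_{m-3}(\Pi_m)$ is the top reduced homology (over $\mathbb{C}$) of the order complex of the proper part of $\Pi_m$, with the convention that it is the trivial one-dimensional representation for $m=1$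 (degree $-2$) and $m=2$ (degree $-1$). For a partition $\rho=1^{m_1}2^{m_2}\cdots$, $L_\rho=\prod_i h_{m_i}[L_i]$ (so $L_{\emptyset}=1$). **Words.** A Lyndon word is a finite nonempty word on $\{1,2,\dots\}$ that is strictly lexicographically smaller than all its nontrivial cyclic rotations. For a composition, partition or word $\alpha=(\alpha_1,\dots,\alpha_k)$: $\mathbf{y}_\alpha=y_{\alpha_1}\cdots y_{\alpha_k}$, $\mathbf{z}_\alpha=z_{\alpha_1}\cdots z_{\alpha_k}$ (commuting variables), $|\alpha|=\alpha_1+\dots+\alpha_k$, $\alpha\cdot m=(\alpha_1m,\dots,\alpha_km)$, and $\alpha^m$ is the $m$-fold concatenation of $\alpha$. The sum over partitions $\rho$ includes the empty partition. *)

theory Defs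
  imports
    "HOL-Analysis.Infinite_Sum"
    "HOL-Library.Poly_Mapping"
    "HOL-Library.Multiset"
    "HOL-Library.Disjoint_Sets"
    "HOL-Combinatorics.Orbits"
    "HOL-Algebra.Ring"
begin

section \<open>Formal power series in arbitrarily many commuting variables\<close>

text \<open>\<open>('v, 'a) mps\<close> is \<open>'a[[v : 'v]]\<close>; a monomial is its finitely supported exponent vector.\<close>

typedef ('v, 'a) mps = "UNIV :: (('v \<Rightarrow>\<^sub>0 nat) \<Rightarrow> 'a) set"
  morphisms mps_nth Abs_mps ..

lemma mps_eqI: "(\<And>m. mps_nth f m = mps_nth g m) \<Longrightarrow> f = g"
  by (metis ext mps_nth_inverse)

lemma mps_nth_Abs [simp]: "mps_nth (Abs_mps f) m = f m"
  by (simp add: Abs_mps_inverse)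

instantiation mps :: (type, comm_ring_1) comm_ring_1
begin

definition zero_mps :: "('a, 'b) mps" where "0 = Abs_mps (\<lambda>m. 0)"

definition one_mps :: "('a, 'b) mps" where "1 = Abs_mps (\<lambda>m. if m = 0 then 1 else 0)"

definition plus_mps :: "('a, 'b) mps \<Rightarrow> ('a, 'b) mps \<Rightarrow> ('a, 'b) mps"
  where "f + g = Abs_mps (\<lambda>m. mps_nth f m + mps_nth g m)"

definition minus_mps :: "('a, 'b) mps \<Rightarrow> ('a, 'b) mps \<Rightarrow> ('a, 'b) mps"
  where "f - g = Abs_mps (\<lambda>m. mps_nth f m - mps_nth g m)"

definition uminus_mps :: "('a, 'b) mps \<Rightarrow> ('a, 'b) mps"
  where "- f = Abs_mps (\<lambda>m. - mps_nth f m)"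

definition times_mps :: "('a, 'b) mps \<Rightarrow> ('a, 'b) mps \<Rightarrow> ('a, 'b) mps"
  where "f * g = Abs_mps (\<lambda>m. \<Sum>(a, b) | a + b = m. mps_nth f a * mps_nth g b)"

lemma finite_monomial_splits: "finite {(a, b). a + b = (m :: 'v \<Rightarrow>\<^sub>0 nat)}"
proof -
  define A where "A = {a :: 'v \<Rightarrow>\<^sub>0 nat. \<exists>b. a + b = m}"
  define F where "F = {f :: 'v \<Rightarrow> nat. \<forall>x.
      (x \<in> Poly_Mapping.keys m \<longrightarrow> f x \<in> {0..Max (Poly_Mapping.lookup m ` Poly_Mapping.keys m)}) \<and>
      (x \<notin> Poly_Mapping.keys m \<longrightarrow> f x = 0)}"
  have "finite F"
    unfolding F_def by (rule finite_set_of_finite_funs) auto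
  moreover have "Poly_Mapping.lookup a \<in> F" if aA: "a \<in> A" for a
  proof -
    obtain b where "a + b = m"
      using aA unfolding A_def by blast
    then have le: "Poly_Mapping.lookup a x \<le> Poly_Mapping.lookup m x" for x
      by (metis le_add1 lookup_add)
    have "Poly_Mapping.lookup a x \<le> Max (Poly_Mapping.lookup m ` Poly_Mapping.keys m)"
      if "x \<in> Poly_Mapping.keys m" for x
      by (rule order_trans[OF le Max_ge]) (use that in auto)
    moreover have "Poly_Mapping.lookup a x = 0" if "x \<notin> Poly_Mapping.keys m" for x
      using le[of x] that by (simp add: in_keys_iff)
    ultimately show ?thesis
      unfolding F_def by simp
  qed
  then have "Poly_Mapping.lookup ` A \<subseteq> F"
    by blast
  moreover have "inj_on Poly_Mapping.lookup A"
    by (simp add: inj_on_def poly_mapping_eqI)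
  ultimately have "finite A"
    by (meson finite_imageD finite_subset)
  moreover have "{(a, b). a + b = m} \<subseteq> (\<lambda>a. (a, m - a)) ` A"
    by (auto simp: A_def)
  ultimately show ?thesis
    by (meson finite_imageI finite_subset)
qed

instance
proof
  fix f g h :: "('a, 'b) mps"
  show "f * g * h = f * (g * h)"
  proof (rule mps_eqI)
    fix m :: "'a \<Rightarrow>\<^sub>0 nat"
    let ?S = "{(a, b). a + b = m}"
    let ?T = "\<lambda>c :: 'a \<Rightarrow>\<^sub>0 nat. {(a, b). a + b = c}"
    have "mps_nth (f * g * h) m =
      (\<Sum>((u, c), (a, b))\<in>Sigma ?S (\<lambda>(u, c). ?T u). mps_nth f a * mps_nth g b * mps_nth h c)"
      by (simp add: times_mps_def case_prod_unfold sum_distrib_right sum.Sigma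
          finite_monomial_splits[unfolded case_prod_unfold])
    also have "\<dots> = (\<Sum>((a, v), (b, c))\<in>Sigma ?S (\<lambda>(a, v). ?T v). mps_nth f a * mps_nth g b * mps_nth h c)"
      by (rule sum.reindex_bij_witness
          [where i = "\<lambda>((a, v), (b, c)). ((a + b, c), (a, b))"
             and j = "\<lambda>((u, c), (a, b)). ((a, b + c), (b, c))"])
        (clarsimp simp: add.assoc)+
    also have "\<dots> = mps_nth (f * (g * h)) m"
      by (simp add: times_mps_def case_prod_unfold sum_distrib_left sum.Sigma mult.assoc
          finite_monomial_splits[unfolded case_prod_unfold])
    finally show "mps_nth (f * g * h) m = mps_nth (f * (g * h)) m" .
  qed
  show "f * g = g * f"
  proof (rule mps_eqI)
    fix m :: "'a \<Rightarrow>\<^sub>0 nat"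
    show "mps_nth (f * g) m = mps_nth (g * f) m"
      unfolding times_mps_def mps_nth_Abs
      by (rule sum.reindex_bij_witness[where i = prod.swap and j = prod.swap])
        (auto simp: mult.commute add.commute)
  qed
  show "1 * f = f"
  proof (rule mps_eqI)
    fix m :: "'a \<Rightarrow>\<^sub>0 nat"
    have "mps_nth (1 * f) m = (\<Sum>p\<in>{(a, b). a + b = m}. if p = (0, m) then mps_nth f m else 0)"
      unfolding times_mps_def mps_nth_Abs one_mps_def
      by (rule sum.cong) (auto split: if_splits)
    also have "\<dots> = mps_nth f m"
      by (subst sum.delta[OF finite_monomial_splits]) auto
    finally show "mps_nth (1 * f) m = mps_nth f m" .
  qed
  show "(f + g) * h = f * h + g * h"
    by (rule mps_eqI) (simp add: times_mps_def plus_mps_def case_prod_unfold distrib_right sum.distrib)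
  show "(0 :: ('a, 'b) mps) \<noteq> 1"
  proof
    assume "(0 :: ('a, 'b) mps) = 1"
    then have "mps_nth (0 :: ('a, 'b) mps) 0 = mps_nth 1 0" by simp
    then show False by (simp add: zero_mps_def one_mps_def)
  qed
qed (auto intro!: mps_eqI simp: zero_mps_def plus_mps_def minus_mps_def uminus_mps_def algebra_simps)

end

text \<open>The topology of coefficientwise stabilisation (the product topology for discrete
  coefficients), which gives meaning to infinite sums and products of formal power series.\<close>

instantiation mps :: (type, type) t2_space
begin

definition open_mps :: "('a, 'b) mps set \<Rightarrow> bool" where
  "open_mps U \<longleftrightarrow>
     (\<forall>f\<in>U. \<exists>M. finite M \<and> (\<forall>g. (\<forall>m\<in>M. mps_nth g m = mps_nth f m) \<longrightarrow> g \<in> U))"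

instance
proof
  show "open (UNIV :: ('a, 'b) mps set)"
    by (auto simp: open_mps_def)
next
  fix S T :: "('a, 'b) mps set"
  assume S: "open S" and T: "open T"
  show "open (S \<inter> T)"
    unfolding open_mps_def
  proof
    fix f assume f: "f \<in> S \<inter> T"
    obtain M where M: "finite M" "\<And>g. (\<forall>m\<in>M. mps_nth g m = mps_nth f m) \<Longrightarrow> g \<in> S"
      using S f unfolding open_mps_def by (metis IntD1)
    obtain N where N: "finite N" "\<And>g. (\<forall>m\<in>N. mps_nth g m = mps_nth f m) \<Longrightarrow> g \<in> T"
      using T f unfolding open_mps_def by (metis IntD2)
    show "\<exists>M. finite M \<and> (\<forall>g. (\<forall>m\<in>M. mps_nth g m = mps_nth f m) \<longrightarrow> g \<in> S \<inter> T)"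
      by (rule exI[of _ "M \<union> N"]) (simp add: M N)
  qed
next
  fix K :: "('a, 'b) mps set set"
  assume K: "\<forall>S\<in>K. open S"
  show "open (\<Union>K)"
    unfolding open_mps_def
  proof
    fix f assume "f \<in> \<Union>K"
    then obtain S where S: "S \<in> K" "f \<in> S" by blast
    then obtain M where "finite M" "\<And>g. (\<forall>m\<in>M. mps_nth g m = mps_nth f m) \<Longrightarrow> g \<in> S"
      using K unfolding open_mps_def by metis
    with S show "\<exists>M. finite M \<and> (\<forall>g. (\<forall>m\<in>M. mps_nth g m = mps_nth f m) \<longrightarrow> g \<in> \<Union>K)"
      by blast
  qed
next
  fix f g :: "('a, 'b) mps"
  assume "f \<noteq> g"
  then obtain m where m: "mps_nth f m \<noteq> mps_nth g m"
    using mps_eqI by blast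
  have op: "open {h :: ('a, 'b) mps. mps_nth h m = c}" for c
    unfolding open_mps_def by (intro ballI exI[of _ "{m}"]) simp
  show "\<exists>U V. open U \<and> open V \<and> f \<in> U \<and> g \<in> V \<and> U \<inter> V = {}"
    using m op by (intro exI[of _ "{h. mps_nth h m = mps_nth f m}"] exI[of _ "{h. mps_nth h m = mps_nth g m}"]) auto
qed

end

definition mps_const :: "'a :: comm_ring_1 \<Rightarrow> ('v, 'a) mps" where
  "mps_const c = Abs_mps (\<lambda>m. if m = 0 then c else 0)"

definition mps_var :: "'v \<Rightarrow> ('v, 'a :: comm_ring_1) mps" where
  "mps_var v = Abs_mps (\<lambda>m. if m = Poly_Mapping.single v 1 then 1 else 0)"


section \<open>Partitions and Lyndon words\<close>

definition partitions :: "nat multiset set" where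
  "partitions = {\<rho>. 0 \<notin># \<rho>}"

definition partitions_of :: "nat \<Rightarrow> nat multiset set" where
  "partitions_of n = {\<rho> \<in> partitions. \<Sum>\<^sub># \<rho> = n}"

definition lyndon_words :: "nat list set" where
  "lyndon_words = {w. w \<noteq> [] \<and> 0 \<notin> set w \<and>
     (\<forall>k. 0 < k \<and> k < length w \<longrightarrow> (w, rotate k w) \<in> lexord less_than)}"


section \<open>Symmetric functions\<close>

text \<open>Symmetric functions over the complex numbers, as power series in \<open>x\<^sub>0, x\<^sub>1, \<dots>\<close>\<close>

type_synonym symfun = "(nat, complex) mps"

definition monomial_degree :: "('v \<Rightarrow>\<^sub>0 nat) \<Rightarrow> nat" where
  "monomial_degree m = (\<Sum>v\<in>Poly_Mapping.keys m. Poly_Mapping.lookup m v)"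

definition sym_h :: "nat \<Rightarrow> symfun" where
  "sym_h k = Abs_mps (\<lambda>m. if monomial_degree m = k then 1 else 0)"

text \<open>The power sum \<open>p\<^sub>k\<close>, for \<open>k > 0\<close>\<close>

definition sym_p :: "nat \<Rightarrow> symfun" where
  "sym_p k = Abs_mps (\<lambda>m. if \<exists>i. m = Poly_Mapping.single i k then 1 else 0)"

definition sym_h_word :: "nat list \<Rightarrow> symfun" where
  "sym_h_word w = (\<Prod>i\<leftarrow>w. sym_h i)"

text \<open>\<open>p\<^sub>k[g] = g(x\<^sub>0\<^sup>k, x\<^sub>1\<^sup>k, \<dots>)\<close>, for \<open>k > 0\<close>\<close>

definition power_subst :: "nat \<Rightarrow> symfun \<Rightarrow> symfun" where
  "power_subst k g = Abs_mps (\<lambda>m.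
     if \<forall>i. k dvd Poly_Mapping.lookup m i then mps_nth g (Poly_Mapping.map (\<lambda>e. e div k) m) else 0)"

text \<open>The coordinates of a symmetric function in the basis of power sum products\<close>

definition power_sum_coords :: "symfun \<Rightarrow> nat multiset \<Rightarrow>\<^sub>0 complex" where
  "power_sum_coords f = (THE c. Poly_Mapping.keys c \<subseteq> partitions \<and>
     f = (\<Sum>\<rho>\<in>Poly_Mapping.keys c. mps_const (Poly_Mapping.lookup c \<rho>) * (\<Prod>k\<in>#\<rho>. sym_p k)))"

text \<open>Plethysm \<open>f[g]\<close>: the algebra homomorphism in \<open>f\<close> with \<open>p\<^sub>k \<mapsto> p\<^sub>k[g]\<close>\<close>

definition plethysm :: "symfun \<Rightarrow> symfun \<Rightarrow> symfun" where
  "plethysm f g = (\<Sum>\<rho>\<in>Poly_Mapping.keys (power_sum_coords f).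
     mps_const (Poly_Mapping.lookup (power_sum_coords f) \<rho>) * (\<Prod>k\<in>#\<rho>. power_subst k g))"


section \<open>Free complex vector spaces and Frobenius characteristic\<close>

definition pm_scale :: "complex \<Rightarrow> ('a \<Rightarrow>\<^sub>0 complex) \<Rightarrow> ('a \<Rightarrow>\<^sub>0 complex)" where
  "pm_scale c f = Poly_Mapping.map ((*) c) f"

lemma lookup_pm_scale [simp]: "Poly_Mapping.lookup (pm_scale c f) x = c * Poly_Mapping.lookup f x"
  by (simp add: pm_scale_def Poly_Mapping.map.rep_eq when_def)

interpretation fvs: vector_space "pm_scale :: complex \<Rightarrow> ('a \<Rightarrow>\<^sub>0 complex) \<Rightarrow> ('a \<Rightarrow>\<^sub>0 complex)"
  by unfold_locales (auto intro!: poly_mapping_eqI simp: lookup_add algebra_simps)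

abbreviation basis_vec :: "'a \<Rightarrow> ('a \<Rightarrow>\<^sub>0 complex)" where
  "basis_vec a \<equiv> Poly_Mapping.single a 1"

definition lin_ext :: "('a \<Rightarrow> ('b \<Rightarrow>\<^sub>0 complex)) \<Rightarrow> ('a \<Rightarrow>\<^sub>0 complex) \<Rightarrow> ('b \<Rightarrow>\<^sub>0 complex)" where
  "lin_ext g f = (\<Sum>a\<in>Poly_Mapping.keys f. pm_scale (Poly_Mapping.lookup f a) (g a))"

text \<open>The trace of the map that \<open>T\<close> induces on \<open>Z / B\<close>, for finite-dimensional \<open>T\<close>-invariant
  \<open>B \<subseteq> Z\<close>: a basis \<open>D\<close> of \<open>B\<close> is extended to a basis \<open>C\<close> of \<open>Z\<close>, so that the classes of
  \<open>C - D\<close> form a basis of \<open>Z / B\<close>.\<close>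

definition subquot_trace ::
  "('a \<Rightarrow>\<^sub>0 complex) set \<Rightarrow> ('a \<Rightarrow>\<^sub>0 complex) set \<Rightarrow> (('a \<Rightarrow>\<^sub>0 complex) \<Rightarrow> ('a \<Rightarrow>\<^sub>0 complex)) \<Rightarrow> complex"
  where
  "subquot_trace Z B T =
     (let (D, C) = (SOME (D, C). D \<subseteq> C \<and> fvs.independent C \<and> fvs.span D = B \<and> fvs.span C = Z)
      in \<Sum>c\<in>C - D. fvs.representation C (T c) c)"

text \<open>The Frobenius characteristic of the representation of \<open>S\<^sub>n\<close> on \<open>Z / B\<close> given by \<open>act\<close>.
  The sets \<open>orbit \<pi> i\<close> are the cycles of \<open>\<pi>\<close>, including the fixed points.\<close>

definition frobenius_ch ::
  "nat \<Rightarrow> ('a \<Rightarrow>\<^sub>0 complex) set \<Rightarrow> ('a \<Rightarrow>\<^sub>0 complex) set \<Rightarrow>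
   ((nat \<Rightarrow> nat) \<Rightarrow> ('a \<Rightarrow>\<^sub>0 complex) \<Rightarrow> ('a \<Rightarrow>\<^sub>0 complex)) \<Rightarrow> symfun" where
  "frobenius_ch n Z B act = mps_const (1 / fact n) *
     (\<Sum>\<pi> | \<pi> permutes {1..n}.
        mps_const (subquot_trace Z B (act \<pi>)) * (\<Prod>c\<in>orbit \<pi> ` {1..n}. sym_p (card c)))"


section \<open>Homology of the partition lattice\<close>

definition set_partitions :: "nat \<Rightarrow> nat set set set" where
  "set_partitions n = {X. partition_on {1..n} X}"

definition block_type :: "nat set set \<Rightarrow> nat multiset" where
  "block_type X = image_mset card (mset_set X)"

definition proper_part :: "nat \<Rightarrow> nat set set set" where
  "proper_part n = set_partitions n - {(\<lambda>i. {i}) ` {1..n}, {{1..n}}}"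

text \<open>Simplices of the order complex of the poset \<open>(V, leq)\<close> with \<open>k\<close> vertices, that is, of
  dimension \<open>k - 1\<close>; for \<open>k = 0\<close> this is the empty simplex, so homology is reduced.\<close>

definition simplices :: "'a set \<Rightarrow> ('a \<Rightarrow> 'a \<Rightarrow> bool) \<Rightarrow> nat \<Rightarrow> 'a set set" where
  "simplices V leq k =
     {C. C \<subseteq> V \<and> finite C \<and> card C = k \<and> (\<forall>x\<in>C. \<forall>y\<in>C. leq x y \<or> leq y x)}"

definition chain_space :: "'a set \<Rightarrow> ('a \<Rightarrow> 'a \<Rightarrow> bool) \<Rightarrow> nat \<Rightarrow> ('a set \<Rightarrow>\<^sub>0 complex) set" where
  "chain_space V leq k = fvs.span (basis_vec ` simplices V leq k)"

definition boundary :: "('a \<Rightarrow> 'a \<Rightarrow> bool) \<Rightarrow> ('a set \<Rightarrow>\<^sub>0 complex) \<Rightarrow> ('a set \<Rightarrow>\<^sub>0 complex)" where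
  "boundary leq = lin_ext (\<lambda>C. \<Sum>x\<in>C.
     Poly_Mapping.single (C - {x}) ((- 1) ^ card {y \<in> C. y \<noteq> x \<and> leq y x}))"

definition cycles :: "'a set \<Rightarrow> ('a \<Rightarrow> 'a \<Rightarrow> bool) \<Rightarrow> nat \<Rightarrow> ('a set \<Rightarrow>\<^sub>0 complex) set" where
  "cycles V leq k = {c \<in> chain_space V leq k. boundary leq c = 0}"

definition boundaries :: "'a set \<Rightarrow> ('a \<Rightarrow> 'a \<Rightarrow> bool) \<Rightarrow> nat \<Rightarrow> ('a set \<Rightarrow>\<^sub>0 complex) set" where
  "boundaries V leq k = boundary leq ` chain_space V leq (Suc k)"

definition perm_partition :: "(nat \<Rightarrow> nat) \<Rightarrow> nat set set \<Rightarrow> nat set set" where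
  "perm_partition \<pi> X = (\<lambda>b. \<pi> ` b) ` X"

text \<open>The characteristic of the top reduced homology (degree \<open>m - 3\<close>, so \<open>m - 2\<close> vertices)
  tensored with the sign representation. For \<open>m = 1\<close> the subtraction truncates and gives the
  span of the empty simplex; this is the convention that the homology is then trivial of
  dimension one.\<close>

definition sym_L :: "nat \<Rightarrow> symfun" where
  "sym_L m = frobenius_ch m
     (cycles (proper_part m) (refines {1..m}) (m - 2))
     (boundaries (proper_part m) (refines {1..m}) (m - 2))
     (\<lambda>\<pi> v. pm_scale (of_int (sign \<pi>)) (lin_ext (\<lambda>C. basis_vec (perm_partition \<pi> ` C)) v))"

definition sym_L_part :: "nat multiset \<Rightarrow> symfun" where
  "sym_L_part \<rho> = (\<Prod>i\<in>set_mset \<rho>. plethysm (sym_h (count \<rho> i)) (sym_L i))"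


section \<open>Complete families of primitive orthogonal idempotents\<close>

definition idempotent_in :: "('a, 'b) ring_scheme \<Rightarrow> 'a \<Rightarrow> bool" where
  "idempotent_in R e \<longleftrightarrow> e \<in> carrier R \<and> e \<otimes>\<^bsub>R\<^esub> e = e"

definition primitive_idempotent :: "('a, 'b) ring_scheme \<Rightarrow> 'a \<Rightarrow> bool" where
  "primitive_idempotent R e \<longleftrightarrow> idempotent_in R e \<and> e \<noteq> \<zero>\<^bsub>R\<^esub> \<and>
     \<not> (\<exists>a b. idempotent_in R a \<and> idempotent_in R b \<and> a \<noteq> \<zero>\<^bsub>R\<^esub> \<and> b \<noteq> \<zero>\<^bsub>R\<^esub> \<and>
          a \<otimes>\<^bsub>R\<^esub> b = \<zero>\<^bsub>R\<^esub> \<and> b \<otimes>\<^bsub>R\<^esub> a = \<zero>\<^bsub>R\<^esub> \<and> e = a \<oplus>\<^bsub>R\<^esub> b)"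

definition cfpoi :: "('a, 'b) ring_scheme \<Rightarrow> 'i set \<Rightarrow> ('i \<Rightarrow> 'a) \<Rightarrow> bool" where
  "cfpoi R I e \<longleftrightarrow> finite I \<and> (\<forall>i\<in>I. primitive_idempotent R (e i)) \<and>
     (\<forall>i\<in>I. \<forall>j\<in>I. i \<noteq> j \<longrightarrow> e i \<otimes>\<^bsub>R\<^esub> e j = \<zero>\<^bsub>R\<^esub>) \<and>
     (\<Oplus>\<^bsub>R\<^esub>i\<in>I. e i) = \<one>\<^bsub>R\<^esub>"


section \<open>The face algebra of the braid arrangement\<close>

text \<open>Ordered set partitions of \<open>{1..n}\<close>\<close>

definition faces :: "nat \<Rightarrow> nat set list set" where
  "faces n = {P. distinct P \<and> partition_on {1..n} (set P)}"

definition face_prod :: "nat set list \<Rightarrow> nat set list \<Rightarrow> nat set list" where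
  "face_prod P Q = [p \<inter> q. p \<leftarrow> P, q \<leftarrow> Q, p \<inter> q \<noteq> {}]"

definition face_mult ::
  "(nat set list \<Rightarrow>\<^sub>0 complex) \<Rightarrow> (nat set list \<Rightarrow>\<^sub>0 complex) \<Rightarrow> (nat set list \<Rightarrow>\<^sub>0 complex)" where
  "face_mult f g = lin_ext (\<lambda>P. lin_ext (\<lambda>Q. basis_vec (face_prod P Q)) g) f"

definition face_algebra :: "nat \<Rightarrow> (nat set list \<Rightarrow>\<^sub>0 complex) ring" where
  "face_algebra n =
     \<lparr>carrier = fvs.span (basis_vec ` faces n), mult = face_mult,
      one = basis_vec (if n = 0 then [] else [{1..n}]), zero = 0, add = (+)\<rparr>"

definition face_act ::
  "(nat \<Rightarrow> nat) \<Rightarrow> (nat set list \<Rightarrow>\<^sub>0 complex) \<Rightarrow> (nat set list \<Rightarrow>\<^sub>0 complex)" where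
  "face_act \<pi> = lin_ext (\<lambda>P. basis_vec (map (\<lambda>b. \<pi> ` b) P))"

definition invariant_algebra :: "nat \<Rightarrow> (nat set list \<Rightarrow>\<^sub>0 complex) ring" where
  "invariant_algebra n = (face_algebra n)
     \<lparr>carrier := {f \<in> carrier (face_algebra n). \<forall>\<pi>. \<pi> permutes {1..n} \<longrightarrow> face_act \<pi> f = f}\<rparr>"

text \<open>The forgetful map from faces to set partitions is \<open>set\<close>.\<close>

definition saliola_family :: "nat \<Rightarrow> (nat set set \<Rightarrow> (nat set list \<Rightarrow>\<^sub>0 complex)) \<Rightarrow> bool" where
  "saliola_family n e \<longleftrightarrow>
     cfpoi (face_algebra n) (set_partitions n) e \<and>
     (\<forall>X\<in>set_partitions n.
        (\<forall>\<pi>. \<pi> permutes {1..n} \<longrightarrow> face_act \<pi> (e X) = e (perm_partition \<pi> X)) \<and>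
        (\<forall>f\<in>faces n. \<not> refines {1..n} X (set f) \<longrightarrow> face_mult (basis_vec f) (e X) = 0) \<and>
        e X \<in> fvs.span (basis_vec ` {f \<in> faces n. refines {1..n} (set f) X}) \<and>
        (\<Sum>f | f \<in> faces n \<and> set f = X. Poly_Mapping.lookup (e X) f) = 1)"

text \<open>The set \<open>a \<cdot> R \<cdot> b\<close>\<close>

definition peirce_part :: "('a, 'b) ring_scheme \<Rightarrow> 'a \<Rightarrow> 'a \<Rightarrow> 'a set" where
  "peirce_part R a b = {a \<otimes>\<^bsub>R\<^esub> x \<otimes>\<^bsub>R\<^esub> b | x. x \<in> carrier R}"


section \<open>Generating functions\<close>

datatype yz_var = Y nat | Z nat

text \<open>Power series in the \<open>y\<^sub>i\<close> and \<open>z\<^sub>i\<close> with symmetric functions as coefficients\<close>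

type_synonym gen_fun = "(yz_var, symfun) mps"

definition y_mon :: "nat multiset \<Rightarrow> gen_fun" where
  "y_mon \<alpha> = (\<Prod>i\<in>#\<alpha>. mps_var (Y i))"

definition z_mon :: "nat multiset \<Rightarrow> gen_fun" where
  "z_mon \<alpha> = (\<Prod>i\<in>#\<alpha>. mps_var (Z i))"

definition peirce_term :: "(nat multiset \<Rightarrow> (nat set list \<Rightarrow>\<^sub>0 complex)) \<Rightarrow> nat \<Rightarrow> gen_fun" where
  "peirce_term E n = (\<Sum>\<rho>\<in>partitions_of n. \<Sum>\<mu>\<in>partitions_of n. y_mon \<rho> * z_mon \<mu> *
     mps_const (frobenius_ch n (peirce_part (face_algebra n) (E \<rho>) (E \<mu>)) {0} face_act))"

definition lyndon_term :: "nat list \<Rightarrow> nat multiset \<Rightarrow> gen_fun" where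
  "lyndon_term w \<rho> =
     y_mon (image_mset (\<lambda>i. i * sum_list w) \<rho>) *
     z_mon (mset (concat (replicate (\<Sum>\<^sub># \<rho>) w))) *
     mps_const (plethysm (sym_L_part \<rho>) (sym_h_word w))"

end

(* The trace of a permutation on a Peirce component is a sum, over the stable pairs of partitions of the given types, of a
 Moebius-inverted count of compatible orders.  Such weights are multiplicative over orbits of blocks, so the Frobenius
 characteristics satisfy a Newton recursion n f(n) = sum g(k) f(n-k).  Splitting the words in g by their Lyndon roots
 gives the logarithmic derivative of the product; the factors L come from the traces on the top homology, computed
 by the Hopf trace formula and Philip Hall's theorem. *)
theory Submission
 imports Defs "HOL-Combinatorics.Cycles" "HOL-Computational_Algebra.Formal_Power_Series"
begin

text \<open>The idempotents are known only through their properties, so no trace is computed from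
  them directly. The sum of the idempotents with index below X and the average of the faces over X
  absorb each other under multiplication and hence give equal traces; with averages a trace merely
  counts fixed faces, and inversion over stable partitions in both indices isolates single
  idempotents. The factor g of the recursion contains a sum over permutations of one block
  (\<open>core_sym\<close>) that is never evaluated by itself. It is free of y-variables, so all y
  may be set to 1: this undoes the inversion and leaves the series of all words, the inverse of 1 -
  z_1 h_1 - z_2 h_2 - ..., whose logarithmic derivative is explicit. Comparing coefficients gives a
  triangular system over divisors for the unknown. A sum over Lyndon roots solves the same system,
  because the sum of s p_(n/s)[L_s] over the divisors s of n is p_1^n. Derivatives are taken in an
  auxiliary power series variable. It marks the weighted degree in the z-variables, so that setting
  it to 1 at the end loses nothing.\<close>

abbreviation "lookup \<equiv> Poly_Mapping.lookup"

abbreviation "keys \<equiv> Poly_Mapping.keys"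

lemmas sum_eqI = sum.cong[OF refl]

section \<open>Stable partitions and the refinement order\<close>

definition stab :: "'a set => ('a => 'a) => 'a set set set" where "stab S t = {X. partition_on S X & (`) t`X = X}"

text \<open>Unlike \<open>refines\<close>, this carries no ground set, so the same relation can be
  used for restrictions, for unions over disjoint ground sets and for empty families.\<close>

definition finer :: "'a set set => 'a set set => bool" where "finer P X \<longleftrightarrow> (ALL y:P. EX x:X. y <= x)"

definition below :: "'a set set => 'a set => 'a set set" where "below X B = {x:X. x <= B}"

definition interval :: "('a => 'a) => 'a set set => 'a set set => 'a set set set" where
 "interval t P X = {M:stab (\<Union>X) t. finer P M & finer M X}"

lemma finer_refl [simp]: "finer X X" by (auto simp: finer_def)

lemma finer_trans: "finer X P ==> finer P M ==> finer X M" unfolding finer_def by (meson order_trans)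

lemma partition_on_member_eq: "partition_on S X ==> a:X ==> b:X ==> x:a ==> x:b ==> a = b" by (auto simp: partition_on_def disjoint_def)

lemma finer_antisym:
 assumes "partition_on S X" "partition_on S P" "finer X P" "finer P X"
 shows "X = P" using assms refines_asym[of S X P] by (simp add: refines_def finer_def)

lemma stabD:
 assumes "X:stab S t"
 shows "partition_on S X" "(`) t`X = X" "\<Union>X = S" using assms by (auto simp: stab_def partition_on_def)

lemma finite_stab [simp]: "finite S ==> finite (stab S t)"
 by (rule finite_subset[of _ "{X. partition_on S X}"]) (auto simp: stab_def finitely_many_partition_on)

lemma stab_empty [simp]: "stab {} t = {{}}" by (auto simp: stab_def partition_on_empty)

lemma finite_interval [simp]: "finite (\<Union>X) ==> finite (interval t P X)"
 by (rule finite_subset[of _ "stab (\<Union>X) t"]) (auto simp: interval_def)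

lemma interval_self: "X:stab S t ==> finer P X ==> X:interval t P X" by (auto simp: interval_def stabD)

lemma finer_Union: "finer P X ==> \<Union>P <= \<Union>X" unfolding finer_def by blast

lemma finer_one_block: "\<Union>P <= S ==> finer P {S}" by (auto simp: finer_def)

lemma stab_one_block: "bij_betw t S S ==> S ~= {} ==> {S}:stab S t" by (auto simp: stab_def partition_on_space bij_betw_def)

lemma stab_cong: "(!!x. x:S ==> t x = t' x) ==> stab S t = stab S t'"
proof -
 assume *: "!!x. x:S ==> t x = t' x"
 have "(`) t`X = (`) t' ` X" if "partition_on S X" for X proof (rule image_cong[OF refl], goal_cases)
  case (1 b)
  hence "b <= S" using that by (auto simp: partition_on_def)
  thus ?case using * by (intro image_cong refl) auto
 qed
 thus ?thesis unfolding stab_def by (metis (mono_tags, lifting))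
qed

lemma image_image_inj_iff:
 assumes "inj_on g S" "P <= Pow S" "M <= Pow S"
 shows "(`) g`P = (`) g`M \<longleftrightarrow> P = M" using inj_on_image_eq_iff[OF inj_on_image_Pow[OF assms(1)]] assms by blast

lemma image_subset_inj_iff:
 assumes "inj_on g S" "a <= S" "b <= S"
 shows "g`a <= g`b \<longleftrightarrow> a <= b"
proof
 assume l: "g`a <= g`b" show "a <= b" proof
  fix x assume "x:a"
  hence "g x:g`b" "x:S" using l assms by auto
  thus "x:b" using inj_on_image_mem_iff[OF assms(1) \<open>x \<in> S\<close> assms(3)] by simp
 qed
qed auto

lemma finer_image:
 assumes "inj_on g S" "P <= Pow S" "X <= Pow S"
 shows "finer ((`) g`P) ((`) g`X) \<longleftrightarrow> finer P X"
proof -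
 have "g`y <= g`x \<longleftrightarrow> y <= x" if "y:P" "x:X" for x y using that assms by (intro image_subset_inj_iff[OF assms(1)]) auto
 thus ?thesis unfolding finer_def by simp
qed

lemma partition_on_subset_Pow: "partition_on S X ==> X <= Pow S" by (auto simp: partition_on_def)

lemma partition_on_image_iff:
 assumes "inj_on g S" "P <= Pow S"
 shows "partition_on (g`S) ((`) g`P) \<longleftrightarrow> partition_on S P"
proof
 assume "partition_on S P"
 thus "partition_on (g`S) ((`) g`P)" proof -
  have "(`) g`P - {{}} = (`) g`P" using \<open>partition_on S P\<close> by (auto simp: partition_on_def)
  thus ?thesis using partition_on_inj_image[OF \<open>partition_on S P\<close> assms(1)] by simp
 qed
next
 assume R: "partition_on (g`S) ((`) g`P)" show "partition_on S P" proof (rule partition_onI)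
  have "g`S = g`\<Union>P" using R by (simp add: partition_on_def image_Union)
  thus "\<Union>P = S" using assms inj_on_image_eq_iff[OF assms(1), of S "\<Union>P"] by auto
  show "{} ~: P" using R by (auto simp: partition_on_def)
  show "disjnt p q" if "p:P" "q:P" "p ~= q" for p q proof -
   have "g`p ~= g`q" using that assms by (subst inj_on_image_eq_iff[OF assms(1)]) auto
   hence "g`p Int g`q = {}" using R that by (auto simp: partition_on_def disjoint_def)
   thus ?thesis by (auto simp: disjnt_def)
  qed
 qed
qed

lemma stab_subset_Pow: "X:stab S t ==> X <= Pow S" by (auto simp: stab_def partition_on_def)

lemma stab_image:
 assumes g: "inj_on g S" and t: "bij_betw t S S" and c: "!!x. x:S ==> t' (g x) = g (t x)" and P: "P <= Pow S"
 shows "(`) g`P:stab (g`S) t' \<longleftrightarrow> P:stab S t"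
proof -
 have "t' ` g`y = g`t`y" if "y:P" for y using that P c by (auto simp: image_image intro!: image_cong)
 hence "(`) t' ` (`) g`P = (`) g`(`) t`P" by (simp add: image_image)
 moreover have "(`) t`P <= Pow S" using P t by (auto simp: bij_betw_def)
 ultimately show ?thesis using image_image_inj_iff[OF g] P partition_on_image_iff[OF g P] by (auto simp: stab_def)
qed

text \<open>Conjugate permutations have corresponding stable partitions. Agreement of
  \<open>t'\<close> with the conjugate of \<open>t\<close> is demanded only on the image of
  \<open>S\<close>, so neither map has to be extended or inverted globally.\<close>

lemma bij_betw_stab_image:
 assumes g: "inj_on g S" and t: "bij_betw t S S" and c: "!!x. x:S ==> t' (g x) = g (t x)"
 shows "bij_betw ((`) ((`) g)) (stab S t) (stab (g`S) t')" unfolding bij_betw_def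
proof
 show "inj_on ((`) ((`) g)) (stab S t)" using image_image_inj_iff[OF g stab_subset_Pow stab_subset_Pow] by (simp add: inj_on_def)
 show "(`) ((`) g)`stab S t = stab (g`S) t'" proof
  show "(`) ((`) g)`stab S t <= stab (g`S) t'" using stab_image[OF g t c stab_subset_Pow] by (simp add: image_subset_iff)
  show "stab (g`S) t' <= (`) ((`) g)`stab S t" proof
   fix P assume P: "P:stab (g`S) t'"
   hence "P <= (`) g`Pow S" using stab_subset_Pow[OF P] by (simp add: image_Pow_surj)
   then obtain M where "M <= Pow S" "P = (`) g`M" by (metis subset_image_iff)
   thus "P:(`) ((`) g)`stab S t" using stab_image[OF g t c] P by simp
  qed
 qed
qed

lemma stab_Un:
 assumes "X1:stab S1 t" "X2:stab S2 t" "S1 Int S2 = {}"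
 shows "X1 Un X2:stab (S1 Un S2) t"
proof -
 have "partition_on (S1 Un S2) (X1 Un X2)" using assms by (auto simp: stab_def partition_on_def intro!: disjoint_union)
 thus ?thesis using assms by (auto simp: stab_def image_Un)
qed

lemma below_Un_left:
 assumes "partition_on S1 X1" "partition_on S2 X2" "S1 Int S2 = {}"
 shows "below (X1 Un X2) S1 = X1"
proof -
 have "x <= S1" if "x:X1" for x using assms(1) that by (auto simp: partition_on_def)
 moreover have "\<not> x <= S1" if "x:X2" for x proof -
  have "x <= S2" "x ~= {}" using assms(2) that by (auto simp: partition_on_def)
  thus ?thesis using assms(3) by blast
 qed
 ultimately show ?thesis unfolding below_def by blast
qed

lemma below_Un_right:
 assumes "partition_on S1 X1" "partition_on S2 X2" "S1 Int S2 = {}"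
 shows "below (X1 Un X2) S2 = X2" using below_Un_left[of S2 X2 S1 X1] assms by (simp add: Un_commute Int_commute)

lemma partition_on_below:
 assumes X: "partition_on S X" and S1: "S1 <= S" and f: "!!x. x:X ==> x <= S1 | x Int S1 = {}"
 shows "partition_on S1 (below X S1)" proof (rule partition_onI)
  have "S1 <= \<Union>X" using X S1 by (simp add: partition_on_def)
  moreover have "EX b:below X S1. x:b" if x: "x:S1" for x proof -
   have "x:\<Union>X" using \<open>S1 \<subseteq> \<Union>X\<close> x by blast
   then obtain b where "b:X" "x:b" by blast
   thus ?thesis using f[of b] x by (auto simp: below_def)
  qed
  ultimately show "\<Union>(below X S1) = S1" by (auto simp: below_def)
  show "{} ~: below X S1" using X by (auto simp: below_def partition_on_def)
  show "disjnt p q" if "p:below X S1" "q:below X S1" "p ~= q" for p q using that X by (auto simp: below_def partition_on_def disjoint_def disjnt_def)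
 qed

lemma stab_below:
 assumes X: "X:stab S t" and t: "bij_betw t S S" and S1: "S1 <= S" "t`S1 = S1" and f: "!!x. x:X ==> x <= S1 | x Int S1 = {}"
 shows "below X S1:stab S1 t"
proof -
 have "partition_on S1 (below X S1)" using partition_on_below[OF stabD(1)[OF X] S1(1) f] by simp
 moreover have "(`) t`below X S1 = below X S1" proof
  show "(`) t`below X S1 <= below X S1" proof (rule image_subsetI)
   fix b assume "b:below X S1"
   hence "t`b:(`) t`X" "t`b <= t`S1" by (auto simp: below_def)
   thus "t`b:below X S1" using S1 stabD(2)[OF X] by (simp add: below_def)
  qed
  show "below X S1 <= (`) t`below X S1" proof
   fix b assume b: "b:below X S1"
   hence "b:(`) t`X" using stabD(2)[OF X] by (simp add: below_def)
   then obtain b' where b': "b':X" "b = t`b'" by auto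
   have "t`b' <= t`S1" using b b' S1 by (auto simp: below_def)
   moreover have "b' <= S" using b' X by (auto simp: stab_def partition_on_def)
   ultimately have "b' <= S1" using image_subset_inj_iff[of t S b' S1] t S1 by (auto simp: bij_betw_def)
   thus "b:(`) t`below X S1" using b' by (auto simp: below_def)
  qed
 qed
 ultimately show ?thesis by (simp add: stab_def)
qed

lemma finer_disjoint_cases:
 assumes "finer P {S1, S2}" "S1 Int S2 = {}" "y:P"
 shows "y <= S1 | y Int S1 = {}" using assms unfolding finer_def by blast

lemma finer_split:
 assumes "X1:stab S1 t" "X2:stab S2 t" "finer P (X1 Un X2)"
 shows "finer P {S1, S2}"
proof -
 have "finer (X1 Un X2) {S1, S2}" using assms stabD(3)[of X1 S1 t] stabD(3)[of X2 S2 t] by (auto simp: finer_def)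
 thus ?thesis using assms(3) finer_trans by blast
qed

lemma finer_Un_iff:
 assumes "partition_on S1 Y1" "partition_on S2 Y2" "partition_on S1 X1" "partition_on S2 X2" "S1 Int S2 = {}"
 shows "finer (Y1 Un Y2) (X1 Un X2) \<longleftrightarrow> finer Y1 X1 & finer Y2 X2"
proof -
 have sub: "y <= S1" "y ~= {}" if "y:Y1 Un X1" for y using that assms(1,3) by (auto simp: partition_on_def)
 have sub': "y <= S2" "y ~= {}" if "y:Y2 Un X2" for y using that assms(2,4) by (auto simp: partition_on_def)
 have 1: "x:X1" if y: "y:Y1" "x:X1 Un X2" "y <= x" for x y proof (rule ccontr)
  assume "x ~: X1"
  hence "y <= S2" "y <= S1" "y ~= {}" using y sub[of y] sub'(1)[of x] by auto
  thus False using assms(5) by auto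
 qed
 have 2: "x:X2" if y: "y:Y2" "x:X1 Un X2" "y <= x" for x y proof (rule ccontr)
  assume "x ~: X2"
  hence "y <= S1" "y <= S2" "y ~= {}" using y sub(1)[of x] sub'[of y] by auto
  thus False using assms(5) by auto
 qed
 show ?thesis proof
  assume f: "finer (Y1 Un Y2) (X1 Un X2)"
  have "EX x:X1. y <= x" if "y:Y1" for y using f 1[OF that] that by (meson UnI1 finer_def)
  moreover have "EX x:X2. y <= x" if "y:Y2" for y using f 2[OF that] that by (meson UnI2 finer_def)
  ultimately show "finer Y1 X1 & finer Y2 X2" by (simp add: finer_def)
 next
  assume "finer Y1 X1 & finer Y2 X2"
  thus "finer (Y1 Un Y2) (X1 Un X2)" unfolding finer_def by (metis Un_iff)
 qed
qed

lemma stab_split: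
 assumes "bij_betw t S1 S1" "bij_betw t S2 S2" "S1 Int S2 = {}" and P: "P:stab (S1 Un S2) t" "finer P {S1, S2}"
 shows "below P S1:stab S1 t" "below P S2:stab S2 t" "P = below P S1 Un below P S2"
proof -
 have b: "bij_betw t (S1 Un S2) (S1 Un S2)" using assms bij_betw_combine by blast
 have c: "y <= S1 | y Int S1 = {}" "y <= S2 | y Int S2 = {}" if "y:P" for y proof -
  have "y <= S1 | y <= S2" using P(2) that by (auto simp: finer_def)
  thus "y <= S1 | y Int S1 = {}" "y <= S2 | y Int S2 = {}" using assms(3) by auto
 qed
 show "below P S1:stab S1 t" using stab_below[OF P(1) b, of S1] c assms by (auto simp: bij_betw_def)
 show "below P S2:stab S2 t" using stab_below[OF P(1) b, of S2] c assms by (auto simp: bij_betw_def)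
 show "P = below P S1 Un below P S2" using P(2) by (auto simp: below_def finer_def)
qed

text \<open>The lower ideal of \<open>X1 Un X2\<close> is the product of the two lower ideals,
  because a partition finer than \<open>X1 Un X2\<close> has no block meeting both ground sets. The
  extra predicate \<open>Q\<close> lets one bijection serve for lower ideals and for
  intervals.\<close>

lemma sum_stab_Un:
 fixes f :: "'a set set => 'b::comm_monoid_add"
 assumes "bij_betw t S1 S1" "bij_betw t S2 S2" and d: "S1 Int S2 = {}" and "finite S1" "finite S2" and X: "X1:stab S1 t" "X2:stab S2 t"
 shows "(\<Sum>P | P:stab (S1 Un S2) t & finer P (X1 Un X2) & Q P. f P) =
  (\<Sum>(Y1, Y2) | Y1:stab S1 t & Y2:stab S2 t & finer Y1 X1 & finer Y2 X2 & Q (Y1 Un Y2). f (Y1 Un Y2))"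
proof (rule sum.reindex_bij_witness[where i = "%(a,b). a Un b" and j = "%P. (below P S1, below P S2)"], goal_cases) case (1 P)
 thus ?case using stab_split(3)[OF assms(1,2) d] finer_split[OF X] by simp
next case (2 P)
 hence s: "below P S1:stab S1 t" "below P S2:stab S2 t" "P = below P S1 Un below P S2" using stab_split[OF assms(1,2) d] finer_split[OF X] by auto
 have "finer (below P S1 Un below P S2) (X1 Un X2)" using 2 s(3) by simp
 hence "finer (below P S1) X1" "finer (below P S2) X2"
  using finer_Un_iff[of S1 "below P S1" S2 "below P S2" X1 X2] s(1,2) X d by (auto simp: stab_def)
 thus ?case using s 2 by auto
next case (3 b)
 thus ?case using below_Un_left[of S1 "fst b" S2 "snd b"] below_Un_right[of S1 "fst b" S2 "snd b"] d by (auto simp: stab_def split: prod.splits)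
next case (4 b)
 thus ?case using stab_Un[OF _ _ d] finer_Un_iff[OF _ _ _ _ d] X by (auto simp: stab_def)
next case (5 P)
 thus ?case using stab_split(3)[OF assms(1,2) d] finer_split[OF X] by auto
qed

section \<open>A single cycle of blocks\<close>

text \<open>\<open>B\<close> has \<open>r\<close> disjoint translates and then returns to itself as
  a set; \<open>t ^^ r\<close> need not be the identity on \<open>B\<close>. This first return map
  is all that remains of \<open>t\<close> when the cycle is reduced to one block.\<close>

definition block_cycle :: "('a => 'a) => 'a set => nat => 'a set set => bool" where
 "block_cycle t B r X \<longleftrightarrow> 0 < r & finite B & B ~= {} & (t ^^ r)`B = B &
   (\<forall>i<r. \<forall>j<r. i ~= j --> (t ^^ i)`B Int (t ^^ j)`B = {}) & X = (%i. (t ^^ i)`B)`{..<r} & inj_on t (\<Union>X)"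

lemma stab_funpow:
 assumes "X:stab S t" shows "(`) (t ^^ i)`X = X"
proof (induction i) case (Suc i)
 have "(`) (t ^^ Suc i)`X = (`) t`(`) (t ^^ i)`X" by (simp add: image_image)
 thus ?case using Suc assms by (simp add: stab_def)
qed simp

context
 fixes t :: "'a => 'a" and B r X
 assumes bc: "block_cycle t B r X"
begin

lemma block_cycle_facts:
 shows "0 < r" "finite B" "B ~= {}" "(t ^^ r)`B = B" "X = (%i. (t ^^ i)`B)`{..<r}" "inj_on t (\<Union>X)"
  "!!i j. i < r ==> j < r ==> i ~= j ==> (t ^^ i)`B Int (t ^^ j)`B = {}" using bc unfolding block_cycle_def by blast+

text \<open>Applying \<open>t\<close> shifts the index of the union by one, and the term with index
  \<open>r\<close> wraps round to the term with index 0.\<close>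

lemma cycle_stable:
 assumes A: "(`) (t ^^ r)`A = A"
 shows "(`) t`(\<Union>i<r. (`) (t ^^ i)`A) = (\<Union>i<r. (`) (t ^^ i)`A)" (is "_ = ?R")
proof -
 have "(`) t`?R = (UN i:Suc`{..<r}. (`) (t ^^ i)`A)" by (simp add: image_UN image_image)
 also have "Suc`{..<r} = insert r {1..<r}" using block_cycle_facts(1) by (auto simp: image_iff Suc_le_eq gr0_conv_Suc less_Suc_eq)
 also have "(UN i:insert r {1..<r}. (`) (t ^^ i)`A) = (UN i:insert 0 {1..<r}. (`) (t ^^ i)`A)" using A by simp
 also have "insert 0 {1..<r} = {..<r}" using block_cycle_facts(1) by auto
 finally show ?thesis .
qed

lemma block_cycle_image: "(`) t`X = X"
proof -
 have "X = (\<Union>i<r. (`) (t ^^ i)`{B})" using block_cycle_facts(5) by auto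
 thus ?thesis using cycle_stable[of "{B}"] block_cycle_facts(4) by simp
qed

lemma block_cycle_bij: "bij_betw t (\<Union>X) (\<Union>X)"
proof -
 have "t`(\<Union>X) = \<Union>((`) t`X)" by (simp add: image_Union)
 thus ?thesis using block_cycle_image block_cycle_facts(6) by (simp add: bij_betw_def)
qed

lemma block_cycle_bij_funpow: "bij_betw (t ^^ i) (\<Union>X) (\<Union>X)" using block_cycle_bij by (rule bij_betw_funpow)

lemma block_cycle_subset: "B <= \<Union>X"
proof -
 have "(t ^^ 0)`B:X" using block_cycle_facts(1) by (subst block_cycle_facts(5)) blast
 thus ?thesis by auto
qed

lemma block_cycle_base: "B:X"
proof -
 have "(t ^^ 0)`B:X" using block_cycle_facts(1) by (subst block_cycle_facts(5)) blast
 thus ?thesis by simp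
qed

lemma block_cycle_inj: "inj_on (t ^^ i) B" using block_cycle_bij_funpow[of i] block_cycle_subset by (auto simp: bij_betw_def intro: inj_on_subset)

lemma block_cycle_power_bij: "bij_betw (t ^^ r) B B" using block_cycle_inj block_cycle_facts(4) by (simp add: bij_betw_def)

lemma block_cycle_blocks_ne: "x:X ==> x ~= {}" using block_cycle_facts(3,5) by auto

lemma block_cycle_disjoint: "x:X ==> x = B | x Int B = {}"
proof -
 assume "x:X"
 then obtain i where i: "i < r" "x = (t ^^ i)`B" using block_cycle_facts(5) by auto
 show ?thesis proof (cases "i = 0")
  case False
  thus ?thesis using block_cycle_facts(7)[of i 0] i by auto
 qed (use i in simp)
qed

lemma block_cycle_partition: "partition_on (\<Union>X) X"
proof (rule partition_onI)
 show "{} ~: X" using block_cycle_blocks_ne by blast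
 show "disjnt p q" if pq: "p:X" "q:X" "p ~= q" for p q proof -
  obtain i j where "i < r" "p = (t ^^ i)`B" "j < r" "q = (t ^^ j)`B" using pq(1,2) block_cycle_facts(5) by auto
  thus ?thesis using block_cycle_facts(7)[of i j] pq(3) by (auto simp: disjnt_def)
 qed
qed simp

lemma block_cycle_stab: "X:stab (\<Union>X) t" using block_cycle_partition block_cycle_image by (simp add: stab_def)

lemma block_cycle_card: "card X = r"
proof -
 have "inj_on (%i. (t ^^ i)`B) {..<r}" proof (rule inj_onI)
  fix i j assume "i:{..<r}" "j:{..<r}" "(t ^^ i)`B = (t ^^ j)`B"
  thus "i = j" using block_cycle_facts(7)[of i j] block_cycle_facts(3) by auto
 qed
 thus ?thesis by (subst block_cycle_facts(5)) (simp add: card_image)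
qed

lemma block_cycle_card_block: "x:X ==> card x = card B" using block_cycle_facts(5) block_cycle_inj by (auto simp: card_image)

lemma block_cycle_finite: "finite (\<Union>X)" using block_cycle_facts(2,5) by auto

lemma block_cycle_card_Union: "card (\<Union>X) = r * card B"
proof -
 have "finite X" "!!x. x:X ==> finite x" using block_cycle_finite block_cycle_facts(2,5) by auto
 hence "card (\<Union>X) = sum card X"
  using block_cycle_partition by (intro card_Union_disjoint) (auto simp: partition_on_def disjoint_def disjnt_def pairwise_def)
 also have "... = r * card B" using block_cycle_card_block block_cycle_card by simp
 finally show ?thesis .
qed

lemma cycle_blocks_ex:
 assumes "P:stab (\<Union>X) t" "finer P X" "y:P" obtains i x where "i < r" "x:below P B" "y = (t ^^ i)`x"
proof -
 obtain i where i: "i < r" "y <= (t ^^ i)`B" using assms block_cycle_facts(5) by (auto simp: finer_def)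
 obtain x where x: "x:P" "y = (t ^^ i)`x" using stab_funpow[OF assms(1)] assms(3) by (metis imageE)
 have "x <= \<Union>X" using x stab_subset_Pow[OF assms(1)] by blast
 hence "x <= B" using image_subset_inj_iff[OF bij_betw_imp_inj_on[OF block_cycle_bij_funpow] _ block_cycle_subset] i x by blast
 thus ?thesis using that i x by (simp add: below_def)
qed

lemma cycle_blocks_union:
 assumes "P:stab (\<Union>X) t" "finer P X"
 shows "(\<Union>i<r. (`) (t ^^ i)`below P B) = P" (is "?l = _")
proof (intro equalityI subsetI) fix y assume "y:P"
 thus "y:?l" by (rule cycle_blocks_ex[OF assms]) blast
qed (use stab_funpow[OF assms(1)] in \<open>auto simp: below_def\<close>)

lemma cycle_block_unique:
 assumes "(t ^^ i)`x = (t ^^ j)`y" "i < r" "j < r" "x <= B" "y <= B" "x ~= {}"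
 shows "i = j" "x = y"
proof -
 show "i = j" using block_cycle_facts(7)[OF assms(2,3)] assms by blast
 thus "x = y" using assms(1) inj_on_image_eq_iff[OF block_cycle_inj assms(4,5)] by simp
qed

text \<open>A stable partition finer than the cycle is determined by its blocks inside
  \<open>B\<close>, since \<open>t\<close> carries these to the other translates; going once round
  imposes exactly stability under \<open>t ^^ r\<close>.\<close>

lemma bij_betw_stab_cycle: "bij_betw (%P. below P B) {P:stab (\<Union>X) t. finer P X} (stab B (t ^^ r))"
proof (rule bij_betw_byWitness[where f' = "%A. \<Union>i<r. (`) (t ^^ i)`A"]; (intro ballI image_subsetI)?)
 fix P assume "P:{P:stab (\<Union>X) t. finer P X}"
 hence P: "P:stab (\<Union>X) t" "finer P X" by auto
 show "(\<Union>i<r. (`) (t ^^ i)`below P B) = P" by (rule cycle_blocks_union[OF P])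
 have "P:stab (\<Union>X) (t ^^ r)" using stabD(1)[OF P(1)] stab_funpow[OF P(1)] by (simp add: stab_def)
 thus "below P B:stab B (t ^^ r)" proof (rule stab_below[OF _ block_cycle_bij_funpow block_cycle_subset block_cycle_facts(4)])
  fix p assume "p:P"
  then obtain x where "x:X" "p <= x" using P(2) by (auto simp: finer_def)
  thus "p <= B | p Int B = {}" using block_cycle_disjoint[of x] by auto
 qed
next fix A assume A: "A:stab B (t ^^ r)"
 let ?P = "\<Union>i<r. (`) (t ^^ i)`A"
 have AB: "a <= B" "a ~= {}" if "a:A" for a using stabD(1)[OF A] that by (auto simp: partition_on_def)
 show "below ?P B = A" proof (intro equalityI subsetI)
  fix y assume "y:below ?P B"
  then obtain i a where i: "i < r" "a:A" "y = (t ^^ i)`a" "y <= B" by (auto simp: below_def)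
  hence "i = 0" using cycle_block_unique(1)[of i a 0 y] AB block_cycle_facts(1) by simp
  thus "y:A" using i by simp
 next fix a assume a: "a:A"
  hence "a:(`) (t ^^ 0)`A" by simp
  hence "a:?P" using block_cycle_facts(1) by blast
  thus "a:below ?P B" using AB a by (simp add: below_def)
 qed
 have fin: "finer ?P X" unfolding finer_def proof clarify
  fix i a assume "i < r" "a:A"
  hence "(t ^^ i)`a <= (t ^^ i)`B" "(t ^^ i)`B:X" using AB block_cycle_facts(5) by auto
  thus "EX x:X. (t ^^ i)`a <= x" by blast
 qed
 have "partition_on (\<Union>X) ?P" proof (rule partition_onI)
  have "\<Union>?P = (\<Union>i<r. (t ^^ i)`\<Union>A)" by blast
  thus "\<Union>?P = \<Union>X" using stabD(3)[OF A] block_cycle_facts(5) by simp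
  show "{} ~: ?P" using AB by auto
  show "disjnt p q" if pq: "p:?P" "q:?P" "p ~= q" for p q proof -
   obtain i a where i: "i < r" "a:A" "p = (t ^^ i)`a" using pq(1) by auto
   obtain j b where j: "j < r" "b:A" "q = (t ^^ j)`b" using pq(2) by auto
   show ?thesis proof (cases "i = j")
    case True
    hence "a Int b = {}" using i j pq(3) stabD(1)[OF A] by (auto simp: partition_on_def disjoint_def)
    thus ?thesis using inj_on_image_Int[OF block_cycle_inj[of i] AB(1)[OF i(2)] AB(1)[OF j(2)]] i j True by (auto simp: disjnt_def)
   next case False
    have "p <= (t ^^ i)`B" "q <= (t ^^ j)`B" using i j AB by auto
    thus ?thesis using block_cycle_facts(7)[OF i(1) j(1) False] by (auto simp: disjnt_def)
   qed
  qed
 qed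
 thus "?P:{P:stab (\<Union>X) t. finer P X}" using fin cycle_stable stabD(2)[OF A] by (simp add: stab_def)
qed

end

section \<open>Multiplicative weights and their inversion over stable intervals\<close>

text \<open>The rules reduce a weight to the case of one coarse block: it is invariant under
  conjugation, multiplicative over disjoint stable pieces, and unchanged when a cycle of blocks is
  replaced by one block with its first return map. Ground sets are arbitrary so that inductions can
  cut them apart.\<close>

locale natural_weight =
 fixes v :: "(nat => nat) => nat set set => nat set set => 'r::comm_ring_1"
 assumes iso: "!!S t X P g t'. finite S ==> bij_betw t S S ==> X:stab S t ==> P:stab S t ==> finer P X ==>
   inj_on g S ==> (!!x. x:S ==> t' (g x) = g (t x)) ==> v t' ((`) g`P) ((`) g`X) = v t P X"
  and union: "!!S1 S2 t X1 X2 P1 P2. finite S1 ==> finite S2 ==> S1 Int S2 = {} ==> bij_betw t S1 S1 ==> bij_betw t S2 S2 ==>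
   X1:stab S1 t ==> P1:stab S1 t ==> finer P1 X1 ==> X2:stab S2 t ==> P2:stab S2 t ==> finer P2 X2 ==>
   v t (P1 Un P2) (X1 Un X2) = v t P1 X1 * v t P2 X2"
  and cycle: "!!t B r X M P. block_cycle t B r X ==> M:stab (\<Union>X) t ==> P:stab (\<Union>X) t ==>
   finer P M ==> finer M X ==> v t P M = v (t ^^ r) (below P B) (below M B)" and empty: "!!t. v t {} {} = 1"

text \<open>Inverse of summation over the upper end of stable intervals, see
  \<open>minv_sum\<close>. The recursion stays among stable partitions, so for the equality weight
  it is the Moebius function of the fixed-point poset and not that of the whole partition lattice.
  The value 0 only makes the function total.\<close>

function minv :: "((nat => nat) => nat set set => nat set set => 'r::comm_ring_1) => (nat => nat) => nat set set => nat set set => 'r" where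
 "minv v t P X = (if finite (\<Union>X) & X:stab (\<Union>X) t
   then v t P X - (SUM M:interval t P X - {X}. minv v t P M) else 0)" by pat_completeness auto

lemma interval_psubset:
 assumes fin: "finite (\<Union>X)" and X: "X:stab (\<Union>X) t" and M: "M:interval t P X" "M ~= X"
 shows "interval t P M \<subset> interval t P X"
proof -
 have m: "M:stab (\<Union>X) t" "finer P M" "finer M X" using M by (auto simp: interval_def)
 have U: "\<Union>M = \<Union>X" using stabD(3)[OF m(1)] .
 have "interval t P M <= interval t P X" using m(3) finer_trans by (auto simp: interval_def U)
 moreover have "X:interval t P X" using X m finer_trans by (auto simp: interval_def)
 moreover have "X ~: interval t P M" using M(2) finer_antisym[OF stabD(1)[OF X] stabD(1)[OF m(1)]] m(3) by (auto simp: interval_def)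
 ultimately show ?thesis by blast
qed

termination minv
proof (relation "measure (%(v, t, P, X). card (interval t P X))", goal_cases) case (2 v t P X M)
 hence "interval t P M \<subset> interval t P X" using interval_psubset[of X t M P] by blast
 thus ?case using 2 by (simp add: psubset_card_mono)
qed simp

declare minv.simps [simp del]

lemma minv_sum:
 assumes "finite S" "X:stab S t" "finer P X"
 shows "(SUM M:interval t P X. minv v t P M) = v t P X" (is "?l = _")
proof -
 have S: "\<Union>X = S" using assms(2) by (rule stabD)
 have "X:interval t P X" using assms by (rule_tac interval_self)
 hence "?l = minv v t P X + (SUM M:interval t P X - {X}. minv v t P M)" using assms(1) by (intro sum.remove) (simp_all add: S)
 also have "... = v t P X" using assms S by (subst minv.simps) simp
 finally show ?thesis .
qed

text \<open>Summation over lower stable intervals is unitriangular, so vanishing sums force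
  vanishing values. \<open>Q\<close> restricts the argument to a downward closed class of
  partitions, namely one where the sums in question are known.\<close>

lemma interval_sum_zero_unique:
 fixes d :: "nat set set => 'r::comm_ring_1"
 assumes S: "finite S" and Q: "!!X M. Q X ==> M:interval t P X ==> Q M"
  and z: "!!X. Q X ==> X:stab S t ==> finer P X ==> (SUM M:interval t P X. d M) = 0" and X: "Q X" "X:stab S t" "finer P X"
 shows "d X = 0" using X
proof (induction "card (interval t P X)" arbitrary: X rule: less_induct) case less
 have U: "\<Union>X = S" using less.prems(2) by (rule stabD)
 have "d M = 0" if M: "M:interval t P X - {X}" for M proof (rule less.hyps)
  have "interval t P M \<subset> interval t P X" using interval_psubset[of X t M P] M less.prems(2) S by (simp add: U)
  thus "card (interval t P M) < card (interval t P X)" using S by (simp add: psubset_card_mono U)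
  show "Q M" using Q[OF less.prems(1)] M by blast
  show "M:stab S t" "finer P M" using M by (auto simp: interval_def U)
 qed
 hence "(SUM M:interval t P X - {X}. d M) = 0" by simp
 moreover have "(SUM M:interval t P X. d M) = d X + (SUM M:interval t P X - {X}. d M)"
  using less.prems S interval_self[of X S t P] by (intro sum.remove) (simp_all add: U)
 ultimately show ?case using z[OF less.prems] by simp
qed

lemma interval_image:
 assumes g: "inj_on g S" and t: "bij_betw t S S" and c: "!!x. x:S ==> t' (g x) = g (t x)" and X: "X:stab S t" "P:stab S t"
 shows "bij_betw ((`) ((`) g)) (interval t P X) (interval t' ((`) g`P) ((`) g`X))"
proof -
 have U: "\<Union>X = S" "\<Union>((`) g`X) = g`S" using X by (auto simp: stabD simp flip: image_Union)
 show ?thesis unfolding interval_def U by (rule bij_betw_Collect[OF bij_betw_stab_image[OF g t c]])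
   (simp_all add: finer_image[OF g] stab_subset_Pow[OF X(1)] stab_subset_Pow[OF X(2)] stab_subset_Pow)
qed

lemma interval_Un:
 assumes "bij_betw t S1 S1" "bij_betw t S2 S2" and d: "S1 Int S2 = {}" and f: "finite S1" "finite S2"
  and X: "X1:stab S1 t" "X2:stab S2 t" and P: "P1:stab S1 t" "P2:stab S2 t"
 shows "(SUM M:interval t (P1 Un P2) (X1 Un X2). h M) = (SUM M1:interval t P1 X1. SUM M2:interval t P2 X2. h (M1 Un M2))" (is "?l = _")
proof -
 have U: "\<Union>X1 = S1" "\<Union>X2 = S2" "\<Union>(X1 Un X2) = S1 Un S2" using X by (auto simp: stabD)
 have "?l = (\<Sum>M | M:stab (S1 Un S2) t & finer M (X1 Un X2) & finer (P1 Un P2) M. h M)" by (rule sum.cong) (auto simp: interval_def U(1,2))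
 also have "... = (\<Sum>(Y1, Y2) | Y1:stab S1 t & Y2:stab S2 t & finer Y1 X1 & finer Y2 X2 & finer (P1 Un P2) (Y1 Un Y2). h (Y1 Un Y2))"
  by (rule sum_stab_Un) (use assms in auto)
 also have "... = (SUM (Y1, Y2):interval t P1 X1 \<times> interval t P2 X2. h (Y1 Un Y2))"
  by (rule sum.cong) (use finer_Un_iff[OF stabD(1)[OF P(1)] stabD(1)[OF P(2)] stabD(1) stabD(1) d] in \<open>auto simp: interval_def U\<close>)
 finally show ?thesis by (simp add: sum.cartesian_product)
qed

lemma below_image_finer: "finer P M ==> \<Union>M = S ==> (!!x. x:M ==> x <= B | x Int B = {}) ==> {} ~: P ==> finer (below P B) (below M B)"
 unfolding finer_def
proof fix y assume a: "ALL y:P. EX x:M. y <= x" "!!x. x:M ==> x <= B | x Int B = {}" "{} ~: P" and y: "y:below P B"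
 then obtain x where x: "x:M" "y <= x" by (auto simp: below_def)
 have "y ~= {}" "y <= B" using y a(3) by (auto simp: below_def)
 hence "x <= B" using a(2)[OF x(1)] x(2) by auto
 thus "EX x:below M B. y <= x" using x by (auto simp: below_def)
qed

lemma finer_below_iff:
 assumes bc: "block_cycle t B r X" and M: "M:stab (\<Union>X) t" "finer M X" and P: "P:stab (\<Union>X) t" "finer P X"
 shows "finer (below P B) (below M B) \<longleftrightarrow> finer P M"
proof
 have "x <= B | x Int B = {}" if "x:M" for x using that M(2) block_cycle_disjoint[OF bc] by (fastforce simp: finer_def)
 moreover assume "finer P M"
 ultimately show "finer (below P B) (below M B)"
  using below_image_finer[of P M "\<Union>X" B] stabD[OF M(1)] stabD[OF P(1)] by (auto simp: partition_on_def)
next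
 assume f: "finer (below P B) (below M B)" show "finer P M" unfolding finer_def proof
  fix y assume "y:P"
  then obtain i a where i: "i < r" "a:below P B" "y = (t ^^ i)`a" by (rule cycle_blocks_ex[OF bc P])
  then obtain x where x: "x:M" "a <= x" using f by (auto simp: finer_def below_def)
  hence "(t ^^ i)`x:M" using stab_funpow[OF M(1)] by blast
  thus "EX x:M. y <= x" using i x by blast
 qed
qed

lemma interval_cycle:
 assumes bc: "block_cycle t B r X" and M: "M:stab (\<Union>X) t" "finer M X" and P: "P:stab (\<Union>X) t" "finer P X"
 shows "bij_betw (%M. below M B) (interval t P M) (interval (t ^^ r) (below P B) (below M B))"
proof -
 note b = bij_betw_stab_cycle[OF bc]
 have "below M B:stab B (t ^^ r)" using b M by (auto simp: bij_betw_def)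
 note U = stabD(3)[OF this] stabD(3)[OF M(1)]
 have "interval t P M = {V:{P:stab (\<Union>X) t. finer P X}. finer P V & finer V M}" using M(2) finer_trans by (auto simp: interval_def U)
 thus ?thesis unfolding interval_def[of "t ^^ r"] U(1)
  using bij_betw_Collect[OF b, of "%V. finer (below P B) V & finer V (below M B)" "%V. finer P V & finer V M"]
   finer_below_iff[OF bc _ _ P] finer_below_iff[OF bc M] by simp
qed

text \<open>Each rule is inherited because both of its sides have the same interval sums: these sums
  are values of \<open>v\<close>, for which the rule holds, and the intervals correspond by
  \<open>interval_image\<close>, \<open>interval_Un\<close> and
  \<open>interval_cycle\<close>.\<close>

lemma (in natural_weight) minv_natural: "natural_weight (minv v)"
proof fix t :: "nat => nat" show "minv v t {} {} = 1" proof -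
  have "interval t {} {} = {{}}" by (auto simp: interval_def)
  thus ?thesis using empty by (subst minv.simps) simp
 qed
next fix S X P and g t t' :: "nat => nat"
 assume a: "finite S" "bij_betw t S S" "X:stab S t" "P:stab S t" "finer P X" "inj_on g S" and c: "!!x. x:S ==> t' (g x) = g (t x)"
 have "minv v t' ((`) g`P) ((`) g`X) - minv v t P X = 0" proof (rule interval_sum_zero_unique[where S = S and Q = "%X. True" and t = t and P = P
    and d = "%X. minv v t' ((`) g`P) ((`) g`X) - minv v t P X"])
  fix X assume X: "X:stab S t" "finer P X"
  have "(SUM M:interval t P X. minv v t' ((`) g`P) ((`) g`M)) = (SUM M:interval t' ((`) g`P) ((`) g`X). minv v t' ((`) g`P) M)"
   by (rule sum.reindex_bij_betw[OF interval_image[OF a(6,2) c X(1) a(4)]])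
  also have "... = v t' ((`) g`P) ((`) g`X)" proof (rule minv_sum[where S = "g`S"])
   show "(`) g`X:stab (g`S) t'" using stab_image[OF a(6,2) c stab_subset_Pow[OF X(1)]] X by simp
   show "finer ((`) g`P) ((`) g`X)" using finer_image[OF a(6)] stab_subset_Pow[OF X(1)] stab_subset_Pow[OF a(4)] X(2) by simp
  qed (use a in simp)
  also have "... = v t P X" by (rule iso[OF a(1,2) X(1) a(4) X(2) a(6) c])
  also have "... = (SUM M:interval t P X. minv v t P M)" by (rule minv_sum[OF a(1) X, symmetric])
  finally show "(SUM M:interval t P X. minv v t' ((`) g`P) ((`) g`M) - minv v t P M) = 0" by (simp add: sum_subtractf)
 qed (use a in auto)
 thus "minv v t' ((`) g`P) ((`) g`X) = minv v t P X" by simp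
next fix S1 S2 X1 X2 P1 P2 and t :: "nat => nat"
 assume a: "finite S1" "finite S2" and d: "S1 Int S2 = {}" and t: "bij_betw t S1 S1" "bij_betw t S2 S2"
  and 1: "X1:stab S1 t" "P1:stab S1 t" "finer P1 X1" and 2: "X2:stab S2 t" "P2:stab S2 t" "finer P2 X2"
 \<comment> \<open>The product formula is written for every partition by restriction to the two
   sides; the comparison is made for the downward closed class of partitions that do not mix the
   sides.\<close>
 let ?Q = "%X. finer X {S1, S2}"
 let ?d = "%X. minv v t (P1 Un P2) X - minv v t P1 (below X S1) * minv v t P2 (below X S2)"
 have bl: "below (M1 Un M2) S1 = M1" "below (M1 Un M2) S2 = M2" if "M1:stab S1 t" "M2:stab S2 t" for M1 M2
  using below_Un_left[OF stabD(1)[OF that(1)] stabD(1)[OF that(2)] d] below_Un_right[OF stabD(1)[OF that(1)] stabD(1)[OF that(2)] d] by auto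
 have "?d (X1 Un X2) = 0" proof (rule interval_sum_zero_unique[where S = "S1 Un S2" and Q = ?Q and t = t and P = "P1 Un P2" and d = ?d])
  show "finite (S1 Un S2)" using a by simp
  show "?Q M" if "?Q X" "M:interval t (P1 Un P2) X" for X M using that finer_trans by (auto simp: interval_def)
  show "?Q (X1 Un X2)" by (rule finer_split[OF 1(1) 2(1)]) simp
  show "X1 Un X2:stab (S1 Un S2) t" by (rule stab_Un[OF 1(1) 2(1) d])
  show "finer (P1 Un P2) (X1 Un X2)" using finer_Un_iff[OF stabD(1)[OF 1(2)] stabD(1)[OF 2(2)] stabD(1)[OF 1(1)] stabD(1)[OF 2(1)] d] 1 2 by simp
  fix X assume X: "?Q X" "X:stab (S1 Un S2) t" "finer (P1 Un P2) X"
  define Y1 where "Y1 = below X S1"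
  define Y2 where "Y2 = below X S2"
  have Y: "Y1:stab S1 t" "Y2:stab S2 t" "X = Y1 Un Y2" using stab_split[OF t d X(2,1)] by (auto simp: Y1_def Y2_def)
  have f: "finer P1 Y1" "finer P2 Y2" using finer_Un_iff[OF stabD(1)[OF 1(2)] stabD(1)[OF 2(2)] stabD(1)[OF Y(1)] stabD(1)[OF Y(2)] d] X Y by auto
  have "(SUM M:interval t (P1 Un P2) X. minv v t (P1 Un P2) M) = v t (P1 Un P2) X" by (rule minv_sum[OF _ X(2,3)]) (use a in simp)
  also have "... = v t P1 Y1 * v t P2 Y2" unfolding Y(3) by (rule union[OF a d t Y(1) 1(2) f(1) Y(2) 2(2) f(2)])
  also have "... = (SUM M1:interval t P1 Y1. minv v t P1 M1) * (SUM M2:interval t P2 Y2. minv v t P2 M2)"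
   using minv_sum[OF a(1) Y(1) f(1), of v] minv_sum[OF a(2) Y(2) f(2), of v] by simp
  also have "... = (SUM M1:interval t P1 Y1. SUM M2:interval t P2 Y2. minv v t P1 (below (M1 Un M2) S1) * minv v t P2 (below (M1 Un M2) S2))"
   unfolding sum_product using Y by (intro sum.cong refl) (simp add: interval_def bl stabD)
  also have "... = (SUM M:interval t (P1 Un P2) X. minv v t P1 (below M S1) * minv v t P2 (below M S2))"
   unfolding Y(3) by (rule interval_Un[OF t d a Y(1,2) 1(2) 2(2), symmetric])
  finally show "(SUM M:interval t (P1 Un P2) X. ?d M) = 0" by (simp add: sum_subtractf)
 qed
 thus "minv v t (P1 Un P2) (X1 Un X2) = minv v t P1 X1 * minv v t P2 X2" using bl[OF 1(1) 2(1)] by simp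
next fix B r X M P and t :: "nat => nat"
 assume bc: "block_cycle t B r X" and M: "M:stab (\<Union>X) t" and P: "P:stab (\<Union>X) t" and f: "finer P M" "finer M X"
 have PX: "finer P X" using f finer_trans by blast
 let ?d = "%M. minv v t P M - minv v (t ^^ r) (below P B) (below M B)"
 have "?d M = 0" proof (rule interval_sum_zero_unique[where S = "\<Union>X" and Q = "%M. finer M X" and t = t and P = P and d = ?d])
  show "finite (\<Union>X)" by (rule block_cycle_finite[OF bc])
  show "finer M' X" if "finer M X" "M':interval t P M" for M M' using that finer_trans by (auto simp: interval_def)
  fix M assume M: "finer M X" "M:stab (\<Union>X) t" "finer P M"
  have b: "below M B:stab B (t ^^ r)" using bij_betw_stab_cycle[OF bc] M by (auto simp: bij_betw_def)
  have "(SUM M:interval t P M. minv v t P M) = v t P M" by (rule minv_sum[OF block_cycle_finite[OF bc] M(2,3)])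
  also have "... = v (t ^^ r) (below P B) (below M B)" by (rule cycle[OF bc M(2) P M(3,1)])
  also have "... = (SUM M:interval (t ^^ r) (below P B) (below M B). minv v (t ^^ r) (below P B) M)" using finer_below_iff[OF bc M(2,1) P PX] M
   by (intro minv_sum[OF block_cycle_facts(2)[OF bc] b, symmetric]) simp
  also have "... = (SUM M:interval t P M. minv v (t ^^ r) (below P B) (below M B))"
   by (rule sum.reindex_bij_betw[OF interval_cycle[OF bc M(2,1) P PX], symmetric])
  finally show "(SUM M:interval t P M. ?d M) = 0" by (simp add: sum_subtractf)
 qed (use M f in auto)
 thus "minv v t P M = minv v (t ^^ r) (below P B) (below M B)" by simp
qed

section \<open>Splitting a permutation along its cycles of blocks\<close>

definition transitive_on :: "('a => 'a) => 'a set set => bool" where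
 "transitive_on t X \<longleftrightarrow> X ~= {} & (ALL b:X. ALL c:X. \<exists>i. c = (t ^^ i)`b)"

definition stabs :: "'a set => (('a => 'a) \<times> 'a set set) set" where "stabs S = {(t, X). t permutes S & X:stab S t}"

definition tstabs :: "'a set => (('a => 'a) \<times> 'a set set) set" where "tstabs S = {(t, X):stabs S. transitive_on t X}"

lemma finite_stabs [simp]: "finite S ==> finite (stabs S)"
proof -
 assume S: "finite S"
 have "stabs S = Sigma {t. t permutes S} (stab S)" by (auto simp: stabs_def)
 thus ?thesis using S by (simp add: finite_permutations)
qed

lemma finite_tstabs [simp]: "finite S ==> finite (tstabs S)" by (rule finite_subset[of _ "stabs S"]) (auto simp: tstabs_def)

lemma funpow_image_image: "(f ^^ i)`(f ^^ j)`A = (f ^^ (i + j))`A" by (simp add: image_comp funpow_add)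

lemma block_cycle_transitive:
 assumes bc: "block_cycle t B r X"
 shows "transitive_on t X" unfolding transitive_on_def
proof (intro conjI ballI)
 show "X ~= {}" using block_cycle_base[OF bc] by blast
 fix b c assume "b:X" "c:X"
 then obtain i j where i: "i < r" "b = (t ^^ i)`B" and j: "j < r" "c = (t ^^ j)`B" using block_cycle_facts(5)[OF bc] by auto
 have "(t ^^ (j + (r - i)))`b = (t ^^ (j + r))`B" using i by (simp add: funpow_image_image)
 also have "... = (t ^^ j)`(t ^^ r)`B" by (simp only: funpow_image_image)
 also have "... = c" using block_cycle_facts(4)[OF bc] j by simp
 finally show "\<exists>i. c = (t ^^ i)`b" by blast
qed

lemma permutes_funpow_id:
 assumes "t permutes S" "finite S" obtains N where "0 < N" "t ^^ N = id" using permutation_is_nilpotent[of t] assms permutation_permutes by blast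

lemma permutes_funpow_image_eq:
 assumes p: "t permutes S" "finite S"
 shows "\<exists>k. (t ^^ j)`B = (t ^^ k)`(t ^^ i)`B"
proof -
 obtain N where N: "0 < N" "t ^^ N = id" using permutes_funpow_id[OF p] .
 then obtain M where M: "N = Suc M" using gr0_conv_Suc by blast
 \<comment> \<open>A negative power of \<open>t\<close> is replaced by a positive one: since N = M +
   1, another M * i steps after the first i complete i rounds of length N.\<close>
 have "(t ^^ (j + M * i))`(t ^^ i)`B = (t ^^ (j + N * i))`B" by (simp add: funpow_image_image M algebra_simps)
 also have "t ^^ (j + N * i) = t ^^ j" by (simp add: funpow_add funpow_mult[symmetric] N)
 finally show ?thesis by metis
qed

text \<open>The cycle length is the least positive return time of \<open>B\<close>. It exists
  because \<open>t\<close> has finite order, and before that time the translates are distinct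
  blocks, hence disjoint.\<close>

lemma transitive_block_cycle:
 assumes p: "t permutes S" "finite S" and X: "X:stab S t" and t: "transitive_on t X" and B: "B:X"
 shows "block_cycle t B (card X) X"
proof -
 obtain N where N: "0 < N" "t ^^ N = id" using permutes_funpow_id[OF p] .
 define r where "r = (LEAST r. 0 < r & (t ^^ r)`B = B)"
 have "0 < r & (t ^^ r)`B = B" unfolding r_def by (rule LeastI[where k = N]) (use N in simp)
 hence r: "0 < r" "(t ^^ r)`B = B" by auto
 have least: "(t ^^ k)`B ~= B" if "0 < k" "k < r" for k using not_less_Least[of k "%r. 0 < r & (t ^^ r)`B = B"] that by (auto simp: r_def)
 have inj: "inj t" using p(1) by (rule permutes_inj)
 hence inji: "inj (t ^^ i)" for i by (rule inj_fn)
 have st: "(t ^^ i)`B:X" for i using stab_funpow[OF X] B by blast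
 have mult: "(t ^^ (r * k))`B = B" for k proof (induction k)
  case (Suc k)
  have "(t ^^ (r * Suc k))`B = (t ^^ r)`(t ^^ (r * k))`B" by (simp add: funpow_image_image)
  thus ?case using Suc r by simp
 qed simp
 let ?t1 = "(%i. (t ^^ i)`B)"
 have Xeq: "X = ?t1`{..<r}" proof
  show "X <= ?t1`{..<r}" proof
   fix c assume "c:X"
   hence "\<exists>i. c = (t ^^ i)`B" using t B unfolding transitive_on_def by simp
   then obtain i where i: "c = (t ^^ i)`B" by (rule exE)
   have "(t ^^ i)`B = (t ^^ (i mod r + r * (i div r)))`B" by simp
   also have "... = (t ^^ (i mod r))`B" by (simp only: funpow_image_image[symmetric] mult)
   finally show "c:?t1`{..<r}" using i r by simp
  qed
  show "?t1`{..<r} <= X" using st by (simp add: image_subset_iff)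
 qed
 have ne: "(t ^^ i)`B ~= (t ^^ j)`B" if "i < j" "j < r" for i j proof
  assume "(t ^^ i)`B = (t ^^ j)`B"
  also have "... = (t ^^ i)`(t ^^ (j - i))`B" using that by (simp add: funpow_image_image)
  finally have "B = (t ^^ (j - i))`B" using inj_image_eq_iff[OF inji, of i B] by simp
  thus False using least[of "j - i"] that by (metis zero_less_diff less_imp_diff_less)
 qed
 have disj: "(t ^^ i)`B Int (t ^^ j)`B = {}" if "i < r" "j < r" "i ~= j" for i j proof -
  have "(t ^^ i)`B ~= (t ^^ j)`B" using ne[of i j] ne[of j i] that by (metis linorder_neqE_nat)
  thus ?thesis using st[of i] st[of j] stabD(1)[OF X] by (simp add: partition_on_def disjoint_def)
 qed
 have BS: "B <= S" using B stab_subset_Pow[OF X] by blast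
 have "block_cycle t B r X" unfolding block_cycle_def proof (intro conjI allI impI)
  show "finite B" using BS p(2) finite_subset by blast
  show "B ~= {}" using B stabD(1)[OF X] by (auto simp: partition_on_def)
  show "inj_on t (\<Union>X)" using inj by (rule inj_on_subset) simp
  show "0 < r" "(t ^^ r)`B = B" "X = ?t1`{..<r}" by (fact r Xeq)+
  show "(t ^^ i)`B Int (t ^^ j)`B = {}" if "i < r" "j < r" "i ~= j" for i j by (rule disj[OF that])
 qed
 thus ?thesis using block_cycle_card[of t B r X] by simp
qed

lemma perm_restrict_permutes:
 assumes "t permutes S" "T <= S" "t`T = T"
 shows "perm_restrict t T permutes T"
proof (rule bij_imp_permutes)
 have "inj_on t T" using assms(1) by (meson permutes_inj_on)
 hence "bij_betw t T T" using assms(3) by (simp add: bij_betw_def)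
 thus "bij_betw (perm_restrict t T) T T" by (rule bij_betw_cong[THEN iffD1, rotated]) (simp add: perm_restrict_def)
qed (simp add: perm_restrict_def)

lemma permutes_bij_betw: "t permutes S ==> bij_betw t S S" by (rule permutes_imp_bij)

definition block_of :: "'a set set => 'a => 'a set" where "block_of X a = (THE b. b:X & a:b)"

lemma block_of_eq:
 assumes "partition_on S X" "b:X" "a:b"
 shows "block_of X a = b" unfolding block_of_def by (rule the_equality) (use assms partition_on_member_eq[OF assms(1)] in auto)

lemma block_of:
 assumes "partition_on S X" "a:S"
 shows "block_of X a:X" "a:block_of X a"
proof -
 obtain b where "b:X" "a:b" using assms by (auto simp: partition_on_def)
 thus "block_of X a:X" "a:block_of X a" using block_of_eq[OF assms(1)] by auto
qed

text \<open>The ground set of the cycle of blocks through \<open>a\<close>. Nonnegative powers are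
  enough because \<open>t\<close> has finite order wherever this is applied.\<close>

definition component :: "('a => 'a) => 'a set set => 'a => 'a set" where "component t X a = (\<Union>i. (t ^^ i)`block_of X a)"

lemma permutes_split:
 assumes p: "t permutes S" and T: "T <= S" "t`T = T"
 shows "perm_restrict t T permutes T" "perm_restrict t (S - T) permutes S - T"
  "perm_restrict t T \<circ> perm_restrict t (S - T) = t" "t`(S - T) = S - T"
proof -
 show R: "t`(S - T) = S - T" using image_set_diff[OF permutes_inj[OF p], of S T] T permutes_image[OF p] by simp
 show "perm_restrict t T permutes T" by (rule perm_restrict_permutes[OF p T])
 show "perm_restrict t (S - T) permutes S - T" by (rule perm_restrict_permutes[OF p Diff_subset R])
 have "(perm_restrict t T \<circ> perm_restrict t (S - T)) x = t x" for x proof (cases "x:S - T")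
  case True
  hence "t x ~: T" using R by blast
  with True show ?thesis by (simp add: perm_restrict_def)
 next case False
  thus ?thesis using permutes_not_in[OF p, of x] by (cases "x:T"; cases "x:S") (simp_all add: perm_restrict_def)
 qed
 thus "perm_restrict t T \<circ> perm_restrict t (S - T) = t" by (rule ext)
qed

lemma permutes_join:
 assumes T: "T <= S" and p: "t1 permutes T" "t2 permutes S - T"
 shows "!!x. x:T ==> (t1 \<circ> t2) x = t1 x" "!!x. x:S - T ==> (t1 \<circ> t2) x = t2 x" "t1 \<circ> t2 permutes S"
  "perm_restrict (t1 \<circ> t2) T = t1" "perm_restrict (t1 \<circ> t2) (S - T) = t2"
proof -
 let ?t1 = "(t1 \<circ> t2)"
 show e1: "?t1 x = t1 x" if "x:T" for x using permutes_not_in[OF p(2), of x] that by simp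
 show e2: "?t1 x = t2 x" if "x:S - T" for x using permutes_not_in[OF p(1), of "t2 x"] permutes_in_image[OF p(2), of x] that by simp
 show "t1 \<circ> t2 permutes S" by (rule permutes_compose[OF permutes_subset[OF p(2) Diff_subset] permutes_subset[OF p(1) T]])
 have "perm_restrict ?t1 T x = t1 x" for x
  unfolding perm_restrict_def using e1[of x] permutes_not_in[OF p(1), of x] by (cases "x:T") (simp_all only: if_True if_False simp_thms)
 thus "perm_restrict ?t1 T = t1" by (rule ext)
 have "perm_restrict ?t1 (S - T) x = t2 x" for x
  unfolding perm_restrict_def using e2[of x] permutes_not_in[OF p(2), of x] by (cases "x:S - T") (simp_all only: if_True if_False simp_thms)
 thus "perm_restrict ?t1 (S - T) = t2" by (rule ext)
qed

lemma component_facts: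
 assumes p: "t permutes S" "finite S" and X: "X:stab S t" and a: "a:S"
 defines "T \<equiv> component t X a"
 shows "a:T" "T <= S" "t`T = T" "t`(S - T) = S - T" "finer X {T, S - T}" "below X T = (%i. (t ^^ i)`block_of X a)`UNIV" "transitive_on t (below X T)"
proof -
 let ?B = "block_of X a"
 have part: "partition_on S X" by (rule stabD(1)[OF X])
 have B: "?B:X" "a:?B" using block_of[OF part a] by auto
 have st: "(t ^^ i)`?B:X" for i using stab_funpow[OF X] B by blast
 let ?t1 = "(%i. (t ^^ i)`?B)"
 have T: "T = \<Union>(range ?t1)" by (simp add: T_def component_def)
 show aT: "a:T" unfolding T using B(2) by (auto intro!: exI[of _ "0::nat"])
 show TS: "T <= S" unfolding T using st stab_subset_Pow[OF X] by blast
 have "t`T <= T" proof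
  fix y assume "y:t`T"
  then obtain i b where "b:?B" "y = t ((t ^^ i) b)" unfolding T by auto
  hence "y:(t ^^ Suc i)`?B" by simp
  thus "y:T" unfolding T by blast
 qed
 moreover have "inj_on t T" using p(1) by (meson permutes_inj_on)
 moreover have "finite T" using TS p(2) finite_subset by blast
 ultimately show pT: "t`T = T" by (rule_tac endo_inj_surj)
 have "t`(S - T) = t`S - t`T" using permutes_inj[OF p(1)] by (rule image_set_diff)
 thus "t`(S - T) = S - T" using pT permutes_image[OF p(1)] by simp
 have cases: "b <= T & b:range ?t1 | b <= S - T" if b: "b:X" for b proof (cases "b:range ?t1")
  case True
  thus ?thesis unfolding T by blast
 next case False
  have "b Int T = {}" proof (rule ccontr)
   assume "b Int T ~= {}"
   then obtain x i where "x:b" "x:(t ^^ i)`?B" unfolding T by blast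
   hence "b = (t ^^ i)`?B" using partition_on_member_eq[OF part b st] by blast
   thus False using False by blast
  qed
  thus ?thesis using b stab_subset_Pow[OF X] by blast
 qed
 show "finer X {T, S - T}" using cases by (auto simp: finer_def)
 show bl: "below X T = range ?t1" proof
  show "below X T <= range ?t1" proof
   fix b assume b: "b:below X T"
   hence "b ~= {}" "b:X" "b <= T" using part by (auto simp: below_def partition_on_def)
   thus "b:range ?t1" using cases[of b] by blast
  qed
  show "range ?t1 <= below X T" using st unfolding T below_def by blast
 qed
 show "transitive_on t (below X T)" unfolding transitive_on_def bl using permutes_funpow_image_eq[OF p, of _ ?B] by fast
qed

lemma funpow_cong_on:
 assumes "!!x. x:T ==> f x = g x" "!!x. x:T ==> g x:T" "x:T"
 shows "(f ^^ i) x = (g ^^ i) x & (g ^^ i) x:T" by (induction i) (use assms in auto)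

lemma transitive_on_cong:
 assumes "partition_on T X" "!!x. x:T ==> f x = g x" "!!x. x:T ==> g x:T"
 shows "transitive_on f X \<longleftrightarrow> transitive_on g X"
proof -
 have "(f ^^ i)`b = (g ^^ i)`b" if "b:X" for b i proof (rule image_cong[OF refl], goal_cases)
  case (1 x)
  hence "x:T" using assms(1) that by (auto simp: partition_on_def)
  thus ?case using funpow_cong_on[of T f g x i] assms(2,3) by simp
 qed
 thus ?thesis unfolding transitive_on_def by (metis (no_types, lifting))
qed

section \<open>Newton recursion for sums over permutations and stable partitions\<close>

text \<open>The index \<open>r\<close> records for how many blocks of a cycle one block stands.
  After reduction to \<open>t ^^ r\<close> all cycle lengths are divided by \<open>r\<close>, and
  the index allows the original ones to be restored.\<close>

locale natural_family =
 fixes \<Theta> :: "nat => (nat => nat) => nat set set => 'r::comm_ring_1"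
 assumes iso: "!!r S t X g t'. finite S ==> bij_betw t S S ==> X:stab S t ==>
   inj_on g S ==> (!!x. x:S ==> t' (g x) = g (t x)) ==> \<Theta> r t' ((`) g`X) = \<Theta> r t X"
  and union: "!!S1 S2 t X1 X2. finite S1 ==> finite S2 ==> S1 Int S2 = {} ==>
   bij_betw t S1 S1 ==> bij_betw t S2 S2 ==> X1:stab S1 t ==> X2:stab S2 t ==> \<Theta> 1 t (X1 Un X2) = \<Theta> 1 t X1 * \<Theta> 1 t X2"
  and cycle: "!!t B r X. block_cycle t B r X ==> \<Theta> 1 t X = \<Theta> r (t ^^ r) {B}" and empty: "!!t. \<Theta> 1 t {} = 1"
begin

lemma cong: "finite S ==> bij_betw t S S ==> X:stab S t ==> (!!x. x:S ==> t' x = t x) ==> \<Theta> r t' X = \<Theta> r t X"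
 using iso[of S t X id t'] by (simp add: image_id)

text \<open>In the language of the exponential formula, \<open>con\<close> collects the connected
  structures among those of \<open>full\<close>, and \<open>core\<close> what is left of a connected
  structure after reduction to one block.\<close>

definition full :: "nat set => 'r" where "full S = (SUM (t, X):stabs S. \<Theta> 1 t X)"
definition con :: "nat set => 'r" where "con S = (SUM (t, X):tstabs S. \<Theta> 1 t X)"
definition core :: "nat => nat set => 'r" where "core r S = (\<Sum>sigma | sigma permutes S. \<Theta> r sigma {S})"

lemma full_empty: "full {} = 1"
proof -
 have "stabs {} = {(id, {} :: nat set set)}" by (auto simp: stabs_def)
 thus ?thesis by (simp add: full_def empty del: One_nat_def)
qed

text \<open>The cycle of blocks through the marked point \<open>a\<close> is split off. This is the
  pointed form of the exponential formula, in which no symmetries among the components have to be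
  divided out.\<close>

lemma full_split:
 assumes S: "finite S" "a:S"
 shows "full S = (\<Sum>T | a:T & T <= S. con T * full (S - T))"
proof -
 let ?J = "{T. a:T & T <= S}"
 let ?R = "Sigma ?J (%T. tstabs T \<times> stabs (S - T))"
 define i :: "nat set \<times> ((nat => nat) \<times> nat set set) \<times> ((nat => nat) \<times> nat set set) => (nat => nat) \<times> nat set set"
  where "i = (%(T, (t1, X1), (t2, X2)). (t1 \<circ> t2, X1 Un X2))"
 define j :: "(nat => nat) \<times> nat set set => nat set \<times> ((nat => nat) \<times> nat set set) \<times> ((nat => nat) \<times> nat set set)"
  where "j = (%(t, X). (component t X a, (perm_restrict t (component t X a), below X (component t X a)),
        (perm_restrict t (S - component t X a), below X (S - component t X a))))"
 have finJ: "finite ?J" using S by simp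
 have "full S = (SUM (T, (t1, X1), (t2, X2)):?R. \<Theta> 1 t1 X1 * \<Theta> 1 t2 X2)" unfolding full_def
 proof (rule sum.reindex_bij_witness[where i = i and j = j]) fix x assume x: "x:stabs S"
  obtain t X where xe: "x = (t, X)" by (cases x)
  have p: "t permutes S" and X: "X:stab S t" using x by (auto simp: stabs_def xe)
  define T where "T = component t X a"
  note cf = component_facts[OF p S(1) X S(2), folded T_def]
  have bT: "bij_betw t T T" "bij_betw t (S - T) (S - T)" using cf(3,4) permutes_inj_on[OF p] by (auto simp: bij_betw_def)
  have un: "T Un (S - T) = S" using cf(2) by blast
  have sp: "below X T:stab T t" "below X (S - T):stab (S - T) t" "X = below X T Un below X (S - T)"
   using stab_split[OF bT _ _ cf(5)] X by (simp_all only: un Diff_disjoint)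
  have finT: "finite T" using S(1) cf(2) finite_subset by blast
  note r1 = permutes_split[OF p cf(2,3)]
  show "i (j x) = x" using r1(3) sp(3) by (simp add: i_def j_def xe flip: T_def)
  have s1: "below X T:stab T (perm_restrict t T)" using sp(1) stab_cong[of T t "perm_restrict t T"] by (simp add: perm_restrict_def)
  have s2: "below X (S - T):stab (S - T) (perm_restrict t (S - T))"
   using sp(2) stab_cong[of "S - T" t "perm_restrict t (S - T)"] by (simp add: perm_restrict_def)
  have t: "transitive_on (perm_restrict t T) (below X T)"
   using transitive_on_cong[OF stabD(1)[OF sp(1)], of "perm_restrict t T" t] cf(3,7) by (auto simp: perm_restrict_def)
  show "j x:?R" using r1 s1 s2 t cf(1,2) by (simp add: j_def xe stabs_def tstabs_def flip: T_def)
  have "\<Theta> 1 t X = \<Theta> 1 t (below X T) * \<Theta> 1 t (below X (S - T))"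
   by (subst sp(3), rule union[OF _ _ _ bT sp(1,2)]) (use S(1) finT in auto)
  also have "\<Theta> 1 t (below X T) = \<Theta> 1 (perm_restrict t T) (below X T)"
   by (rule cong[where S = T, symmetric]) (use finT bT sp in \<open>auto simp: perm_restrict_def\<close>)
  also have "\<Theta> 1 t (below X (S - T)) = \<Theta> 1 (perm_restrict t (S - T)) (below X (S - T))"
   by (rule cong[where S = "S - T", symmetric]) (use S(1) bT sp in \<open>auto simp: perm_restrict_def\<close>)
  finally show "(%(T, (t1, X1), (t2, X2)). \<Theta> 1 t1 X1 * \<Theta> 1 t2 X2) (j x) = (%(t, X). \<Theta> 1 t X) x"
   by (simp add: j_def xe flip: T_def)
 next fix y assume y: "y:?R"
  obtain T t1 X1 t2 X2 where ye: "y = (T, (t1, X1), (t2, X2))" by (cases y) auto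
  have T: "a:T" "T <= S" and p1: "t1 permutes T" and p2: "t2 permutes (S - T)"
   and X1: "X1:stab T t1" and X2: "X2:stab (S - T) t2" and t: "transitive_on t1 X1" using y by (auto simp: ye stabs_def tstabs_def)
  let ?t = "t1 \<circ> t2"
  note j = permutes_join[OF T(2) p1 p2]
  note e1 = j(1) and e2 = j(2) and p = j(3)
  have un: "T Un (S - T) = S" using T by blast
  have X1': "X1:stab T ?t" using X1 stab_cong[of T ?t t1] e1 by simp
  have X2': "X2:stab (S - T) ?t" using X2 stab_cong[of "S - T" ?t t2] e2 by simp
  have X: "X1 Un X2:stab S ?t" using stab_Un[OF X1' X2'] by (simp only: un Diff_disjoint)
  have t': "transitive_on ?t X1" using transitive_on_cong[OF stabD(1)[OF X1], of ?t t1] e1 permutes_in_image[OF p1] t by simp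
  have B: "block_of X1 a:X1" "a:block_of X1 a" using block_of[OF stabD(1)[OF X1] T(1)] by auto
  have bo: "block_of (X1 Un X2) a = block_of X1 a" using block_of_eq[OF stabD(1)[OF X], of "block_of X1 a" a] B by simp
  have bl: "below (X1 Un X2) T = X1" "below (X1 Un X2) (S - T) = X2"
   using below_Un_left[OF stabD(1)[OF X1] stabD(1)[OF X2]] below_Un_right[OF stabD(1)[OF X1] stabD(1)[OF X2]] by auto
  have st: "(?t ^^ i)`block_of X1 a:X1" for i using stab_funpow[OF X1'] B by blast
  let ?t1 = "(%i. (?t ^^ i)`block_of X1 a)"
  have "X1 = ?t1`UNIV" proof
   show "X1 <= ?t1`UNIV" proof
    fix c assume "c:X1"
    hence "\<exists>i. c = (?t ^^ i)`block_of X1 a" using t' B(1) unfolding transitive_on_def by simp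
    then obtain i where "c = (?t ^^ i)`block_of X1 a" by (rule exE)
    thus "c:?t1`UNIV" by simp
   qed
  qed (use st in blast)
  \<comment> \<open>Transitivity makes the orbit of the block of \<open>a\<close> exhaust
    \<open>X1\<close>, so gluing and splitting again returns the same set \<open>T\<close>.\<close>
  hence comp: "component ?t (X1 Un X2) a = T" unfolding component_def bo using stabD(3)[OF X1] by simp
  show "j (i y) = y" by (simp only: i_def j_def ye prod.case comp j(4,5) bl)
  show "i y:stabs S" using p X by (simp add: i_def ye stabs_def)
 qed
 also have "... = (SUM T:?J. SUM x:tstabs T \<times> stabs (S - T). case x of ((t1, X1), (t2, X2)) => \<Theta> 1 t1 X1 * \<Theta> 1 t2 X2)" proof -
  have "finite (tstabs T \<times> stabs (S - T))" if "T:?J" for T using that finite_subset[of T S] S by simp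
  thus ?thesis
   using sum.Sigma[OF finJ, of "%T. tstabs T \<times> stabs (S - T)" "%T x. case x of ((t1, X1), (t2, X2)) => \<Theta> 1 t1 X1 * \<Theta> 1 t2 X2"]
   by (simp add: case_prod_unfold)
 qed
 also have "... = (SUM T:?J. con T * full (S - T))" proof (rule sum_eqI, goal_cases)
  case (1 T)
  have "con T * full (S - T) = (SUM x:tstabs T. SUM y:stabs (S - T). (case x of (t, X) => \<Theta> 1 t X) * (case y of (t, X) => \<Theta> 1 t X))"
   unfolding con_def full_def by (rule sum_product)
  also have "... = (SUM x:tstabs T \<times> stabs (S - T). case x of ((t1, X1), (t2, X2)) => \<Theta> 1 t1 X1 * \<Theta> 1 t2 X2)"
   unfolding sum.cartesian_product by (rule sum.cong) auto
  finally show ?case by simp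
 qed
 finally show ?thesis .
qed

end

lemma block_cycle_enum:
 assumes bc: "block_cycle t B r X"
 shows "bij_betw (%(i, b). (t ^^ i) b) ({..<r} \<times> B) (\<Union>X)"
proof (rule bij_betw_imageI)
 let ?t1 = "(%(i, b). (t ^^ i) b)"
 show "inj_on ?t1 ({..<r} \<times> B)" proof (rule inj_onI, clarify)
  fix i b j c assume "i < r" "b:B" "j < r" "c:B" "(t ^^ i) b = (t ^^ j) c"
  thus "i = j & b = c" using cycle_block_unique[OF bc, of i "{b}" j "{c}"] by simp
 qed
 have "?t1`({..<r} \<times> B) = (\<Union>i<r. (t ^^ i)`B)" by auto
 thus "?t1`({..<r} \<times> B) = \<Union>X" using block_cycle_facts(5)[OF bc] by simp
qed

text \<open>The fibre over \<open>sigma\<close> of the map that sends a cycle of blocks with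
  distinguished block \<open>B\<close> to its first return map on \<open>B\<close>.\<close>

definition cyc_fiber :: "nat set => nat set => nat => (nat => nat) => ((nat => nat) \<times> nat set set) set" where
 "cyc_fiber S B r sigma = {(t, X). (t, X):tstabs S & B:X & (ALL b:B. (t ^^ r) b = sigma b)}"

context
 fixes S B :: "nat set" and r :: nat and sigma :: "nat => nat"
 assumes S: "finite S" and B: "B <= S" "B ~= {}" and card: "card S = r * card B" and r: "0 < r" and sigma: "sigma permutes B"
begin

lemma finB: "finite B" using S B finite_subset by blast

lemma cyc_fiber_block_cycle:
 assumes "(t, X):cyc_fiber S B r sigma"
 shows "block_cycle t B r X" "\<Union>X = S" "t permutes S"
proof -
 have p: "t permutes S" "X:stab S t" "transitive_on t X" "B:X" using assms by (auto simp: cyc_fiber_def tstabs_def stabs_def)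
 hence bc: "block_cycle t B (card X) X" using transitive_block_cycle S by blast
 have U: "\<Union>X = S" using p(2) by (rule stabD)
 hence e: "card X * card B = r * card B" using block_cycle_card_Union[OF bc] card unfolding U by linarith
 have "card B ~= 0" using finB B by simp
 hence "card X = r" using e by (metis mult_right_cancel)
 thus "block_cycle t B r X" "\<Union>X = S" "t permutes S" using bc U p by auto
qed

text \<open>The iterates below \<open>r\<close> determine \<open>t\<close> on every level except the
  last, and there \<open>t\<close> is determined by \<open>sigma\<close>.\<close>

lemma cyc_fiber_ext:
 assumes y: "(t, X):cyc_fiber S B r sigma" "(t', X'):cyc_fiber S B r sigma" and e: "!!i b. i < r ==> b:B ==> (t ^^ i) b = (t' ^^ i) b"
 shows "t = t' & X = X'"
proof
 note bc = cyc_fiber_block_cycle[OF y(1)] and bc' = cyc_fiber_block_cycle[OF y(2)]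
 show "t = t'" proof
  fix x show "t x = t' x" proof (cases "x:S")
   case True
   then obtain i b where ib: "i < r" "b:B" "x = (t ^^ i) b" using block_cycle_facts(5)[OF bc(1)] bc(2) by auto
   have "(t ^^ Suc i) b = (t' ^^ Suc i) b" proof (cases "Suc i < r")
    case False
    hence "Suc i = r" using ib by simp
    thus ?thesis using y ib(2) unfolding cyc_fiber_def by simp
   qed (use e ib in blast)
   thus ?thesis using ib e by simp
  qed (use permutes_not_in[OF bc(3)] permutes_not_in[OF bc'(3)] in simp)
 qed
 have "(t ^^ i)`B = (t' ^^ i)`B" if "i < r" for i by (rule image_cong[OF refl e[OF that]])
 thus "X = X'" using block_cycle_facts(5)[OF bc(1)] block_cycle_facts(5)[OF bc'(1)] by simp
qed

text \<open>\<open>S\<close> is arranged as a tower of \<open>r\<close> copies of \<open>B\<close>: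
  \<open>beta\<close> names the points of the levels 1 to r - 1, and level 0 is \<open>B\<close>
  itself.\<close>

lemma cyc_fiber_ex:
 assumes beta: "bij_betw beta ({1..<r} \<times> B) (S - B)"
 shows "\<exists>t X. (t, X):cyc_fiber S B r sigma & (\<forall>i b. 0 < i --> i < r --> b:B --> (t ^^ i) b = beta (i, b))"
proof -
 let ?D = "{..<r} \<times> B"
 define j where "j = (%(i, b). if i = 0 then b else beta (i, b))"
 have "bij_betw j ({0} \<times> B) B" by (rule bij_betw_byWitness[where f' = "%b. (0, b)"]) (auto simp: j_def)
 moreover have "bij_betw j ({1..<r} \<times> B) (S - B)" by (rule bij_betw_cong[THEN iffD1, OF _ beta]) (auto simp: j_def)
 ultimately have "bij_betw j ({0} \<times> B Un {1..<r} \<times> B) (B Un (S - B))" by (rule bij_betw_combine) auto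
 moreover have "{0} \<times> B Un {1..<r} \<times> B = ?D" using r by auto
 moreover have "B Un (S - B) = S" using B by blast
 ultimately have j: "bij_betw j ?D S" by simp
 \<comment> \<open>The permutation climbs the tower and applies \<open>sigma\<close> only on the way
   back to level 0, so that one full round acts on \<open>B\<close> as \<open>sigma\<close>.\<close>
 define step where "step = (%(i, b). if Suc i < r then (Suc i, b) else (0, sigma b))"
 have inj: "inj_on step ?D" using permutes_inj[OF sigma] by (auto simp: inj_on_def step_def split: if_splits)
 have "step`?D <= ?D" proof (rule image_subsetI)
  fix x assume "x:?D"
  then obtain i b where "x = (i, b)" "b:B" by blast
  thus "step x:?D" using permutes_in_image[OF sigma, of b] r by (simp add: step_def)
 qed
 hence "step`?D = ?D" using inj finB by (intro endo_inj_surj) auto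
 hence st: "bij_betw step ?D ?D" using inj by (simp add: bij_betw_def)
 define t where "t = (%x. if x:S then j (step (inv_into ?D j x)) else x)"
 have p: "t permutes S" proof (rule bij_imp_permutes)
  have "bij_betw (j \<circ> (step \<circ> inv_into ?D j)) S S" by (intro bij_betw_trans[OF bij_betw_trans[OF bij_betw_inv_into[OF j] st] j])
  thus "bij_betw t S S" by (rule bij_betw_cong[THEN iffD1, rotated]) (simp add: t_def)
 qed (simp add: t_def)
 have pj: "t (j x) = j (step x)" if "x:?D" for x proof -
  have "j x:S" using bij_betwE[OF j] that by blast
  thus ?thesis using bij_betw_inv_into_left[OF j that] by (simp add: t_def)
 qed
 have pi: "(t ^^ i) b = j (i, b)" if "i < r" "b:B" for i b using that proof (induction i)
  case 0
  thus ?case by (simp add: j_def)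
 next case (Suc i)
  thus ?case using pj[of "(i, b)"] by (simp add: step_def)
 qed
 have pr: "(t ^^ r) b = sigma b" if "b:B" for b proof -
  obtain k where k: "r = Suc k" using r gr0_conv_Suc by blast
  hence "(t ^^ r) b = t (j (k, b))" using pi[of k b] that by simp
  also have "... = sigma b" using pj[of "(k, b)"] that k by (simp add: step_def j_def)
  finally show ?thesis .
 qed
 define X where "X = (%i. (t ^^ i)`B)`{..<r}"
 have img: "(t ^^ i)`B = j`({i} \<times> B)" if "i < r" for i using pi[OF that] by force
 have U: "\<Union>X = S" proof -
  have "\<Union>X = (\<Union>i<r. j`({i} \<times> B))" using img by (simp add: X_def)
  also have "... = j`?D" by auto
  finally show ?thesis using j by (simp add: bij_betw_def)
 qed
 have bc: "block_cycle t B r X" unfolding block_cycle_def proof (intro conjI allI impI)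
  have "(t ^^ r)`B = sigma`B" using pr by (rule image_cong[OF refl])
  thus "(t ^^ r)`B = B" using permutes_image[OF sigma] by simp
  show "(t ^^ i)`B Int (t ^^ k)`B = {}" if "i < r" "k < r" "i ~= k" for i k proof -
   have "j`({i} \<times> B) Int j`({k} \<times> B) = j`(({i} \<times> B) Int ({k} \<times> B))"
    using bij_betw_imp_inj_on[OF j] that by (intro inj_on_image_Int[symmetric]) auto
   also have "... = {}" using that by auto
   finally show ?thesis using img that by simp
  qed
  show "inj_on t (\<Union>X)" using permutes_inj_on[OF p] .
 qed (use r finB B X_def in auto)
 have "X:stab S t" using block_cycle_stab[OF bc] U by simp
 hence "(t, X):cyc_fiber S B r sigma" using p block_cycle_transitive[OF bc] block_cycle_base[OF bc] pr
  by (simp add: cyc_fiber_def tstabs_def stabs_def)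
 moreover have "(t ^^ i) b = beta (i, b)" if "0 < i" "i < r" "b:B" for i b using pi[OF that(2,3)] that(1) by (simp add: j_def)
 ultimately show ?thesis by blast
qed

text \<open>An element of the fibre amounts to an enumeration of \<open>S - B\<close> by the levels
  1 to r - 1 of a tower over \<open>B\<close>. Relative to one fixed enumeration these are the
  permutations of \<open>S - B\<close>; in particular their number does not depend on
  \<open>sigma\<close>.\<close>

lemma card_cyc_fiber: "card (cyc_fiber S B r sigma) = fact (card S - card B)"
proof -
 let ?E = "{1..<r} \<times> B" and ?P = "{p. p permutes S - B}"
 have cSB: "card (S - B) = card S - card B" by (rule card_Diff_subset[OF finB B(1)])
 have "card ?E = card (S - B)" using card by (simp add: cSB card_cartesian_product diff_mult_distrib)
 then obtain beta where beta: "bij_betw beta ?E (S - B)" using finite_same_card_bij[of ?E "S - B"] S finB by auto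
 \<comment> \<open>\<open>G\<close> measures the enumeration given by the iterates of
   \<open>t\<close> against the fixed one \<open>beta\<close>.\<close>
 define G where "G = (%(t :: nat => nat, X :: nat set set) x. if x:S - B then (case inv_into ?E beta x of (i, b) => (t ^^ i) b) else x)"
 have G: "G (t, X) (beta (i, b)) = (t ^^ i) b" if "0 < i" "i < r" "b:B" for t X i b proof -
  have "(i, b):?E" using that by simp
  thus ?thesis using bij_betw_inv_into_left[OF beta] bij_betwE[OF beta] unfolding G_def by fastforce
 qed
 have "bij_betw G (cyc_fiber S B r sigma) ?P" proof (rule bij_betw_imageI)
  show "inj_on G (cyc_fiber S B r sigma)" proof (rule inj_onI, clarify)
   fix t X t' X' assume y: "(t, X):cyc_fiber S B r sigma" "(t', X'):cyc_fiber S B r sigma" and e: "G (t, X) = G (t', X')" show "t = t' & X = X'"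
   proof (rule cyc_fiber_ext[OF y]) fix i b assume ib: "i < r" "b:B"
    show "(t ^^ i) b = (t' ^^ i) b" using G[OF _ ib, of t X] G[OF _ ib, of t' X'] e by (cases "i = 0") simp_all
   qed
  qed
  show "G`cyc_fiber S B r sigma = ?P" proof (intro equalityI subsetI)
   fix p assume "p:G`cyc_fiber S B r sigma"
   then obtain t X where y: "(t, X):cyc_fiber S B r sigma" and p: "p = G (t, X)" by auto
   note bc = cyc_fiber_block_cycle[OF y]
   let ?e = "%(i, b). (t ^^ i) b"
   have "bij_betw ?e ({..<r} \<times> B) S" using block_cycle_enum[OF bc(1)] bc(2) by simp
   moreover have "bij_betw ?e ({0} \<times> B) B" by (rule bij_betw_byWitness[where f' = "%b. (0, b)"]) auto
   ultimately have "bij_betw ?e ({..<r} \<times> B - {0} \<times> B) (S - B)" using r B(1) by (intro bij_betw_DiffI) auto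
   moreover have "{..<r} \<times> B - {0} \<times> B = ?E" by auto
   ultimately have "bij_betw (?e \<circ> inv_into ?E beta) (S - B) (S - B)" using bij_betw_trans[OF bij_betw_inv_into[OF beta]] by simp
   hence "bij_betw p (S - B) (S - B)" by (rule bij_betw_cong[THEN iffD1, rotated]) (simp add: p G_def)
   hence "p permutes S - B" by (rule bij_imp_permutes) (simp only: p G_def prod.case if_False)
   thus "p:?P" by simp
  next fix p assume "p:?P"
   hence p: "p permutes S - B" by simp
   obtain t X where y: "(t, X):cyc_fiber S B r sigma" and e: "!!i b. 0 < i ==> i < r ==> b:B ==> (t ^^ i) b = p (beta (i, b))"
    using cyc_fiber_ex[OF bij_betw_trans[OF beta permutes_imp_bij[OF p]]] by auto
   have "G (t, X) x = p x" for x proof (cases "x:S - B")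
    case True
    then obtain i b where ib: "0 < i" "i < r" "b:B" "x = beta (i, b)" unfolding bij_betw_imp_surj_on[OF beta, symmetric] by (auto simp: Suc_le_eq)
    thus ?thesis using G[OF ib(1-3)] e[OF ib(1-3)] by simp
   next case False
    thus ?thesis using permutes_not_in[OF p False] by (simp only: G_def prod.case if_False)
   qed
   hence "G (t, X) = p" by (rule ext)
   thus "p:G`cyc_fiber S B r sigma" using y by blast
  qed
 qed
 thus ?thesis using card_permutations[OF cSB] S by (simp add: bij_betw_same_card)
qed

end

lemma bij_map_permutation:
 assumes g: "bij_betw g S S'"
 shows "bij_betw (map_permutation S g) {t. t permutes S} {t. t permutes S'}"
proof -
 have b: "bij_betw (%t x. if x:S' then g (t (inv_into S g x)) else x) {t. t permutes S} {t. t permutes S'}" by (rule bij_betw_permutations[OF g])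
 show ?thesis by (rule bij_betw_cong[THEN iffD1, OF _ b])
   (use g in \<open>auto simp: map_permutation_def restrict_id_def bij_betw_def fun_eq_iff\<close>)
qed

context natural_family
begin

lemma core_iso:
 assumes "finite S" "S ~= {}" "bij_betw g S S'"
 shows "core r S = core r S'"
proof -
 have inj: "inj_on g S" and im: "g`S = S'" using assms by (auto simp: bij_betw_def)
 have "core r S' = (\<Sum>sigma | sigma permutes S. \<Theta> r (map_permutation S g sigma) {S'})"
  unfolding core_def by (rule sum.reindex_bij_betw[OF bij_map_permutation[OF assms(3)], symmetric])
 also have "... = core r S" unfolding core_def proof (rule sum_eqI, goal_cases)
  case (1 sigma)
  hence s: "sigma permutes S" by simp
  show ?case using iso[of S sigma "{S}" g "map_permutation S g sigma" r] assms(1,2) inj im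
    permutes_bij_betw[OF s] stab_one_block[OF permutes_bij_betw[OF s] assms(2)] by (simp add: map_permutation_apply)
 qed
 finally show ?thesis by simp
qed

lemma full_nested: "finite S ==> full S = (\<Sum>t | t permutes S. SUM X:stab S t. \<Theta> 1 t X)"
proof -
 assume S: "finite S"
 have "stabs S = Sigma {t. t permutes S} (stab S)" by (auto simp: stabs_def)
 thus ?thesis unfolding full_def using S by (subst sum.Sigma) (auto simp: finite_permutations)
qed

lemma full_iso:
 assumes "finite S" "bij_betw g S S'"
 shows "full S = full S'"
proof -
 have inj: "inj_on g S" and im: "g`S = S'" using assms by (auto simp: bij_betw_def)
 have S': "finite S'" using assms bij_betw_finite by blast
 have "full S' = (\<Sum>t | t permutes S. SUM X:stab S' (map_permutation S g t). \<Theta> 1 (map_permutation S g t) X)"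
  unfolding full_nested[OF S'] by (rule sum.reindex_bij_betw[OF bij_map_permutation[OF assms(2)], symmetric])
 also have "... = full S" unfolding full_nested[OF assms(1)] proof (rule sum_eqI, goal_cases)
  case (1 t)
  hence p: "bij_betw t S S" by (simp add: permutes_bij_betw)
  have c: "map_permutation S g t (g x) = g (t x)" if "x:S" for x using map_permutation_apply[OF inj that] .
  have "(SUM X:stab S' (map_permutation S g t). \<Theta> 1 (map_permutation S g t) X) =
    (SUM X:stab S t. \<Theta> 1 (map_permutation S g t) ((`) g`X))"
   using sum.reindex_bij_betw[OF bij_betw_stab_image[OF inj p c], where g = "\<Theta> 1 (map_permutation S g t)"] im by simp
  also have "... = (SUM X:stab S t. \<Theta> 1 t X)" by (rule sum_eqI) (rule iso[OF assms(1) p _ inj c])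
  finally show ?case .
 qed
 finally show ?thesis by simp
qed

text \<open>A cycle of blocks is cut at its block through \<open>a\<close>. Its weight is that of
  the first return map, and the number of cycles with a prescribed first return map is always the
  same, so the sum factors.\<close>

lemma con_fibers:
 assumes S: "finite S" "a:S"
 shows "con S = (\<Sum>B | a:B & B <= S & card B dvd card S. of_nat (fact (card S - card B)) * core (card S div card B) B)"
proof -
 let ?J = "{B. a:B & B <= S & card B dvd card S}"
 let ?I = "Sigma ?J (%B. {sigma. sigma permutes B})"
 let ?r = "%B. card S div card B"
 let ?R = "Sigma ?I (%(B, sigma). cyc_fiber S B (?r B) sigma)"
 have Bf: "finite B" "B ~= {}" "B <= S" "card S = ?r B * card B" "0 < ?r B" if "B:?J" for B proof -
  show "finite B" "B ~= {}" "B <= S" "card S = ?r B * card B" using that S finite_subset[of B S] by auto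
  thus "0 < ?r B" using S by (metis card_gt_0_iff empty_iff mult_eq_0_iff neq0_conv)
 qed
 have finJ: "finite ?J" by (rule finite_subset[of _ "Pow S"]) (use S in auto)
 define i :: "(nat set \<times> (nat => nat)) \<times> ((nat => nat) \<times> nat set set) => ((nat => nat) \<times> nat set set)" where "i = snd"
 define j where "j = (%(t :: nat => nat, X). ((block_of X a, perm_restrict (t ^^ card X) (block_of X a)), (t, X)))"
 have "con S = (SUM x:?R. \<Theta> 1 (fst (snd x)) (snd (snd x)))" unfolding con_def proof (rule sum.reindex_bij_witness[where i = i and j = j])
  fix x assume x: "x:tstabs S" obtain t X where xe: "x = (t, X)" by (cases x)
  have p: "t permutes S" "X:stab S t" "transitive_on t X" using x by (auto simp: tstabs_def stabs_def xe)
  let ?B = "block_of X a"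
  have B: "?B:X" "a:?B" using block_of[OF stabD(1)[OF p(2)] S(2)] by auto
  have bc: "block_cycle t ?B (card X) X" by (rule transitive_block_cycle[OF p(1) S(1) p(2,3) B(1)])
  have U: "\<Union>X = S" using p(2) by (rule stabD)
  have c: "card S = card X * card ?B" using block_cycle_card_Union[OF bc] U by simp
  have cB: "card ?B ~= 0" using block_cycle_facts(2,3)[OF bc] by simp
  have J: "?B:?J" using B U c by auto
  have r: "?r ?B = card X" using c cB by simp
  have "perm_restrict (t ^^ card X) ?B permutes ?B"
   by (rule perm_restrict_permutes[OF permutes_funpow[OF p(1)]]) (use J block_cycle_facts(4)[OF bc] in auto)
  thus "j x:?R" using J r x B by (simp add: j_def xe cyc_fiber_def perm_restrict_def)
  show "i (j x) = x" by (simp add: i_def j_def xe)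
  show "\<Theta> 1 (fst (snd (j x))) (snd (snd (j x))) = (%(t, X). \<Theta> 1 t X) x" by (simp add: j_def xe)
 next fix y assume y: "y:?R"
  obtain B sigma t X where ye: "y = ((B, sigma), (t, X))" by (cases y) auto
  have B: "B:?J" and s: "sigma permutes B" and q: "(t, X):cyc_fiber S B (?r B) sigma" using y by (auto simp: ye)
  note bc = cyc_fiber_block_cycle[OF S(1) Bf(3)[OF B] Bf(2)[OF B] Bf(4)[OF B] Bf(5)[OF B] s q]
  have t: "(t, X):tstabs S" "B:X" "!!b. b:B ==> (t ^^ ?r B) b = sigma b" using q by (auto simp: cyc_fiber_def)
  show "i y:tstabs S" using t by (simp add: i_def ye)
  have X: "partition_on S X" using t(1) by (auto simp: tstabs_def stabs_def stab_def)
  have b: "block_of X a = B" using block_of_eq[OF X t(2)] B by simp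
  have "perm_restrict (t ^^ card X) B = sigma"
   using t(3) permutes_not_in[OF s] block_cycle_card[OF bc(1)] by (auto simp: perm_restrict_def fun_eq_iff)
  thus "j (i y) = y" by (simp add: i_def j_def ye b)
 qed
 also have "... = (SUM I:?I. SUM x:(case I of (B, sigma) => cyc_fiber S B (?r B) sigma). \<Theta> 1 (fst x) (snd x))" proof -
  have 1: "finite ?I" by (rule finite_SigmaI[OF finJ finite_permutations[OF Bf(1)]])
  have 2: "finite (case I of (B, sigma) => cyc_fiber S B (?r B) sigma)" for I
   by (rule finite_subset[OF _ finite_tstabs[OF S(1)]]) (auto simp: cyc_fiber_def split: prod.splits)
  have "(SUM I:?I. SUM x:(case I of (B, sigma) => cyc_fiber S B (?r B) sigma). \<Theta> 1 (fst x) (snd x)) =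
    (SUM (I, x):?R. \<Theta> 1 (fst x) (snd x))" by (rule sum.Sigma[OF 1]) (use 2 in blast)
  thus ?thesis by (simp add: case_prod_unfold)
 qed
 also have "... = (SUM I:?I. of_nat (fact (card S - card (fst I))) * \<Theta> (?r (fst I)) (snd I) {fst I})"
 proof (rule sum.cong[OF refl], goal_cases) case I: (1 I)
  obtain B sigma where Ie: "I = (B, sigma)" by (cases I)
  have B: "B:?J" and s: "sigma permutes B" using I by (auto simp: Ie)
  have "\<Theta> 1 (fst x) (snd x) = \<Theta> (?r B) sigma {B}" if "x:cyc_fiber S B (?r B) sigma" for x proof -
   obtain t X where xe: "x = (t, X)" by (cases x)
   note bc = cyc_fiber_block_cycle[OF S(1) Bf(3)[OF B] Bf(2)[OF B] Bf(4)[OF B] Bf(5)[OF B] s that[unfolded xe]]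
   have "\<Theta> 1 t X = \<Theta> (?r B) (t ^^ ?r B) {B}" by (rule cycle[OF bc(1)])
   also have "... = \<Theta> (?r B) sigma {B}"
    by (rule cong[OF Bf(1)[OF B] permutes_bij_betw[OF s] stab_one_block[OF permutes_bij_betw[OF s] Bf(2)[OF B]]])
     (use that in \<open>simp add: xe cyc_fiber_def\<close>)
   finally show ?thesis by (simp add: xe)
  qed
  hence "(SUM x:cyc_fiber S B (?r B) sigma. \<Theta> 1 (fst x) (snd x)) = of_nat (card (cyc_fiber S B (?r B) sigma)) * \<Theta> (?r B) sigma {B}"
   by simp
  also have "card (cyc_fiber S B (?r B) sigma) = fact (card S - card B)"
   by (rule card_cyc_fiber[OF S(1) Bf(3)[OF B] Bf(2)[OF B] Bf(4)[OF B] Bf(5)[OF B] s])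
  finally show ?case by (simp add: Ie)
 qed
 also have "... = (SUM B:?J. \<Sum>sigma | sigma permutes B. of_nat (fact (card S - card B)) * \<Theta> (?r B) sigma {B})" proof -
  have "ALL B:?J. finite {sigma. sigma permutes B}" by (rule ballI) (rule finite_permutations[OF Bf(1)])
  from sum.Sigma[OF finJ this, of "%B sigma. of_nat (fact (card S - card B)) * \<Theta> (?r B) sigma {B}"]
  show ?thesis by (simp add: case_prod_unfold)
 qed
 finally show ?thesis by (simp only: core_def sum_distrib_left)
qed

end

lemma sum_pointed_subsets:
 fixes g :: "nat => 'r::comm_ring_1"
 assumes S: "finite S" "a:S"
 shows "(\<Sum>T | a:T & T <= S & Q (card T). g (card T)) = (\<Sum>k | k:{1..card S} & Q k. of_nat ((card S - 1) choose (k - 1)) * g k)"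
proof -
 let ?A = "{T. a:T & T <= S & Q (card T)}" and ?K = "{k. k:{1..card S} & Q k}"
 have fin: "finite ?A" by (rule finite_subset[of _ "Pow S"]) (use S in auto)
 have finK: "finite ?K" by (rule finite_subset[of _ "{1..card S}"]) auto
 have im: "card`?A <= ?K" proof (rule image_subsetI)
  fix T assume T: "T:?A"
  hence "finite T" using S finite_subset by blast
  hence "card T ~= 0" "card T <= card S" using T card_mono[OF S(1), of T] by auto
  thus "card T:?K" using T by simp
 qed
 have "(SUM T:?A. g (card T)) = (SUM k:?K. SUM T:{T:?A. card T = k}. g (card T))" by (rule sum.group[OF fin finK im, symmetric])
 also have "... = (SUM k:?K. of_nat ((card S - 1) choose (k - 1)) * g k)" proof (rule sum_eqI, goal_cases)
  case k: (1 k)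
  let ?t1 = "{U. U <= S - {a} & card U = k - 1}"
  let ?t2 = "{T:?A. card T = k}"
  have "bij_betw (insert a) ?t1 ?t2" proof (rule bij_betw_byWitness[where f' = "%T. T - {a}"])
   show "insert a`?t1 <= ?t2" proof (rule image_subsetI)
    fix U assume U: "U:?t1"
    hence "U <= S" "a ~: U" by auto
    hence "finite U" using S(1) finite_subset by blast
    hence "card (insert a U) = k" using U k \<open>a \<notin> U\<close> by simp
    thus "insert a U:?t2" using \<open>U \<subseteq> S\<close> k S(2) by simp
   qed
   show "(%T. T - {a})`?t2 <= ?t1" proof (rule image_subsetI)
    fix T assume T: "T:?t2"
    hence "card (T - {a}) = k - 1" by (simp add: card_Diff_singleton)
    thus "T - {a}:?t1" using T by blast
   qed
  qed auto
  hence "card ?t2 = card ?t1" by (simp add: bij_betw_same_card)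
  also have "... = (card S - 1) choose (k - 1)" using S n_subsets[of "S - {a}" "k - 1"] by simp
  finally have "card ?t2 = (card S - 1) choose (k - 1)" .
  moreover have "(SUM T:{T:?A. card T = k}. g (card T)) = (SUM T:{T:?A. card T = k}. g k)" by (rule sum.cong) auto
  ultimately show ?case by simp
 qed
 finally show ?thesis .
qed

context natural_family
begin

lemma core_card: "finite S ==> S ~= {} ==> core r S = core r {1..card S}"
proof -
 assume S: "finite S" "S ~= {}"
 then obtain g where "bij_betw g S {1..card S}" using finite_same_card_bij[of S "{1..card S}"] by auto
 thus ?thesis using core_iso[OF S] by blast
qed

lemma full_card: "finite S ==> full S = full {1..card S}"
proof -
 assume S: "finite S"
 then obtain g where "bij_betw g S {1..card S}" using finite_same_card_bij[of S "{1..card S}"] by auto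
 thus ?thesis using full_iso[OF S] by blast
qed

lemma con_formula:
 assumes "finite S" "S ~= {}"
 shows "con S = (\<Sum>s | s dvd card S. of_nat ((card S - 1) choose (s - 1)) * (of_nat (fact (card S - s)) * core (card S div s) {1..s}))"
proof -
 obtain a where a: "a:S" using assms by blast
 have c0: "card S ~= 0" using assms by simp
 have "con S = (\<Sum>B | a:B & B <= S & card B dvd card S. of_nat (fact (card S - card B)) * core (card S div card B) {1..card B})"
  unfolding con_fibers[OF assms(1) a] proof (rule sum_eqI, goal_cases)
  case B: (1 B)
  hence "finite B" "B ~= {}" using finite_subset[of B S] assms by auto
  thus ?case using core_card[of B] by simp
 qed
 also have "... = (\<Sum>k | k:{1..card S} & k dvd card S. of_nat ((card S - 1) choose (k - 1)) * (of_nat (fact (card S - k)) * core (card S div k) {1..k}))"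
  by (rule sum_pointed_subsets[OF assms(1) a, where Q = "%k. k dvd card S" and g = "%k. of_nat (fact (card S - k)) * core (card S div k) {1..k}"])
 also have "{k. k:{1..card S} & k dvd card S} = {s. s dvd card S}" proof (rule Collect_cong)
  fix k show "k:{1..card S} & k dvd card S \<longleftrightarrow> k dvd card S" using dvd_imp_le[of k "card S"] c0 by (cases "k = 0") auto
 qed
 finally show ?thesis .
qed

text \<open>\<open>ifact\<close> expresses invertibility of factorials in a ring without division.
  After normalisation by it, the binomial coefficients of \<open>full_split\<close> and
  \<open>con_formula\<close> cancel and a convolution remains.\<close>

lemma full_recursion:
 assumes ifact: "!!n. of_nat (fact n) * ifact n = (1::'r)"
 shows "of_nat n * (ifact n * full {1..n}) =
  (\<Sum>k=1..n. (\<Sum>s | s dvd k. of_nat s * (ifact s * core (k div s) {1..s})) * (ifact (n - k) * full {1..n - k}))"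
proof (cases "n = 0") case False
 hence n: "finite {1..n}" "1:{1..n}" "card {1..n} = n" by auto
 have cancel: "ifact m * (of_nat (fact m) * x) = x" for m x proof -
  have "ifact m * (of_nat (fact m) * x) = (of_nat (fact m) * ifact m) * x" by (simp only: ac_simps)
  thus ?thesis using ifact[of m] by simp
 qed
 have con: "con T = of_nat (fact (k - 1)) * (\<Sum>s | s dvd k. of_nat s * (ifact s * core (k div s) {1..s}))"
  if T: "finite T" "card T = k" "0 < k" for T k proof -
  have "T ~= {}" using T by auto
  hence "con T = (\<Sum>s | s dvd k. of_nat ((k - 1) choose (s - 1)) * (of_nat (fact (k - s)) * core (k div s) {1..s}))"
   using con_formula[OF T(1)] T(2) by simp
  also have "... = (\<Sum>s | s dvd k. of_nat (fact (k - 1)) * (of_nat s * (ifact s * core (k div s) {1..s})))" proof (rule sum_eqI, goal_cases)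
   case (1 s)
   hence s: "0 < s" "s <= k" using T(3) by (auto intro: dvd_pos_nat dvd_imp_le)
   \<comment> \<open>The binomial coefficient times (k - s)! is (k - 1)! / (s - 1)!. It is used in
     the form (k - 1)! s / s!, because the core on s points is normalised by 1 / s!; this is the
     origin of the factor s.\<close>
   have f: "fact (s - 1) * fact (k - s) * ((k - 1) choose (s - 1)) = (fact (k - 1) :: nat)" using binomial_fact_lemma[of "s - 1" "k - 1"] s by simp
   have fs: "(fact s :: nat) = s * fact (s - 1)" using s by (simp add: fact_reduce)
   have "of_nat ((k - 1) choose (s - 1)) * (of_nat (fact (k - s)) * core (k div s) {1..s}) =
     ifact s * (of_nat (fact s) * (of_nat ((k - 1) choose (s - 1)) * (of_nat (fact (k - s)) * core (k div s) {1..s})))" by (simp only: cancel)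
   also have "... = of_nat (fact s * ((k - 1) choose (s - 1)) * fact (k - s)) * (ifact s * core (k div s) {1..s})"
    by (simp only: of_nat_mult ac_simps)
   also have "fact s * ((k - 1) choose (s - 1)) * fact (k - s) = s * fact (k - 1)" unfolding fs f[symmetric] by (simp only: ac_simps)
   finally show ?case by (simp only: of_nat_mult ac_simps)
  qed
  finally show ?thesis by (simp only: sum_distrib_left)
 qed
 let ?D = "%k. \<Sum>s | s dvd k. of_nat s * (ifact s * core (k div s) {1..s})"
 have "full {1..n} = (\<Sum>T | 1:T & T <= {1..n} & True. of_nat (fact (card T - 1)) * ?D (card T) * full {1..n - card T})"
  unfolding full_split[OF n(1,2)] proof (rule sum.cong)
  fix T assume "T:{T. 1:T & T <= {1..n} & True}"
  hence T: "1:T" "T <= {1..n}" by auto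
  hence fT: "finite T" using finite_subset by blast
  hence "0 < card T" using T by (auto simp: card_gt_0_iff)
  moreover have "full ({1..n} - T) = full {1..n - card T}" using full_card[of "{1..n} - T"] card_Diff_subset[OF fT T(2)] by simp
  ultimately show "con T * full ({1..n} - T) = of_nat (fact (card T - 1)) * ?D (card T) * full {1..n - card T}" using con[OF fT refl] by simp
 qed simp
 also have "... = (\<Sum>k | k:{1..n} & True. of_nat ((n - 1) choose (k - 1)) * (of_nat (fact (k - 1)) * ?D k * full {1..n - k}))"
  using sum_pointed_subsets[OF n(1,2), where Q = "%k. True" and g = "%k. of_nat (fact (k - 1)) * ?D k * full {1..n - k}"] n(3) by simp
 also have "... = (\<Sum>k=1..n. of_nat (fact (n - 1)) * (?D k * (ifact (n - k) * full {1..n - k})))" proof (rule sum.cong)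
  fix k assume "k:{1..n}"
  hence le: "k - 1 <= n - 1" "n - 1 - (k - 1) = n - k" by auto
  have f: "fact (k - 1) * fact (n - k) * ((n - 1) choose (k - 1)) = (fact (n - 1) :: nat)" using binomial_fact_lemma[OF le(1)] unfolding le(2) .
  have "of_nat ((n - 1) choose (k - 1)) * (of_nat (fact (k - 1)) * ?D k * full {1..n - k}) =
    ifact (n - k) * (of_nat (fact (n - k)) * (of_nat ((n - 1) choose (k - 1)) * (of_nat (fact (k - 1)) * ?D k * full {1..n - k})))"
   by (simp only: cancel)
  also have "... = of_nat (fact (k - 1) * fact (n - k) * ((n - 1) choose (k - 1))) * (?D k * (ifact (n - k) * full {1..n - k}))"
   by (simp only: of_nat_mult ac_simps)
  finally show "of_nat ((n - 1) choose (k - 1)) * (of_nat (fact (k - 1)) * ?D k * full {1..n - k}) =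
    of_nat (fact (n - 1)) * (?D k * (ifact (n - k) * full {1..n - k}))" by (simp only: f)
 qed auto
 finally have e: "full {1..n} = of_nat (fact (n - 1)) * (\<Sum>k=1..n. ?D k * (ifact (n - k) * full {1..n - k}))" by (simp only: sum_distrib_left)
 have "(fact n :: nat) = n * fact (n - 1)" using False by (simp add: fact_reduce)
 hence "of_nat n * (ifact n * full {1..n}) = ifact n * (of_nat (fact n) * (\<Sum>k=1..n. ?D k * (ifact (n - k) * full {1..n - k})))"
  by (subst e) (simp only: of_nat_mult ac_simps)
 thus ?thesis by (simp only: cancel)
qed simp

end

section \<open>Cycle products and the families attached to a weight\<close>

text \<open>\<open>orbit\<close> consists of positive iterates, so finiteness is what puts the start
  into its own orbit. Here \<open>t\<close> is a bijection on \<open>S\<close> only; restricting it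
  to \<open>S\<close> makes the facts about permutations available.\<close>

lemma self_in_orbit_on:
 assumes "bij_betw t S S" "finite S" "x:S"
 shows "x:orbit t x" "orbit t x <= S"
proof -
 let ?p = "perm_restrict t S"
 have p: "?p permutes S" proof (rule bij_imp_permutes)
  show "bij_betw ?p S S" by (rule bij_betw_cong[THEN iffD1, OF _ assms(1)]) (simp add: perm_restrict_def)
 qed (simp add: perm_restrict_def)
 have "orbit ?p x = orbit t x" proof (rule orbit_cong0[OF assms(3)])
  show "?p:S \<rightarrow> S" using permutes_in_image[OF p] by (intro Pi_I) simp
  show "?p y = t y" if "y:S" for y using that by (simp add: perm_restrict_def)
 qed
 thus "x:orbit t x" "orbit t x <= S"
  using permutation_self_in_orbit[of ?p x] permutes_orbit_subset[OF p assms(3)] permutation_permutes p assms(2) by auto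
qed

lemma orbit_partition:
 assumes "bij_betw t S S" "finite S"
 shows "partition_on S (orbit t`S)"
proof (rule partition_onI)
 show "\<Union>(orbit t`S) = S" using self_in_orbit_on[OF assms] by blast
 show "{} ~: orbit t`S" using orbit_nonempty by (metis imageE)
 show "disjnt p q" if pq: "p:orbit t`S" "q:orbit t`S" "p ~= q" for p q proof -
  obtain x y where x: "x:S" "p = orbit t x" and y: "y:S" "q = orbit t y" using pq(1,2) by blast
  have "z ~: q" if z: "z:p" for z proof
   assume "z:q"
   have sx: "x:orbit t x" and sy: "y:orbit t y" using self_in_orbit_on[OF assms] x y by auto
   have "x:orbit t z" using orbit_swap[OF sx] z x by simp
   moreover have "y:orbit t z" using orbit_swap[OF sy] \<open>z \<in> q\<close> y by simp
   ultimately have "orbit t x <= orbit t y" "orbit t y <= orbit t x" using z x y \<open>z \<in> q\<close> orbit_trans by (metis subsetI)+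
   thus False using \<open>p \<noteq> q\<close> x y by simp
  qed
  thus ?thesis by (auto simp: disjnt_def)
 qed
qed

text \<open>With \<open>sym_p\<close> for \<open>f\<close> this is the power sum product of the
  cycle type of \<open>t\<close> on \<open>S\<close>.\<close>

definition cyc_prod :: "(nat => 'r::comm_monoid_mult) => ('a => 'a) => 'a set => 'r" where "cyc_prod f t S = (PROD c:orbit t`S. f (card c))"

lemma cyc_prod_empty [simp]: "cyc_prod f t {} = 1" by (simp add: cyc_prod_def)

lemma cyc_prod_iso:
 assumes S: "finite S" "bij_betw t S S" and g: "inj_on g S" and c: "!!x. x:S ==> t' (g x) = g (t x)"
 shows "cyc_prod f t' (g`S) = cyc_prod f t S"
proof -
 have o: "orbit t' (g x) = g`orbit t x" if "x:S" for x using self_in_orbit_on[OF S(2,1) that] c by (intro orbit_inverse[symmetric]) auto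
 have im: "orbit t' ` g`S = (`) g`orbit t`S" by (simp add: image_image o)
 have sub: "orbit t x <= S" if "x:S" for x using self_in_orbit_on[OF S(2,1) that] by simp
 have "inj_on ((`) g) (orbit t`S)" by (rule inj_on_subset[OF inj_on_image_Pow[OF g]]) (use sub in blast)
 hence "cyc_prod f t' (g`S) = (PROD c:orbit t`S. f (card (g`c)))" unfolding cyc_prod_def im by (simp add: prod.reindex)
 also have "... = cyc_prod f t S" unfolding cyc_prod_def proof (rule prod.cong[OF refl], goal_cases)
  case (1 c)
  hence "c <= S" using sub by blast
  thus ?case using card_image inj_on_subset[OF g] by metis
 qed
 finally show ?thesis .
qed

lemma cyc_prod_union:
 assumes "finite S1" "finite S2" "S1 Int S2 = {}" "bij_betw t S1 S1" "bij_betw t S2 S2"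
 shows "cyc_prod f t (S1 Un S2) = cyc_prod f t S1 * cyc_prod f t S2" unfolding cyc_prod_def image_Un
proof (rule prod.union_disjoint)
 show "orbit t`S1 Int orbit t`S2 = {}" proof (rule ccontr)
  assume "orbit t`S1 Int orbit t`S2 ~= {}"
  then obtain x y where "x:S1" "y:S2" "orbit t x = orbit t y" by blast
  thus False using self_in_orbit_on[OF assms(4,1), of x] self_in_orbit_on[OF assms(5,2), of y] assms(3) by blast
 qed
qed (use assms in auto)

lemma orbit_cycle:
 assumes bc: "block_cycle t B r X" and b: "b:B"
 shows "orbit t b = (\<Union>i<r. (t ^^ i)`orbit (t ^^ r) b)"
proof -
 have s1: "b:orbit t b" using self_in_orbit_on[OF block_cycle_bij[OF bc] block_cycle_finite[OF bc]] b block_cycle_subset[OF bc] by blast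
 have s2: "b:orbit (t ^^ r) b" using self_in_orbit_on[OF block_cycle_power_bij[OF bc] block_cycle_facts(2)[OF bc] b] by simp
 have e1: "orbit t b = {(t ^^ n) b |n. True}" by (rule orbit_altdef_self_in[OF s1])
 have e2: "orbit (t ^^ r) b = {((t ^^ r) ^^ n) b |n. True}" by (rule orbit_altdef_self_in[OF s2])
 have r: "0 < r" by (rule block_cycle_facts(1)[OF bc])
 show ?thesis proof
  let ?t1 = "(\<Union>i<r. (t ^^ i)`orbit (t ^^ r) b)"
  show "orbit t b <= ?t1" proof
   fix x assume "x:orbit t b"
   then obtain n where n: "x = (t ^^ n) b" unfolding e1 by blast
   let ?t2 = "((t ^^ r) ^^ (n div r))"
   have "(t ^^ n) b = (t ^^ (n mod r + r * (n div r))) b" by simp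
   also have "... = (t ^^ (n mod r)) (?t2 b)" by (simp only: funpow_add funpow_mult comp_apply)
   finally have "x = (t ^^ (n mod r)) (?t2 b)" using n by (rule trans[rotated])
   moreover have "?t2 b:orbit (t ^^ r) b" unfolding e2 by blast
   ultimately have "x:(t ^^ (n mod r))`orbit (t ^^ r) b" by (rule image_eqI)
   moreover have "n mod r < r" using r by simp
   ultimately show "x:?t1" by (rule_tac UN_I[of "n mod r"]) simp_all
  qed
  show "?t1 <= orbit t b" proof (rule UN_least, rule image_subsetI)
   fix i x assume "x:orbit (t ^^ r) b"
   then obtain n where "x = ((t ^^ r) ^^ n) b" unfolding e2 by blast
   hence "(t ^^ i) x = (t ^^ (i + r * n)) b" by (simp add: funpow_add funpow_mult)
   thus "(t ^^ i) x:orbit t b" unfolding e1 by blast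
  qed
 qed
qed

lemma orbit_cycle_Int:
 assumes bc: "block_cycle t B r X" and b: "b:B"
 shows "orbit t b Int B = orbit (t ^^ r) b" "card (orbit t b) = r * card (orbit (t ^^ r) b)"
proof -
 let ?o = "orbit (t ^^ r) b"
 have s: "?o <= B" using self_in_orbit_on[OF block_cycle_power_bij[OF bc] block_cycle_facts(2)[OF bc] b] by simp
 have r: "0 < r" by (rule block_cycle_facts(1)[OF bc])
 have d: "(t ^^ i)`?o Int (t ^^ j)`?o = {}" if "i < r" "j < r" "i ~= j" for i j using block_cycle_facts(7)[OF bc that] s by blast
 have d0: "(t ^^ i)`?o Int B = {}" if "i < r" "i ~= 0" for i using block_cycle_facts(7)[OF bc that(1) r that(2)] s by auto
 show "orbit t b Int B = ?o" proof
  show "orbit t b Int B <= ?o" proof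
   fix x assume x: "x:orbit t b Int B"
   then obtain i where i: "i < r" "x:(t ^^ i)`?o" unfolding orbit_cycle[OF bc b] by blast
   hence "i = 0" using d0[of i] x by blast
   thus "x:?o" using i by simp
  qed
  have "(t ^^ 0)`?o <= orbit t b" unfolding orbit_cycle[OF bc b] using r by blast
  thus "?o <= orbit t b Int B" using s by simp
 qed
 have fin: "finite ?o" using s block_cycle_facts(2)[OF bc] finite_subset by blast
 have "card (orbit t b) = (\<Sum>i<r. card ((t ^^ i)`?o))" unfolding orbit_cycle[OF bc b] by (rule card_UN_disjoint) (use fin d in auto)
 also have "... = (\<Sum>i<r. card ?o)" by (rule sum_eqI, rule card_image, rule inj_on_subset[OF block_cycle_inj[OF bc] s])
 finally show "card (orbit t b) = r * card ?o" by simp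
qed

text \<open>A cycle of \<open>t\<close> runs through all \<open>r\<close> translates of
  \<open>B\<close> and meets \<open>B\<close> in one cycle of the first return map. A cycle of
  length k of the latter thus comes from one of length r * k, whence the scaled argument.\<close>

lemma cyc_prod_cycle:
 assumes bc: "block_cycle t B r X"
 shows "cyc_prod f t (\<Union>X) = cyc_prod (%k. f (r * k)) (t ^^ r) B"
proof -
 have fin: "finite (\<Union>X)" by (rule block_cycle_finite[OF bc])
 have "orbit t`(\<Union>X) = orbit t`B" proof
  show "orbit t`B <= orbit t`(\<Union>X)" using block_cycle_subset[OF bc] by blast
  show "orbit t`(\<Union>X) <= orbit t`B" proof (rule image_subsetI)
   fix x assume "x:\<Union>X"
   then obtain i b where ib: "b:B" "x = (t ^^ i) b" using block_cycle_facts(5)[OF bc] by auto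
   have bX: "b:\<Union>X" using ib block_cycle_subset[OF bc] by blast
   have s: "b:orbit t b" using self_in_orbit_on[OF block_cycle_bij[OF bc] fin bX] by simp
   have "x:orbit t b" using funpow_in_orbit[OF s] ib by simp
   hence "orbit t x = orbit t b" using partition_on_member_eq[OF orbit_partition[OF block_cycle_bij[OF bc] fin], of "orbit t x" "orbit t b" x]
     self_in_orbit_on[OF block_cycle_bij[OF bc] fin \<open>x \<in> \<Union>X\<close>] \<open>x \<in> \<Union>X\<close> bX by simp
   thus "orbit t x:orbit t`B" using ib by simp
  qed
 qed
 hence "cyc_prod f t (\<Union>X) = (PROD c:orbit t`B. f (card c))" by (simp add: cyc_prod_def)
 also have "... = (PROD d:orbit (t ^^ r)`B. f (r * card d))"
 proof (rule prod.reindex_bij_witness[where j = "%c. c Int B" and i = "%d. \<Union>i<r. (t ^^ i)`d"])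
  show "(\<Union>i<r. (t ^^ i)`(a Int B)) = a" "a Int B:orbit (t ^^ r)`B" "f (r * card (a Int B)) = f (card a)" if "a:orbit t`B" for a proof -
   from that obtain b where b: "b:B" "a = orbit t b" by blast
   show "(\<Union>i<r. (t ^^ i)`(a Int B)) = a" "a Int B:orbit (t ^^ r)`B" "f (r * card (a Int B)) = f (card a)"
    unfolding b(2) orbit_cycle_Int[OF bc b(1)] using orbit_cycle[OF bc b(1)] b(1) by auto
  qed
  show "(\<Union>i<r. (t ^^ i)`a) Int B = a" "(\<Union>i<r. (t ^^ i)`a):orbit t`B" if "a:orbit (t ^^ r)`B" for a proof -
   from that obtain b where b: "b:B" "a = orbit (t ^^ r) b" by blast
   show "(\<Union>i<r. (t ^^ i)`a) Int B = a" "(\<Union>i<r. (t ^^ i)`a):orbit t`B"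
    unfolding b(2) orbit_cycle[OF bc b(1), symmetric] orbit_cycle_Int[OF bc b(1)] using b(1) by auto
  qed
 qed
 finally show ?thesis by (simp add: cyc_prod_def)
qed

text \<open>Each block of \<open>P\<close> inside \<open>B\<close> has \<open>r\<close> translates
  of the same size.\<close>

lemma prod_blocks_cycle:
 fixes h :: "nat => 'r::comm_ring_1"
 assumes bc: "block_cycle t B r X" and P: "P:stab (\<Union>X) t" "finer P X"
 shows "(PROD y:P. h (card y)) = (PROD y:below P B. h (card y)^r)"
proof -
 have sub: "y <= B" "y ~= {}" if "y:below P B" for y using that stabD(1)[OF P(1)] by (auto simp: below_def partition_on_def)
 have fin: "finite (below P B)" by (rule finite_subset[of _ "Pow B"]) (use block_cycle_facts(2)[OF bc] sub in auto)
 have inj: "inj_on ((`) (t ^^ i)) (below P B)" for i by (rule inj_on_subset[OF inj_on_image_Pow[OF block_cycle_inj[OF bc]]]) (use sub in blast)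
 have "(PROD y:P. h (card y)) = (PROD y:(\<Union>i<r. (`) (t ^^ i)`below P B). h (card y))" by (simp only: cycle_blocks_union[OF bc P])
 also have "... = (\<Prod>i<r. PROD y:(`) (t ^^ i)`below P B. h (card y))"
  by (rule prod.UNION_disjoint) (use fin cycle_block_unique(1)[OF bc] sub in \<open>auto simp: disjoint_iff image_iff\<close>)
 also have "... = (\<Prod>i<r. PROD y:below P B. h (card y))"
  by (simp add: prod.reindex[OF inj] card_image[OF inj_on_subset[OF block_cycle_inj[OF bc] sub(1)]])
 also have "... = (PROD y:below P B. h (card y)^r)" by (simp add: prod_power_distrib)
 finally show ?thesis .
qed

lemma prod_blocks_image:
 assumes "inj_on g S" "P <= Pow S"
 shows "(PROD y:(`) g`P. h (card y)) = (PROD y:P. h (card y))" (is "?l = _")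
proof -
 have "inj_on ((`) g) P" by (rule inj_on_subset[OF inj_on_image_Pow[OF assms(1)] assms(2)])
 hence "?l = (PROD y:P. h (card (g`y)))" by (simp add: prod.reindex)
 also have "... = (PROD y:P. h (card y))" proof (rule prod.cong[OF refl], goal_cases)
  case (1 y)
  hence "card (g`y) = card y" using assms by (intro card_image inj_on_subset[OF assms(1)]) auto
  thus ?case by simp
 qed
 finally show ?thesis .
qed

lemma prod_blocks_Un:
 assumes "P1:stab S1 t" "P2:stab S2 t" "S1 Int S2 = {}" "finite S1" "finite S2"
 shows "(PROD y:P1 Un P2. h y) = (PROD y:P1. h y) * (PROD y:P2. h y)"
proof (rule prod.union_disjoint)
 show "finite P1" "finite P2" by (rule finite_elements[OF assms(4) stabD(1)[OF assms(1)]], rule finite_elements[OF assms(5) stabD(1)[OF assms(2)]])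
 have "y <= S1" "y ~= {}" if "y:P1" for y using stabD(1)[OF assms(1)] that by (auto simp: partition_on_def)
 moreover have "y <= S2" if "y:P2" for y using stabD(1)[OF assms(2)] that by (auto simp: partition_on_def)
 ultimately have "\<not> y:P2" if "y:P1" for y using assms(3) that by (metis Int_greatest subset_empty)
 thus "P1 Int P2 = {}" by blast
qed

text \<open>There are three markers: \<open>phi\<close> for the cycles of the permutation,
  \<open>eta\<close> for the blocks of \<open>X\<close> and \<open>zeta\<close> for those of the
  finer \<open>P\<close>. They later become power sums, y-variables and z-variables. The factor r in
  the argument of \<open>phi\<close> and the r-th powers restore the contribution of a whole cycle
  of r blocks.\<close>

definition weight_family :: "((nat => nat) => nat set set => nat set set => 'r::comm_ring_1) =>
  (nat => 'r) => (nat => 'r) => (nat => 'r) => nat => (nat => nat) => nat set set => 'r" where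
 "weight_family w phi zeta eta r t X = cyc_prod (%k. phi (r * k)) t (\<Union>X) * (PROD x:X. eta (card x)^r) *
   (\<Sum>P | P:stab (\<Union>X) t & finer P X. w t P X * (PROD y:P. zeta (card y)^r))"

text \<open>Every factor obeys the rules on its own: cycle products through orbits, block products
  because translates have equal size, and the inner sum through the bijections between stable
  partitions.\<close>

lemma (in natural_weight) natural_weight_family: "natural_family (weight_family v phi zeta eta)"
proof fix t :: "nat => nat"
 have "{P. P:stab {} t & finer P {}} = {{}}" by auto
 thus "weight_family v phi zeta eta 1 t {} = 1" by (simp add: weight_family_def empty)
next fix r S X and g t t' :: "nat => nat"
 assume S: "finite S" "bij_betw t S S" and X: "X:stab S t" and g: "inj_on g S" and c: "!!x. x:S ==> t' (g x) = g (t x)"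
 have U: "\<Union>X = S" using X by (rule stabD)
 have U': "\<Union>((`) g`X) = g`S" using U by (metis image_Union)
 have b: "bij_betw ((`) ((`) g)) (stab S t) (stab (g`S) t')" by (rule bij_betw_stab_image[OF g S(2) c])
 have fi: "finer ((`) g`P) ((`) g`X) \<longleftrightarrow> finer P X" if "P:stab S t" for P
  by (rule finer_image[OF g stab_subset_Pow[OF that] stab_subset_Pow[OF X]])
 have "bij_betw ((`) ((`) g)) {P:stab S t. finer P X} {P:stab (g`S) t'. finer P ((`) g`X)}" by (rule bij_betw_Collect[OF b], rule fi)
 from sum.reindex_bij_betw[OF this, symmetric, of "%P. v t' P ((`) g`X) * (PROD y:P. zeta (card y)^r)"]
 have "(\<Sum>P | P:stab (g`S) t' & finer P ((`) g`X). v t' P ((`) g`X) * (PROD y:P. zeta (card y)^r)) =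
   (\<Sum>P | P:stab S t & finer P X. v t' ((`) g`P) ((`) g`X) * (PROD y:(`) g`P. zeta (card y)^r))" .
 also have "... = (\<Sum>P | P:stab S t & finer P X. v t P X * (PROD y:P. zeta (card y)^r))" proof (rule sum_eqI, goal_cases)
  case (1 P)
  hence P: "P:stab S t" "finer P X" by auto
  have "v t' ((`) g`P) ((`) g`X) = v t P X" by (rule iso[OF S X P g c])
  moreover have "(PROD y:(`) g`P. zeta (card y)^r) = (PROD y:P. zeta (card y)^r)"
   by (rule prod_blocks_image[OF g stab_subset_Pow[OF P(1)], where h = "%k. zeta k^r"])
  ultimately show ?case by simp
 qed
 finally show "weight_family v phi zeta eta r t' ((`) g`X) = weight_family v phi zeta eta r t X" unfolding weight_family_def U U'
  using cyc_prod_iso[OF S g c, where f = "%k. phi (r * k)"] prod_blocks_image[OF g stab_subset_Pow[OF X], where h = "%k. eta k^r"] by simp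
next fix S1 S2 X1 X2 and t :: "nat => nat"
 assume f: "finite S1" "finite S2" and d: "S1 Int S2 = {}" and t: "bij_betw t S1 S1" "bij_betw t S2 S2" and X: "X1:stab S1 t" "X2:stab S2 t"
 have U: "\<Union>X1 = S1" "\<Union>X2 = S2" "\<Union>(X1 Un X2) = S1 Un S2" using stabD(3)[OF X(1)] stabD(3)[OF X(2)] by auto
 let ?A = "%S X. {P:stab S t. finer P X}"
 have "(\<Sum>P | P:stab (S1 Un S2) t & finer P (X1 Un X2). v t P (X1 Un X2) * (PROD y:P. zeta (card y)^1)) =
  (\<Sum>(P1, P2) | P1:stab S1 t & P2:stab S2 t & finer P1 X1 & finer P2 X2. v t (P1 Un P2) (X1 Un X2) * (PROD y:P1 Un P2. zeta (card y)^1))"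
  using sum_stab_Un[OF t d f X, where Q = "%P. True" and f = "%P. v t P (X1 Un X2) * (PROD y:P. zeta (card y)^1)"] by simp
 also have "... = (SUM (P1, P2):?A S1 X1 \<times> ?A S2 X2. (v t P1 X1 * (PROD y:P1. zeta (card y)^1)) * (v t P2 X2 * (PROD y:P2. zeta (card y)^1)))"
 proof (rule sum.cong)
  show "{(P1, P2). P1:stab S1 t & P2:stab S2 t & finer P1 X1 & finer P2 X2} = ?A S1 X1 \<times> ?A S2 X2" by auto
  fix x assume "x:?A S1 X1 \<times> ?A S2 X2"
  then obtain P1 P2 where x: "x = (P1, P2)" "P1:stab S1 t" "finer P1 X1" "P2:stab S2 t" "finer P2 X2" by blast
  show "(%(P1, P2). v t (P1 Un P2) (X1 Un X2) * (PROD y:P1 Un P2. zeta (card y)^1)) x =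
    (%(P1, P2). (v t P1 X1 * (PROD y:P1. zeta (card y)^1)) * (v t P2 X2 * (PROD y:P2. zeta (card y)^1))) x"
   unfolding x(1) prod.case union[OF f d t X(1) x(2,3) X(2) x(4,5)] prod_blocks_Un[OF x(2,4) d f] by (simp only: ac_simps)
 qed
 also have "... = (SUM P1:?A S1 X1. v t P1 X1 * (PROD y:P1. zeta (card y)^1)) * (SUM P2:?A S2 X2. v t P2 X2 * (PROD y:P2. zeta (card y)^1))"
  by (simp only: sum_product sum.cartesian_product)
 finally show "weight_family v phi zeta eta 1 t (X1 Un X2) = weight_family v phi zeta eta 1 t X1 * weight_family v phi zeta eta 1 t X2"
  unfolding weight_family_def U cyc_prod_union[OF f d t] prod_blocks_Un[OF X d f] by (simp only: ac_simps)
next fix B r X and t :: "nat => nat"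
 assume bc: "block_cycle t B r X"
 have B: "below X B = {B}" proof -
  have "x = B" if "x:X" "x <= B" for x using block_cycle_disjoint[OF bc that(1)] block_cycle_blocks_ne[OF bc that(1)] that(2) by blast
  thus ?thesis using block_cycle_base[OF bc] by (auto simp: below_def)
 qed
 have all: "{P:stab B (t ^^ r). finer P {B}} = stab B (t ^^ r)" using finer_one_block stabD(3) by blast
 have "(\<Sum>P | P:stab (\<Union>X) t & finer P X. v t P X * (PROD y:P. zeta (card y)^1)) =
   (\<Sum>P | P:stab (\<Union>X) t & finer P X. v (t ^^ r) (below P B) {B} * (PROD y:below P B. zeta (card y)^r))" proof (rule sum_eqI, goal_cases)
  case (1 P)
  hence P: "P:stab (\<Union>X) t" "finer P X" by auto
  show ?case unfolding power_one_right prod_blocks_cycle[OF bc P] cycle[OF bc block_cycle_stab[OF bc] P finer_refl] B by simp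
 qed
 also have "... = (SUM P:stab B (t ^^ r). v (t ^^ r) P {B} * (PROD y:P. zeta (card y)^r))"
  by (rule sum.reindex_bij_betw[OF bij_betw_stab_cycle[OF bc], where g = "%P. v (t ^^ r) P {B} * (PROD y:P. zeta (card y)^r)"])
 finally show "weight_family v phi zeta eta 1 t X = weight_family v phi zeta eta r (t ^^ r) {B}"
  unfolding weight_family_def all[unfolded cSup_singleton] using cyc_prod_cycle[OF bc, of phi] prod_blocks_cycle[OF bc block_cycle_stab[OF bc] finer_refl, of eta]
  by (simp add: B all)
qed

lemma below_partition:
 assumes "partition_on S P" "partition_on S X" "finer P X" "x:X"
 shows "partition_on x (below P x)"
proof (rule partition_on_below[OF assms(1)])
 show "x <= S" using assms(2,4) by (auto simp: partition_on_def)
 fix p assume "p:P"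
 then obtain x' where x': "x':X" "p <= x'" using assms(3) by (auto simp: finer_def)
 show "p <= x | p Int x = {}" proof (cases "x' = x")
  case False
  hence "x' Int x = {}" using x'(1) assms(2,4) by (simp add: partition_on_def disjoint_def)
  thus ?thesis using x'(2) by blast
 qed (use x' in simp)
qed

section \<open>The two basic weights: equality and compatible orders\<close>

text \<open>The unit of the incidence algebra, which \<open>minv\<close> turns into the Moebius
  function of the stable partitions.\<close>

definition same_weight :: "(nat => nat) => nat set set => nat set set => 'r::comm_ring_1" where "same_weight t P X = (if X = P then 1 else 0)"

lemma natural_weight_same: "natural_weight same_weight"
proof fix S X P and t g t' :: "nat => nat"
 assume "X:stab S t" "P:stab S t" and g: "inj_on g S"
 thus "same_weight t' ((`) g`P) ((`) g`X) = same_weight t P X"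
  using image_image_inj_iff[OF g stab_subset_Pow stab_subset_Pow, of X t P t] by (simp add: same_weight_def)
next fix S1 S2 X1 X2 P1 P2 and t :: "nat => nat"
 assume d: "S1 Int S2 = {}" and X: "X1:stab S1 t" "X2:stab S2 t" and P: "P1:stab S1 t" "P2:stab S2 t"
 have "X1 Un X2 = P1 Un P2 \<longleftrightarrow> X1 = P1 & X2 = P2"
  using below_Un_left[OF stabD(1)[OF X(1)] stabD(1)[OF X(2)] d] below_Un_right[OF stabD(1)[OF X(1)] stabD(1)[OF X(2)] d]
   below_Un_left[OF stabD(1)[OF P(1)] stabD(1)[OF P(2)] d] below_Un_right[OF stabD(1)[OF P(1)] stabD(1)[OF P(2)] d] by metis
 thus "same_weight t (P1 Un P2) (X1 Un X2) = same_weight t P1 X1 * same_weight t P2 X2" by (simp add: same_weight_def)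
next fix B r X M P and t :: "nat => nat"
 assume bc: "block_cycle t B r X" and M: "M:stab (\<Union>X) t" "finer M X" and P: "P:stab (\<Union>X) t" and f: "finer P M"
 have "finer P X" using f M(2) by (rule finer_trans)
 hence "M = P \<longleftrightarrow> below M B = below P B"
  using inj_on_eq_iff[OF bij_betw_imp_inj_on[OF bij_betw_stab_cycle[OF bc]], of M P] M P by simp
 thus "same_weight t P M = same_weight (t ^^ r) (below P B) (below M B)" by (simp add: same_weight_def)
qed (simp add: same_weight_def)

definition orders :: "'a set => 'a list set" where "orders A = {l. distinct l & set l = A}"

text \<open>A linear order of the blocks of \<open>P\<close> inside each block of \<open>X\<close>,
  chosen equivariantly. If \<open>t\<close> fixes a block of \<open>X\<close>, the list chosen there
  is mapped to itself entry by entry, so \<open>t\<close> fixes every block of \<open>P\<close> in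
  it.\<close>

definition order_families :: "('a => 'a) => 'a set set => 'a set set => ('a set => 'a set list) set" where
 "order_families t P X = {k:Pi\<^sub>E X (%x. orders (below P x)). ALL x:X. k (t`x) = map ((`) t) (k x)}"

lemma order_familiesD:
 assumes "k:order_families t P X" "x:X"
 shows "distinct (k x)" "set (k x) = below P x" "k (t`x) = map ((`) t) (k x)" using assms by (auto simp: order_families_def orders_def)

lemma order_families_restrict: "k:order_families t P X ==> restrict k X = k" by (auto simp: order_families_def intro: PiE_restrict)

lemma order_families_ext:
 assumes "k:order_families t P X" "k':order_families t P X" "!!x. x:X ==> k x = k' x"
 shows "k = k'" using assms by (auto simp: order_families_def intro: PiE_ext)

lemma order_familiesI:
 assumes "!!x. x:X ==> t`x:X" "!!x. x:X ==> distinct (k x) & set (k x) = below P x" "!!x. x:X ==> k (t`x) = map ((`) t) (k x)"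
 shows "restrict k X:order_families t P X" using assms by (auto simp: order_families_def orders_def)

definition order_weight :: "(nat => nat) => nat set set => nat set set => complex" where "order_weight t P X = of_nat (card (order_families t P X))"

lemma below_image:
 assumes g: "inj_on g S" and "P <= Pow S" "x <= S"
 shows "below ((`) g`P) (g`x) = (`) g`below P x" using image_subset_inj_iff[OF g _ assms(3)] assms(2) unfolding below_def by blast

lemma stab_image_mem: "X:stab S t ==> x:X ==> t`x:X" using stabD(2) by blast

lemma card_order_families_image:
 assumes g: "inj_on g S" and c: "!!x. x:S ==> t' (g x) = g (t x)" and P: "P:stab S t" and X: "X:stab S t"
 shows "card (order_families t' ((`) g`P) ((`) g`X)) = card (order_families t P X)"
proof -
 let ?h = "inv_into S g"
 note PS = stab_subset_Pow[OF P] and XS = stab_subset_Pow[OF X] and Xm = stab_image_mem[OF X]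
 have hg: "?h`g`y = y" if "y <= S" for y using inv_into_image_cancel[OF g that] .
 have b: "below ((`) g`P) (g`x) = (`) g`below P x" if "x:X" for x using below_image[OF g PS] XS that by blast
 have e: "t' ` g`y = g`t`y" if "y <= S" for y using c that by (auto simp: image_image intro!: image_cong)
 have bS: "y <= S" if "y:below P x" for x y using PS that by (auto simp: below_def)
 have "bij_betw (%k. \<lambda>y\<in>(`) g`X. map ((`) g) (k (?h`y))) (order_families t P X) (order_families t' ((`) g`P) ((`) g`X))"
 proof (rule bij_betw_byWitness[where f' = "%k. \<lambda>x\<in>X. map ((`) ?h) (k (g`x))"]; (intro ballI image_subsetI)?)
  fix k assume k: "k:order_families t P X"
  note kD = order_familiesD[OF k]
  have m: "map ((`) ?h) (map ((`) g) (k x)) = k x" if "x:X" for x using hg bS kD(2)[OF that] by (auto intro: map_idI)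
  let ?t1 = "(\<lambda>y\<in>(`) g`X. map ((`) g) (k (?h`y)))"
  let ?t4 = "(\<lambda>x\<in>X. map ((`) ?h) (?t1 (g`x)))"
  have "?t4 = restrict k X" by (rule restrict_ext) (use m hg XS in auto)
  thus "?t4 = k" unfolding order_families_restrict[OF k] .
  show "?t1:order_families t' ((`) g`P) ((`) g`X)" proof (rule order_familiesI)
   fix y assume "y:(`) g`X"
   then obtain x where x: "x:X" "y = g`x" by blast
   hence hy: "?h`y = x" and xS: "x <= S" using hg XS by auto
   hence ey: "t' ` y = g`t`x" using e x by simp
   thus "t' ` y:(`) g`X" using Xm x by blast
   let ?t3 = "(map ((`) g) (k (?h`y)))"
   have "inj_on ((`) g) (set (k x))" using kD(2)[OF x(1)] bS by (intro inj_on_subset[OF inj_on_image_Pow[OF g]]) auto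
   thus "distinct ?t3 & set ?t3 = below ((`) g`P) y" using kD[OF x(1)] b x hy by (simp add: distinct_map)
   have "t`x <= S" using Xm XS x by blast
   hence "?h`t' ` y = t`x" using ey hg by simp
   thus "map ((`) g) (k (?h`t' ` y)) = map ((`) t') ?t3" using kD(2,3)[OF x(1)] hy e bS by auto
  qed
 next fix k assume k: "k:order_families t' ((`) g`P) ((`) g`X)"
  note kD = order_familiesD[OF k imageI]
  have s: "EX z:below P x. y = g`z" if "x:X" "y:set (k (g`x))" for x y using kD(2)[OF that(1)] b[OF that(1)] that(2) by auto
  have m: "map ((`) g) (map ((`) ?h) (k (g`x))) = k (g`x)" if x: "x:X" for x proof -
   have "g`?h`y = y" if y: "y:set (k (g`x))" for y using s[OF x y] hg bS by force
   thus ?thesis by (simp add: map_idI)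
  qed
  have kg: "map ((`) ?h) (k (g`t`x)) = map ((`) t) (map ((`) ?h) (k (g`x)))" if x: "x:X" for x proof -
   have "x <= S" using XS x by blast
   moreover have "?h`t' ` y = t`?h`y" if y: "y:set (k (g`x))" for y proof -
    obtain z where z: "z:P" "y = g`z" using s[OF x y] by (auto simp: below_def)
    hence "z <= S" "t`z <= S" using PS stab_image_mem[OF P] by blast+
    thus ?thesis using z e hg by simp
   qed
   ultimately show ?thesis using kD(3)[OF x] e by simp
  qed
  let ?t2 = "(\<lambda>y\<in>(`) g`X. map ((`) g) ((\<lambda>x\<in>X. map ((`) ?h) (k (g`x))) (?h`y)))"
  have "?t2 = restrict k ((`) g`X)" by (rule restrict_ext) (use m hg XS in auto)
  thus "?t2 = k" unfolding order_families_restrict[OF k] .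
  show "(\<lambda>x\<in>X. map ((`) ?h) (k (g`x))):order_families t P X" proof (rule order_familiesI)
   fix x assume x: "x:X" show "t`x:X" by (rule Xm[OF x]) show "map ((`) ?h) (k (g`t`x)) = map ((`) t) (map ((`) ?h) (k (g`x)))" by (rule kg[OF x])
   have "set (map ((`) ?h) (k (g`x))) = (`) ?h`(`) g`below P x" using kD(2)[OF x] b[OF x] by simp
   also have "... = below P x" using hg bS[of _ x] by (simp add: image_image)
   finally show "distinct (map ((`) ?h) (k (g`x))) & set (map ((`) ?h) (k (g`x))) = below P x" using kD(1)[OF x] m[OF x] by (metis distinct_map)
  qed
 qed
 thus ?thesis by (simp add: bij_betw_same_card)
qed

lemma card_order_families_Un:
 assumes d: "S1 Int S2 = {}" and X: "X1:stab S1 t" "X2:stab S2 t" and P: "P1:stab S1 t" "P2:stab S2 t"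
 shows "card (order_families t (P1 Un P2) (X1 Un X2)) = card (order_families t P1 X1) * card (order_families t P2 X2)"
proof -
 have pp: "partition_on S1 P1" "partition_on S2 P2" "partition_on S1 X1" "partition_on S2 X2" using X P by (auto simp: stabD)
 have sub1: "y <= S1 & y ~= {}" if "y:P1 Un X1" for y using pp that by (auto simp: partition_on_def)
 have sub2: "y <= S2 & y ~= {}" if "y:P2 Un X2" for y using pp that by (auto simp: partition_on_def)
 have b1: "below (P1 Un P2) x = below P1 x" if "x:X1" for x using sub1[of x] sub2 d that unfolding below_def by blast
 have b2: "below (P1 Un P2) x = below P2 x" if "x:X2" for x using sub2[of x] sub1 d that unfolding below_def by blast
 have dX: "x ~: X2" if "x:X1" for x using sub1[of x] sub2[of x] d that by blast
 note Xm = stab_image_mem[OF X(1)] stab_image_mem[OF X(2)]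
 let ?f = "%k1 k2 x. if x:X1 then k1 x else k2 x"
 let ?t1 = "(%(k1, k2). \<lambda>x\<in>X1 Un X2. ?f k1 k2 x)"
 have "bij_betw ?t1 (order_families t P1 X1 \<times> order_families t P2 X2) (order_families t (P1 Un P2) (X1 Un X2))"
 proof (rule bij_betw_byWitness[where f' = "%k. (restrict k X1, restrict k X2)"]; (intro ballI image_subsetI)?)
  fix a assume a: "a:order_families t P1 X1 \<times> order_families t P2 X2"
  then obtain k1 k2 where a: "a = (k1, k2)" and k1: "k1:order_families t P1 X1" and k2: "k2:order_families t P2 X2" by blast
  have n: "x ~: X1" if "x:X2" for x using dX that by blast
  have r: "restrict k1 X1 = k1" "restrict k2 X2 = k2" using k1 k2 by (auto simp: order_families_def)
  have "restrict (restrict (?f k1 k2) (X1 Un X2)) X1 = restrict k1 X1" "restrict (restrict (?f k1 k2) (X1 Un X2)) X2 = restrict k2 X2"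
   using n by (auto simp: restrict_def)
  thus "(%k. (restrict k X1, restrict k X2)) (?t1 a) = a" by (simp add: a r)
  have "restrict (?f k1 k2) (X1 Un X2):order_families t (P1 Un P2) (X1 Un X2)"
   using order_familiesD[OF k1] order_familiesD[OF k2] b1 b2 Xm n by (intro order_familiesI) (auto split: if_splits)
  thus "?t1 a:order_families t (P1 Un P2) (X1 Un X2)" by (simp add: a)
 next fix k assume k: "k:order_families t (P1 Un P2) (X1 Un X2)"
  have "?t1 (restrict k X1, restrict k X2) = restrict k (X1 Un X2)" by (auto simp: fun_eq_iff restrict_def)
  thus "?t1 (restrict k X1, restrict k X2) = k" unfolding order_families_restrict[OF k] .
  show "(restrict k X1, restrict k X2):order_families t P1 X1 \<times> order_families t P2 X2"
   using order_familiesD[OF k] b1 b2 Xm by (auto intro!: order_familiesI)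
 qed
 from bij_betw_same_card[OF this] show ?thesis by (simp only: card_cartesian_product)
qed

text \<open>An equivariant choice is known once it is known inside \<open>B\<close>, since
  \<open>t\<close> transports it along the cycle. The only remaining condition comes from a full
  round and is equivariance under \<open>t ^^ r\<close>.\<close>

lemma card_order_families_cycle:
 assumes bc: "block_cycle t B r X" and M: "M:stab (\<Union>X) t" "finer M X" and P: "P:stab (\<Union>X) t"
 shows "card (order_families t P M) = card (order_families (t ^^ r) (below P B) (below M B))"
proof -
 let ?M = "below M B"
 note st = stab_funpow
 have bb: "below (below P B) x = below P x" if "x:?M" for x using that by (auto simp: below_def)
 have inj: "inj_on (t ^^ i) (\<Union>X)" for i by (rule bij_betw_imp_inj_on[OF block_cycle_bij_funpow[OF bc]])
 have MX: "x <= \<Union>X" if "x:M" for x using stab_subset_Pow[OF M(1)] that by blast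
 have Mi: "(t ^^ i)`x:M" if "x:M" for x i using st[OF M(1)] that by blast
 have bimg: "below P ((t ^^ i)`x) = (`) (t ^^ i)`below P x" if "x:M" for x i
  using below_image[OF inj stab_subset_Pow[OF P] MX[OF that], of i] st[OF P] by simp
 have kp: "k ((t ^^ i)`x) = map ((`) (t ^^ i)) (k x)" if k: "k:order_families t P M" and x: "x:M" for k x i proof (induction i)
  case (Suc i)
  have "k ((t ^^ Suc i)`x) = k (t`(t ^^ i)`x)" by (simp add: image_image)
  thus ?case using order_familiesD(3)[OF k Mi[OF x]] Suc by (simp add: image_image)
 qed simp
 have un: "i = j & y = z" if "i < r" "j < r" "y:?M" "z:?M" "(t ^^ i)`y = (t ^^ j)`z" for i j y z proof -
  have "y ~= {}" using that stabD(1)[OF M(1)] by (auto simp: partition_on_def below_def)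
  thus ?thesis using cycle_block_unique[OF bc that(5,1,2)] that by (simp add: below_def)
 qed
 let ?t1 = "(%k. restrict k ?M)"
 have "bij_betw ?t1 (order_families t P M) (order_families (t ^^ r) (below P B) ?M)" proof (rule bij_betw_imageI)
  show "inj_on ?t1 (order_families t P M)" proof (rule inj_onI, rule order_families_ext)
   fix k k' x assume k: "k:order_families t P M" "k':order_families t P M" and e: "restrict k ?M = restrict k' ?M" and "x:M"
   then obtain i y where y: "i < r" "y:?M" "x = (t ^^ i)`y" using cycle_blocks_ex[OF bc M] by blast
   hence "k y = k' y" using e by (metis restrict_apply')
   thus "k x = k' x" using kp[OF k(1), of y i] kp[OF k(2), of y i] y by (simp add: below_def)
  qed
  show "?t1`order_families t P M = order_families (t ^^ r) (below P B) ?M" proof (rule equalityI; rule subsetI)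
   fix c assume "c:?t1`order_families t P M"
   then obtain k where k: "k:order_families t P M" "c = restrict k ?M" by blast
   have "(t ^^ r)`x:?M" if "x:?M" for x using that Mi[of x r] image_mono[of x B "t ^^ r"] block_cycle_facts(4)[OF bc] by (auto simp: below_def)
   thus "c:order_families (t ^^ r) (below P B) ?M" unfolding k(2)
    by (rule order_familiesI) (use order_familiesD[OF k(1)] kp[OF k(1)] bb in \<open>auto simp: below_def\<close>)
  next fix c assume c: "c:order_families (t ^^ r) (below P B) ?M"
   note cD = order_familiesD[OF c]
   \<comment> \<open>Every block of \<open>M\<close> has the form (t ^^ i) y for exactly one level i
     below r and one y inside \<open>B\<close>, by \<open>un\<close>; this makes the description
     unique.\<close>
   define k where "k x = (THE l. \<exists>i y. i < r & y:?M & x = (t ^^ i)`y & l = map ((`) (t ^^ i)) (c y))" for x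
   have k: "k ((t ^^ i)`y) = map ((`) (t ^^ i)) (c y)" if "i < r" "y:?M" for i y unfolding k_def using that un by (intro the_equality) blast+
   have "restrict k M:order_families t P M" proof (rule order_familiesI[OF stab_image_mem[OF M(1)]])
    fix x assume "x:M"
    then obtain i y where y: "i < r" "y:?M" "x = (t ^^ i)`y" using cycle_blocks_ex[OF bc M] by blast
    have yM: "y:M" using y by (simp add: below_def)
    have "set (c y) <= Pow (\<Union>X)" using cD(2)[OF y(2)] stab_subset_Pow[OF P] by (auto simp: below_def)
    hence "inj_on ((`) (t ^^ i)) (set (c y))" by (rule inj_on_subset[OF inj_on_image_Pow[OF inj]])
    thus "distinct (k x) & set (k x) = below P x" using cD[OF y(2)] bb[OF y(2)] bimg[OF yM] k[OF y(1,2)] y(3) by (simp add: distinct_map)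
    have ix: "t`x = (t ^^ Suc i)`y" using y by (simp add: image_image)
    show "k (t`x) = map ((`) t) (k x)" proof (cases "Suc i < r")
     case True
     thus ?thesis unfolding ix using k[OF True y(2)] k[OF y(1,2)] y(3) by (simp add: image_image)
    next case False
     \<comment> \<open>Leaving the last level leads back into \<open>B\<close>, where
       \<open>c\<close> is prescribed; this is the only place where its equivariance under
       \<open>t ^^ r\<close> enters.\<close>
     hence r: "Suc i = r" using y(1) by simp
     have "(t ^^ r)`y:?M" using y(2) Mi[OF yM, of r] image_mono[of y B "t ^^ r"] block_cycle_facts(4)[OF bc] by (auto simp: below_def)
     hence "k (t`x) = map ((`) (t ^^ r)) (c y)" unfolding ix r using k[of 0] block_cycle_facts(1)[OF bc] cD(3)[OF y(2)] by simp
     thus ?thesis using k[OF y(1,2)] y(3) by (simp add: image_image flip: r)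
    qed
   qed
   moreover have "restrict (restrict k M) ?M = c" proof -
    have "k y = c y" if "y:?M" for y using k[of 0 y] block_cycle_facts(1)[OF bc] that by simp
    hence "restrict (restrict k M) ?M = restrict c ?M" by (auto simp: fun_eq_iff restrict_def below_def)
    thus ?thesis unfolding order_families_restrict[OF c] .
   qed
   ultimately show "c:?t1`order_families t P M" by blast
  qed
 qed
 thus ?thesis by (rule bij_betw_same_card)
qed

lemma natural_weight_order: "natural_weight order_weight"
proof fix S X P and t g t' :: "nat => nat"
 assume "bij_betw t S S" "X:stab S t" "P:stab S t" "inj_on g S" "!!x. x:S ==> t' (g x) = g (t x)"
 thus "order_weight t' ((`) g`P) ((`) g`X) = order_weight t P X" using card_order_families_image[of g S t' t P X] by (simp add: order_weight_def)
next fix S1 S2 X1 X2 P1 P2 and t :: "nat => nat"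
 assume "S1 Int S2 = {}" "bij_betw t S1 S1" "bij_betw t S2 S2" "X1:stab S1 t" "P1:stab S1 t" "finer P1 X1" "X2:stab S2 t" "P2:stab S2 t" "finer P2 X2"
 thus "order_weight t (P1 Un P2) (X1 Un X2) = order_weight t P1 X1 * order_weight t P2 X2"
  using card_order_families_Un[of S1 S2 X1 t X2 P1 P2] by (simp add: order_weight_def)
next fix B r X M P and t :: "nat => nat"
 assume "block_cycle t B r X" "M:stab (\<Union>X) t" "P:stab (\<Union>X) t" "finer P M" "finer M X"
 thus "order_weight t P M = order_weight (t ^^ r) (below P B) (below M B)"
  using card_order_families_cycle[of t B r X M P] by (simp add: order_weight_def)
next fix t :: "nat => nat"
 have "order_families t {} {} = {%x. undefined}" by (auto simp: order_families_def)
 thus "order_weight t {} {} = 1" by (simp add: order_weight_def)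
qed

section \<open>Linear maps and traces on free vector spaces\<close>

lemma pm_scale_simps [simp]: "pm_scale 1 f = f" "pm_scale 0 f = 0" "pm_scale c 0 = 0" "pm_scale a (pm_scale b f) = pm_scale (a * b) f"
 by (auto intro!: poly_mapping_eqI)

lemma pm_scale_add: "pm_scale c (f + g) = pm_scale c f + pm_scale c g" by (auto intro!: poly_mapping_eqI simp: lookup_add algebra_simps)

lemma pm_scale_add_left: "pm_scale (a + b) f = pm_scale a f + pm_scale b f" by (auto intro!: poly_mapping_eqI simp: lookup_add algebra_simps)

lemma lookup_sum_pm: "lookup (sum f A) x = (SUM a:A. lookup (f a) x)" by (induction A rule: infinite_finite_induct) (auto simp: lookup_add)

lemma pm_scale_sum: "pm_scale c (sum f A) = (SUM a:A. pm_scale c (f a))" by (rule poly_mapping_eqI) (simp add: lookup_sum_pm sum_distrib_left)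

lemma lin_ext_superset:
 assumes "finite A" "keys f <= A"
 shows "lin_ext g f = (SUM a:A. pm_scale (lookup f a) (g a))"
 unfolding lin_ext_def by (rule sum.mono_neutral_left) (use assms in \<open>auto simp: in_keys_iff\<close>)

definition linmap :: "(('a \<Rightarrow>\<^sub>0 complex) => ('b \<Rightarrow>\<^sub>0 complex)) => bool" where
 "linmap T \<longleftrightarrow> (\<forall>f g. T (f + g) = T f + T g) & (\<forall>c f. T (pm_scale c f) = pm_scale c (T f))"

lemma linmapD:
 assumes "linmap T"
 shows "T (f + g) = T f + T g" "T (pm_scale c f) = pm_scale c (T f)" "T 0 = 0" "T (sum h A) = (SUM a:A. T (h a))"
  "T (- f) = - T f" "T (f - g) = T f - T g"
proof -
 show a: "T (f + g) = T f + T g" "T (pm_scale c f) = pm_scale c (T f)" for f g c using assms by (auto simp: linmap_def)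
 show z: "T 0 = 0" using a(2)[of 0 0] by simp
 show "T (sum h A) = (SUM a:A. T (h a))" by (induction A rule: infinite_finite_induct) (simp_all add: a z)
 show m: "T (- f) = - T f" for f using a(1)[of f "- f"] z by (simp add: add_eq_0_iff)
 show "T (f - g) = T f - T g" using a(1)[of f "- g"] m by simp
qed

lemma linmap_lin_ext: "linmap (lin_ext g)" for g :: "'a => ('b \<Rightarrow>\<^sub>0 complex)" unfolding linmap_def
proof safe fix f1 f2 :: "'a \<Rightarrow>\<^sub>0 complex" and c
 let ?A = "keys f1 Un keys f2"
 have "keys (f1 + f2) <= ?A" by (rule keys_add)
 hence "lin_ext g (f1 + f2) = (SUM a:?A. pm_scale (lookup (f1 + f2) a) (g a))" by (intro lin_ext_superset) auto
 also have "... = (SUM a:?A. pm_scale (lookup f1 a) (g a)) + (SUM a:?A. pm_scale (lookup f2 a) (g a))"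
  by (simp add: lookup_add pm_scale_add_left sum.distrib)
 also have "... = lin_ext g f1 + lin_ext g f2" using lin_ext_superset[of ?A f1 g] lin_ext_superset[of ?A f2 g] by simp
 finally show "lin_ext g (f1 + f2) = lin_ext g f1 + lin_ext g f2" .
 have "keys (pm_scale c f1) <= keys f1" by (auto simp: in_keys_iff)
 hence "lin_ext g (pm_scale c f1) = (SUM a:keys f1. pm_scale (lookup (pm_scale c f1) a) (g a))" by (intro lin_ext_superset) auto
 thus "lin_ext g (pm_scale c f1) = pm_scale c (lin_ext g f1)" by (simp add: lin_ext_def pm_scale_sum)
qed

lemma lin_ext_basis [simp]: "lin_ext g (basis_vec a) = g a" by (simp add: lin_ext_def)

lemma linmap_comp: "linmap S ==> linmap T ==> linmap (%f. S (T f))" by (simp add: linmap_def)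

lemma linmap_id: "linmap (%f. f)" by (simp add: linmap_def)

lemma linmap_scale: "linmap T ==> linmap (%f. pm_scale c (T f))" by (simp add: linmap_def pm_scale_add mult.commute)

lemma linmap_diff: "linmap S ==> linmap T ==> linmap (%f. S f - T f)"
 unfolding linmap_def by (auto intro!: poly_mapping_eqI simp: lookup_add lookup_minus algebra_simps)

definition supported :: "'a set => ('a \<Rightarrow>\<^sub>0 complex) set" where "supported A = {f. keys f <= A}"

lemma supportedI: "(!!x. lookup f x ~= 0 ==> x:A) ==> f:supported A" by (auto simp: supported_def in_keys_iff)

lemma supported_lookup: "f:supported A ==> x ~: A ==> lookup f x = 0" by (auto simp: supported_def in_keys_iff)

lemma supported_simps: "0:supported A" "f:supported A ==> pm_scale c f:supported A" "f:supported A ==> g:supported A ==> f + g:supported A"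
 "f:supported A ==> g:supported A ==> f - g:supported A" "(!!i. i:I ==> h i:supported A) ==> sum h I:supported A" "a:A ==> basis_vec a:supported A"
proof -
 show "0:supported A" by (simp add: supported_def)
 show "pm_scale c f:supported A" if "f:supported A" using supported_lookup[OF that] by (intro supportedI) auto
 show "f + g:supported A" if "f:supported A" "g:supported A" for f g proof (rule supportedI, rule ccontr)
  fix x assume "lookup (f + g) x ~= 0" "x ~: A"
  thus False using supported_lookup[OF that(1), of x] supported_lookup[OF that(2), of x] by (simp add: lookup_add)
 qed
 show "f - g:supported A" if "f:supported A" "g:supported A" proof (rule supportedI, rule ccontr)
  fix x assume "lookup (f - g) x ~= 0" "x ~: A"
  thus False using supported_lookup[OF that(1), of x] supported_lookup[OF that(2), of x] by (simp add: lookup_minus)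
 qed
 show "sum h I:supported A" if h: "!!i. i:I ==> h i:supported A" proof (rule supportedI)
  fix x assume x: "lookup (sum h I) x ~= 0" show "x:A" proof (rule ccontr) assume "x ~: A"
   hence "lookup (h i) x = 0" if "i:I" for i by (rule supported_lookup[OF h[OF that]])
   thus False using x by (simp add: lookup_sum_pm)
  qed
 qed
 show "basis_vec a:supported A" if "a:A" using that by (simp add: supported_def)
qed

lemma basis_expansion:
 assumes "finite A" "f:supported A"
 shows "f = (SUM a:A. pm_scale (lookup f a) (basis_vec a))"
proof (rule poly_mapping_eqI) fix x
 have "(SUM a:A. lookup f a * lookup (basis_vec a) x) = (SUM a:A. if a = x then lookup f a else 0)"
  by (rule sum.cong) (auto simp: lookup_single when_def)
 also have "... = lookup f x" using assms supported_lookup[OF assms(2), of x] by (simp add: sum.delta)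
 finally show "lookup f x = lookup (SUM a:A. pm_scale (lookup f a) (basis_vec a)) x" by (simp add: lookup_sum_pm)
qed

lemma linmap_expansion:
 assumes "linmap T" "finite A" "f:supported A"
 shows "T f = (SUM a:A. pm_scale (lookup f a) (T (basis_vec a)))" by (subst basis_expansion[OF assms(2,3)]) (simp add: linmapD[OF assms(1)])

lemma linmap_eqI:
 assumes "linmap S" "linmap T" "!!a. a:A ==> S (basis_vec a) = T (basis_vec a)" "f:supported A"
 shows "S f = T f"
proof -
 have f: "f:supported (keys f)" by (simp add: supported_def)
 have "S (basis_vec a) = T (basis_vec a)" if "a:keys f" for a using assms(3,4) that by (auto simp: supported_def)
 thus ?thesis using linmap_expansion[OF assms(1) finite_keys f] linmap_expansion[OF assms(2) finite_keys f] by simp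
qed

lemma span_basis_vec: "fvs.span (basis_vec`A) = supported A"
proof
 have "basis_vec`A <= supported A" by (auto simp: supported_simps)
 moreover have "fvs.subspace (supported A)" by (rule fvs.subspaceI) (simp_all add: supported_simps)
 ultimately show "fvs.span (basis_vec`A) <= supported A" by (rule fvs.span_minimal)
 show "supported A <= fvs.span (basis_vec`A)" proof
  fix f assume f: "f:supported A"
  have "f = (SUM a:keys f. pm_scale (lookup f a) (basis_vec a))" by (rule basis_expansion) (simp_all add: supported_def)
  also have "...:fvs.span (basis_vec`A)" by (intro fvs.span_sum fvs.span_scale fvs.span_base) (use f in \<open>auto simp: supported_def\<close>)
  finally show "f:fvs.span (basis_vec`A)" .
 qed
qed

definition op_trace :: "'a set => (('a \<Rightarrow>\<^sub>0 complex) => ('a \<Rightarrow>\<^sub>0 complex)) => complex" where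
 "op_trace A T = (SUM a:A. lookup (T (basis_vec a)) a)"

lemma op_trace_cong: "(!!a. a:A ==> S (basis_vec a) = T (basis_vec a)) ==> op_trace A S = op_trace A T" by (simp add: op_trace_def)

lemma op_trace_linear: "op_trace A (%f. S f + T f) = op_trace A S + op_trace A T" "op_trace A (%f. S f - T f) = op_trace A S - op_trace A T"
 "op_trace A (%f. pm_scale c (T f)) = c * op_trace A T" "op_trace A (%f. SUM i:I. U i f) = (SUM i:I. op_trace A (U i))"
 by (simp_all add: op_trace_def lookup_add lookup_minus lookup_sum_pm sum.distrib sum_subtractf sum_distrib_left sum.swap[of _ I])

text \<open>Cyclicity of the trace for maps between two possibly different spaces, a form that also
  fits maps between neighbouring chain spaces of a complex.\<close>

lemma op_trace_comm:
 fixes S :: "('b \<Rightarrow>\<^sub>0 complex) => ('a \<Rightarrow>\<^sub>0 complex)" and T :: "('a \<Rightarrow>\<^sub>0 complex) => ('b \<Rightarrow>\<^sub>0 complex)"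
 assumes A: "finite A" "finite B" and l: "linmap S" "linmap T"
  and m: "!!b. b:B ==> S (basis_vec b):supported A" "!!a. a:A ==> T (basis_vec a):supported B"
 shows "op_trace A (%f. S (T f)) = op_trace B (%f. T (S f))"
proof -
 have "op_trace A (%f. S (T f)) = (SUM a:A. SUM b:B. lookup (T (basis_vec a)) b * lookup (S (basis_vec b)) a)" unfolding op_trace_def
 proof (rule sum_eqI, goal_cases) case a: (1 a)
  show ?case by (subst linmap_expansion[OF l(1) A(2) m(2)[OF a]]) (simp add: lookup_sum_pm)
 qed
 also have "... = (SUM b:B. SUM a:A. lookup (S (basis_vec b)) a * lookup (T (basis_vec a)) b)" by (subst sum.swap) (simp add: mult.commute)
 also have "... = op_trace B (%f. T (S f))" unfolding op_trace_def proof (rule sum_eqI, goal_cases)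
  case b: (1 b) show ?case by (subst linmap_expansion[OF l(2) A(1) m(1)[OF b]]) (simp add: lookup_sum_pm)
 qed
 finally show ?thesis .
qed

text \<open>Replaces the chosen bases in the definition of the trace by the standard basis of the
  ambient space. Both traces are expanded in coordinates with respect to a basis \<open>C\<close> of
  \<open>V\<close>; those of \<open>P f\<close> are linear in f on the whole ambient space.\<close>

lemma subquot_trace_projection:
 assumes A: "finite A" and V: "V <= supported A" "fvs.subspace V" and P: "linmap P" "!!a. a:A ==> P (basis_vec a):V" "!!v. v:V ==> P v = v"
  and T: "linmap T" "!!v. v:V ==> T v:V"
 shows "subquot_trace V {0} T = op_trace A (%f. T (P f))"
proof -
 define ok where "ok = (%(D, C). D <= C & fvs.independent C & fvs.span D = {0} & fvs.span C = V)"
 obtain C0 where C0: "C0 <= V" "fvs.independent C0" "V <= fvs.span C0" using fvs.maximal_independent_subset by blast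
 have "fvs.span C0 = V" using C0 V(2) fvs.span_minimal by blast
 hence "ok ({}, C0)" using C0 by (simp add: ok_def)
 hence "ok (SOME p. ok p)" by (rule someI)
 moreover obtain D C where DC: "(SOME p. ok p) = (D, C)" by (cases "SOME p. ok p")
 ultimately have C: "D <= C" "fvs.independent C" "fvs.span D = {0}" "fvs.span C = V" by (auto simp: ok_def)
 \<comment> \<open>\<open>D\<close> spans the zero space, so any member would be the zero vector
   inside the independent set \<open>C\<close>.\<close>
 have "D = {}" proof (rule ccontr)
  assume "D ~= {}"
  then obtain d where d: "d:D" by blast
  hence "d:fvs.span D" by (rule fvs.span_base)
  hence "0:C" using C d by auto
  thus False using C(2) fvs.dependent_zero by blast
 qed
 have st: "subquot_trace V {0} T = (SUM c:C. fvs.representation C (T c) c)"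
  unfolding subquot_trace_def ok_def[symmetric] DC using \<open>D = {}\<close> by simp
 have CV: "C <= V" using C(4) fvs.span_superset by blast
 have finC: "finite C" proof -
  have "C <= fvs.span (basis_vec`A)" using CV V(1) by (simp add: span_basis_vec)
  thus ?thesis using fvs.independent_span_bound[of "basis_vec`A" C] A C(2) by blast
 qed
 define rho where "rho = (%c f. fvs.representation C (P f) c)"
 have inV: "P f:V" if f: "f:supported A" for f by (subst linmap_expansion[OF P(1) A f])
   (intro fvs.subspace_sum[OF V(2)] fvs.subspace_scale[OF V(2)] P(2))
 have exp: "P f = (SUM c:C. pm_scale (rho c f) c)" if "f:supported A" for f unfolding rho_def
  by (rule fvs.sum_representation_eq[symmetric]) (use C finC inV[OF that] in auto)
 have rlin: "rho c f = (SUM a:A. lookup f a * rho c (basis_vec a))" if f: "f:supported A" for c f proof -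
  have "rho c f = fvs.representation C (SUM a:A. pm_scale (lookup f a) (P (basis_vec a))) c"
   unfolding rho_def by (subst linmap_expansion[OF P(1) A f]) simp
  also have "... = (SUM a:A. fvs.representation C (pm_scale (lookup f a) (P (basis_vec a))) c)"
   by (subst fvs.representation_sum[OF C(2)]) (simp_all add: C(4) P(2) fvs.subspace_scale[OF V(2)])
  also have "... = (SUM a:A. lookup f a * rho c (basis_vec a))"
   unfolding rho_def by (intro sum.cong refl) (simp add: fvs.representation_scale[OF C(2)] C(4) P(2))
  finally show ?thesis .
 qed
 have "op_trace A (%f. T (P f)) = (SUM a:A. SUM c:C. rho c (basis_vec a) * lookup (T c) a)" unfolding op_trace_def proof (rule sum_eqI, goal_cases)
  case (1 a)
  thus ?case by (subst exp) (simp_all add: supported_simps linmapD[OF T(1)] lookup_sum_pm)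
 qed
 also have "... = (SUM c:C. SUM a:A. lookup (T c) a * rho c (basis_vec a))" by (subst sum.swap) (simp add: mult.commute)
 also have "... = (SUM c:C. rho c (T c))" proof (rule sum_eqI, goal_cases)
  case (1 c)
  hence "T c:V" using T(2) CV by blast
  thus ?case using rlin[of "T c" c] V(1) by auto
 qed
 also have "... = (SUM c:C. fvs.representation C (T c) c)" unfolding rho_def proof (rule sum_eqI, goal_cases)
  case (1 c)
  hence "T c:V" using T(2) CV by blast
  thus ?case using P(3) by simp
 qed
 finally show ?thesis using st by simp
qed

section \<open>The face algebra\<close>

text \<open>One block of the left factor cut by all blocks of the right factor. Products are
  concatenations of such rows, which reduces associativity to list inductions.\<close>

definition face_row :: "nat set => nat set list => nat set list" where "face_row p Q = filter (%s. s ~= {}) (map ((\<inter>) p) Q)"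

lemma face_prod_rows: "face_prod P Q = concat (map (%p. face_row p Q) P)"
proof -
 have "concat (map (%q. if p Int q ~= {} then [p Int q] else []) Q) = face_row p Q" for p by (induction Q) (auto simp: face_row_def)
 thus ?thesis by (simp add: face_prod_def)
qed

lemma face_row_simps: "face_row p [] = []" "face_row p (q # Q) = (if p Int q ~= {} then [p Int q] else []) @ face_row p Q"
 "face_row p (A @ B) = face_row p A @ face_row p B" by (auto simp: face_row_def)

lemma face_prod_simps: "face_prod [] Q = []" "face_prod (p # P) Q = face_row p Q @ face_prod P Q"
 "face_prod (A @ B) Q = face_prod A Q @ face_prod B Q" by (simp_all add: face_prod_rows)

lemma face_row_row: "face_row p (face_row q R) = face_prod (if p Int q ~= {} then [p Int q] else []) R"
proof (induction R) case (Cons r R)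
 have "p Int (q Int r) = p Int q Int r" by blast
 thus ?case using Cons by (auto simp: face_row_simps face_prod_simps split: if_splits)
qed (simp add: face_row_simps face_prod_simps)

lemma face_prod_row: "face_prod (face_row p Q) R = face_row p (face_prod Q R)"
 by (induction Q) (simp_all add: face_row_simps face_prod_simps face_row_row)

lemma face_prod_assoc: "face_prod (face_prod P Q) R = face_prod P (face_prod Q R)" by (induction P) (simp_all add: face_prod_simps face_prod_row)

lemma set_face_row: "set (face_row p Q) = {p Int q |q. q:set Q & p Int q ~= {}}" by (auto simp: face_row_def)

lemma set_face_prod: "set (face_prod P Q) = {p Int q |p q. p:set P & q:set Q & p Int q ~= {}}" by (auto simp: face_prod_rows set_face_row)

lemma distinct_face_row:
 assumes "distinct Q" "disjoint (set Q)"
 shows "distinct (face_row p Q)" using assms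
proof (induction Q) case (Cons q Q)
 have d: "disjoint (set Q)" using Cons.prems(2) by (auto simp: disjoint_def)
 have "p Int q ~: set (face_row p Q)" if ne: "p Int q ~= {}" proof
  assume "p Int q:set (face_row p Q)"
  then obtain q' where q': "q':set Q" "p Int q = p Int q'" by (auto simp: set_face_row)
  have "q Int q' = {}" using Cons.prems q'(1) by (auto simp: disjoint_def)
  thus False using q'(2) ne by blast
 qed
 thus ?case using Cons d by (simp add: face_row_simps)
qed (simp add: face_row_simps)

lemma distinct_face_prod:
 assumes "distinct P" "disjoint (set P)" "distinct Q" "disjoint (set Q)"
 shows "distinct (face_prod P Q)" using assms(1,2)
proof (induction P) case (Cons p P)
 have d: "disjoint (set P)" using Cons.prems(2) by (auto simp: disjoint_def)
 have "set (face_row p Q) Int set (face_prod P Q) = {}" proof (rule ccontr)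
  assume "\<not> ?thesis"
  then obtain s where s: "s:set (face_row p Q)" "s:set (face_prod P Q)" by blast
  hence "s <= p" "s ~= {}" by (auto simp: set_face_row)
  moreover obtain p' where "p':set P" "s <= p'" using s(2) by (auto simp: set_face_prod)
  moreover have "p Int p' = {}" using Cons.prems \<open>p' \<in> set P\<close> by (auto simp: disjoint_def)
  ultimately show False by blast
 qed
 thus ?case using Cons d distinct_face_row[OF assms(3,4)] by (simp add: face_prod_simps)
qed (simp add: face_prod_simps)

lemma facesD:
 assumes "P:faces n"
 shows "distinct P" "partition_on {1..n} (set P)" "disjoint (set P)" "\<Union>(set P) = {1..n}" "{} ~: set P"
 using assms by (auto simp: faces_def partition_on_def)

lemma face_prod_closed:
 assumes "P:faces n" "Q:faces n"
 shows "face_prod P Q:faces n" unfolding faces_def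
proof (intro CollectI conjI)
 show "distinct (face_prod P Q)" using facesD[OF assms(1)] facesD[OF assms(2)] by (intro distinct_face_prod)
 show "partition_on {1..n} (set (face_prod P Q))" proof (rule partition_onI)
  show "\<Union>(set (face_prod P Q)) = {1..n}" proof
   show "\<Union>(set (face_prod P Q)) <= {1..n}" using facesD(4)[OF assms(1)] by (auto simp: set_face_prod)
   show "{1..n} <= \<Union>(set (face_prod P Q))" proof
    fix x assume x: "x:{1..n}" obtain p where "p:set P" "x:p" using x facesD(4)[OF assms(1)] by blast
    moreover obtain q where "q:set Q" "x:q" using x facesD(4)[OF assms(2)] by blast
    ultimately have "p Int q:set (face_prod P Q)" "x:p Int q" unfolding set_face_prod by blast+
    thus "x:\<Union>(set (face_prod P Q))" by blast
   qed
  qed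
  show "{} ~: set (face_prod P Q)" by (auto simp: set_face_prod)
  show "disjnt a b" if ab: "a:set (face_prod P Q)" "b:set (face_prod P Q)" "a ~= b" for a b proof -
   obtain p q where a: "p:set P" "q:set Q" "a = p Int q" using ab(1) by (auto simp: set_face_prod)
   obtain p' q' where b: "p':set P" "q':set Q" "b = p' Int q'" using ab(2) by (auto simp: set_face_prod)
   have pp: "p = p' | p Int p' = {}" using a(1) b(1) facesD(3)[OF assms(1)] by (auto simp: disjoint_def)
   have qq: "q = q' | q Int q' = {}" using a(2) b(2) facesD(3)[OF assms(2)] by (auto simp: disjoint_def)
   have "p Int p' = {} | q Int q' = {}" using pp qq a(3) b(3) ab(3) by blast
   thus ?thesis using a b by (auto simp: disjnt_def)
  qed
 qed
qed

lemma face_row_refines: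
 assumes "!!q. q:set Q ==> q ~= {} & (q <= p | p Int q = {})"
 shows "face_row p Q = filter (%q. q <= p) Q" using assms
proof (induction Q) case (Cons q Q)
 have q: "q ~= {}" "q <= p | p Int q = {}" using Cons.prems[of q] by auto
 have IH: "face_row p Q = filter (%q. q <= p) Q" using Cons by auto
 show ?case proof (cases "q <= p")
  case True
  hence "p Int q = q" by blast
  thus ?thesis using True q IH by (simp add: face_row_simps)
 next case False
  thus ?thesis using q IH by (simp add: face_row_simps)
 qed
qed (simp add: face_row_simps)

lemma face_row_absorb:
 assumes "distinct Q" "disjoint (set Q)" "q:set Q" "p <= q" "p ~= {}"
 shows "face_row p Q = [p]" using assms(1-3)
proof (induction Q) case (Cons x Q)
 have d: "disjoint (set Q)" using Cons.prems(2) by (auto simp: disjoint_def)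
 show ?case proof (cases "x = q")
  case True
  have "p Int y = {}" if "y:set Q" for y proof -
   have "y ~= q" using that Cons.prems(1) True by auto
   hence "q Int y = {}" using Cons.prems(2) that True by (auto simp: disjoint_def)
   thus ?thesis using assms(4) by blast
  qed
  hence "face_row p Q = []" by (simp add: face_row_def)
  moreover have "p Int x = p" using True assms(4) by blast
  ultimately show ?thesis using assms(5) by (simp add: face_row_simps)
 next case False
  hence qQ: "q:set Q" using Cons.prems(3) by simp
  hence "x Int q = {}" using Cons.prems(2) False by (auto simp: disjoint_def)
  hence "p Int x = {}" using assms(4) by blast
  thus ?thesis using Cons.IH[OF _ d qQ] Cons.prems(1) by (simp add: face_row_simps)
 qed
qed simp

lemma face_prod_absorb:
 assumes "f:faces n" "g:faces n" "finer (set f) (set g)"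
 shows "face_prod f g = f"
proof -
 have "face_row p g = [p]" if p: "p:set f" for p proof -
  obtain q where "q:set g" "p <= q" using assms(3) p by (auto simp: finer_def)
  moreover have "p ~= {}" using facesD(5)[OF assms(1)] p by auto
  ultimately show ?thesis using face_row_absorb[OF facesD(1,3)[OF assms(2)]] by blast
 qed
 hence "map (%p. face_row p g) f = map (%p. [p]) f" by simp
 thus ?thesis unfolding face_prod_rows by (simp only: concat_map_singleton map_ident)
qed

lemma face_prod_refined:
 assumes f: "f:faces n" and g: "g:faces n" and fi: "finer (set g) (set f)"
 shows "face_prod f g = concat (map (%p. filter (%q. q <= p) g) f)"
proof -
 have "face_row p g = filter (%q. q <= p) g" if p: "p:set f" for p proof (rule face_row_refines)
  fix q assume q: "q:set g"
  then obtain p' where p': "p':set f" "q <= p'" using fi by (auto simp: finer_def)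
  have "q ~= {}" using facesD(5)[OF g] q by auto
  moreover have "q <= p | p Int q = {}" proof (cases "p = p'")
   case False
   hence "p Int p' = {}" using facesD(3)[OF f] p p' by (simp add: disjoint_def)
   thus ?thesis using p'(2) by blast
  qed (use p' in simp)
  ultimately show "q ~= {} & (q <= p | p Int q = {})" ..
 qed
 thus ?thesis unfolding face_prod_rows by (simp cong: map_cong)
qed

lemma finer_face_prod: "finer (set (face_prod f g)) (set f)" "finer (set (face_prod f g)) (set g)" unfolding finer_def set_face_prod by blast+

lemma finite_faces [simp]: "finite (faces n)"
proof (rule finite_subset)
 let ?t1 = "{P. set P <= Pow {1..n} & distinct P}"
 show "faces n <= ?t1" using facesD(4) by (auto simp: faces_def partition_on_def)
 show "finite ?t1" by (rule finite_subset_distinct) simp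
qed

definition top_face :: "nat => nat set list" where "top_face n = (if n = 0 then [] else [{1..n}])"

lemma top_face: "top_face n:faces n" "finer X (set (top_face n)) \<longleftrightarrow> (if n = 0 then X = {} else \<Union>X <= {1..n})"
proof -
 show "top_face n:faces n" by (auto simp: top_face_def faces_def partition_on_empty intro!: partition_on_space)
 show "finer X (set (top_face n)) \<longleftrightarrow> (if n = 0 then X = {} else \<Union>X <= {1..n})" by (auto simp: top_face_def finer_def)
qed

lemma top_face_unit:
 assumes "f:faces n"
 shows "face_prod (top_face n) f = f" "face_prod f (top_face n) = f"
proof -
 have U: "\<Union>(set f) = {1..n}" by (rule facesD(4)[OF assms])
 have z: "f = []" if "n = 0" using assms that by (simp add: faces_def partition_on_empty)
 have fi: "finer (set f) (set (top_face n))" unfolding top_face using U z by simp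
 thus "face_prod f (top_face n) = f" by (rule face_prod_absorb[OF assms top_face(1)])
 show "face_prod (top_face n) f = f" proof (cases "n = 0")
  case True
  thus ?thesis using z by (simp add: top_face_def face_prod_simps)
 next case False
  have "filter (%q. q <= {1..n}) f = f" using U by (intro filter_True) blast
  thus ?thesis using face_prod_refined[OF top_face(1) assms fi] False by (simp add: top_face_def)
 qed
qed

lemma linmap_sum: "(!!i. i:I ==> linmap (T i)) ==> linmap (%f. SUM i:I. T i f)" unfolding linmap_def by (simp add: sum.distrib pm_scale_sum)

lemma linmap_face_mult: "linmap (%f. face_mult f g)" "linmap (face_mult f)"
proof -
 show "linmap (%f. face_mult f g)" unfolding face_mult_def by (rule linmap_lin_ext)
 let ?t1 = "(%g. SUM P:keys f. pm_scale (lookup f P) (lin_ext (%Q. basis_vec (face_prod P Q)) g))"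
 have "linmap (%g. lin_ext (%Q. basis_vec (face_prod P Q)) g :: nat set list \<Rightarrow>\<^sub>0 complex)" for P by (rule linmap_lin_ext)
 hence "linmap ?t1" by (intro linmap_sum linmap_scale)
 moreover have "face_mult f = ?t1" unfolding face_mult_def by (rule ext) (rule lin_ext_def)
 ultimately show "linmap (face_mult f)" by simp
qed

lemma face_mult_basis [simp]: "face_mult (basis_vec P) (basis_vec Q) = basis_vec (face_prod P Q)" by (simp add: face_mult_def)

lemma supported_UNIV [simp]: "f:supported UNIV" by (simp add: supported_def)

lemma face_mult_assoc: "face_mult (face_mult f g) h = face_mult f (face_mult g h)"
proof -
 note l = linmap_face_mult
 have 1: "face_mult (face_mult (basis_vec P) (basis_vec Q)) h = face_mult (basis_vec P) (face_mult (basis_vec Q) h)" for P Q h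
  by (rule linmap_eqI[of "%h. face_mult (face_mult (basis_vec P) (basis_vec Q)) h" "%h. face_mult (basis_vec P) (face_mult (basis_vec Q) h)" UNIV])
   (simp_all add: l linmap_comp[OF l(2) l(2)] face_prod_assoc)
 have 2: "face_mult (face_mult (basis_vec P) g) h = face_mult (basis_vec P) (face_mult g h)" for P g h
  by (rule linmap_eqI[of "%g. face_mult (face_mult (basis_vec P) g) h" "%g. face_mult (basis_vec P) (face_mult g h)" UNIV])
   (simp_all only: linmap_comp[OF l(1) l(2)] linmap_comp[OF l(2) l(1)] 1 supported_UNIV)
 show ?thesis by (rule linmap_eqI[of "%f. face_mult (face_mult f g) h" "%f. face_mult f (face_mult g h)" UNIV])
   (simp_all only: linmap_comp[OF l(1) l(1)] l(1) 2 supported_UNIV)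
qed

lemma face_mult_linear: "face_mult (f + f') g = face_mult f g + face_mult f' g" "face_mult f (g + g') = face_mult f g + face_mult f g'"
 "face_mult (pm_scale c f) g = pm_scale c (face_mult f g)" "face_mult f (pm_scale c g) = pm_scale c (face_mult f g)"
 "face_mult 0 g = 0" "face_mult f 0 = 0" "face_mult (sum h I) g = (SUM i:I. face_mult (h i) g)" "face_mult f (sum h I) = (SUM i:I. face_mult f (h i))"
 using linmapD[OF linmap_face_mult(1)] linmapD[OF linmap_face_mult(2)] by auto

lemma linmap_supported:
 assumes "linmap T" "!!a. a:A ==> T (basis_vec a):supported B" "f:supported A"
 shows "T f:supported B"
proof -
 have f: "f:supported (keys f)" by (simp add: supported_def)
 show ?thesis by (subst linmap_expansion[OF assms(1) finite_keys f], intro supported_simps(5) supported_simps(2) assms(2))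
   (use assms(3) in \<open>auto simp: supported_def\<close>)
qed

lemma face_mult_closed:
 assumes "f:supported (faces n)" "g:supported (faces n)"
 shows "face_mult f g:supported (faces n)"
proof (rule linmap_supported[OF linmap_face_mult(1) _ assms(1)]) fix P assume P: "P:faces n"
 show "face_mult (basis_vec P) g:supported (faces n)"
  by (rule linmap_supported[OF linmap_face_mult(2) _ assms(2)]) (simp add: supported_simps face_prod_closed[OF P])
qed

lemma linmap_face_act: "linmap (face_act t)" unfolding face_act_def by (rule linmap_lin_ext)

lemma face_act_basis [simp]: "face_act t (basis_vec P) = basis_vec (map ((`) t) P)" by (simp add: face_act_def)

lemma face_act_mult:
 assumes "inj t"
 shows "face_act t (face_mult f g) = face_mult (face_act t f) (face_act t g)"
proof -
 note l = linmap_face_mult linmap_face_act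
 have row: "map ((`) t) (face_row p Q) = face_row (t`p) (map ((`) t) Q)" for p Q
  by (induction Q) (simp_all add: face_row_simps image_Int[OF assms, symmetric])
 have b: "map ((`) t) (face_prod P Q) = face_prod (map ((`) t) P) (map ((`) t) Q)" for P Q by (induction P) (simp_all add: face_prod_simps row)
 have 1: "face_act t (face_mult (basis_vec P) g) = face_mult (face_act t (basis_vec P)) (face_act t g)" for P g
  by (rule linmap_eqI[of "%g. face_act t (face_mult (basis_vec P) g)" "%g. face_mult (face_act t (basis_vec P)) (face_act t g)" UNIV])
   (simp_all only: linmap_comp[OF l(3) l(2)] linmap_comp[OF l(2) l(3)] face_act_basis face_mult_basis b supported_UNIV)
 show ?thesis by (rule linmap_eqI[of "%f. face_act t (face_mult f g)" "%f. face_mult (face_act t f) (face_act t g)" UNIV])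
   (simp_all only: linmap_comp[OF l(3) l(1)] linmap_comp[OF l(1) l(3)] 1 supported_UNIV)
qed

lemma face_act_face:
 assumes "t permutes {1..n}" "P:faces n"
 shows "map ((`) t) P:faces n" unfolding faces_def
proof (intro CollectI conjI)
 have inj: "inj_on t {1..n}" using permutes_inj_on[OF assms(1)] .
 have sub: "set P <= Pow {1..n}" using facesD(4)[OF assms(2)] by blast
 show "distinct (map ((`) t) P)" using facesD(1)[OF assms(2)] inj_on_subset[OF inj_on_image_Pow[OF inj] sub] by (simp add: distinct_map)
 show "partition_on {1..n} (set (map ((`) t) P))" using partition_on_image_iff[OF inj sub] facesD(2)[OF assms(2)] permutes_image[OF assms(1)] by simp
qed

lemma face_act_closed:
 assumes "t permutes {1..n}" "f:supported (faces n)"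
 shows "face_act t f:supported (faces n)"
 by (rule linmap_supported[OF linmap_face_act _ assms(2)]) (simp add: supported_simps face_act_face[OF assms(1)])

lemma face_mult_one:
 assumes "f:supported (faces n)"
 shows "face_mult (basis_vec (top_face n)) f = f" "face_mult f (basis_vec (top_face n)) = f"
 using linmap_eqI[OF linmap_face_mult(2) linmap_id, of "faces n" "basis_vec (top_face n)", OF _ assms]
  linmap_eqI[OF linmap_face_mult(1) linmap_id, of "faces n" "basis_vec (top_face n)", OF _ assms] by (simp_all add: top_face_unit)

lemma face_algebra_simps: "carrier (face_algebra n) = supported (faces n)" "x \<otimes>\<^bsub>face_algebra n\<^esub> y = face_mult x y"
 "\<one>\<^bsub>face_algebra n\<^esub> = basis_vec (top_face n)" "\<zero>\<^bsub>face_algebra n\<^esub> = 0" "x \<oplus>\<^bsub>face_algebra n\<^esub> y = x + y"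
 by (simp_all add: face_algebra_def span_basis_vec top_face_def)

lemma face_algebra_finsum:
 assumes "finite I" "!!i. i:I ==> f i:supported (faces n)"
 shows "(\<Oplus>\<^bsub>face_algebra n\<^esub>i\<in>I. f i) = sum f I"
proof -
 interpret abelian_monoid "face_algebra n" by (rule abelian_monoidI) (simp_all add: face_algebra_simps supported_simps add.assoc add.commute)
 show ?thesis using assms proof (induction I)
  case (insert i I)
  hence "f:I \<rightarrow> carrier (face_algebra n)" "f i:carrier (face_algebra n)" by (auto simp: face_algebra_simps)
  thus ?case using insert by (simp add: finsum_insert face_algebra_simps(5))
 qed (simp add: face_algebra_simps)
qed

section \<open>Traces with averaged faces\<close>

lemma concat_map_single:
 assumes "distinct f" "x:set f" "!!p. p:set f ==> p ~= x ==> k p = []"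
 shows "concat (map k f) = k x" using assms
proof (induction f) case (Cons a f)
 show ?case proof (cases "a = x")
  case True
  hence "k p = []" if "p:set f" for p using Cons.prems that by auto
  hence "concat (map k f) = []" by simp
  thus ?thesis using True by simp
 next case False
  thus ?thesis using Cons by simp
 qed
qed simp

definition faces_over :: "nat => nat set set => nat set list set" where "faces_over n X = {f:faces n. set f = X}"

lemma faces_over:
 assumes "partition_on {1..n} X"
 shows "finite (faces_over n X)" "faces_over n X ~= {}"
proof -
 show "finite (faces_over n X)" by (simp add: faces_over_def)
 have "finite X" using assms finite_elements by blast
 then obtain f where "set f = X" "distinct f" using finite_distinct_list by blast
 thus "faces_over n X ~= {}" using assms by (auto simp: faces_over_def faces_def)
qed

lemma filter_block_map:
 assumes "inj t"
 shows "filter (%y. y <= t`x) (map ((`) t) g) = map ((`) t) (filter (%y. y <= x) g)" by (induction g) (auto simp: inj_image_subset_iff[OF assms])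

text \<open>Left multiplication by \<open>f\<close> sorts the blocks of the image of g by the blocks
  of \<open>f\<close> and keeps their order inside each. A fixed g is therefore the concatenation
  along \<open>f\<close> of its lists inside the blocks of \<open>X\<close>, and being fixed means
  that \<open>t\<close> carries these lists to one another: they form a compatible family of
  orders.\<close>

lemma card_fixed_faces:
 assumes p: "t permutes {1..n}" and f: "f:faces_over n X" and X: "X:stab {1..n} t" and W: "W:stab {1..n} t" and fin: "finer W X"
 shows "card {g:faces n. set g = W & face_prod f (map ((`) t) g) = g} = card (order_families t W X)"
proof -
 let ?D = "{g:faces n. set g = W & face_prod f (map ((`) t) g) = g}"
 let ?fil = "%x g. filter (%y. y <= x) (g :: nat set list)"
 let ?F = "%g. \<lambda>x\<in>X. ?fil x g" and ?H = "%k. concat (map k f)"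
 have fF: "f:faces n" "set f = X" using f by (auto simp: faces_over_def)
 have pX: "partition_on {1..n} X" and pW: "partition_on {1..n} W" using X W by (auto simp: stabD)
 have inj: "inj t" by (rule permutes_inj[OF p])
 have BU: "\<Union>(below W x) = x" if "x:X" for x using below_partition[OF pW pX fin that] by (simp add: partition_on_def)
 have sf: "set (?fil x g) = below W x" if "set g = W" for x g using that by (auto simp: below_def)
 \<comment> \<open>Filtering the concatenation by x recovers the list chosen for x, because a
   nonempty block of \<open>W\<close> cannot lie in two blocks of \<open>X\<close>.\<close>
 have concf: "?fil x (concat (map k f)) = k x" if x: "x:X" and k: "!!p. p:X ==> set (k p) = below W p" for x k proof -
  have "?fil x (k p) = []" if p: "p:X" "p ~= x" for p proof -
   have "\<not> y <= x" if "y:set (k p)" for y proof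
    assume "y <= x"
    moreover have "y <= p" "y:W" using that k[OF p(1)] by (auto simp: below_def)
    moreover have "y ~= {}" using pW \<open>y \<in> W\<close> by (auto simp: partition_on_def)
    moreover have "p Int x = {}" using pX p x by (simp add: partition_on_def disjoint_def)
    ultimately show False by blast
   qed
   thus ?thesis by (simp add: filter_empty_conv)
  qed
  hence "concat (map (%p. ?fil x (k p)) f) = ?fil x (k x)" using concat_map_single[OF facesD(1)[OF fF(1)], of x "%p. ?fil x (k p)"] x fF(2) by blast
  moreover have "?fil x (concat (map k f)) = concat (map (%p. ?fil x (k p)) f)" by (simp add: filter_concat comp_def)
  moreover have "?fil x (k x) = k x" using k[OF x] by (intro filter_True) (auto simp: below_def)
  ultimately show ?thesis by simp
 qed
 have Xs: "t`x:X" if "x:X" for x using stabD(2)[OF X] that by blast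
 have D: "g = concat (map (%p. ?fil p g) f) & (ALL x:X. ?fil (t`x) g = map ((`) t) (?fil x g))" if g: "g:?D" for g proof -
  let ?h = "map ((`) t) g"
  have gg: "g:faces n" "set g = W" "face_prod f ?h = g" using g by auto
  have h: "?h:faces n" "set ?h = W" using face_act_face[OF p gg(1)] gg(2) stabD(2)[OF W] by auto
  have e: "g = concat (map (%p. ?fil p ?h) f)" using face_prod_refined[OF fF(1) h(1)] fin h(2) fF(2) gg(3) by simp
  have fe: "?fil x g = ?fil x ?h" if "x:X" for x by (subst e, rule concf[OF that]) (use sf[OF h(2)] in simp)
  have "map (%p. ?fil p ?h) f = map (%p. ?fil p g) f" using fe fF(2) by (intro map_cong) auto
  hence "g = concat (map (%p. ?fil p g) f)" using e by argo
  moreover have "?fil (t`x) g = map ((`) t) (?fil x g)" if "x:X" for x using fe[OF Xs[OF that]] filter_block_map[OF inj] by simp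
  ultimately show ?thesis by blast
 qed
 have "bij_betw ?F ?D (order_families t W X)" proof (rule bij_betw_byWitness[where f' = ?H]; (intro ballI image_subsetI)?)
  fix g assume g: "g:?D"
  have "map (?F g) f = map (%p. ?fil p g) f" using fF(2) by (intro map_cong) auto
  thus "?H (?F g) = g" using D[OF g] by argo
  show "?F g:order_families t W X" using g D[OF g] sf[of g] facesD(1) by (intro order_familiesI Xs) auto
 next fix k assume k: "k:order_families t W X"
  note kD = order_familiesD[OF k]
  have fH: "?fil x (?H k) = k x" if "x:X" for x by (rule concf[OF that kD(2)])
  have "?F (?H k) = restrict k X" using fH by (rule restrict_ext)
  thus "?F (?H k) = k" unfolding order_families_restrict[OF k] .
  have sg: "set (?H k) = W" using kD(2) fF(2) fin by (fastforce simp: below_def finer_def)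
  have dg: "distinct (?H k)" proof (rule distinct_concat)
   have "inj_on k X" using BU kD(2) by (metis inj_onI)
   thus "distinct (map k f)" using fF facesD(1) by (simp add: distinct_map)
   show "distinct ys" if "ys:set (map k f)" for ys using that kD(1) fF(2) by auto
   show "set ys Int set zs = {}" if yz: "ys:set (map k f)" "zs:set (map k f)" "ys ~= zs" for ys zs proof -
    obtain x y where x: "x:X" "ys = k x" "y:X" "zs = k y" using yz fF(2) by auto
    hence "x ~= y" using yz(3) by blast
    hence "x Int y = {}" using pX x by (simp add: partition_on_def disjoint_def)
    moreover have "w <= x Int y & w ~= {}" if "w:set ys Int set zs" for w using that x kD(2) pW by (auto simp: below_def partition_on_def)
    ultimately show ?thesis by fastforce
   qed
  qed
  have gF: "?H k:faces n" using sg dg pW by (simp add: faces_def)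
  let ?h = "map ((`) t) (?H k)"
  have h: "?h:faces n" "set ?h = W" using face_act_face[OF p gF] sg stabD(2)[OF W] by auto
  have "?fil x ?h = k x" if "x:X" for x proof -
   have "x:(`) t`X" unfolding stabD(2)[OF X] by (rule that)
   then obtain x0 where x0: "x = t`x0" "x0:X" by (rule imageE)
   show ?thesis by (simp only: x0(1) filter_block_map[OF inj] fH[OF x0(2)] kD(3)[OF x0(2)])
  qed
  hence "map (%p. ?fil p ?h) f = map k f" using fF(2) by (intro map_cong) auto
  moreover have "finer (set ?h) (set f)" unfolding h(2) fF(2) by (rule fin)
  ultimately have "face_prod f ?h = ?H k" using face_prod_refined[OF fF(1) h(1)] by argo
  thus "?H k:?D" using gF sg by blast
 qed
 thus ?thesis by (rule bij_betw_same_card)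
qed

text \<open>The coefficients sum to 1, as in the idempotents, which is what absorption requires;
  taking them all equal makes the element invariant under every permutation that fixes
  \<open>X\<close>.\<close>

definition avg_face :: "nat => nat set set => (nat set list \<Rightarrow>\<^sub>0 complex)" where
 "avg_face n X = pm_scale (1 / of_nat (card (faces_over n X))) (SUM f:faces_over n X. basis_vec f)"

lemma avg_face_supported: "avg_face n X:supported (faces n)" unfolding avg_face_def by (intro supported_simps) (auto simp: faces_over_def)

text \<open>A partition and its image have equally many blocks, so neither can strictly refine the
  other.\<close>

lemma stab_finer_eq:
 fixes n :: nat
 assumes p: "t permutes {1..n}" and W: "partition_on {1..n} W" and f: "finer W ((`) t`W)"
 shows "(`) t`W = W"
proof -
 have inj: "inj_on t {1..n}" using permutes_inj_on[OF p] .
 have sub: "W <= Pow {1..n}" using W by (auto simp: partition_on_def)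
 have pW: "partition_on {1..n} ((`) t`W)" using partition_on_image_iff[OF inj sub] W permutes_image[OF p] by simp
 have fW: "finite W" by (rule finite_elements[OF _ W]) simp
 have UW: "\<Union>W = \<Union>((`) t`W)" using W pW by (simp add: partition_on_def)
 have ex: "\<exists>c. c:(`) t`W & b <= c" if "b:W" for b using f that by (auto simp: finer_def)
 have sub_eq: "EX b:W. b <= c" if c: "c:(`) t`W" for c proof -
  have "c ~= {}" using c pW by (auto simp: partition_on_def)
  then obtain x where x: "x:c" by blast
  have "x:\<Union>W" using UW c x by blast
  then obtain b where b: "b:W" "x:b" by blast
  obtain c' where "c':(`) t`W" "b <= c'" using ex[OF b(1)] by blast
  hence "c' = c" using partition_on_member_eq[OF pW _ c] b(2) x by blast
  thus ?thesis using b(1) \<open>b \<subseteq> c'\<close> by blast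
 qed
 \<comment> \<open>\<open>h\<close> picks a block of \<open>W\<close> inside each image block. It is
   injective, hence onto by counting, and then each image block is contained in the block picked for
   it.\<close>
 obtain h where h: "!!c. c:(`) t`W ==> h c:W & h c <= c" using sub_eq by metis
 have hinj: "inj_on h ((`) t`W)" proof (rule inj_onI)
  fix c d assume c: "c:(`) t`W" and d: "d:(`) t`W" and e: "h c = h d"
  have "h c ~= {}" using h[OF c] W by (auto simp: partition_on_def)
  then obtain x where "x:h c" by blast
  thus "c = d" using partition_on_member_eq[OF pW c d, of x] h[OF c] h[OF d] e by auto
 qed
 have cardW: "card ((`) t`W) = card W" using inj_on_subset[OF inj_on_image_Pow[OF inj] sub] by (rule card_image)
 have "h`(`) t`W <= W" using h by blast
 moreover have "card (h`(`) t`W) = card W" using card_image[OF hinj] cardW by simp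
 ultimately have hW: "h`(`) t`W = W" using fW card_subset_eq by blast
 have "finer ((`) t`W) W" unfolding finer_def proof
  fix c assume c: "c:(`) t`W"
  have "c <= h c" proof
   fix x assume x: "x:c"
   have "x:\<Union>W" using UW c x by blast
   then obtain b where b: "b:W" "x:b" by blast
   then obtain d where d: "d:(`) t`W" "b = h d" using hW by blast
   have "x:d" using h[OF d(1)] d(2) b(2) by blast
   hence "d = c" using partition_on_member_eq[OF pW d(1) c] x by blast
   thus "x:h c" using d(2) b(2) by simp
  qed
  thus "EX x:W. c <= x" using h[OF c] by blast
 qed
 thus ?thesis using finer_antisym[OF pW W] f by blast
qed

text \<open>The trace averages the numbers of faces g with f (t g) h = g. Such a g has support below
  \<open>P\<close>, so h is absorbed and g = f (t g); then the support of g refines its own image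
  and is stable, and \<open>card_fixed_faces\<close> counts the g with that support. The number is
  the same for all f and h, so averaging leaves it unchanged.\<close>

lemma trace_avg_faces:
 assumes p: "t permutes {1..n}" and X: "X:stab {1..n} t" and P: "P:stab {1..n} t"
 shows "op_trace (faces n) (%x. face_mult (face_mult (avg_face n X) (face_act t x)) (avg_face n P)) =
  (\<Sum>W | W:stab {1..n} t & finer W P & finer W X. order_weight t W X)" (is "?l = _")
proof -
 let ?kX = "of_nat (card (faces_over n X)) :: complex" and ?kP = "of_nat (card (faces_over n P)) :: complex"
 have pX: "partition_on {1..n} X" and pP: "partition_on {1..n} P" using X P by (auto simp: stabD)
 have kX: "?kX ~= 0" "?kP ~= 0" using faces_over[OF pX] faces_over[OF pP] by auto
 let ?A = "{W. W:stab {1..n} t & finer W P & finer W X}"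
 let ?N = "SUM W:?A. card (order_families t W X)"
 have cnt: "card {g:faces n. face_prod (face_prod f (map ((`) t) g)) h = g} = ?N" if f: "f:faces_over n X" and h: "h:faces_over n P" for f h proof -
  have fF: "f:faces n" "set f = X" and hF: "h:faces n" "set h = P" using f h by (auto simp: faces_over_def)
  let ?D = "%W. {g:faces n. set g = W & face_prod f (map ((`) t) g) = g}"
  let ?t1 = "(UN W:?A. ?D W)"
  have "{g:faces n. face_prod (face_prod f (map ((`) t) g)) h = g} = ?t1" proof
   show "{g:faces n. face_prod (face_prod f (map ((`) t) g)) h = g} <= ?t1" proof
    fix g assume "g:{g:faces n. face_prod (face_prod f (map ((`) t) g)) h = g}"
    hence g: "g:faces n" "face_prod (face_prod f (map ((`) t) g)) h = g" by auto
    let ?tg = "map ((`) t) g"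
    have tg: "?tg:faces n" by (rule face_act_face[OF p g(1)])
    have fg: "face_prod f ?tg:faces n" by (rule face_prod_closed[OF fF(1) tg])
    have gP: "finer (set g) P" using finer_face_prod(2)[of "face_prod f ?tg" h] g(2) hF(2) by simp
    have sub: "set g <= Pow {1..n}" using facesD(4)[OF g(1)] by blast
    have "finer (set ?tg) P" using finer_image[OF permutes_inj_on[OF p] sub stab_subset_Pow[OF P]] gP stabD(2)[OF P] by simp
    hence "finer (set (face_prod f ?tg)) (set h)" using finer_face_prod(2)[of f ?tg] finer_trans hF(2) by blast
    hence e: "face_prod f ?tg = g" using face_prod_absorb[OF fg hF(1)] g(2) by simp
    have gX: "finer (set g) X" using finer_face_prod(1)[of f ?tg] e fF(2) by simp
    have "finer (set g) ((`) t`set g)" using finer_face_prod(2)[of f ?tg] e by simp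
    hence "set g:stab {1..n} t" using stab_finer_eq[OF p facesD(2)[OF g(1)]] facesD(2)[OF g(1)] by (simp add: stab_def)
    thus "g:?t1" using gP gX e g(1) by blast
   qed
   show "?t1 <= {g:faces n. face_prod (face_prod f (map ((`) t) g)) h = g}" proof
    fix g assume "g:?t1"
    hence g: "g:faces n" "finer (set g) P" "face_prod f (map ((`) t) g) = g" by auto
    hence "face_prod g h = g" using face_prod_absorb[OF g(1) hF(1)] hF(2) by simp
    thus "g:{g:faces n. face_prod (face_prod f (map ((`) t) g)) h = g}" using g by simp
   qed
  qed
  also have "card ... = (SUM W:?A. card (?D W))" proof (rule card_UN_disjoint)
   show "finite ?A" by (rule finite_subset[OF _ finite_stab[of "{1..n}" t]]) auto
  qed auto
  also have "... = ?N" by (rule sum_eqI) (use card_fixed_faces[OF p f X] in auto)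
  finally show ?thesis .
 qed
 have "?l = (SUM g:faces n. SUM h:faces_over n P. SUM f:faces_over n X. 1 / ?kP * (1 / ?kX * (if face_prod (face_prod f (map ((`) t) g)) h = g then 1 else 0)))"
  unfolding op_trace_def avg_face_def by (intro sum.cong refl)
   (simp add: face_mult_linear lookup_sum_pm lookup_single when_def pm_scale_sum sum_distrib_left)
 also have "... = (SUM h:faces_over n P. SUM f:faces_over n X. SUM g:faces n. 1 / ?kP * (1 / ?kX * (if face_prod (face_prod f (map ((`) t) g)) h = g then 1 else 0)))"
  by (subst sum.swap, rule sum_eqI, rule sum.swap)
 also have "... = (SUM h:faces_over n P. SUM f:faces_over n X. 1 / ?kP * (1 / ?kX * of_nat ?N))" proof (intro sum.cong refl)
  fix h f assume h: "h:faces_over n P" and f: "f:faces_over n X"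
  have "(SUM g:faces n. if face_prod (face_prod f (map ((`) t) g)) h = g then 1 else 0 :: complex) = of_nat ?N"
   unfolding cnt[OF f h, symmetric] by (simp add: sum.If_cases Int_def)
  thus "(SUM g:faces n. 1 / ?kP * (1 / ?kX * (if face_prod (face_prod f (map ((`) t) g)) h = g then 1 else 0))) = 1 / ?kP * (1 / ?kX * of_nat ?N)"
   by (simp only: sum_distrib_left[symmetric])
 qed
 also have "... = of_nat ?N" using kX by simp
 finally show ?thesis by (simp add: order_weight_def)
qed

text \<open>The cut-off matters: for \<open>P\<close> not below \<open>X\<close> the interval is
  empty and \<open>minv\<close> would return the bare weight instead of 0.\<close>

definition order_coeff :: "(nat => nat) => nat set set => nat set set => complex" where
 "order_coeff t P X = (if finer P X then minv order_weight t P X else 0)"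

lemma sum_order_coeff:
 assumes S: "finite S" and X: "X:stab S t" and P: "P:stab S t"
 shows "(\<Sum>Z | Z:stab S t & finer Z X. order_coeff t P Z) = (if finer P X then order_weight t P X else 0)" (is "?l = _")
proof -
 have U: "\<Union>X = S" using X by (rule stabD)
 have "?l = (SUM Z:interval t P X. minv order_weight t P Z)" proof (rule sum.mono_neutral_cong_right)
  let ?t1 = "{Z. Z:stab S t & finer Z X}"
  show "finite ?t1" by (rule finite_subset[OF _ finite_stab[OF S]]) auto
  show "interval t P X <= ?t1" by (auto simp: interval_def U)
  show "ALL i:?t1 - interval t P X. order_coeff t P i = 0" by (auto simp: interval_def U order_coeff_def)
  show "!!x. x:interval t P X ==> order_coeff t P x = minv order_weight t P x" by (auto simp: interval_def order_coeff_def)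
 qed
 also have "... = (if finer P X then order_weight t P X else 0)" proof (cases "finer P X")
  case True
  thus ?thesis using minv_sum[OF S X True] by simp
 next case False
  hence "interval t P X = {}" using finer_trans by (auto simp: interval_def)
  thus ?thesis using False by simp
 qed
 finally show ?thesis .
qed

text \<open>Unitriangularity is used once in each index. Intervals starting at the empty family,
  which is finer than everything, are the full lower ideals of stable partitions.\<close>

lemma double_sum_zero_unique:
 fixes d :: "nat set set => nat set set => complex"
 assumes S: "finite S" and z: "!!X P. X:stab S t ==> P:stab S t ==> (\<Sum>Z | Z:stab S t & finer Z X. \<Sum>V | V:stab S t & finer V P. d Z V) = 0"
  and X: "X:stab S t" "P:stab S t"
 shows "d X P = 0"
proof -
 have I: "interval t {} X = {Z. Z:stab S t & finer Z X}" if "X:stab S t" for X using stabD(3)[OF that] by (auto simp: interval_def finer_def)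
 have e: "finer {} X" for X :: "nat set set" by (simp add: finer_def)
 have 1: "(\<Sum>V | V:stab S t & finer V P. d X V) = 0" if X: "X:stab S t" and P: "P:stab S t" for X P
  by (rule interval_sum_zero_unique[where S = S and Q = "%_. True" and t = t and P = "{}" and d = "%Z. \<Sum>V | V:stab S t & finer V P. d Z V"])
   (use S X P z I e in simp_all)
 show ?thesis by (rule interval_sum_zero_unique[where S = S and Q = "%_. True" and t = t and P = "{}" and d = "d X"]) (use S X 1 I e in simp_all)
qed

section \<open>Traces with the equivariant primitive idempotents\<close>

context
 fixes n :: nat and eh :: "nat set set => (nat set list \<Rightarrow>\<^sub>0 complex)"
 assumes sal: "saliola_family n eh"
begin

abbreviation "U \<equiv> supported (faces n)"

lemma set_partitions_iff: "X:set_partitions n \<longleftrightarrow> partition_on {1..n} X" by (simp add: set_partitions_def)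

lemma eh_supp: "X:set_partitions n ==> eh X:U" using sal unfolding saliola_family_def cfpoi_def primitive_idempotent_def idempotent_in_def
 by (simp add: face_algebra_simps)

lemma eh_idem: "X:set_partitions n ==> face_mult (eh X) (eh X) = eh X"
 using sal unfolding saliola_family_def cfpoi_def primitive_idempotent_def idempotent_in_def by (simp add: face_algebra_simps)

lemma eh_orth: "X:set_partitions n ==> X':set_partitions n ==> X ~= X' ==> face_mult (eh X) (eh X') = 0"
 using sal unfolding saliola_family_def cfpoi_def by (simp add: face_algebra_simps)

lemma finite_set_partitions: "finite (set_partitions n)" unfolding set_partitions_def by (rule finitely_many_partition_on) simp

lemma eh_sum: "(SUM X:set_partitions n. eh X) = basis_vec (top_face n)"
proof -
 have "(\<Oplus>\<^bsub>face_algebra n\<^esub>X\<in>set_partitions n. eh X) = basis_vec (top_face n)"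
  using sal unfolding saliola_family_def cfpoi_def by (simp add: face_algebra_simps)
 thus ?thesis using face_algebra_finsum[OF finite_set_partitions, of eh n] eh_supp by simp
qed

lemma eh_act: "X:set_partitions n ==> t permutes {1..n} ==> face_act t (eh X) = eh ((`) t`X)"
 using sal unfolding saliola_family_def perm_partition_def by simp

lemma eh_zero: "X:set_partitions n ==> f:faces n ==> \<not> finer X (set f) ==> face_mult (basis_vec f) (eh X) = 0"
 using sal unfolding saliola_family_def refines_def finer_def by blast

lemma eh_below: "X:set_partitions n ==> eh X:supported {f:faces n. finer (set f) X}"
proof -
 assume X: "X:set_partitions n"
 have "eh X:supported {f:faces n. refines {1..n} (set f) X}" using sal X unfolding saliola_family_def span_basis_vec by simp
 moreover have "{f:faces n. refines {1..n} (set f) X} = {f:faces n. finer (set f) X}"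
  using X facesD(2) unfolding refines_def finer_def set_partitions_iff by blast
 ultimately show ?thesis by simp
qed

text \<open>The idempotents of a whole lower ideal; in contrast to a single one, their sum can be
  compared with \<open>avg_face\<close>.\<close>

definition esum :: "nat set set => (nat set list \<Rightarrow>\<^sub>0 complex)" where "esum X = (\<Sum>Z | Z:set_partitions n & finer Z X. eh Z)"

lemma esum_supp: "esum X:U" unfolding esum_def by (rule supported_simps(5)) (simp add: eh_supp)

text \<open>Multiply the average by 1, written as the sum of all idempotents: a face with support
  \<open>X\<close> annihilates every idempotent whose index is not below \<open>X\<close>.\<close>

lemma avg_esum:
 assumes "X:set_partitions n"
 shows "face_mult (avg_face n X) (esum X) = avg_face n X"
proof -
 have z: "face_mult (avg_face n X) (eh Z) = 0" if "Z:set_partitions n" "\<not> finer Z X" for Z proof -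
  have "face_mult (basis_vec f) (eh Z) = 0" if "f:faces_over n X" for f
   using eh_zero[of Z f] that \<open>Z \<in> _\<close> \<open>\<not> finer Z X\<close> by (simp add: faces_over_def)
  thus ?thesis by (simp add: avg_face_def face_mult_linear)
 qed
 have "avg_face n X = face_mult (avg_face n X) (SUM Z:set_partitions n. eh Z)" using face_mult_one(2)[OF avg_face_supported] eh_sum by simp
 also have "... = (SUM Z:set_partitions n. face_mult (avg_face n X) (eh Z))" by (simp add: face_mult_linear)
 also have "... = (\<Sum>Z | Z:set_partitions n & finer Z X. face_mult (avg_face n X) (eh Z))"
  by (rule sum.mono_neutral_right[OF finite_set_partitions]) (use z in auto)
 also have "... = face_mult (avg_face n X) (esum X)" by (simp add: esum_def face_mult_linear)
 finally show ?thesis by simp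
qed

text \<open>Every idempotent in the sum is a combination of faces with support below
  \<open>X\<close>, and such a face absorbs on its right any combination of faces over
  \<open>X\<close> with coefficient sum 1.\<close>

lemma esum_avg:
 assumes "X:set_partitions n"
 shows "face_mult (esum X) (avg_face n X) = esum X"
proof -
 have pX: "partition_on {1..n} X" using assms by (simp add: set_partitions_iff)
 have k: "of_nat (card (faces_over n X)) ~= (0::complex)" using faces_over[OF pX] by simp
 have b: "face_mult (basis_vec f) (avg_face n X) = basis_vec f" if f: "f:faces n" "finer (set f) X" for f proof -
  have "face_mult (basis_vec f) (basis_vec g) = basis_vec f" if "g:faces_over n X" for g
   using face_prod_absorb[OF f(1), of g] f(2) that by (simp add: faces_over_def)
  hence "face_mult (basis_vec f) (avg_face n X) = pm_scale (1 / of_nat (card (faces_over n X))) (SUM g:faces_over n X. basis_vec f)"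
   by (simp add: avg_face_def face_mult_linear)
  also have "(SUM g:faces_over n X. basis_vec f) = pm_scale (of_nat (card (faces_over n X))) (basis_vec f)"
   by (rule poly_mapping_eqI) (simp add: lookup_sum_pm)
  finally show ?thesis using k by simp
 qed
 have "face_mult (eh Z) (avg_face n X) = eh Z" if Z: "Z:set_partitions n" "finer Z X" for Z
 proof (rule linmap_eqI[OF linmap_face_mult(1) linmap_id _ eh_below[OF Z(1)]]) fix f assume "f:{f:faces n. finer (set f) Z}"
  thus "face_mult (basis_vec f) (avg_face n X) = basis_vec f" using b Z(2) finer_trans by blast
 qed
 thus ?thesis by (simp add: esum_def face_mult_linear)
qed

context
 fixes t :: "nat => nat"
 assumes p: "t permutes {1..n}"
begin

lemma stab_set_partitions: "X:stab {1..n} t ==> X:set_partitions n" by (simp add: stabD set_partitions_iff)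

lemma image_set_partitions: "X:set_partitions n ==> (`) t`X:set_partitions n"
proof -
 assume X: "X:set_partitions n"
 hence "X <= Pow {1..n}" by (auto simp: set_partitions_iff partition_on_def)
 thus ?thesis using partition_on_image_iff[OF permutes_inj_on[OF p], of X "{1..n}"] X permutes_image[OF p] by (simp add: set_partitions_iff)
qed

lemma face_act_avg:
 assumes X: "X:stab {1..n} t"
 shows "face_act t (avg_face n X) = avg_face n X"
proof -
 have sub: "map ((`) t)`faces_over n X <= faces_over n X" using face_act_face[OF p] stabD(2)[OF X] by (auto simp: faces_over_def)
 have inj: "inj_on (map ((`) t)) (faces_over n X)" proof -
  have "inj ((`) t)" using inj_on_image_Pow[OF permutes_inj[OF p]] by simp
  thus ?thesis using inj_on_subset[OF inj_mapI[of "(`) t"]] by blast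
 qed
 have im: "map ((`) t)`faces_over n X = faces_over n X" by (rule endo_inj_surj[OF _ sub inj]) (simp add: faces_over_def)
 let ?t1 = "(SUM f:faces_over n X. basis_vec (map ((`) t) f))"
 have "face_act t (avg_face n X) = pm_scale (1 / of_nat (card (faces_over n X))) ?t1" by (simp add: avg_face_def linmapD[OF linmap_face_act])
 also have "?t1 = (SUM f:map ((`) t)`faces_over n X. basis_vec f)" by (simp add: sum.reindex[OF inj])
 finally show ?thesis by (simp add: im avg_face_def)
qed

lemma face_act_esum:
 assumes X: "X:stab {1..n} t"
 shows "face_act t (esum X) = esum X"
proof -
 let ?A = "{Z. Z:set_partitions n & finer Z X}"
 have finA: "finite ?A" by (rule finite_subset[OF _ finite_set_partitions]) auto
 have sub: "(`) ((`) t)`?A <= ?A" proof (rule image_subsetI)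
  fix Z assume Z: "Z:?A"
  hence "Z <= Pow {1..n}" by (auto simp: set_partitions_iff partition_on_def)
  hence "finer ((`) t`Z) ((`) t`X)" using finer_image[OF permutes_inj_on[OF p] _ stab_subset_Pow[OF X], of Z] Z by simp
  thus "(`) t`Z:?A" using image_set_partitions Z stabD(2)[OF X] by simp
 qed
 have inj: "inj_on ((`) ((`) t)) ?A" proof -
  have "inj ((`) t)" using inj_on_image_Pow[OF permutes_inj[OF p]] by simp
  from inj_on_image_Pow[OF this] have "inj ((`) ((`) t))" by simp
  thus ?thesis by (rule inj_on_subset) simp
 qed
 have im: "(`) ((`) t)`?A = ?A" by (rule endo_inj_surj[OF finA sub inj])
 have "face_act t (esum X) = (SUM Z:?A. eh ((`) t`Z))"
  unfolding esum_def linmapD(4)[OF linmap_face_act] by (rule sum_eqI) (use eh_act[OF _ p] in simp)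
 also have "... = (SUM Z:(`) ((`) t)`?A. eh Z)" by (simp add: sum.reindex[OF inj])
 finally show ?thesis unfolding im esum_def .
qed

text \<open>For invariant idempotents \<open>a\<close> and \<open>b\<close> this is the character
  value at \<open>t\<close> of the Peirce component that they cut out.\<close>

definition ptrace :: "(nat set list \<Rightarrow>\<^sub>0 complex) => (nat set list \<Rightarrow>\<^sub>0 complex) => complex" where
 "ptrace a b = op_trace (faces n) (%x. face_mult (face_mult a (face_act t x)) b)"

text \<open>A left factor that is moved round the trace passes through the action of
  \<open>t\<close> and comes back twisted by it.\<close>

lemma ptrace_cyclic_left:
 assumes "a:U" "b:U" "c:U"
 shows "ptrace (face_mult a c) b = ptrace (face_mult c (face_act t a)) b"
proof -
 note l = linmap_face_mult linmap_face_act
 let ?T = "%x. face_mult (face_mult c (face_act t x)) b"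
 have lT: "linmap ?T" by (rule linmap_comp[OF l(1) linmap_comp[OF l(2) l(3)]])
 have cT: "?T (basis_vec f):U" if "f:faces n" for f by (intro face_mult_closed face_act_closed[OF p] supported_simps assms that)
 have "ptrace (face_mult a c) b = op_trace (faces n) (%x. face_mult a (?T x))" by (simp add: ptrace_def face_mult_assoc)
 also have "... = op_trace (faces n) (%x. ?T (face_mult a x))"
  by (rule op_trace_comm) (use l lT cT assms in \<open>simp_all add: face_mult_closed supported_simps\<close>)
 also have "... = ptrace (face_mult c (face_act t a)) b" by (simp add: ptrace_def face_act_mult[OF permutes_inj[OF p]] face_mult_assoc)
 finally show ?thesis .
qed

lemma ptrace_cyclic_right:
 assumes "a:U" "b:U" "c:U"
 shows "ptrace a (face_mult c b) = ptrace a (face_mult (face_act t b) c)"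
proof -
 note l = linmap_face_mult linmap_face_act
 let ?T = "%x. face_mult (face_mult a (face_act t x)) c"
 have lT: "linmap ?T" by (rule linmap_comp[OF l(1) linmap_comp[OF l(2) l(3)]])
 have cT: "?T (basis_vec f):U" if "f:faces n" for f by (intro face_mult_closed face_act_closed[OF p] supported_simps assms that)
 have "ptrace a (face_mult c b) = op_trace (faces n) (%x. face_mult (?T x) b)" by (simp add: ptrace_def face_mult_assoc)
 also have "... = op_trace (faces n) (%x. ?T (face_mult x b))"
  by (rule op_trace_comm[where S = "%x. face_mult x b"]) (use l lT cT assms in \<open>simp_all add: face_mult_closed supported_simps\<close>)
 also have "... = ptrace a (face_mult (face_act t b) c)" by (simp add: ptrace_def face_act_mult[OF permutes_inj[OF p]] face_mult_assoc)
 finally show ?thesis .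
qed

lemma ptrace_sum: "ptrace (SUM i:I. a i) b = (SUM i:I. ptrace (a i) b)" "ptrace c (SUM i:I. a i) = (SUM i:I. ptrace c (a i))"
 unfolding ptrace_def face_mult_linear by (rule op_trace_linear(4))+

text \<open>Write the idempotent as its square and move one copy round the trace: it meets the other
  copy as the idempotent of a different index, and distinct idempotents are orthogonal.\<close>

lemma ptrace_not_stable:
 assumes X: "X:set_partitions n" and P: "P:set_partitions n" and ns: "X ~: stab {1..n} t | P ~: stab {1..n} t"
 shows "ptrace (eh X) (eh P) = 0"
proof (cases "X:stab {1..n} t") case False
 hence ne: "X ~= (`) t`X" using X by (auto simp: stab_def set_partitions_iff)
 have "ptrace (eh X) (eh P) = ptrace (face_mult (eh X) (face_act t (eh X))) (eh P)"
  using ptrace_cyclic_left[OF eh_supp[OF X] eh_supp[OF P] eh_supp[OF X]] eh_idem[OF X] by simp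
 also have "face_mult (eh X) (face_act t (eh X)) = 0" using eh_act[OF X p] eh_orth[OF X image_set_partitions[OF X] ne] by simp
 finally show ?thesis by (simp add: ptrace_def face_mult_linear op_trace_def)
next case True
 hence ne: "(`) t`P ~= P" using P ns by (auto simp: stab_def set_partitions_iff)
 have "ptrace (eh X) (eh P) = ptrace (eh X) (face_mult (face_act t (eh P)) (eh P))"
  using ptrace_cyclic_right[OF eh_supp[OF X] eh_supp[OF P] eh_supp[OF P]] eh_idem[OF P] by simp
 also have "face_mult (face_act t (eh P)) (eh P) = 0" using eh_act[OF P p] eh_orth[OF image_set_partitions[OF P] P ne] by simp
 finally show ?thesis by (simp add: ptrace_def face_mult_linear op_trace_def)
qed

text \<open>An average is multiplied by its \<open>esum\<close>, the \<open>esum\<close> is moved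
  round the trace, and there it absorbs the average. The twist has no effect, since both elements
  are invariant under \<open>t\<close>.\<close>

lemma ptrace_esum:
 assumes X: "X:stab {1..n} t" and P: "P:stab {1..n} t"
 shows "ptrace (esum X) (esum P) = ptrace (avg_face n X) (avg_face n P)"
proof -
 note sX = stab_set_partitions[OF X] and sP = stab_set_partitions[OF P]
 have "ptrace (avg_face n X) (avg_face n P) = ptrace (face_mult (avg_face n X) (esum X)) (avg_face n P)" by (simp add: avg_esum[OF sX])
 also have "... = ptrace (face_mult (esum X) (face_act t (avg_face n X))) (avg_face n P)"
  by (rule ptrace_cyclic_left[OF avg_face_supported avg_face_supported esum_supp])
 also have "... = ptrace (esum X) (avg_face n P)" by (simp add: face_act_avg[OF X] esum_avg[OF sX])
 also have "... = ptrace (esum X) (face_mult (avg_face n P) (esum P))" by (simp add: avg_esum[OF sP])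
 also have "... = ptrace (esum X) (face_mult (face_act t (esum P)) (avg_face n P))"
  by (rule ptrace_cyclic_right[OF esum_supp esum_supp avg_face_supported])
 also have "... = ptrace (esum X) (esum P)" by (simp add: face_act_esum[OF P] esum_avg[OF sP])
 finally show ?thesis by simp
qed

text \<open>Both sides have the same double sums over lower ideals. On the side of the traces
  unstable indices may be added, as they contribute 0, which produces \<open>ptrace_esum\<close>; on
  the other side summation over the upper index undoes \<open>minv\<close> and gives the count of
  \<open>trace_avg_faces\<close>.\<close>

lemma ptrace_eh:
 assumes X: "X:stab {1..n} t" and P: "P:stab {1..n} t"
 shows "ptrace (eh X) (eh P) = order_coeff t P X"
proof -
 let ?d = "%X P. ptrace (eh X) (eh P) - order_coeff t P X"
 have "?d X P = 0" proof (rule double_sum_zero_unique[where S = "{1..n}" and t = t and d = ?d, OF _ _ X P])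
  fix X P assume X: "X:stab {1..n} t" and P: "P:stab {1..n} t"
  let ?A = "%X. {Z. Z:stab {1..n} t & finer Z X}" and ?B = "%X. {Z. Z:set_partitions n & finer Z X}"
  have AB: "?A X <= ?B X" for X using stab_set_partitions by blast
  have finB: "finite (?B X)" for X by (rule finite_subset[OF _ finite_set_partitions]) auto
  have "(SUM Z:?A X. SUM V:?A P. ptrace (eh Z) (eh V)) = (SUM Z:?B X. SUM V:?B P. ptrace (eh Z) (eh V))"
  proof (rule sum.mono_neutral_cong_left[OF finB AB])
   show "ALL Z:?B X - ?A X. (SUM V:?B P. ptrace (eh Z) (eh V)) = 0" proof
    fix Z assume Z: "Z:?B X - ?A X"
    have "ptrace (eh Z) (eh V) = 0" if "V:?B P" for V using ptrace_not_stable[of Z V] Z that by blast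
    thus "(SUM V:?B P. ptrace (eh Z) (eh V)) = 0" by (simp add: sum.neutral)
   qed
   fix Z assume Z: "Z:?A X" show "(SUM V:?A P. ptrace (eh Z) (eh V)) = (SUM V:?B P. ptrace (eh Z) (eh V))"
   proof (rule sum.mono_neutral_left[OF finB AB], rule ballI) fix V assume V: "V:?B P - ?A P"
    show "ptrace (eh Z) (eh V) = 0" using ptrace_not_stable[of Z V] V Z stab_set_partitions by blast
   qed
  qed
  also have "... = ptrace (esum X) (esum P)" unfolding esum_def ptrace_sum(1) unfolding ptrace_sum(2) ..
  also have "... = ptrace (avg_face n X) (avg_face n P)" by (rule ptrace_esum[OF X P])
  also have "... = (\<Sum>W | W:stab {1..n} t & finer W P & finer W X. order_weight t W X)" unfolding ptrace_def by (rule trace_avg_faces[OF p X P])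
  also have "... = (SUM W:?A P. if finer W X then order_weight t W X else 0)"
   by (rule sum.mono_neutral_cong_left) (auto intro: finite_subset[OF _ finite_stab[of "{1..n}" t]])
  also have "... = (SUM W:?A P. SUM Z:?A X. order_coeff t W Z)" by (rule sum_eqI, rule sum_order_coeff[OF _ X, symmetric]) auto
  also have "... = (SUM Z:?A X. SUM W:?A P. order_coeff t W Z)" by (rule sum.swap)
  finally show "(SUM Z:?A X. SUM V:?A P. ?d Z V) = 0" by (simp add: sum_subtractf)
 qed simp
 thus ?thesis by simp
qed

end

end

section \<open>The Frobenius characteristic of a Peirce component\<close>

lemma block_type_image:
 assumes p: "t permutes {1..n}" and X: "partition_on {1..n} X"
 shows "block_type ((`) t`X) = block_type X"
proof -
 have inj: "inj_on t {1..n}" using permutes_inj_on[OF p] .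
 have sub: "X <= Pow {1..n}" using X by (auto simp: partition_on_def)
 have i: "inj_on ((`) t) X" by (rule inj_on_subset[OF inj_on_image_Pow[OF inj] sub])
 have "block_type ((`) t`X) = image_mset (%b. card (t`b)) (mset_set X)"
  by (simp add: block_type_def image_mset_mset_set[OF i, symmetric] multiset.map_comp comp_def)
 also have "... = block_type X" unfolding block_type_def proof (rule image_mset_cong)
  fix b assume "b \<in># mset_set X"
  hence "b:X" by (metis elem_mset_set finite_elements[OF finite_atLeastAtMost X])
  thus "card (t`b) = card b" using sub by (intro card_image inj_on_subset[OF inj]) auto
 qed
 finally show ?thesis .
qed

lemma invariant_algebra_simps: "carrier (invariant_algebra n) = {f:supported (faces n). \<forall>t. t permutes {1..n} --> face_act t f = f}"
 "x \<otimes>\<^bsub>invariant_algebra n\<^esub> y = face_mult x y" "\<one>\<^bsub>invariant_algebra n\<^esub> = basis_vec (top_face n)"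
 unfolding invariant_algebra_def using face_algebra_simps[of n] by simp_all

lemma monoid_invariant_algebra: "monoid (invariant_algebra n)"
proof (rule monoidI) fix x y z assume x: "x:carrier (invariant_algebra n)" and y: "y:carrier (invariant_algebra n)"
 show "x \<otimes>\<^bsub>invariant_algebra n\<^esub> y:carrier (invariant_algebra n)"
  using x y face_mult_closed[of x n y] face_act_mult[OF permutes_inj] by (simp add: invariant_algebra_simps)
 show "x \<otimes>\<^bsub>invariant_algebra n\<^esub> y \<otimes>\<^bsub>invariant_algebra n\<^esub> z = x \<otimes>\<^bsub>invariant_algebra n\<^esub> (y \<otimes>\<^bsub>invariant_algebra n\<^esub> z)"
  by (simp add: invariant_algebra_simps face_mult_assoc)
 show "\<one>\<^bsub>invariant_algebra n\<^esub> \<otimes>\<^bsub>invariant_algebra n\<^esub> x = x" "x \<otimes>\<^bsub>invariant_algebra n\<^esub> \<one>\<^bsub>invariant_algebra n\<^esub> = x"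
  using x face_mult_one[of x n] by (simp_all add: invariant_algebra_simps)
next
 have "map ((`) t) (top_face n) = top_face n" if "t permutes {1..n}" for t using permutes_image[OF that] by (simp add: top_face_def)
 thus "\<one>\<^bsub>invariant_algebra n\<^esub>:carrier (invariant_algebra n)" by (simp add: invariant_algebra_simps supported_simps top_face(1))
qed

text \<open>The unit \<open>u\<close> is invariant, so cyclicity of the trace cancels it against its
  inverse on both sides. The conjugated idempotents are thereby replaced by plain sums of
  \<open>eh X\<close>, and of these only the stable indices contribute.\<close>

theorem peirce_frobenius_ch:
 assumes sal: "saliola_family n eh" and u: "u:Units (invariant_algebra n)"
 defines "E \<equiv> %rho. u \<otimes>\<^bsub>invariant_algebra n\<^esub> (\<Sum>X | X:set_partitions n & block_type X = rho. eh X)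
   \<otimes>\<^bsub>invariant_algebra n\<^esub> inv\<^bsub>invariant_algebra n\<^esub> u"
 shows "frobenius_ch n (peirce_part (face_algebra n) (E rho) (E mu)) {0} face_act = mps_const (1 / fact n) * (\<Sum>t | t permutes {1..n}.
   mps_const (\<Sum>X | X:stab {1..n} t & block_type X = rho. \<Sum>P | P:stab {1..n} t & block_type P = mu. order_coeff t P X) *
   cyc_prod sym_p t {1..n})"
proof -
 interpret inv_alg: monoid "invariant_algebra n" by (rule monoid_invariant_algebra)
 let ?U = "supported (faces n)"
 define v where "v = inv\<^bsub>invariant_algebra n\<^esub> u"
 have uc: "u:carrier (invariant_algebra n)" using u by (rule inv_alg.Units_closed)
 have vc: "v:carrier (invariant_algebra n)" unfolding v_def using u by (rule inv_alg.Units_inv_closed)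
 have uv: "face_mult u v = basis_vec (top_face n)" "face_mult v u = basis_vec (top_face n)"
  using inv_alg.Units_r_inv[OF u] inv_alg.Units_l_inv[OF u] by (simp_all add: invariant_algebra_simps v_def)
 have uU: "u:?U" "v:?U" using uc vc by (auto simp: invariant_algebra_simps)
 have ua: "face_act t u = u" "face_act t v = v" if "t permutes {1..n}" for t using uc vc that by (auto simp: invariant_algebra_simps)
 define s where "s = (%rho. \<Sum>X | X:set_partitions n & block_type X = rho. eh X)"
 have E: "E rho = face_mult (face_mult u (s rho)) v" for rho by (simp add: E_def invariant_algebra_simps v_def s_def)
 have sU: "s rho:?U" for rho unfolding s_def by (rule supported_simps(5)) (simp add: eh_supp[OF sal])
 have EU: "E rho:?U" for rho unfolding E by (intro face_mult_closed uU sU)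
 have finT: "finite {X. X:set_partitions n & block_type X = rho}" for rho by (rule finite_subset[OF _ finite_set_partitions[OF sal]]) auto
 have ss: "face_mult (s rho) (s rho) = s rho" for rho proof -
  have "face_mult (eh X) (s rho) = eh X" if X: "X:set_partitions n" "block_type X = rho" for X proof -
   have "face_mult (eh X) (s rho) = (\<Sum>Z | Z:set_partitions n & block_type Z = rho. if Z = X then eh X else 0)" unfolding s_def face_mult_linear
    by (rule sum_eqI) (use X eh_idem[OF sal] eh_orth[OF sal, of X] in auto)
   thus ?thesis using X finT by (simp add: sum.delta)
  qed
  thus ?thesis unfolding s_def by (subst (1) face_mult_linear) (simp add: s_def[symmetric])
 qed
 have sa: "face_act t (s rho) = s rho" if p: "t permutes {1..n}" for t rho proof -
  let ?A = "{X. X:set_partitions n & block_type X = rho}"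
  have sub: "(`) ((`) t)`?A <= ?A" using image_set_partitions[OF sal p] block_type_image[OF p] by (auto simp: set_partitions_def)
  from inj_on_image_Pow[OF permutes_inj[OF p]] have "inj ((`) t)" by simp
  from inj_on_image_Pow[OF this] have "inj ((`) ((`) t))" by simp
  hence inj: "inj_on ((`) ((`) t)) ?A" by (rule inj_on_subset) simp
  have im: "(`) ((`) t)`?A = ?A" by (rule endo_inj_surj[OF finT sub inj])
  have "face_act t (s rho) = (SUM X:?A. eh ((`) t`X))"
   unfolding s_def linmapD(4)[OF linmap_face_act] by (rule sum_eqI) (use eh_act[OF sal _ p] in simp)
  also have "... = (SUM X:(`) ((`) t)`?A. eh X)" by (simp add: sum.reindex[OF inj])
  finally show ?thesis unfolding im s_def .
 qed
 have vus: "face_mult v (face_mult u x) = x" if "x:?U" for x using face_mult_assoc[of v u x] uv face_mult_one[OF that] by simp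
 have EE: "face_mult (E rho) (E rho) = E rho" for rho proof -
  have "face_mult (E rho) (E rho) = face_mult u (face_mult (s rho) (face_mult v (face_mult u (face_mult (s rho) v))))"
   by (simp add: E face_mult_assoc)
  also have "... = face_mult u (face_mult (face_mult (s rho) (s rho)) v)" by (subst vus) (simp_all add: face_mult_closed sU uU face_mult_assoc)
  finally show ?thesis by (simp add: ss E face_mult_assoc)
 qed
 have Ea: "face_act t (E rho) = E rho" if p: "t permutes {1..n}" for t rho by (simp add: E face_act_mult[OF permutes_inj[OF p]] ua[OF p] sa[OF p])
 let ?V = "peirce_part (face_algebra n) (E rho) (E mu)"
 let ?P = "%x. face_mult (face_mult (E rho) x) (E mu)"
 have PP: "?P (?P x) = ?P x" for x proof -
  have "?P (?P x) = face_mult (face_mult (face_mult (E rho) (E rho)) x) (face_mult (E mu) (E mu))" by (simp add: face_mult_assoc)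
  thus ?thesis by (simp add: EE)
 qed
 have PU: "?P x:?U" if "x:?U" for x by (intro face_mult_closed EU that)
 let ?t1 = "{x:?U. ?P x = x}"
 \<comment> \<open>\<open>?P\<close> is idempotent, so its image is its fixed space; this
   description makes \<open>subquot_trace_projection\<close> applicable.\<close>
 have V: "?V = ?t1" proof -
  have "?P`?U = ?t1" proof (intro equalityI subsetI)
   fix x assume "x:?P`?U"
   then obtain y where "x = ?P y" "y:?U" by (rule imageE)
   thus "x:?t1" using PP[of y] PU[of y] by simp
  next fix x assume "x:?t1"
   hence "x:?U" "x = ?P x" by simp_all
   thus "x:?P`?U" by (rule rev_image_eqI)
  qed
  moreover have "?V = ?P`?U" by (auto simp: peirce_part_def face_algebra_simps)
  ultimately show ?thesis by (rule trans[rotated])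
 qed
 have lP: "linmap ?P" by (rule linmap_comp[OF linmap_face_mult(1) linmap_face_mult(2)])
 have tr: "subquot_trace ?V {0} (face_act t) =
   (\<Sum>X | X:stab {1..n} t & block_type X = rho. \<Sum>P | P:stab {1..n} t & block_type P = mu. order_coeff t P X)" if p: "t permutes {1..n}" for t
 proof -
  let ?A = "%rho. {X. X:set_partitions n & block_type X = rho}" and ?B = "%rho. {X. X:stab {1..n} t & block_type X = rho}"
  have BA: "?B rho <= ?A rho" for rho using stab_set_partitions[OF sal p] by blast
  have ns: "ptrace n t (eh X) (eh P) = 0" if "X:set_partitions n" "P:set_partitions n" "X ~: stab {1..n} t | P ~: stab {1..n} t" for X P
   using ptrace_not_stable[OF sal p] that by blast
  note pt = ptrace_def[OF sal p]
  have aP: "face_act t (?P x) = ?P (face_act t x)" for x by (simp add: face_act_mult[OF permutes_inj[OF p]] Ea[OF p])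
  have "subquot_trace ?V {0} (face_act t) = op_trace (faces n) (%f. face_act t (?P f))" proof (rule subquot_trace_projection[OF finite_faces])
   show "?V <= ?U" unfolding V by blast
   show "fvs.subspace ?V" unfolding V by (rule fvs.subspaceI) (simp_all add: face_mult_linear supported_simps linmapD[OF lP])
   show "?P (basis_vec a):?V" if "a:faces n" for a unfolding V using PP PU[OF supported_simps(6)[OF that]] by simp
   show "face_act t x:?V" if "x:?V" for x using that face_act_closed[OF p, of x] aP[of x] unfolding V by simp
  qed (use lP linmap_face_act V in auto)
  also have "... = ptrace n t (E rho) (E mu)" by (simp add: pt aP)
  also have "... = ptrace n t (face_mult u (face_mult (s rho) v)) (E mu)" by (simp add: E face_mult_assoc)
  also have "ptrace n t (face_mult u (face_mult (s rho) v)) (E mu) = ptrace n t (face_mult (face_mult (s rho) v) (face_act t u)) (E mu)"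
   by (rule ptrace_cyclic_left[OF sal p uU(1) EU face_mult_closed[OF sU uU(2)]])
  also have "face_mult (face_mult (s rho) v) (face_act t u) = s rho" using face_mult_one(2)[OF sU] by (simp add: ua[OF p] face_mult_assoc uv)
  also have "ptrace n t (s rho) (E mu) = ptrace n t (s rho) (face_mult (face_act t v) (face_mult u (s mu)))"
   unfolding E by (rule ptrace_cyclic_right[OF sal p sU uU(2) face_mult_closed[OF uU(1) sU]])
  also have "face_mult (face_act t v) (face_mult u (s mu)) = s mu" by (simp add: ua[OF p] vus[OF sU])
  also have "ptrace n t (s rho) (s mu) = (SUM X:?A rho. SUM P:?A mu. ptrace n t (eh X) (eh P))"
   unfolding s_def ptrace_sum(1)[OF sal p] unfolding ptrace_sum(2)[OF sal p] ..
  also have "... = (SUM X:?B rho. SUM P:?A mu. ptrace n t (eh X) (eh P))"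
   by (rule sum.mono_neutral_right[OF finT]) (use BA ns in \<open>auto intro!: sum.neutral\<close>)
  also have "... = (SUM X:?B rho. SUM P:?B mu. ptrace n t (eh X) (eh P))" by (intro sum.cong refl sum.mono_neutral_right finT) (use BA ns in auto)
  also have "... = (\<Sum>X | X:stab {1..n} t & block_type X = rho. \<Sum>P | P:stab {1..n} t & block_type P = mu. order_coeff t P X)"
   by (intro sum.cong refl) (use ptrace_eh[OF sal p] in auto)
  finally show ?thesis .
 qed
 show ?thesis unfolding frobenius_ch_def cyc_prod_def by (rule arg_cong[where f = "%x. mps_const (1 / fact n) * x"], rule sum_eqI) (simp add: tr)
qed

section \<open>Reduced homology of order complexes\<close>

text \<open>Reflexivity is not an axiom, because \<open>refines S\<close> relates partitions of
  \<open>S\<close> only; it appears as a condition on individual vertices instead.\<close>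

locale simplicial_order =
 fixes leq :: "'a => 'a => bool"
 assumes leq_antisym: "leq x y ==> leq y x ==> x = y" and leq_trans: "leq x y ==> leq y z ==> leq x z"
begin

abbreviation "bdry \<equiv> boundary leq"

abbreviation "chn V k \<equiv> supported (simplices V leq k)"

abbreviation "sgn_at x C \<equiv> (- 1 :: complex)^card {y:C. y ~= x & leq y x}"

text \<open>The cone operator with apex \<open>x\<close>. The sign is that of the position of
  \<open>x\<close> in the ordered simplex; with it, every chain is its far part plus
  \<open>x\<close> joined to its link part, and the boundary of a join takes the standard form of
  \<open>boundary_join\<close>.\<close>

definition join_vertex :: "'a => ('a set \<Rightarrow>\<^sub>0 complex) => ('a set \<Rightarrow>\<^sub>0 complex)" where
 "join_vertex x = lin_ext (%C. pm_scale (sgn_at x C) (basis_vec (insert x C)))"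

definition link_part :: "'a => ('a set \<Rightarrow>\<^sub>0 complex) => ('a set \<Rightarrow>\<^sub>0 complex)" where
 "link_part x = lin_ext (%C. if x:C then pm_scale (sgn_at x (C - {x})) (basis_vec (C - {x})) else 0)"

definition far_part :: "'a => ('a set \<Rightarrow>\<^sub>0 complex) => ('a set \<Rightarrow>\<^sub>0 complex)" where
 "far_part x = lin_ext (%C. if x:C then 0 else basis_vec C)"

definition link :: "'a set => 'a => 'a set" where "link V x = {y:V. y ~= x & (leq x y | leq y x)}"

text \<open>\<open>k\<close> counts vertices. The case k = 0 concerns the empty simplex, so
  exactness there already provides a vertex.\<close>

definition exact_at :: "'a set => nat => bool" where "exact_at V k \<longleftrightarrow> (ALL c:chn V k. bdry c = 0 -->
   (EX d:chn V (Suc k). bdry d = c))"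

lemma linmaps: "linmap (bdry)" "linmap (join_vertex x)" "linmap (link_part x)" "linmap (far_part x)"
 unfolding boundary_def join_vertex_def link_part_def far_part_def by (rule linmap_lin_ext)+

lemmas bd = linmapD[OF linmaps(1)] and jv = linmapD[OF linmaps(2)] and lk = linmapD[OF linmaps(3)] and fp = linmapD[OF linmaps(4)]

lemma boundary_basis: "bdry (basis_vec C) = (SUM x:C. pm_scale (sgn_at x C) (basis_vec (C - {x})))" unfolding boundary_def lin_ext_basis
 by (rule sum_eqI) (auto intro!: poly_mapping_eqI simp: lookup_single when_def)

lemma join_basis: "join_vertex x (basis_vec C) = pm_scale (sgn_at x C) (basis_vec (insert x C))" by (simp add: join_vertex_def)

lemma link_basis: "link_part x (basis_vec C) = (if x:C then pm_scale (sgn_at x (C - {x})) (basis_vec (C - {x})) else 0)" by (simp add: link_part_def)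

lemma far_basis: "far_part x (basis_vec C) = (if x:C then 0 else basis_vec C)" by (simp add: far_part_def)

lemma sgn_sq [simp]: "sgn_at x C * sgn_at x D = (-1)^(card {y:C. y ~= x & leq y x} + card {y:D. y ~= x & leq y x})" by (simp add: power_add)

lemma simplex_cases:
 assumes "C:simplices V leq k" "x:V"
 shows "if x:C then C - {x}:simplices (link V x) leq (k - 1) & k > 0 else C:simplices (V - {x}) leq k"
proof (cases "x:C") case True
 hence "card C > 0" using assms(1) by (auto simp: simplices_def card_gt_0_iff)
 with True assms show ?thesis by (auto simp: simplices_def link_def)
qed (use assms in \<open>auto simp: simplices_def\<close>)

lemma simplices_mono: "V <= V' ==> simplices V leq k <= simplices V' leq k" by (auto simp: simplices_def)

lemma insert_simplex:
 assumes "C:simplices (link V x) leq k" "x:V" "leq x x"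
 shows "insert x C:simplices V leq (Suc k)"
proof -
 have "x ~: C" using assms by (auto simp: simplices_def link_def)
 thus ?thesis using assms by (auto simp: simplices_def link_def)
qed

lemma supported_mono: "A <= B ==> supported A <= supported B" by (auto simp: supported_def)

lemma linmap_supported:
 assumes T: "linmap T" and f: "f:supported A" and b: "!!a. a:A ==> T (basis_vec a):supported B"
 shows "T f:supported B"
proof -
 have f': "f:supported (keys f)" by (simp add: supported_def)
 have k: "keys f <= A" using f by (simp add: supported_def)
 have e: "T f = (SUM a:keys f. pm_scale (lookup f a) (T (basis_vec a)))" by (rule linmap_expansion[OF T finite_keys f'])
 show ?thesis unfolding e by (rule supported_simps(5), rule supported_simps(2), rule b) (use k in blast)
qed

lemma decompose:
 assumes "c:chn V k" "x:V"
 shows "far_part x c:chn (V - {x}) k" "link_part x c:chn (link V x) (k - 1)" "c = far_part x c + join_vertex x (link_part x c)"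
proof -
 show "far_part x c:chn (V - {x}) k" proof (rule linmap_supported[OF linmaps(4) assms(1)])
  fix C assume "C:simplices V leq k"
  from simplex_cases[OF this assms(2)] show "far_part x (basis_vec C):chn (V - {x}) k" by (auto simp: far_basis supported_simps)
 qed
 show "link_part x c:chn (link V x) (k - 1)" proof (rule linmap_supported[OF linmaps(3) assms(1)])
  fix C assume "C:simplices V leq k"
  from simplex_cases[OF this assms(2)] show "link_part x (basis_vec C):chn (link V x) (k - 1)" by (auto simp: link_basis supported_simps)
 qed
 let ?t1 = "(%c. far_part x c + join_vertex x (link_part x c))"
 have "(%c. c) c = ?t1 c" proof (rule linmap_eqI[OF linmap_id _ _ assms(1)])
  show "linmap ?t1" unfolding linmap_def by (simp add: fp jv lk pm_scale_add)
  show "basis_vec C = far_part x (basis_vec C) + join_vertex x (link_part x (basis_vec C))" for C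
   by (auto simp: far_basis link_basis jv(3) jv(2) join_basis insert_absorb mult_2[symmetric])
 qed
 thus "c = far_part x c + join_vertex x (link_part x c)" .
qed

lemma parts:
 assumes "c:chn (V - {x}) k"
 shows "far_part x c = c" "link_part x c = 0" "far_part x (join_vertex x c) = 0" "link_part x (join_vertex x c) = c"
proof -
 have n: "x ~: C" if "C:simplices (V - {x}) leq k" for C using that by (auto simp: simplices_def)
 have "far_part x c = (%c. c) c" by (rule linmap_eqI[OF linmaps(4) linmap_id _ assms]) (simp add: far_basis n)
 thus "far_part x c = c" .
 have "link_part x c = (%c. pm_scale 0 c) c" by (rule linmap_eqI[OF linmaps(3) linmap_scale[OF linmap_id] _ assms]) (simp add: link_basis n)
 thus "link_part x c = 0" by simp
 have "far_part x (join_vertex x c) = (%c. pm_scale 0 c) c"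
  by (rule linmap_eqI[OF linmap_comp[OF linmaps(4,2)] linmap_scale[OF linmap_id] _ assms]) (simp add: join_basis fp far_basis n)
 thus "far_part x (join_vertex x c) = 0" by simp
 have "link_part x (join_vertex x c) = (%c. c) c"
  by (rule linmap_eqI[OF linmap_comp[OF linmaps(3,2)] linmap_id _ assms]) (simp add: join_basis lk link_basis n mult_2[symmetric])
 thus "link_part x (join_vertex x c) = c" .
qed

lemma boundary_supported:
 assumes "c:chn V k"
 shows "bdry c:chn V (k - 1)"
proof (rule linmap_supported[OF linmaps(1) assms]) fix C assume C: "C:simplices V leq k"
 have "C - {x}:simplices V leq (k - 1)" if "x:C" for x using C that by (auto simp: simplices_def)
 thus "bdry (basis_vec C):chn V (k - 1)" unfolding boundary_basis by (intro supported_simps(5) supported_simps(2) supported_simps(6))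
qed

lemma boundary_join_basis:
 assumes "C:simplices (link V x) leq k"
 shows "bdry (join_vertex x (basis_vec C)) = basis_vec C - join_vertex x (bdry (basis_vec C))"
proof -
 have x: "x ~: C" and fin: "finite C" and cmp: "!!y. y:C ==> leq x y | leq y x" using assms by (auto simp: simplices_def link_def)
 \<comment> \<open>Exactly one of two positions changes: if y comes before x, deleting y moves x;
   otherwise inserting x moves y.\<close>
 have s: "sgn_at x C * sgn_at y (insert x C) = - (sgn_at y C * sgn_at x (C - {y}))" if y: "y:C" for y proof (cases "leq y x")
  case True
  have nx: "\<not> leq x y" using True leq_antisym y x by metis
  have "{z:C. z ~= x & leq z x} = insert y {z:C - {y}. z ~= x & leq z x}" using True y x by auto
  hence a: "card {z:C. z ~= x & leq z x} = Suc (card {z:C - {y}. z ~= x & leq z x})" using fin by simp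
  have b: "{z:insert x C. z ~= y & leq z y} = {z:C. z ~= y & leq z y}" using nx by auto
  show ?thesis unfolding a b by simp
 next case False
  have xy: "leq x y" using False cmp[OF y] by simp
  have a: "{z:C - {y}. z ~= x & leq z x} = {z:C. z ~= x & leq z x}" using False by auto
  have "{z:insert x C. z ~= y & leq z y} = insert x {z:C. z ~= y & leq z y}" using xy x y by auto
  hence b: "card {z:insert x C. z ~= y & leq z y} = Suc (card {z:C. z ~= y & leq z y})" using fin x by simp
  show ?thesis unfolding a b by simp
 qed
 have self: "{y:insert x C. y ~= x & leq y x} = {y:C. y ~= x & leq y x}" by auto
 let ?t1 = "(SUM y:C. pm_scale (sgn_at x C * sgn_at y (insert x C)) (basis_vec (insert x C - {y})))"
 have "bdry (join_vertex x (basis_vec C)) = (SUM y:insert x C. pm_scale (sgn_at x C * sgn_at y (insert x C)) (basis_vec (insert x C - {y})))"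
  by (simp only: join_basis bd(2) boundary_basis pm_scale_sum pm_scale_simps(4))
 also have "... = pm_scale (sgn_at x C * sgn_at x C) (basis_vec C) + ?t1" by (subst sum.insert[OF fin x]) (simp only: self Diff_insert_absorb[OF x])
 also have "pm_scale (sgn_at x C * sgn_at x C) (basis_vec C) = basis_vec C" by (simp add: mult_2[symmetric])
 also have "?t1 = - join_vertex x (bdry (basis_vec C))" unfolding boundary_basis jv(4) sum_negf[symmetric] proof (rule sum_eqI, goal_cases)
  case y: (1 y)
  hence e: "insert x C - {y} = insert x (C - {y})" using x by auto
  show ?case unfolding s[OF y] e jv(2) join_basis pm_scale_simps(4) by (rule poly_mapping_eqI) simp
 qed
 finally show ?thesis by simp
qed

lemma boundary_join:
 assumes "c:chn (link V x) k"
 shows "bdry (join_vertex x c) = c - join_vertex x (bdry c)"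
 by (rule linmap_eqI[OF linmap_comp[OF linmaps(1,2)] linmap_diff[OF linmap_id linmap_comp[OF linmaps(2,1)]] boundary_join_basis assms])

text \<open>Induction over the simplex by the cone formula takes the place of cancelling pairs of
  faces.\<close>

lemma boundary_boundary_basis: "finite C ==> C:simplices V leq k ==> bdry (bdry (basis_vec C)) = 0"
proof (induction C arbitrary: k rule: finite_induct) case empty
 show ?case by (simp add: boundary_basis bd)
next case (insert x C)
 have C: "C:simplices V leq (k - 1)" using insert.prems insert.hyps by (auto simp: simplices_def)
 have l: "C:simplices (link V x) leq (k - 1)" using insert.prems insert.hyps by (auto simp: simplices_def link_def)
 have ls: "bdry (basis_vec C):chn (link V x) (k - 1 - 1)" by (rule boundary_supported[OF supported_simps(6)[OF l]])
 have "bdry (bdry (join_vertex x (basis_vec C))) = 0"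
  unfolding boundary_join_basis[OF l] bd(6) boundary_join[OF ls] using insert.IH[OF C] by (simp add: jv)
 hence "pm_scale (sgn_at x C) (bdry (bdry (join_vertex x (basis_vec C)))) = 0" by simp
 thus ?case unfolding join_basis bd(2) by (simp add: mult_2[symmetric])
qed

lemma boundary_boundary:
 assumes "c:chn V k"
 shows "bdry (bdry c) = 0"
proof -
 have "bdry (bdry c) = (%c. pm_scale 0 c) c" by (rule linmap_eqI[OF linmap_comp[OF linmaps(1,1)] linmap_scale[OF linmap_id] _ assms])
   (use boundary_boundary_basis in \<open>auto simp: simplices_def\<close>)
 thus ?thesis by simp
qed

lemma link_subset: "link V x <= V - {x}" by (auto simp: link_def)

text \<open>The equation for a cycle is separated into the simplices that contain \<open>x\<close>
  and those that do not.\<close>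

lemma cycle_parts:
 assumes c: "c:chn V k" "bdry c = 0" and x: "x:V"
 shows "bdry (far_part x c) + link_part x c = 0" "bdry (link_part x c) = 0"
proof -
 let ?N = "far_part x c" and ?R = "link_part x c"
 note d = decompose[OF c(1) x]
 have e: "bdry ?N + ?R - join_vertex x (bdry ?R) = 0" proof -
  have "bdry (?N + join_vertex x ?R) = 0" using c(2) d(3) by simp
  thus ?thesis unfolding bd(1) boundary_join[OF d(2)] by (simp add: algebra_simps)
 qed
 have R: "?R:chn (V - {x}) (k - 1)" using d(2) supported_mono[OF simplices_mono[OF link_subset]] by blast
 note pN = parts[OF boundary_supported[OF d(1)]] and pR = parts[OF R] and pB = parts[OF boundary_supported[OF R]]
 \<comment> \<open>The two projections are applied to \<open>e\<close>: \<open>far_part\<close>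
   annihilates the join term, and \<open>link_part\<close> sees nothing else.\<close>
 show "bdry ?N + ?R = 0" using arg_cong[OF e, of "far_part x"] by (simp add: fp pN pR pB)
 show "bdry ?R = 0" using arg_cong[OF e, of "link_part x"] by (simp add: lk pN pR pB)
qed

text \<open>The Mayer-Vietoris argument for V - {x} and the cone over the link of \<open>x\<close>,
  carried out on cycles: fill the link part inside the link, correct the far part by this filling so
  that it becomes a cycle, and fill that away from \<open>x\<close>.\<close>

lemma exact_add_vertex:
 assumes x: "x:V" "leq x x" and V: "exact_at (V - {x}) k" and L: "k > 0 ==> exact_at (link V x) (k - 1)"
 shows "exact_at V k" unfolding exact_at_def
proof (intro ballI impI) fix c assume c: "c:chn V k" "bdry c = 0"
 let ?N = "far_part x c" and ?R = "link_part x c"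
 note d = decompose[OF c(1) x(1)] and p = cycle_parts[OF c x(1)]
 have sV: "chn (V - {x}) j <= chn V j" for j by (rule supported_mono[OF simplices_mono]) auto
 show "EX d:chn V (Suc k). bdry d = c" proof (cases "k = 0")
  case True
  have "x ~: C" if "C:simplices V leq k" for C using that True by (auto simp: simplices_def)
  hence "c:chn (V - {x}) k" using c(1) unfolding supported_def simplices_def by blast
  thus ?thesis using V c(2) sV unfolding exact_at_def by blast
 next case False
  then obtain e where e: "e:chn (link V x) k" "bdry e = ?R" using L d(2) p(2) unfolding exact_at_def by fastforce
  have je: "join_vertex x e:chn V (Suc k)" proof (rule linmap_supported[OF linmaps(2) e(1)])
   fix C assume "C:simplices (link V x) leq k"
   from insert_simplex[OF this x] show "join_vertex x (basis_vec C):chn V (Suc k)"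
    by (auto simp: join_basis intro!: supported_simps(2) supported_simps(6))
  qed
  have e': "e:chn (V - {x}) k" using e(1) supported_mono[OF simplices_mono[OF link_subset]] by blast
  have be: "bdry (join_vertex x e) = e - join_vertex x ?R" using boundary_join[OF e(1)] e(2) by simp
  have "?N + e:chn (V - {x}) k" by (rule supported_simps(3)[OF d(1) e'])
  moreover have "bdry (?N + e) = 0" using p(1) by (simp add: bd e(2))
  ultimately obtain g where g: "g:chn (V - {x}) (Suc k)" "bdry g = ?N + e" using V unfolding exact_at_def by blast
  have "g - join_vertex x e:chn V (Suc k)" using g(1) sV by (intro supported_simps(4) je) auto
  moreover have "bdry (g - join_vertex x e) = c" unfolding bd(6) g(2) be using d(3) by (simp add: algebra_simps)
  ultimately show ?thesis by blast
 qed
qed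

text \<open>A vertex comparable to all others has the whole rest as its link, so joining it to the
  far part of a cycle gives a filling.\<close>

lemma exact_cone:
 assumes p: "p:V" "leq p p" and cmp: "!!y. y:V ==> leq p y | leq y p"
 shows "exact_at V k" unfolding exact_at_def
proof (intro ballI impI) fix c assume c: "c:chn V k" "bdry c = 0"
 have l: "link V p = V - {p}" using cmp by (auto simp: link_def)
 note d = decompose[OF c(1) p(1)] and q = cycle_parts[OF c p(1)]
 have N: "far_part p c:chn (link V p) k" using d(1) l by simp
 have "join_vertex p (far_part p c):chn V (Suc k)" proof (rule linmap_supported[OF linmaps(2) N])
  fix C assume "C:simplices (link V p) leq k"
  from insert_simplex[OF this p] show "join_vertex p (basis_vec C):chn V (Suc k)"
   by (auto simp: join_basis intro!: supported_simps(2) supported_simps(6))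
 qed
 moreover have "bdry (join_vertex p (far_part p c)) = c" proof -
  have "bdry (far_part p c) = - link_part p c" using q(1) by (simp add: eq_neg_iff_add_eq_0)
  thus ?thesis unfolding boundary_join[OF N] using d(3) by (simp add: jv)
 qed
 ultimately show "EX d:chn V (Suc k). bdry d = c" by blast
qed

text \<open>Built degree by degree: for a simplex C, the chain C - h (boundary C) is a cycle by the
  homotopy identity one degree lower, and exactness supplies a value for h on C.\<close>

lemma contracting_homotopy:
 assumes "!!k. k < K ==> exact_at V k"
 shows "\<exists>h. linmap h & (\<forall>k<K. ALL C:simplices V leq k. h (basis_vec C):chn V (Suc k) &
   bdry (h (basis_vec C)) + h (bdry (basis_vec C)) = basis_vec C)" using assms
proof (induction K) case 0
 show ?case using linmap_id by blast
next case (Suc K)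
 then obtain h where h: "linmap h" "!!k C. k < K ==> C:simplices V leq k ==> h (basis_vec C):chn V (Suc k)"
  "!!k C. k < K ==> C:simplices V leq k ==> bdry (h (basis_vec C)) + h (bdry (basis_vec C)) = basis_vec C" by fastforce
 note hl = linmapD[OF h(1)]
 have hom: "bdry (h f) + h (bdry f) = f" if "f:chn V k" "k < K" for f k proof -
  have "(%f. bdry (h f) + h (bdry f)) f = (%f. f) f" by (rule linmap_eqI[OF _ linmap_id _ that(1)])
    (use h(3)[OF that(2)] in \<open>simp_all add: linmap_def hl bd pm_scale_add\<close>)
  thus ?thesis .
 qed
 have "\<exists>d. C:simplices V leq K --> d:chn V (Suc K) & bdry d = basis_vec C - h (bdry (basis_vec C))" for C proof (cases "C:simplices V leq K")
  case C: True
  let ?b = "bdry (basis_vec C)"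
  have bs: "?b:chn V (K - 1)" by (rule boundary_supported[OF supported_simps(6)[OF C]])
  have bb: "bdry ?b = 0" by (rule boundary_boundary[OF supported_simps(6)[OF C]])
  have hb: "h ?b:chn V K & bdry (h ?b) = ?b" proof (cases "K = 0")
   case True
   hence "C = {}" using C by (auto simp: simplices_def)
   hence "?b = 0" by (simp add: boundary_basis)
   thus ?thesis by (simp add: hl bd supported_simps)
  next case False
   hence K: "K - 1 < K" "Suc (K - 1) = K" by auto
   have "h ?b:chn V (Suc (K - 1))" by (rule linmap_supported[OF h(1) bs]) (rule h(2)[OF K(1)])
   moreover have "bdry (h ?b) = ?b" using hom[OF bs K(1)] bb by (simp add: hl)
   ultimately show ?thesis using K by simp
  qed
  have "basis_vec C - h ?b:chn V K" using hb C by (intro supported_simps(4) supported_simps(6)) auto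
  moreover have "bdry (basis_vec C - h ?b) = 0" using hb by (simp add: bd)
  ultimately show ?thesis using Suc.prems[of K] unfolding exact_at_def by blast
 qed simp
 then obtain d where d: "!!C. C:simplices V leq K ==> d C:chn V (Suc K) & bdry (d C) = basis_vec C - h (bdry (basis_vec C))" by metis
 \<comment> \<open>Simplices with \<open>K\<close> vertices receive the new values and all others
   keep the old ones, so the identities already obtained are untouched.\<close>
 define h' where "h' = lin_ext (%C. if card C = K then d C else h (basis_vec C))"
 have h'l: "linmap h'" unfolding h'_def by (rule linmap_lin_ext)
 have h'h: "h' f = h f" if "f:chn V k" "k ~= K" for f k
  by (rule linmap_eqI[OF h'l h(1) _ that(1)]) (use that(2) in \<open>simp add: h'_def simplices_def\<close>)
 have "h' (basis_vec C):chn V (Suc k) &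
   bdry (h' (basis_vec C)) + h' (bdry (basis_vec C)) = basis_vec C" if k: "k < Suc K" and C: "C:simplices V leq k" for k C proof -
  have bs: "bdry (basis_vec C):chn V (k - 1)" by (rule boundary_supported[OF supported_simps(6)[OF C]])
  have b: "h' (bdry (basis_vec C)) = h (bdry (basis_vec C))" proof (cases "k = 0")
   case True
   hence "C = {}" using C by (auto simp: simplices_def)
   hence "bdry (basis_vec C) = 0" by (simp add: boundary_basis)
   thus ?thesis by (simp add: hl linmapD[OF h'l])
  next case False
   thus ?thesis using k by (intro h'h[OF bs]) auto
  qed
  show ?thesis proof (cases "k = K")
   case True
   hence "h' (basis_vec C) = d C" using C by (simp add: h'_def simplices_def)
   thus ?thesis using d[of C] C True b by simp
  next case False
   hence "k < K" using k by simp
   thus ?thesis using h'h[OF supported_simps(6)[OF C] False] h(2,3) C b by simp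
  qed
 qed
 thus ?case using h'l by blast
qed

lemma finite_simplices: "finite V ==> finite (simplices V leq k)" by (rule finite_subset[of _ "Pow V"]) (auto simp: simplices_def)

text \<open>The Hopf trace formula for a complex that is exact below the top degree\<close>

lemma trace_top_cycles:
 assumes V: "finite V" and ex: "!!k. k < K ==> exact_at V k" and T: "linmap T" "!!k C. C:simplices V leq k ==> T (basis_vec C):chn V k"
  and comm: "!!k C. C:simplices V leq k ==> bdry (T (basis_vec C)) = T (bdry (basis_vec C))"
 shows "subquot_trace (cycles V leq K) {0} T = (SUM k<=K. (-1)^(K - k) * op_trace (simplices V leq k) T)" (is "?l = _")
proof -
 obtain h where h: "linmap h" "!!k C. k < K ==> C:simplices V leq k ==> h (basis_vec C):chn V (Suc k)"
  "!!k C. k < K ==> C:simplices V leq k ==> bdry (h (basis_vec C)) + h (bdry (basis_vec C)) = basis_vec C" using contracting_homotopy[OF ex] by metis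
 note hl = linmapD[OF h(1)] and Tl = linmapD[OF T(1)]
 have hom: "bdry (h f) + h (bdry f) = f" if "f:chn V k" "k < K" for f k proof -
  have "(%f. bdry (h f) + h (bdry f)) f = (%f. f) f" by (rule linmap_eqI[OF _ linmap_id _ that(1)])
    (use h(3)[OF that(2)] in \<open>simp_all add: linmap_def hl bd pm_scale_add\<close>)
  thus ?thesis .
 qed
 have TS: "T f:chn V k" if "f:chn V k" for f k by (rule linmap_supported[OF T(1) that]) (rule T(2))
 have hS: "h f:chn V (Suc k)" if "f:chn V k" "k < K" for f k by (rule linmap_supported[OF h(1) that(1)]) (rule h(2)[OF that(2)])
 have com: "bdry (T f) = T (bdry f)" if "f:chn V k" for f k
  by (rule linmap_eqI[OF linmap_comp[OF linmaps(1) T(1)] linmap_comp[OF T(1) linmaps(1)] comm that])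
 have hb: "k = 0 & bdry f = 0 | h (bdry f):chn V k" if f: "f:chn V k" "k <= K" for f k proof (cases "k = 0")
  case True
  have "bdry f = (%f. pm_scale 0 f) f" by (rule linmap_eqI[OF linmaps(1) linmap_scale[OF linmap_id] _ f(1)])
    (use True in \<open>auto simp: boundary_basis simplices_def\<close>)
  thus ?thesis using True by simp
 next case False
  hence "h (bdry f):chn V (Suc (k - 1))" using f by (intro hS boundary_supported) auto
  thus ?thesis using False by simp
 qed
 have hb': "h (bdry f):chn V k" if "f:chn V k" "k <= K" for f k using hb[OF that] by (auto simp: hl supported_simps)
 let ?tr = "%k. op_trace (simplices V leq k)"
 let ?t1 = "(%f. T (f - h (bdry f)))"
 \<comment> \<open>With d for the boundary: cyclicity turns the trace of T h d on k + 1 vertices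
   into that of d T h = T d h on k vertices, and there d h = 1 - h d. Each trace is thus the plain
   trace minus the previous one, which unrolls into the alternating sum.\<close>
 have rec: "k <= K ==> ?tr k ?t1 = (SUM j<=k. (-1)^(k - j) * ?tr j T)" for k proof (induction k)
  case 0
  have "T (basis_vec C - h (bdry (basis_vec C))) = T (basis_vec C)" if "C:simplices V leq 0" for C proof -
   have "C = {}" using that by (auto simp: simplices_def)
   thus ?thesis by (simp add: boundary_basis hl)
  qed
  thus ?case by (simp add: op_trace_def)
 next case (Suc k)
  have "?tr (Suc k) ?t1 = ?tr (Suc k) T - ?tr (Suc k) (%f. T (h (bdry f)))" by (simp add: Tl op_trace_linear)
  also have "?tr (Suc k) (%f. T (h (bdry f))) = ?tr k (%f. bdry (T (h f)))"
  proof (rule op_trace_comm[OF finite_simplices[OF V] finite_simplices[OF V] linmap_comp[OF T(1) h(1)] linmaps(1)])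
   show "T (h (basis_vec b)):chn V (Suc k)" if "b:simplices V leq k" for b using that Suc.prems by (intro TS h(2)) auto
   show "bdry (basis_vec a):chn V k" if "a:simplices V leq (Suc k)" for a using boundary_supported[OF supported_simps(6)[OF that]] by simp
  qed
  also have "... = ?tr k ?t1" proof (rule op_trace_cong)
   fix C assume C: "C:simplices V leq k"
   have k: "k < K" using Suc.prems by simp
   have "bdry (T (h (basis_vec C))) = T (bdry (h (basis_vec C)))" by (rule com[OF h(2)[OF k C]])
   also have "bdry (h (basis_vec C)) = basis_vec C - h (bdry (basis_vec C))" using h(3)[OF k C] by (simp add: eq_diff_eq)
   finally show "bdry (T (h (basis_vec C))) = T (basis_vec C - h (bdry (basis_vec C)))" .
  qed
  also have "... = (SUM j<=k. (-1)^(k - j) * ?tr j T)" using Suc by simp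
  finally show ?case by (simp add: sum_negf[symmetric] Suc_diff_le)
 qed
 \<comment> \<open>A projection onto the cycles: it fixes them, and its values are cycles because d
   h is the identity on boundaries.\<close>
 let ?P = "%f. f - h (bdry f)"
 have "?l = op_trace (simplices V leq K) (%f. T (?P f))" proof (rule subquot_trace_projection[OF finite_simplices[OF V]])
  have c: "cycles V leq K = {c:chn V K. bdry c = 0}" by (simp add: cycles_def chain_space_def span_basis_vec)
  show "cycles V leq K <= chn V K" by (auto simp: c)
  show "fvs.subspace (cycles V leq K)" by (rule fvs.subspaceI) (auto simp: c bd supported_simps)
  show "linmap ?P" by (rule linmap_diff[OF linmap_id linmap_comp[OF h(1) linmaps(1)]])
  show "?P v = v" if "v:cycles V leq K" for v using that by (simp add: c hl)
  show "T v:cycles V leq K" if "v:cycles V leq K" for v using that by (auto simp: c TS com Tl)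
  show "linmap T" by (rule T(1))
  fix C assume C: "C:simplices V leq K"
  let ?b = "bdry (basis_vec C)"
  have s: "basis_vec C:chn V K" by (rule supported_simps(6)[OF C])
  have "bdry (h ?b) = ?b" proof (cases "?b = 0")
   case True
   thus ?thesis by (simp add: hl bd)
  next case False
   hence K: "K > 0" using C by (auto simp: simplices_def boundary_basis intro: Nat.gr0I)
   thus ?thesis using hom[OF boundary_supported[OF s]] boundary_boundary[OF s] by (simp add: hl)
  qed
  thus "?P (basis_vec C):cycles V leq K" using hb'[OF s] s by (simp add: c bd supported_simps)
 qed
 also have "... = (SUM k<=K. (-1)^(K - k) * op_trace (simplices V leq k) T)" by (rule rec) simp
 finally show ?thesis .
qed

end

section \<open>The partition lattice is exact below its top degree\<close>

lemma finer_block: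
 assumes "partition_on S X" "partition_on S M" "finer X M" "c:X" "b:M" "x:c" "x:b"
 shows "c <= b"
proof -
 obtain b' where b': "b':M" "c <= b'" using assms(3,4) by (auto simp: finer_def)
 hence "b' = b" using partition_on_member_eq[OF assms(2) b'(1) assms(5), of x] assms(6,7) by blast
 thus ?thesis using b' by simp
qed

lemma partition_on_obtain:
 assumes "partition_on S X" "x:S" obtains c where "c:X" "x:c" using assms by (auto simp: partition_on_def)

text \<open>Picking a block of \<open>X\<close> inside each block of \<open>M\<close> is injective,
  and if it were onto the two partitions would coincide.\<close>

lemma finer_card_less:
 assumes S: "finite S" and p: "partition_on S X" "partition_on S M" and f: "finer X M" "X ~= M"
 shows "card M < card X"
proof -
 have finX: "finite X" by (rule finite_elements[OF S p(1)])
 have "\<exists>c. c:X & c <= b" if b: "b:M" for b proof -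
  obtain x where x: "x:b" using b p(2) by (metis partition_onD3 ex_in_conv)
  hence "x:S" using b p(2) by (auto simp: partition_on_def)
  then obtain c where c: "c:X" "x:c" by (rule partition_on_obtain[OF p(1)])
  show ?thesis using finer_block[OF p f(1) c(1) b c(2) x] c(1) by blast
 qed
 then obtain g where g: "!!b. b:M ==> g b:X & g b <= b" by metis
 have ne: "g b ~= {}" if "b:M" for b using g[OF that] p(1) by (metis partition_onD3)
 have uniq: "b = b'" if "b:M" "b':M" "g b <= b'" for b b' proof -
  have "\<exists>x. x:g b" using ne[OF that(1)] by blast
  then obtain x where x: "x:g b" ..
  show ?thesis using partition_on_member_eq[OF p(2) that(1,2), of x] x g[OF that(1)] that(3) by blast
 qed
 have inj: "inj_on g M" by (rule inj_onI) (use uniq g in metis)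
 have "g`M ~= X" proof
  assume e: "g`M = X"
  have "g b = b" if b: "b:M" for b proof -
   have "x:g b" if x: "x:b" for x proof -
    have "x:S" using b x p(2) by (auto simp: partition_on_def)
    then obtain c where c: "c:X" "x:c" by (rule partition_on_obtain[OF p(1)])
    then obtain b' where b': "b':M" "c = g b'" using e by blast
    have "g b' <= b" using finer_block[OF p f(1) c(1) b c(2) x] b' by simp
    thus ?thesis using uniq[OF b'(1) b] b' c by simp
   qed
   thus ?thesis using g[OF b] by blast
  qed
  hence "g`M = M" by force
  thus False using e f(2) by simp
 qed
 hence "g`M \<subset> X" using g by blast
 hence "card (g`M) < card X" by (rule psubset_card_mono[OF finX])
 thus ?thesis by (simp add: card_image[OF inj])
qed

definition disc :: "'a set => 'a set set" where "disc S = (%i. {i})`S"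

lemma partition_on_disc: "partition_on S (disc S)" by (auto simp: partition_on_def disc_def disjoint_def)

lemma finer_disc: "partition_on S X ==> finer (disc S) X" by (auto simp: finer_def disc_def partition_on_def)

text \<open>The join of \<open>X\<close> with the atom that merges \<open>u\<close> and
  \<open>v\<close>; \<open>together u v X\<close> says that \<open>X\<close> lies above that
  atom.\<close>

definition fuse :: "'a => 'a => 'a set set => 'a set set" where "fuse u v X = insert (\<Union>{c:X. u:c | v:c}) {c:X. u ~: c & v ~: c}"

definition together :: "'a => 'a => 'a set set => bool" where "together u v X \<longleftrightarrow> (EX b:X. u:b & v:b)"

context
 fixes S :: "'a set" and u v :: 'a
 assumes S: "finite S" and uv: "u:S" "v:S"
begin

lemma partition_on_fuse:
 assumes X: "partition_on S X"
 shows "partition_on S (fuse u v X)"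
proof (rule partition_onI)
 let ?D = "{c:X. u:c | v:c}"
 obtain c where c: "c:X" "u:c" by (rule partition_on_obtain[OF X uv(1)])
 show "\<Union>(fuse u v X) = S" using X by (auto simp: fuse_def partition_on_def)
 show "{} ~: fuse u v X" using c X by (auto simp: fuse_def partition_on_def)
 have d: "a Int b = {}" if "a:X" "b:X" "a ~= b" for a b using that X by (auto simp: partition_on_def disjoint_def)
 have d1: "disjnt (\<Union>?D) p" if "p:X" "u ~: p" "v ~: p" for p unfolding disjnt_def using d[of _ p] that by blast
 show "disjnt p q" if pq: "p:fuse u v X" "q:fuse u v X" "p ~= q" for p q proof -
  consider "p = \<Union>?D" "q:X" "u ~: q" "v ~: q" | "q = \<Union>?D" "p:X" "u ~: p" "v ~: p" | "p:X" "q:X" using pq unfolding fuse_def by blast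
  thus ?thesis proof cases
   case 1 thus ?thesis using d1 by simp
  next case 2 thus ?thesis using d1[of p] by (simp add: disjnt_sym)
  next case 3 thus ?thesis using d[of p q] pq(3) by (simp add: disjnt_def)
  qed
 qed
qed

lemma finer_fuse: "finer X (fuse u v X)" unfolding finer_def fuse_def
proof fix c assume c: "c:X"
 show "EX b:insert (\<Union>{c:X. u:c | v:c}) {c:X. u ~: c & v ~: c}. c <= b" proof (cases "u:c | v:c")
  case True show ?thesis by (rule bexI[OF _ insertI1], rule Union_upper) (use True c in simp)
 next case False
  show ?thesis by (rule bexI[where x = c]) (use False c in simp_all)
 qed
qed

lemma together_fuse:
 assumes X: "partition_on S X"
 shows "together u v (fuse u v X)"
proof -
 obtain c where c: "c:X" "u:c" by (rule partition_on_obtain[OF X uv(1)])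
 obtain d where d: "d:X" "v:d" by (rule partition_on_obtain[OF X uv(2)])
 have "u:\<Union>{c:X. u:c | v:c}" "v:\<Union>{c:X. u:c | v:c}" using c d by auto
 thus ?thesis unfolding together_def fuse_def by (intro bexI[OF _ insertI1] conjI)
qed

lemma fuse_least:
 assumes X: "partition_on S X" "partition_on S M" and f: "finer X M" and t: "together u v M"
 shows "finer (fuse u v X) M"
proof -
 obtain b where b: "b:M" "u:b" "v:b" using t by (auto simp: together_def)
 have "c <= b" if "c:X" "u:c | v:c" for c using finer_block[OF X f that(1) b(1)] that(2) b(2,3) by blast
 hence "\<Union>{c:X. u:c | v:c} <= b" by blast
 thus ?thesis using f b(1) by (auto simp: finer_def fuse_def)
qed

lemma fuse_together:
 assumes X: "partition_on S X" and t: "together u v X"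
 shows "fuse u v X = X" by (rule finer_antisym[OF partition_on_fuse[OF X] X fuse_least[OF X X finer_refl t] finer_fuse])

lemma card_fuse:
 assumes X: "partition_on S X"
 shows "card X <= Suc (card (fuse u v X))"
proof -
 have fin: "finite X" by (rule finite_elements[OF S X])
 obtain c where c: "c:X" "u:c" by (rule partition_on_obtain[OF X uv(1)])
 obtain d where d: "d:X" "v:d" by (rule partition_on_obtain[OF X uv(2)])
 let ?t1 = "{c:X. u ~: c & v ~: c}"
 let ?t2 = "{c:X. u:c | v:c}"
 have "?t2 = {c, d}" proof (intro equalityI subsetI)
  fix b assume "b:?t2"
  hence b: "b:X" "u:b | v:b" by auto
  thus "b:{c, d}" using partition_on_member_eq[OF X b(1) c(1) _ c(2)] partition_on_member_eq[OF X b(1) d(1) _ d(2)] by auto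
 qed (use c d in auto)
 moreover have "X = ?t2 Un ?t1" by auto
 ultimately have e: "X = {c, d} Un ?t1" by simp
 have le: "card X <= card {c, d} + card ?t1" using card_Un_le[of "{c, d}" "?t1"] unfolding e[symmetric] .
 have "card {c, d} <= 2" by (simp add: card_insert_if)
 moreover have "\<Union>{c:X. u:c | v:c} ~: ?t1" using c by blast
 hence "card (fuse u v X) = Suc (card ?t1)" unfolding fuse_def using fin by (subst card_insert_disjoint) auto
 ultimately show ?thesis using le by linarith
qed

end

text \<open>The open interval between the discrete partition and \<open>T\<close>; for T = {S} it is
  the proper part of the lattice.\<close>

definition between :: "'a set => 'a set set => 'a set set set" where "between S T = {X. partition_on S X & finer X T & X ~= T & X ~= disc S}"

lemma finite_between:
 assumes "finite S"
 shows "finite (between S T)"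
proof (rule finite_subset[OF _ finitely_many_partition_on[OF assms]])
 show "between S T <= {X. partition_on S X}" by (simp add: between_def subset_eq)
qed

interpretation refines_order: simplicial_order "refines S" for S :: "'a set" by unfold_locales (rule refines_asym, assumption+, rule refines_trans)

lemma refines_finer: "partition_on S X ==> partition_on S M ==> refines S X M \<longleftrightarrow> finer X M" by (simp add: refines_def finer_def)

lemma partition_on_merge_exists:
 assumes T: "partition_on S T" "T ~= disc S"
 shows "\<exists>u v. u:S & v:S & u ~= v & (EX b:T. u:b & v:b)"
proof (rule ccontr)
 assume n: "\<nexists>u v. u:S & v:S & u ~= v & (EX b:T. u:b & v:b)"
 have "b:disc S" if b: "b:T" for b proof -
  have sub: "b <= S" using b T(1) by (auto simp: partition_on_def)
  obtain x where x: "x:b" using b T(1) by (metis partition_onD3 ex_in_conv)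
  have "b = {x}" using n b x sub by blast
  thus ?thesis using x sub by (auto simp: disc_def)
 qed
 hence "finer T (disc S)" unfolding finer_def by blast
 thus False using finer_antisym[OF T(1) partition_on_disc _ finer_disc[OF T(1)]] T(2) by blast
qed

text \<open>A maximal chain of the open interval has card S - card T - 1 members, so this is
  exactness below the top degree. Fix an atom below \<open>T\<close>. The partitions whose join with
  the atom is not \<open>T\<close> form a part that is exact everywhere; the remaining ones are
  coatoms of the interval, and adding them one at a time requires only the open intervals below
  them, known by induction.\<close>

lemma exact_between:
 assumes S: "finite S" and T: "partition_on S T" and k: "k + card T + 1 < card S"
 shows "simplicial_order.exact_at (refines S) (between S T) k" using T k
proof (induction "card S - card T" arbitrary: T k rule: less_induct) case less
 have cd: "card (disc S) = card S" unfolding disc_def by (rule card_image) simp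
 have Tp: "partition_on S T" by (rule less.prems)
 have "T ~= disc S" using less.prems cd by auto
 then obtain u v where uv: "u:S" "v:S" and ne: "u ~= v" and tT: "together u v T"
  using partition_on_merge_exists[OF Tp] unfolding together_def by blast
 note fz = partition_on_fuse[OF S uv] finer_fuse[OF S uv] together_fuse[OF S uv] fuse_least[OF S uv] fuse_together[OF S uv] card_fuse[OF S uv]
 let ?j = "fuse u v" and ?W = "between S T"
 let ?ex = "refines_order.exact_at S"
 have Wp: "partition_on S X" "finer X T" "X ~= T" "X ~= disc S" if "X:?W" for X using that by (auto simp: between_def)
 have rr: "refines S X X" if "X:?W" for X by (rule refines_refl[OF Wp(1)[OF that]])
 define H where "H = {X:?W. ?j X = T}"
 define A where "A = {X:?W. together u v X}"
 have nd: "\<not> together u v (disc S)" using ne by (auto simp: together_def disc_def)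
 have jW: "?j X:A" if X: "X:?W - H" for X proof -
  have X': "X:?W" "?j X ~= T" using X by (auto simp: H_def)
  have t: "together u v (?j X)" by (rule fz(3)[OF Wp(1)[OF X'(1)]])
  have "?j X ~= disc S" using t nd by metis
  thus ?thesis unfolding A_def between_def using t X'(2) fz(1)[OF Wp(1)[OF X'(1)]] fz(4)[OF Wp(1)[OF X'(1)] Tp Wp(2)[OF X'(1)] tT] by simp
 qed
 have AH: "A <= ?W - H" proof
  fix X assume "X:A"
  hence X: "X:?W" "together u v X" by (auto simp: A_def)
  have e: "?j X = X" by (rule fz(5)[OF Wp(1)[OF X(1)] X(2)])
  have "X ~: H" unfolding H_def using e Wp(3)[OF X(1)] by simp
  with X(1) show "X:?W - H" by (rule DiffI)
 qed
 \<comment> \<open>The atom itself differs from \<open>T\<close>: it has at least card S - 1 blocks,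
   which exceeds card T by the bound even for k = 0.\<close>
 have jd: "?j (disc S):A" proof -
  have t: "together u v (?j (disc S))" by (rule fz(3)[OF partition_on_disc])
  have "card S <= Suc (card (?j (disc S)))" using fz(6)[OF partition_on_disc] cd by simp
  hence "?j (disc S) ~= T" using less.prems(2) by auto
  moreover have "?j (disc S) ~= disc S" using t nd by metis
  ultimately show ?thesis unfolding A_def between_def using t fz(1)[OF partition_on_disc] fz(4)[OF partition_on_disc Tp finer_disc[OF Tp] tT] by simp
 qed
 \<comment> \<open>\<open>A\<close>, the part above the atom, is a cone. For larger V a vertex x
   outside \<open>A\<close> with fewest blocks is taken off: everything coarser than x in V then
   lies in \<open>A\<close>, so the link of x is a cone whose apex is the join of x with the
   atom.\<close>
 have V0: "?ex V k'" if V: "A <= V" "V <= ?W - H" for V k' using V proof (induction "card V" arbitrary: V k' rule: less_induct)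
  case (less V k')
  have finV: "finite V" by (rule finite_subset[OF less.prems(2) finite_Diff[OF finite_between[OF S]]])
  show ?case proof (cases "V = A")
   case True show ?thesis proof (rule refines_order.exact_cone[where p = "?j (disc S)"]) show "?j (disc S):V" using jd True by simp
    show "refines S (?j (disc S)) (?j (disc S))" using fz(1)[OF partition_on_disc] by (rule refines_refl)
    fix y assume "y:V"
    hence y: "partition_on S y" "together u v y" using True Wp(1) by (auto simp: A_def)
    show "refines S (?j (disc S)) y | refines S y (?j (disc S))"
     using fz(4)[OF partition_on_disc y(1) finer_disc[OF y(1)] y(2)] refines_finer[OF fz(1)[OF partition_on_disc] y(1)] by simp
   qed
  next case False
   hence "\<exists>x. x:V - A" using less.prems by blast
   then obtain x where x: "x:V - A" "!!y. y:V - A ==> card x <= card y" using ex_has_least_nat[of "%x. x:V - A" _ card] by blast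
   have xW: "x:?W - H" using x(1) less.prems by blast
   hence xp: "partition_on S x" using Wp(1) by blast
   show ?thesis proof (rule refines_order.exact_add_vertex[where x = x])
    show "x:V" using x by blast
    show "refines S x x" by (rule refines_refl[OF xp])
    have "card (V - {x}) < card V" using x(1) finV by (intro psubset_card_mono) auto
    thus "?ex (V - {x}) k'" using less.hyps[of "V - {x}"] less.prems x(1) by blast
    have jx: "?j x:A" by (rule jW[OF xW])
    hence jxp: "partition_on S (?j x)" and jxt: "together u v (?j x)" using Wp(1) by (auto simp: A_def)
    have tx: "\<not> together u v x" using x(1) xW by (auto simp: A_def)
    show "?ex (refines_order.link S V x) (k' - 1)" proof (rule refines_order.exact_cone[where p = "?j x"])
     have "?j x ~= x" using jxt tx by metis
     moreover have "refines S x (?j x)" using fz(2) refines_finer[OF xp jxp] by simp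
     ultimately show "?j x:refines_order.link S V x" using jx less.prems(1) unfolding refines_order.link_def by blast
     show "refines S (?j x) (?j x)" by (rule refines_refl[OF jxp])
     fix y assume y: "y:refines_order.link S V x"
     hence y': "y:V" "y ~= x" "refines S x y | refines S y x" by (auto simp: refines_order.link_def)
     hence yp: "partition_on S y" using less.prems(2) Wp(1) by blast
     show "refines S (?j x) y | refines S y (?j x)" proof (cases "refines S y x")
      case True
      thus ?thesis using \<open>refines S x (?j x)\<close> refines_trans by blast
     next case F: False
      hence f: "finer x y" using y'(3) refines_finer[OF xp yp] by blast
      have "card y < card x" using finer_card_less[OF S xp yp f] y'(2) by blast
      hence "y:A" using x(2)[of y] y'(1) by force
      hence "together u v y" by (simp add: A_def)
      thus ?thesis using fz(4)[OF xp yp f] refines_finer[OF jxp yp] by simp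
     qed
    qed
   qed
  qed
 qed
 have "?ex V k" if V: "?W - H <= V" "V <= ?W" for V using V proof (induction "card V" arbitrary: V rule: less_induct)
  case inner: (less V)
  have finV: "finite V" by (rule finite_subset[OF inner.prems(2) finite_between[OF S]])
  show ?case proof (cases "V = ?W - H")
   case True show ?thesis unfolding True by (rule V0[OF AH order_refl])
  next case False
   then obtain x where x: "x:V" "x:H" using inner.prems by blast
   have xW: "x:?W" and jx: "?j x = T" using x(2) by (auto simp: H_def)
   note xp = Wp[OF xW]
   have cx: "card x = Suc (card T)" using fz(6)[OF xp(1)] finer_card_less[OF S xp(1) Tp xp(2,3)] jx by simp
   show ?thesis proof (rule refines_order.exact_add_vertex[where x = x])
    show "x:V" by (rule x(1))
    show "refines S x x" by (rule rr[OF xW])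
    have "card (V - {x}) < card V" using x(1) finV by (intro psubset_card_mono) auto
    thus "?ex (V - {x}) k" using inner.hyps[of "V - {x}"] inner.prems x by blast
    assume k0: "k > 0"
    \<comment> \<open>No partition lies strictly between x and \<open>T\<close>, so the link
      consists of partitions below x. Conversely those have too many blocks to be in
      \<open>H\<close>, and hence are present in V at every stage.\<close>
    have "refines_order.link S V x = between S x" proof (rule equalityI)
     show "refines_order.link S V x <= between S x" proof (rule subsetI)
      fix y assume "y:refines_order.link S V x"
      hence y: "y:V" "y ~= x" "refines S x y | refines S y x" by (auto simp: refines_order.link_def)
      hence yW: "y:?W" using inner.prems(2) by blast
      note yp = Wp[OF yW]
      have "\<not> finer x y" proof
       assume "finer x y"
       hence "card y < card x" using finer_card_less[OF S xp(1) yp(1)] y(2) by blast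
       moreover have "card T < card y" by (rule finer_card_less[OF S yp(1) Tp yp(2,3)])
       ultimately show False using cx by simp
      qed
      hence "finer y x" using y(3) by (simp add: refines_finer[OF xp(1) yp(1)] refines_finer[OF yp(1) xp(1)])
      thus "y:between S x" unfolding between_def using yp(1,4) y(2) by simp
     qed
     show "between S x <= refines_order.link S V x" proof (rule subsetI)
      fix y assume "y:between S x"
      hence y: "partition_on S y" "finer y x" "y ~= x" "y ~= disc S" by (auto simp: between_def)
      have yT: "finer y T" by (rule finer_trans[OF y(2) xp(2)])
      have c: "card x < card y" by (rule finer_card_less[OF S y(1) xp(1) y(2,3)])
      hence nT: "y ~= T" using cx by auto
      have yW: "y:?W" unfolding between_def using y(1,4) yT nT by simp
      have "?j y ~= T" using fz(6)[OF y(1)] c cx by auto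
      hence "y:?W - H" using yW by (simp add: H_def)
      hence "y:V" by (rule subsetD[OF inner.prems(1)])
      thus "y:refines_order.link S V x" using y refines_finer[OF y(1) xp(1)] by (simp add: refines_order.link_def)
     qed
    qed
    moreover have "?ex (between S x) (k - 1)" proof (rule less.hyps)
     show "card S - card x < card S - card T" using cx less.prems(2) by simp
     show "partition_on S x" by (rule xp(1))
     show "k - 1 + card x + 1 < card S" using cx less.prems(2) k0 by simp
    qed
    ultimately show "?ex (refines_order.link S V x) (k - 1)" by simp
   qed
  qed
 qed
 thus ?case by blast
qed

section \<open>Coefficients of formal power series\<close>

lemma mps_nth_simps [simp]: "mps_nth 0 m = 0" "mps_nth (f + g) m = mps_nth f m + mps_nth g m" "mps_nth (- f) m = - mps_nth f m"
 "mps_nth (f - g) m = mps_nth f m - mps_nth g m" by (simp_all add: zero_mps_def plus_mps_def minus_mps_def uminus_mps_def)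

lemma mps_nth_one: "mps_nth 1 m = (if m = 0 then 1 else 0)" by (simp add: one_mps_def)

lemma mps_nth_const: "mps_nth (mps_const c) m = (if m = 0 then c else 0)" by (simp add: mps_const_def)

lemma mps_nth_mult: "mps_nth (f * g) m = (\<Sum>(a, b) | a + b = m. mps_nth f a * mps_nth g b)" by (simp add: times_mps_def)

lemma mps_nth_sum [simp]: "mps_nth (sum f A) m = (SUM a:A. mps_nth (f a) m)" by (induction A rule: infinite_finite_induct) simp_all

lemma mps_nth_const_mult [simp]: "mps_nth (mps_const c * f) m = c * mps_nth f m"
proof -
 have "mps_nth (mps_const c * f) m = (SUM p:{(a, b). a + b = m}. if p = (0, m) then c * mps_nth f m else 0)" unfolding mps_nth_mult
 proof (rule sum_eqI, clarify) fix a b :: "'b \<Rightarrow>\<^sub>0 nat"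
  show "mps_nth (mps_const c) a * mps_nth f b = (if (a, b) = (0, a + b) then c * mps_nth f (a + b) else 0)"
   by (cases "a = 0") (simp_all add: mps_nth_const)
 qed
 thus ?thesis by (simp add: sum.delta[OF finite_monomial_splits])
qed

lemma mps_const_simps [simp]: "mps_const 0 = 0" "mps_const 1 = 1" by (rule mps_eqI, simp add: mps_nth_const mps_nth_one)+

lemma mps_const_hom: "mps_const (a + b) = mps_const a + mps_const b" "mps_const (- a) = - mps_const a"
 "mps_const (a - b) = mps_const a - mps_const b" "mps_const (a * b) = mps_const a * mps_const b" by (rule mps_eqI, simp add: mps_nth_const)+

lemma mps_const_sum: "mps_const (sum f A) = (SUM a:A. mps_const (f a))" by (induction A rule: infinite_finite_induct) (simp_all add: mps_const_hom)

lemma mps_const_prod: "mps_const (prod f A) = (PROD a:A. mps_const (f a))" by (induction A rule: infinite_finite_induct) (simp_all add: mps_const_hom)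

lemma mps_const_power: "mps_const (a^k) = mps_const a^k" by (induction k) (simp_all add: mps_const_hom)

lemma mps_const_of_nat: "mps_const (of_nat k) = of_nat k" by (induction k) (simp_all add: mps_const_hom)

lemma mps_const_prod_mset: "mps_const (\<Prod>a\<in>#M. f a) = (\<Prod>a\<in>#M. mps_const (f a))" by (induction M) (simp_all add: mps_const_hom)

section \<open>Chains of stable partitions and the trace on the top homology\<close>

definition open_below :: "'a set => ('a => 'a) => 'a set set => 'a set set set" where
 "open_below S t X = {M:stab S t. M ~= disc S & M ~= X & finer M X}"

text \<open>The empty chain is included, in accordance with reduced homology.\<close>

definition chains_below :: "'a set => ('a => 'a) => 'a set set => 'a set set set set" where
 "chains_below S t X = {C. C <= open_below S t X & (ALL x:C. ALL y:C. finer x y | finer y x)}"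

lemma finite_open_below: "finite S ==> finite (open_below S t X)" unfolding open_below_def by simp

lemma finite_chains_below: "finite S ==> finite (chains_below S t X)"
 by (rule finite_subset[of _ "Pow (open_below S t X)"]) (auto simp: chains_below_def finite_open_below)

lemma disc_stab:
 assumes "bij_betw t S S"
 shows "disc S:stab S t"
proof -
 have "(`) t`disc S = disc (t`S)" by (simp add: disc_def image_image)
 thus ?thesis using assms partition_on_disc by (auto simp: stab_def bij_betw_def)
qed

lemma chain_has_top:
 assumes S: "finite S" and C: "C:chains_below S t X" "C ~= {}"
 shows "EX M:C. ALL x:C. finer x M"
proof -
 obtain M where M: "M:C" "!!x. x:C ==> card M <= card x" using C(2) ex_has_least_nat[of "%x. x:C" _ card] by blast
 have st: "partition_on S x" if "x:C" for x using C(1) that by (auto simp: chains_below_def open_below_def stab_def)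
 have "finer x M" if x: "x:C" for x proof (rule ccontr)
  assume n: "\<not> finer x M"
  hence f: "finer M x" "M ~= x" using C(1) x M(1) by (auto simp: chains_below_def)
  show False using finer_card_less[OF S st[OF M(1)] st[OF x] f] M(2)[OF x] by simp
 qed
 thus ?thesis using M(1) by blast
qed

text \<open>The nonempty chains are grouped by their coarsest member; removing it changes the sign
  and leaves a chain below it.\<close>

lemma sum_chains_below:
 assumes S: "finite S"
 shows "(SUM C:chains_below S t X. (-1)^card C) =
  (1 :: 'r::comm_ring_1) - (SUM M:open_below S t X. SUM C:chains_below S t M. (-1)^card C)" (is "?l = _")
proof -
 let ?N = "chains_below S t X - {{}}" and ?A = "Sigma (open_below S t X) (chains_below S t)"
 have p: "partition_on S M" if "M:open_below S t X" for M X using that by (auto simp: open_below_def stab_def)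
 have notin: "M ~: C" if "C:chains_below S t M" for M C using that by (auto simp: chains_below_def open_below_def)
 let ?t1 = "(%(M, C). insert M C)"
 have inj: "inj_on ?t1 ?A" proof (rule inj_onI, clarify)
  fix M C N D assume M: "M:open_below S t X" and N: "N:open_below S t X"
   and C: "C:chains_below S t M" and D: "D:chains_below S t N" and e: "insert M C = insert N D"
  have "M:insert N D" "N:insert M C" using e by auto
  hence "finer M N" "finer N M" using C D by (auto simp: chains_below_def open_below_def)
  hence MN: "M = N" by (rule finer_antisym[OF p[OF M] p[OF N]])
  have "C = insert M C - {M}" "D = insert N D - {N}" using notin[OF C] notin[OF D] by auto
  thus "M = N & C = D" using e MN by metis
 qed
 have im: "?t1`?A = ?N" proof (rule equalityI; rule subsetI)
  fix D assume "D:?t1`?A"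
  then obtain M C where M: "M:open_below S t X" and C: "C:chains_below S t M" and D: "D = insert M C" by auto
  have sub: "open_below S t M <= open_below S t X" proof
   fix P assume P: "P:open_below S t M"
   have "P ~= X" proof
    assume "P = X"
    hence "finer M P" "finer P M" using M P by (auto simp: open_below_def)
    hence "M = P" using finer_antisym[OF p[OF M] p[OF P]] by simp
    thus False using P by (simp add: open_below_def)
   qed
   thus "P:open_below S t X" using P M finer_trans by (auto simp: open_below_def)
  qed
  show "D:?N" using M C sub unfolding D chains_below_def by (auto simp: open_below_def)
 next fix D assume D: "D:?N"
  hence D': "D:chains_below S t X" "D ~= {}" by auto
  from chain_has_top[OF S D'] obtain M where M: "M:D" "ALL x:D. finer x M" by blast
  have MX: "M:open_below S t X" using D'(1) M(1) by (auto simp: chains_below_def)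
  have "D - {M}:chains_below S t M" using D'(1) M by (auto simp: chains_below_def open_below_def)
  hence "(M, D - {M}):?A" using MX by simp
  moreover have "D = ?t1 (M, D - {M})" using M(1) by auto
  ultimately show "D:?t1`?A" by (rule rev_image_eqI)
 qed
 have e: "{}:chains_below S t X" by (simp add: chains_below_def)
 have fC: "finite C" if "C:chains_below S t M" for C M
  by (rule finite_subset[OF _ finite_open_below[OF S, of t M]]) (use that in \<open>simp add: chains_below_def\<close>)
 have "?l = (1 :: 'r) + (SUM C:?N. (-1)^card C)" by (subst sum.remove[OF finite_chains_below[OF S] e]) simp
 also have "(SUM C:?N. (-1)^card C) = (SUM (M, C):?A. (-1 :: 'r)^card (insert M C))"
  unfolding im[symmetric] by (subst sum.reindex[OF inj]) (simp add: case_prod_unfold comp_def)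
 also have "... = (SUM (M, C):?A. - ((-1)^card C))" proof (rule sum_eqI, clarify)
  fix M C assume C: "C:chains_below S t M" show "(-1 :: 'r)^card (insert M C) = - ((-1)^card C)" using fC[OF C] notin[OF C] by simp
 qed
 also have "... = (SUM M:open_below S t X. SUM C:chains_below S t M. - ((-1)^card C))"
  by (rule sum.Sigma[symmetric]) (simp_all add: finite_open_below[OF S] finite_chains_below[OF S])
 finally show ?thesis by (simp add: sum_negf)
qed

lemma minv_same_disc:
 fixes S :: "nat set"
 assumes S: "finite S" and b: "bij_betw t S S"
 shows "minv same_weight t (disc S) (disc S) = (1 :: 'r::comm_ring_1)"
proof -
 note dS = disc_stab[OF b]
 have UX: "\<Union>(disc S) = S" by (auto simp: disc_def)
  have "interval t (disc S) (disc S) = {disc S}" proof (rule equalityI; rule subsetI)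
   fix M assume "M:interval t (disc S) (disc S)"
   hence M: "M:stab S t" "finer (disc S) M" "finer M (disc S)" by (auto simp: interval_def UX)
   thus "M:{disc S}" using finer_antisym[OF partition_on_disc, of S M] by (auto simp: stab_def)
  qed (use dS in \<open>simp add: interval_def UX\<close>)
  thus ?thesis using minv_sum[OF S dS finer_refl, of "same_weight :: _ => _ => _ => 'r"] by (simp add: same_weight_def)
qed

text \<open>Philip Hall's theorem for the poset of stable partitions\<close>

lemma minv_chains:
 fixes S :: "nat set"
 assumes S: "finite S" and b: "bij_betw t S S" and X: "X:stab S t" "X ~= disc S"
 shows "minv same_weight t (disc S) X = - (SUM C:chains_below S t X. (-1 :: 'r::comm_ring_1)^card C)" using X
proof (induction "card S - card X" arbitrary: X rule: less_induct) case less
 let ?m = "minv same_weight t (disc S) :: _ => 'r"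
 note dS = disc_stab[OF b]
 have Xp: "partition_on S X" using less.prems by (simp add: stab_def)
 have fX: "finer (disc S) X" by (rule finer_disc[OF Xp])
 have UX: "\<Union>X = S" "\<Union>(disc S) = S" using stabD(3)[OF less.prems(1)] by (auto simp: disc_def)
 have cle: "card x <= card S" if "partition_on S x" for x proof (cases "x = disc S")
  case True
  thus ?thesis by (simp add: disc_def card_image_le[OF S])
 next case False
  hence "card x < card (disc S)" using finer_card_less[OF S partition_on_disc that finer_disc[OF that]] by blast
  thus ?thesis using card_image_le[OF S, of "%i. {i}"] by (simp add: disc_def)
 qed
 have md: "?m (disc S) = 1" by (rule minv_same_disc[OF S b])
 have int: "interval t (disc S) X = insert (disc S) (insert X (open_below S t X))"
  using dS less.prems fX finer_disc by (auto simp: interval_def open_below_def UX stab_def)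
 let ?t1 = "(SUM M:open_below S t X. SUM C:chains_below S t M. (-1)^card C)"
 have "(SUM M:interval t (disc S) X. ?m M) = ?m (disc S) + (?m X + (SUM M:open_below S t X. ?m M))"
  unfolding int using less.prems finite_open_below[OF S, of t X] by (subst sum.insert) (auto simp: open_below_def)
 moreover have "(SUM M:interval t (disc S) X. ?m M) = 0"
  using minv_sum[OF S less.prems(1) fX, of "same_weight :: _ => _ => _ => 'r"] less.prems(2) by (simp add: same_weight_def)
 moreover have "(SUM M:open_below S t X. ?m M) = (SUM M:open_below S t X. - (SUM C:chains_below S t M. (-1)^card C))" proof (rule sum_eqI, goal_cases)
  case (1 M)
  hence M: "M:stab S t" "M ~= disc S" "M ~= X" "finer M X" by (auto simp: open_below_def)
  have Mp: "partition_on S M" using M by (simp add: stab_def)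
  have "card X < card M" by (rule finer_card_less[OF S Mp Xp M(4,3)])
  hence "card S - card M < card S - card X" using cle[OF Mp] by linarith
  thus ?case by (rule less.hyps[OF _ M(1,2)])
 qed
 ultimately have e: "1 + (?m X + - ?t1) = 0" unfolding md by (simp add: sum_negf)
 have c: "(SUM C:chains_below S t X. (-1 :: 'r)^card C) = 1 - ?t1" by (rule sum_chains_below[OF S])
 have "?m X + (SUM C:chains_below S t X. (-1)^card C) = 0" unfolding c using e by (simp add: algebra_simps)
 thus ?case by (simp add: eq_neg_iff_add_eq_0)
qed

text \<open>Induction on the ground set. A fixed point is a cycle of its own; otherwise a
  transposition takes the point out of its cycle, which keeps the number of cycles, lowers the
  number of points by one and changes the sign.\<close>

lemma sign_cycles:
 assumes "finite S" "t permutes S"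
 shows "(sign t :: int) * (-1)^card S = (-1)^card (orbit t`S)" using assms
proof (induction S arbitrary: t rule: finite_induct) case empty
 thus ?case by simp
next case (insert a S)
 note p = insert.prems
 have perm: "permutation t" using p insert.hyps(1) by (auto simp: permutation_permutes)
 show ?case proof (cases "t a = a")
  case True
  have pS: "t permutes S" using permutes_subset[OF permutes_superset[OF p, of S]] True by auto
  have oa: "orbit t a = {a}" using True by (simp add: orbit_eq_singleton_iff)
  have "{a} ~: orbit t`S" proof
   assume "{a}:orbit t`S"
   then obtain x where x: "x:S" "orbit t x = {a}" by auto
   have "x:orbit t x" by (rule permutation_self_in_orbit[OF perm])
   thus False using x insert.hyps(2) by auto
  qed
  hence "card (orbit t`insert a S) = Suc (card (orbit t`S))" using insert.hyps(1) by (simp add: oa)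
  thus ?thesis using insert.IH[OF pS] insert.hyps by (simp add: algebra_simps)
 next case False
  define q where "q = transpose a (t a) \<circ> t"
  have piaS: "t a:S" using permutes_in_image[OF p, of a] False by auto
  have inj: "inj t" by (rule permutes_inj[OF p])
  have qp: "q permutes insert a S" unfolding q_def by (rule permutes_compose[OF p permutes_swap_id]) (use piaS in auto)
  have qa: "q a = a" by (simp add: q_def)
  have qS: "q permutes S" using permutes_superset[OF qp, of S] qa by auto
  have qx: "q x = (if t x = a then t a else t x)" if "x ~= a" for x using that inj_eq[OF inj, of x a] by (simp add: q_def transpose_def)
  have s: "sign q = - sign t" unfolding q_def using sign_compose[OF permutation_swap_id perm] False by (simp add: sign_swap_id)
  have oq: "orbit q x = orbit t x - {a}" if x: "x:S" for x proof (rule equalityI; rule subsetI)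
   fix y assume "y:orbit q x"
   thus "y:orbit t x - {a}" proof induction
    case base
    have "x ~= a" using x insert.hyps(2) by auto
    thus ?case using qx[of x] False by (auto intro: orbit.intros)
   next case (step y)
    hence "y ~= a" by auto
    thus ?case using qx[of y] False step.IH by (auto intro: orbit.intros)
   qed
  next fix y assume "y:orbit t x - {a}"
   hence y: "y:orbit t x" "y ~= a" by auto
   have xa: "x ~= a" using x insert.hyps(2) by auto
   have "(y ~= a --> y:orbit q x) & (y = a --> t a:orbit q x)" using y(1) proof induction
    case base show ?case using orbit.base[of q x] qx[OF xa] by (auto split: if_splits)
   next case (step y)
    show ?case proof (cases "y = a")
     case True
     thus ?thesis using step.IH False by auto
    next case ya: False
     hence "q y:orbit q x" using step.IH by (auto intro: orbit.step)
     thus ?thesis using qx[OF ya] by (auto split: if_splits)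
    qed
   qed
   thus "y:orbit q x" using y(2) by simp
  qed
  have oin: "orbit t`insert a S = orbit t`S" proof -
   have "orbit t a = orbit t (t a)" using permutation_orbit_step[OF perm] by simp
   thus ?thesis using piaS by auto
  qed
  have "orbit q`S = (%c. c - {a})`orbit t`S" using oq by (simp add: image_image)
  moreover have "inj_on (%c. c - {a}) (orbit t`S)" proof (rule inj_onI, clarify)
   fix x y assume x: "x:S" and y: "y:S" and e: "orbit t x - {a} = orbit t y - {a}"
   have "x:orbit t x - {a}" using permutation_self_in_orbit[OF perm, of x] x insert.hyps(2) by auto
   hence xy: "x:orbit t y" unfolding e by simp
   show "orbit t x = orbit t y" by (rule orbit_cyclic_eq3[OF cyclic_on_orbit[OF p] xy]) (use insert.hyps(1) in simp)
  qed
  ultimately have "card (orbit q`S) = card (orbit t`S)" by (simp add: card_image)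
  thus ?thesis using insert.IH[OF qS] insert.hyps unfolding oin by (simp add: s)
 qed
qed

text \<open>No chain has m - 1 members, so there are no boundaries to divide out and the trace is
  one on cycles. In it only chains fixed by \<open>t\<close> count, and as the members of a chain
  have different numbers of blocks, all members of a fixed chain are fixed. What remains is the
  alternating sum over chains of stable partitions.\<close>

lemma trace_top_homology:
 assumes m: "m \<ge> 1" and p: "t permutes {1..m}"
 shows "subquot_trace (cycles (proper_part m) (refines {1..m}) (m - 2)) (boundaries (proper_part m) (refines {1..m}) (m - 2))
   (%v. pm_scale (of_int (sign t)) (lin_ext (%C. basis_vec (perm_partition t`C)) v)) =
   - ((-1)^card (orbit t`{1..m}) * minv same_weight t (disc {1..m}) {{1..m}})"
proof -
 let ?S = "{1..m}" and ?V = "proper_part m" and ?leq = "refines {1..m}" and ?tau = "perm_partition t"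
 let ?\<Delta> = "simplices ?V ?leq" and ?s = "of_int (sign t) :: complex"
 let ?T = "%v. pm_scale ?s (lin_ext (%C. basis_vec (?tau`C)) v)"
 have inj: "inj t" by (rule permutes_inj[OF p])
 have tau: "?tau = (`) ((`) t)" by (rule ext) (simp add: perm_partition_def)
 note injP = inj_on_image_Pow[OF inj, unfolded Pow_UNIV]
 have injt: "inj ?tau" unfolding tau using inj_on_image_Pow[OF injP, unfolded Pow_UNIV] .
 note injt' = inj_on_subset[OF injt subset_UNIV]
 have V: "?V = between ?S {?S}" proof -
  have "finer X {?S}" if "partition_on ?S X" for X by (rule finer_one_block) (use that in \<open>simp add: partition_on_def\<close>)
  thus ?thesis by (auto simp: proper_part_def set_partitions_def between_def disc_def)
 qed
 have oneS: "partition_on ?S {?S}" using m by (intro partition_on_space) auto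
 have finV: "finite ?V" unfolding V by (rule finite_between) simp
 have Vp: "partition_on ?S X" if "X:?V" for X using that by (simp add: V between_def)
 have bij: "bij_betw t ?S ?S" by (rule permutes_imp_bij[OF p])
 have leq: "?leq X M \<longleftrightarrow> finer X M" if "X:?V" "M:?V" for X M by (rule refines_finer[OF Vp[OF that(1)] Vp[OF that(2)]])
 have tV: "?tau X:?V" if X: "X:?V" for X proof -
  have "?tau {?S} = {?S}" using permutes_image[OF p] by (simp add: tau)
  moreover have "?tau (disc ?S) = disc (t`?S)" by (simp add: tau disc_def image_image)
  moreover have "?tau X ~= ?tau {?S}" "?tau X ~= ?tau (disc ?S)" using X unfolding V between_def by (simp_all add: inj_eq[OF injt])
  moreover have "partition_on ?S (?tau X)" using partition_on_image_iff[OF permutes_inj_on[OF p] partition_on_subset_Pow[OF Vp[OF X]]] Vp[OF X]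
   unfolding tau permutes_image[OF p] by (rule iffD2)
  ultimately show ?thesis unfolding permutes_image[OF p] by (simp add: proper_part_def set_partitions_def disc_def)
 qed
 have tleq: "?leq (?tau X) (?tau M) \<longleftrightarrow> ?leq X M" if X: "X:?V" "M:?V" for X M proof -
  have "X <= Pow ?S" "M <= Pow ?S" using Vp[OF X(1)] Vp[OF X(2)] by (auto simp: partition_on_def)
  from finer_image[OF permutes_inj_on[OF p] this] show ?thesis unfolding leq[OF X] leq[OF tV[OF X(1)] tV[OF X(2)]] by (simp add: tau)
 qed
 have cdisc: "card (disc ?S) = m" unfolding disc_def by (simp add: card_image)
 have Vc: "1 < card X & card X < m" if X: "X:?V" for X proof -
  have X': "finer X {?S}" "X ~= {?S}" "disc ?S ~= X" using X unfolding V between_def by auto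
  have "card {?S} < card X" by (rule finer_card_less[OF _ Vp[OF X] oneS X'(1,2)]) simp
  moreover have "card X < card (disc ?S)" by (rule finer_card_less[OF _ partition_on_disc Vp[OF X] finer_disc[OF Vp[OF X]] X'(3)]) simp
  ultimately show ?thesis unfolding cdisc by simp
 qed
 have ceq: "X = M" if XM: "X:?V" "M:?V" "card X = card M" "?leq X M | ?leq M X" for X M
  using XM(3,4) finer_card_less[OF finite_atLeastAtMost Vp[OF XM(1)] Vp[OF XM(2)]] finer_card_less[OF finite_atLeastAtMost Vp[OF XM(2)] Vp[OF XM(1)]]
  unfolding leq[OF XM(1,2)] leq[OF XM(2,1)] by (metis less_irrefl)
 have sD: "C <= ?V" "finite C" "card C = k" "x:C ==> y:C ==> ?leq x y | ?leq y x" if "C:?\<Delta> k" for C k x y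
  using that by (auto simp: simplices_def)
 have chain_card: "k <= m - 2" if C: "C:?\<Delta> k" for C k proof -
  have "inj_on card C" by (rule inj_onI) (use ceq sD[OF C] in blast)
  moreover have "card`C <= {2..m - 1}" using Vc sD(1)[OF C] by fastforce
  ultimately have "card C <= card {2..m - 1}" by (rule card_inj_on_le) simp
  thus ?thesis using sD(3)[OF C] by simp
 qed
 have tS: "?tau`C:?\<Delta> k" if C: "C:?\<Delta> k" for C k proof -
  have "card (?tau`C) = card C" by (rule card_image[OF injt'])
  thus ?thesis using C sD(1)[OF C] tV tleq unfolding simplices_def by (simp add: subset_eq)
 qed
 have Tb: "?T (basis_vec C) = pm_scale ?s (basis_vec (?tau`C))" for C by simp
 \<comment> \<open>The numbers of blocks along a chain are distinct and lie between 2 and m - 1. For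
   m = 1 the proper part is empty, which agrees with the truncated subtraction.\<close>
 have "?\<Delta> (Suc (m - 2)) = {}" using chain_card[of _ "Suc (m - 2)"] by fastforce
 hence bd0: "boundaries ?V ?leq (m - 2) = {0}" unfolding boundaries_def chain_space_def by (simp add: refines_order.bd)
 let ?t1 = "(SUM k<=m - 2. (-1)^(m - 2 - k) * op_trace (?\<Delta> k) ?T)"
 let ?t3 = "(SUM C:chains_below ?S t {?S}. (-1)^card C)"
 have "subquot_trace (cycles ?V ?leq (m - 2)) {0} ?T = ?t1" proof (rule refines_order.trace_top_cycles[OF finV _ linmap_scale[OF linmap_lin_ext]])
  show "refines_order.exact_at ?S ?V k" if "k < m - 2" for k unfolding V by (rule exact_between[OF _ oneS]) (use that in auto)
  show "?T (basis_vec C):supported (?\<Delta> k)" if "C:?\<Delta> k" for k C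
   unfolding Tb by (rule supported_simps(2), rule supported_simps(6), rule tS[OF that])
  fix k C assume C: "C:?\<Delta> k"
  have "boundary ?leq (basis_vec (?tau`C)) = (SUM x:C. pm_scale (refines_order.sgn_at ?S x C) (basis_vec (?tau`(C - {x}))))"
   unfolding refines_order.boundary_basis proof (subst sum.reindex[OF injt'], rule sum_eqI, goal_cases)
   case x: (1 x)
   have "?leq (?tau y) (?tau x) \<longleftrightarrow> ?leq y x" if "y:C" for y using tleq sD(1)[OF C] x that by blast
   hence "{y:?tau`C. y ~= ?tau x & ?leq y (?tau x)} = ?tau`{y:C. y ~= x & ?leq y x}" by (auto simp: inj_eq[OF injt])
   moreover have "?tau`C - {?tau x} = ?tau`(C - {x})" using inj_eq[OF injt] by auto
   ultimately show ?case by (simp add: card_image[OF injt'])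
  qed
  thus "boundary ?leq (?T (basis_vec C)) = ?T (boundary ?leq (basis_vec C))"
   unfolding Tb refines_order.bd(2) refines_order.boundary_basis linmapD(4)[OF linmap_lin_ext] linmapD(2)[OF linmap_lin_ext] lin_ext_basis by simp
 qed
 also have "... = ?s * (-1)^(m - 2) * ?t3" proof -
  let ?F = "%k. {C:?\<Delta> k. C <= stab ?S t}"
  have fixed: "?tau`C = C \<longleftrightarrow> C <= stab ?S t" if C: "C:?\<Delta> k" for C k proof -
   have st: "x:stab ?S t \<longleftrightarrow> ?tau x = x" if "x:C" for x using Vp that sD(1)[OF C] by (auto simp: stab_def tau)
   have f: "?tau x = x" if e: "?tau`C = C" and x: "x:C" for x proof (rule ceq)
    have tx: "?tau x:C" using e x by blast
    thus "?tau x:?V" "x:?V" "?leq (?tau x) x | ?leq x (?tau x)" using sD[OF C] x by auto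
    show "card (?tau x) = card x" unfolding tau by (rule card_image[OF inj_on_subset[OF injP subset_UNIV]])
   qed
   show ?thesis proof
    assume e: "?tau`C = C" show "C <= stab ?S t" by (rule subsetI) (simp only: st f[OF e])
   next
    assume "C <= stab ?S t"
    hence "?tau x = x" if "x:C" for x unfolding st[OF that, symmetric] using that by (rule subsetD)
    from image_cong[where g = "%x. x", OF refl this] show "?tau`C = C" by simp
   qed
  qed
  let ?t4 = "(UN k<=m - 2. ?F k)"
  have ch: "chains_below ?S t {?S} = ?t4" proof -
   have o: "open_below ?S t {?S} = ?V Int stab ?S t" by (auto simp: V between_def open_below_def stab_def)
   have l: "?leq x y \<longleftrightarrow> finer x y" if "C <= ?V" "x:C" "y:C" for C x y by (rule leq) (use that in blast)+
   have c: "C:chains_below ?S t {?S} \<longleftrightarrow> C:?F (card C)" for C proof (cases "C <= ?V")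
    case True
    thus ?thesis unfolding chains_below_def simplices_def o using finite_subset[OF True finV] l[OF True] by (simp add: conj_commute)
   next case False
    thus ?thesis unfolding chains_below_def simplices_def o by simp
   qed
   show ?thesis proof (intro equalityI subsetI)
    fix C assume "C:chains_below ?S t {?S}"
    hence F: "C:?F (card C)" unfolding c .
    hence "card C <= m - 2" using chain_card[of C "card C"] by simp
    with F show "C:?t4" by (intro UN_I[of "card C"]) simp_all
   next fix C assume "C:?t4"
    then obtain k where k: "C:?F k" by (rule UN_E)
    hence "card C = k" using sD(3)[of C k] by simp
    with k show "C:chains_below ?S t {?S}" unfolding c by simp
   qed
  qed
  have ot: "op_trace (?\<Delta> k) ?T = ?s * of_nat (card (?F k))" for k proof -
   have "op_trace (?\<Delta> k) ?T = (SUM C:?\<Delta> k. ?s * (if C <= stab ?S t then 1 else 0))"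
    unfolding op_trace_def Tb by (rule sum_eqI) (use fixed in \<open>auto simp: lookup_single when_def\<close>)
   thus ?thesis unfolding sum_distrib_left[symmetric] sum.If_cases[OF refines_order.finite_simplices[OF finV]] by (simp add: Collect_conj_eq)
  qed
  have "?t1 = (SUM k<=m - 2. ?s * (-1)^(m - 2) * (SUM C:?F k. (-1)^card C))" proof (intro sum.cong refl, goal_cases)
   case (1 k)
   have "(SUM C:?F k. (-1 :: complex)^card C) = (SUM C:?F k. (-1)^k)" by (rule sum.cong) (auto simp: simplices_def)
   moreover have "(-1 :: complex)^(m - 2 - k) = (-1)^(m - 2) * (-1)^k" using 1 by (auto simp: minus_one_power_iff; presburger)
   ultimately show ?case unfolding ot by (simp only: sum_constant mult_ac)
  qed
  also have "... = ?s * (-1)^(m - 2) * ?t3" unfolding sum_distrib_left[symmetric] ch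
   by (subst sum.UNION_disjoint) (auto simp: simplices_def intro: finite_subset[OF _ refines_order.finite_simplices[OF finV]])
  finally show ?thesis .
 qed
 also have "... = - ((-1)^card (orbit t`?S) * minv same_weight t (disc ?S) {?S})" proof -
  have "of_int (sign t * (-1)^card ?S) = (of_int ((-1)^card (orbit t`?S)) :: complex)" by (rule arg_cong[OF sign_cycles[OF _ p]]) simp
  hence sg: "?s * (-1)^m = (-1)^card (orbit t`?S)" by simp
  let ?t2 = "(SUM C:chains_below ?S t {?S}. (-1 :: complex)^card C)"
  show ?thesis proof (cases "m = 1")
   case True
   hence d: "{?S} = disc ?S" by (auto simp: disc_def)
   have "M ~: open_below ?S t (disc ?S)" for M
    using finer_antisym[OF _ partition_on_disc _ finer_disc, of ?S M] by (auto simp: open_below_def stab_def)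
   hence "open_below ?S t (disc ?S) = {}" by blast
   hence "?t2 = 1" using sum_chains_below[of ?S t "disc ?S", where ?'r = complex] unfolding d by simp
   moreover have "minv same_weight t (disc ?S) {?S} = (1 :: complex)" unfolding d by (rule minv_same_disc[OF _ bij]) simp
   ultimately show ?thesis unfolding sg[symmetric] using True by simp
  next case False
   hence m2: "m \<ge> 2" using m by simp
   have "{?S} ~= disc ?S"
   proof
    assume "{?S} = disc ?S"
    from arg_cong[where f = card, OF this] show False using cdisc False by simp
   qed
   hence c: "?t2 = - minv same_weight t (disc ?S) {?S}" using minv_chains[OF _ bij stab_one_block[OF bij], where ?'r = complex] m by simp
   have "(-1 :: complex)^(m - 2) = (-1)^m" using m2 by (simp add: minus_one_power_iff)
   thus ?thesis unfolding c sg[symmetric] by simp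
  qed
 qed
 finally show ?thesis unfolding bd0 .
qed

text \<open>The sign counting the cycles is absorbed by negating the power sums, one factor for each
  cycle.\<close>

lemma sym_L_formula:
 assumes "m \<ge> 1"
 shows "sym_L m = - (mps_const (1 / fact m) * (\<Sum>t | t permutes {1..m}.
   mps_const (minv same_weight t (disc {1..m}) {{1..m}}) * cyc_prod (%k. - sym_p k) t {1..m}))"
proof -
 have c: "cyc_prod (%k. - sym_p k) t {1..m} = (-1)^card (orbit t`{1..m}) * cyc_prod sym_p t {1..m}" for t unfolding cyc_prod_def by (rule prod_uminus)
 have k: "mps_const (- ((-1)^j * a)) = (- ((-1)^j * mps_const a) :: symfun)" for j :: nat and a :: complex
  by (simp add: mps_const_hom mps_const_power)
 have neg: "- (a * sum f A) = a * (SUM x:A. - f x)" for a :: symfun and f :: "'z => symfun" and A by (simp add: sum_negf)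
 show ?thesis unfolding sym_L_def frobenius_ch_def neg proof (rule arg_cong[where f = "%x. mps_const (1 / fact m) * x"], rule sum_eqI, goal_cases)
  case (1 t)
  hence p: "t permutes {1..m}" by simp
  show ?case unfolding trace_top_homology[OF assms p] c k by (simp add: cyc_prod_def algebra_simps)
 qed
qed

section \<open>The recursion on initial segments\<close>

lemma natural_weight_hom:
 assumes w: "natural_weight w" and h: "h 1 = 1" "!!a b. h (a * b) = h a * h b"
 shows "natural_weight (%t P X. h (w t P X))"
proof -
 interpret natural_weight w by (rule w)
 show ?thesis proof
  fix S X P and g t t' :: "nat => nat" assume a: "finite S" "bij_betw t S S" "X:stab S t" "P:stab S t" "finer P X" "inj_on g S"
   and c: "!!x. x:S ==> t' (g x) = g (t x)"
  show "h (w t' ((`) g`P) ((`) g`X)) = h (w t P X)" by (rule arg_cong[OF iso[OF a c]])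
 next fix S1 S2 X1 X2 P1 P2 and t :: "nat => nat"
  assume "finite S1" "finite S2" "S1 Int S2 = {}" "bij_betw t S1 S1" "bij_betw t S2 S2"
   "X1:stab S1 t" "P1:stab S1 t" "finer P1 X1" "X2:stab S2 t" "P2:stab S2 t" "finer P2 X2"
  from union[OF this] show "h (w t (P1 Un P2) (X1 Un X2)) = h (w t P1 X1) * h (w t P2 X2)" by (simp only: h)
 next fix B r X M P and t :: "nat => nat"
  assume a: "block_cycle t B r X" "M:stab (\<Union>X) t" "P:stab (\<Union>X) t" "finer P M" "finer M X"
  show "h (w t P M) = h (w (t ^^ r) (below P B) (below M B))" by (rule arg_cong[OF cycle[OF a]])
 next
  show "h (w t {} {}) = 1" for t :: "nat => nat" by (simp only: empty h)
 qed
qed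

text \<open>These are \<open>full\<close> and \<open>core\<close> of \<open>weight_family\<close> on
  an initial segment, with the marker \<open>eta\<close> of the single block taken out of the
  core.\<close>

definition weight_full where "weight_full w phi zeta eta n = (\<Sum>t | t permutes {1..n}. cyc_prod phi t {1..n} *
   (SUM X:stab {1..n} t. (PROD x:X. eta (card x)) * (\<Sum>P | P:stab {1..n} t & finer P X. w t P X * (PROD y:P. zeta (card y)))))"

definition weight_core where "weight_core w phi zeta r s = (\<Sum>sigma | sigma permutes {1..s}. cyc_prod (%k. phi (r * k)) sigma {1..s} *
   (SUM P:stab {1..s} sigma. w sigma P {{1..s}} * (PROD y:P. zeta (card y)^r)))"

text \<open>The recursions for the cycle index, the Lie index, the Peirce series and the series of
  words are all instances; they differ only in the weight and the three markers.\<close>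

theorem weight_recursion:
 fixes w :: "(nat => nat) => nat set set => nat set set => 'r::comm_ring_1"
 assumes w: "natural_weight w" and ifact: "!!n. of_nat (fact n) * ifact n = (1::'r)"
 shows "of_nat n * (ifact n * weight_full w phi zeta eta n) =
  (\<Sum>k=1..n. (\<Sum>s | s dvd k. of_nat s * (ifact s * (eta s^(k div s) * weight_core w phi zeta (k div s) s))) *
    (ifact (n - k) * weight_full w phi zeta eta (n - k)))"
proof -
 interpret natural_weight w by (rule w)
 interpret fam: natural_family "weight_family w phi zeta eta" by (rule natural_weight_family)
 have full: "fam.full {1..n} = weight_full w phi zeta eta n" for n proof -
  have "fam.full {1..n} = (\<Sum>t | t permutes {1..n}. SUM X:stab {1..n} t. weight_family w phi zeta eta 1 t X)" by (rule fam.full_nested) simp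
  also have "... = weight_full w phi zeta eta n" unfolding weight_full_def proof (rule sum_eqI, goal_cases)
   case (1 t) show ?case proof (subst sum_distrib_left, rule sum_eqI, goal_cases)
    case (1 X)
    hence "\<Union>X = {1..n}" by (rule stabD)
    thus ?case unfolding weight_family_def by (simp add: mult.assoc)
   qed
  qed
  finally show ?thesis .
 qed
 have core: "fam.core r {1..s} = eta s^r * weight_core w phi zeta r s" for r s unfolding fam.core_def weight_core_def
 proof (subst sum_distrib_left, rule sum_eqI, goal_cases) case (1 sigma)
  have "{P:stab {1..s} sigma. finer P {{1..s}}} = stab {1..s} sigma" proof -
   have "finer P {{1..s}}" if "P:stab {1..s} sigma" for P by (rule finer_one_block) (use stabD(3)[OF that] in simp)
   thus ?thesis by blast
  qed
  thus ?case unfolding weight_family_def by (simp add: mult_ac)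
 qed
 show ?thesis using fam.full_recursion[OF ifact, of n] unfolding full core .
qed

text \<open>As the marker \<open>zeta\<close>, the indicator of size 1 leaves only the discrete
  partition in the inner sum of a weighted family.\<close>

lemma prod_indicator_disc:
 fixes S :: "nat set"
 assumes "finite S" "partition_on S P"
 shows "(PROD y:P. if card y = 1 then 1 else 0) = (if P = disc S then 1 else (0 :: 'r::comm_ring_1))"
proof (cases "P = disc S") case True
 have "(PROD y:disc S. if card y = 1 then 1 else (0 :: 'r)) = 1" by (rule prod.neutral) (auto simp: disc_def)
 thus ?thesis using True by simp
next case False
 have "EX y:P. card y ~= 1" proof (rule ccontr)
  assume n: "\<not> (EX y:P. card y ~= 1)"
  have "finer P (disc S)" unfolding finer_def proof
   fix y assume y: "y:P"
   then obtain i where i: "y = {i}" using n by (metis card_1_singletonE)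
   hence "i:S" using y assms(2) by (auto simp: partition_on_def)
   thus "EX x:disc S. y <= x" using i by (auto simp: disc_def)
  qed
  thus False using False finer_antisym[OF assms(2) partition_on_disc _ finer_disc[OF assms(2)]] by blast
 qed
 moreover have "finite P" by (rule finite_elements[OF assms])
 ultimately have "(PROD y:P. if card y = 1 then 1 else (0 :: 'r)) = 0" by (intro prod_zero) auto
 thus ?thesis using False by simp
qed

lemma sum_disc_weight:
 fixes S :: "nat set" and f :: "nat set set => 'r::comm_ring_1"
 assumes S: "finite S" "bij_betw t S S"
 shows "X:stab S t ==> (\<Sum>P | P:stab S t & finer P X. f P * (PROD y:P. if card y = 1 then 1 else 0)) = f (disc S)"
  "r > 0 ==> (SUM P:stab S t. f P * (PROD y:P. (if card y = 1 then 1 else 0)^r)) = f (disc S)"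
proof -
 have e: "f P * (PROD y:P. if card y = 1 then 1 else 0) = (if P = disc S then f (disc S) else 0)" if "P:stab S t" for P
  unfolding prod_indicator_disc[OF S(1) stabD(1)[OF that]] by simp
 note d = disc_stab[OF S(2)]
 let ?t1 = "(\<Sum>P | P:stab S t & finer P X. f P * (PROD y:P. if card y = 1 then 1 else 0))"
 show "?t1 = f (disc S)" if X: "X:stab S t" proof -
  have "?t1 = (\<Sum>P | P:stab S t & finer P X. if P = disc S then f (disc S) else 0)" by (rule sum_eqI) (use e in blast)
  thus ?thesis using d finer_disc[OF stabD(1)[OF X]] finite_stab[OF S(1)] by (simp add: sum.delta)
 qed
 assume r: "r > 0"
 have p: "(if c then 1 else (0 :: 'r))^r = (if c then 1 else 0)" for c using r by (simp add: zero_power)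
 let ?t2 = "(SUM P:stab S t. f P * (PROD y:P. (if card y = 1 then 1 else 0)^r))"
 have "?t2 = (SUM P:stab S t. if P = disc S then f (disc S) else 0)" unfolding p by (rule sum_eqI) (rule e)
 thus "?t2 = f (disc S)" using d finite_stab[OF S(1)] by (simp add: sum.delta)
qed

section \<open>Cycle index and Lie index\<close>

abbreviation sym_ifact :: "nat => ('v, complex) mps" where "sym_ifact n \<equiv> mps_const (1 / fact n)"

lemma sym_ifact: "of_nat (fact n) * sym_ifact n = (1 :: ('v, complex) mps)"
proof -
 have "of_nat (fact n) * sym_ifact n = (mps_const (of_nat (fact n) * (1 / fact n)) :: ('v, complex) mps)"
  by (simp only: mps_const_hom mps_const_of_nat)
 thus ?thesis by simp
qed

text \<open>The symmetric function h_n as a polynomial in the power sums, with free values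
  \<open>x k\<close> in place of p_k, so that plethysm becomes substitution.\<close>

definition cycle_index :: "nat => (nat => ('v, complex) mps) => ('v, complex) mps" where
 "cycle_index n x = sym_ifact n * (\<Sum>t | t permutes {1..n}. cyc_prod x t {1..n})"

text \<open>The same for \<open>sym_L\<close>. The outer minus sign and the negated arguments are
  those of \<open>sym_L_formula\<close>.\<close>

definition lie_index :: "nat => (nat => ('v, complex) mps) => ('v, complex) mps" where "lie_index n x = - (sym_ifact n * (\<Sum>t | t permutes {1..n}.
   mps_const (minv same_weight t (disc {1..n}) {{1..n}}) * cyc_prod (%k. - x k) t {1..n}))"

lemma cycle_index_0 [simp]: "cycle_index 0 x = 1" by (simp add: cycle_index_def)

lemma weight_disc:
 fixes w :: "(nat => nat) => nat set set => nat set set => 'r::comm_ring_1"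
 shows "weight_full w x (%m. if m = 1 then 1 else 0) (%_. 1) n =
   (\<Sum>t | t permutes {1..n}. cyc_prod x t {1..n} * (SUM X:stab {1..n} t. w t (disc {1..n}) X))"
  and "r > 0 ==> weight_core w x (%m. if m = 1 then 1 else 0) r n =
   (\<Sum>sigma | sigma permutes {1..n}. cyc_prod (%k. x (r * k)) sigma {1..n} * w sigma (disc {1..n}) {{1..n}})"
 unfolding weight_full_def weight_core_def by (rule sum_eqI, simp add: sum_disc_weight[OF finite_atLeastAtMost permutes_imp_bij] del: One_nat_def)+

lemma one_block_disc: "{{1..n}} = disc {1..n::nat} \<longleftrightarrow> n = 1"
proof
 assume "{{1..n}} = disc {1..n}"
 hence "card ((%i. {i})`{1..n}) = 1" unfolding disc_def by (metis card_1_singleton_iff One_nat_def)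
 thus "n = 1" by (simp add: card_image)
qed (simp add: disc_def)

lemma sum_cyc_prod_one:
 "(\<Sum>sigma | sigma permutes {1..n::nat}. cyc_prod x sigma {1..n} * (if n = 1 then 1 else 0)) = (if n = 1 then x 1 else (0 :: 'r::comm_ring_1))"
proof (cases "n = 1") case True
 have "orbit id (1::nat) = {1}" by (simp add: orbit_eq_singleton_iff)
 thus ?thesis unfolding True cyc_prod_def atLeastAtMost_singleton by (simp add: permutes_sing)
qed simp

text \<open>With the equality weight and a discrete finer partition, \<open>X\<close> is discrete as
  well. Only blocks of size 1 survive, and of all divisors s just s = 1 is left.\<close>

lemma cycle_index_newton: "of_nat n * cycle_index n x = (\<Sum>k=1..n. x k * cycle_index (n - k) x)"
proof -
 let ?w = "same_weight :: (nat => nat) => nat set set => nat set set => ('a, complex) mps"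
 let ?zeta = "%m :: nat. if m = 1 then 1 else (0 :: ('a, complex) mps)"
 have f: "sym_ifact n * weight_full ?w x ?zeta (%_. 1) n = cycle_index n x" for n unfolding weight_disc cycle_index_def
  by (rule arg_cong[where f = "%x. sym_ifact n * x"], rule sum_eqI) (simp add: same_weight_def disc_stab[OF permutes_imp_bij])
 have c: "sym_ifact s * (1^r * weight_core ?w x ?zeta r s) = (if s = 1 then x r else 0)" if "s > 0" "r > 0" for r s proof -
  have "weight_core ?w x ?zeta r s = (if s = 1 then x r else 0)" using weight_disc(2)[OF that(2), of ?w x s] sum_cyc_prod_one[of "%k. x (r * k)" s]
   by (simp only: same_weight_def one_block_disc mult_1_right cong: if_cong)
  thus ?thesis by simp
 qed
 have "of_nat n * cycle_index n x = (\<Sum>k=1..n. (\<Sum>s | s dvd k. of_nat s * (sym_ifact s * (1^(k div s) * weight_core ?w x ?zeta (k div s) s))) * cycle_index (n - k) x)"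
  using weight_recursion[OF natural_weight_same sym_ifact, of n x ?zeta "%_. 1"] unfolding f .
 also have "... = (\<Sum>k=1..n. x k * cycle_index (n - k) x)" proof (rule sum_eqI, goal_cases)
  case (1 k)
  hence k: "k > 0" by simp
  have "(\<Sum>s | s dvd k. of_nat s * (sym_ifact s * (1^(k div s) * weight_core ?w x ?zeta (k div s) s))) = (\<Sum>s | s dvd k. if s = 1 then x k else 0)"
  proof (rule sum_eqI, goal_cases) case (1 s)
   hence "s > 0" "k div s > 0" using k by (auto elim!: dvdE)
   from c[OF this] show ?case by simp
  qed
  also have "... = x k" using k by (simp add: sum.delta)
  finally show ?case by simp
 qed
 finally show ?thesis .
qed

text \<open>The divisor identity of the characters of free Lie algebras. A Moebius function sums to
  0 over a nontrivial interval, so the full sums \<open>F\<close> vanish beyond n = 1, and the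
  Newton recursion for them degenerates to G (n + 1) = x 1 * G n.\<close>

lemma lie_index_divisor_sum:
 assumes n: "n > 0"
 shows "(\<Sum>s | s dvd n. of_nat s * lie_index s (%k. x (n div s * k))) = x 1^n"
proof -
 let ?w = "%t P X. mps_const (minv same_weight t P X) :: ('a, complex) mps"
 let ?zeta = "%m :: nat. if m = 1 then 1 else (0 :: ('a, complex) mps)"
 let ?x = "%k. - x k"
 interpret same: natural_weight "same_weight :: (nat => nat) => nat set set => nat set set => complex" by (rule natural_weight_same)
 have w: "natural_weight ?w" by (rule natural_weight_hom[OF same.minv_natural]) (simp_all add: mps_const_hom)
 define F where "F = (%n. sym_ifact n * weight_full ?w ?x ?zeta (%_. 1) n)"
 define G where "G = (%n. \<Sum>s | s dvd n. of_nat s * lie_index s (%k. x (n div s * k)))"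
 have f: "F n = (if n = 0 then 1 else if n = 1 then - x 1 else 0)" for n proof (cases "n = 0")
  case True
  have "{P. P = {} & finer P {}} = {{} :: nat set set}" by auto
  thus ?thesis using True by (simp add: F_def weight_full_def same.empty same.minv_natural[THEN natural_weight.empty])
 next case False
  have top: "{{1..n}}:stab {1..n} t" if "t permutes {1..n}" for t using stab_one_block[OF permutes_imp_bij[OF that]] False by simp
  have int: "interval t (disc {1..n}) {{1..n}} = stab {1..n} t" for t
   by (auto simp: interval_def intro: finer_disc[OF stabD(1)] finer_one_block[OF equalityD1[OF stabD(3)]])
  have "(SUM X:stab {1..n} t. ?w t (disc {1..n}) X) = (if n = 1 then 1 else 0)" if p: "t permutes {1..n}" for t
   using minv_sum[OF finite_atLeastAtMost top[OF p] finer_disc[OF stabD(1)[OF top[OF p]]], of "same_weight :: _ => _ => _ => complex"]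
   by (simp add: int same_weight_def one_block_disc del: One_nat_def flip: mps_const_sum)
  hence "weight_full ?w ?x ?zeta (%_. 1) n = (if n = 1 then - x 1 else 0)"
   unfolding weight_disc sum_cyc_prod_one[of ?x n, symmetric] by (intro sum.cong refl) simp
  thus ?thesis using False by (simp add: F_def)
 qed
 have c: "sym_ifact s * (1^r * weight_core ?w ?x ?zeta r s) = - lie_index s (%k. x (r * k))" if "r > 0" for r s proof -
  have "weight_core ?w ?x ?zeta r s = (\<Sum>t | t permutes {1..s}. ?w t (disc {1..s}) {{1..s}} * cyc_prod (%k. - x (r * k)) t {1..s})"
   unfolding weight_disc(2)[OF that] by (simp only: mult.commute)
  thus ?thesis by (simp add: lie_index_def)
 qed
 have rec: "of_nat n * F n = (\<Sum>k=1..n. - G k * F (n - k))" for n proof -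
  have "of_nat n * F n = (\<Sum>k=1..n. (\<Sum>s | s dvd k. of_nat s * (sym_ifact s * (1^(k div s) * weight_core ?w ?x ?zeta (k div s) s))) * F (n - k))"
   using weight_recursion[OF w sym_ifact, of n ?x ?zeta "%_. 1"] unfolding F_def .
  also have "... = (\<Sum>k=1..n. - G k * F (n - k))" proof (rule sum_eqI, rule arg_cong[where f = "%x. x * _"])
   fix k assume "k:{1..n}"
   hence k: "k > 0" by simp
   show "(\<Sum>s | s dvd k. of_nat s * (sym_ifact s * (1^(k div s) * weight_core ?w ?x ?zeta (k div s) s))) = - G k"
    unfolding G_def sum_negf[symmetric] proof (rule sum_eqI, goal_cases)
    case (1 s)
    hence "k div s > 0" using k by (auto elim!: dvdE)
    from c[OF this] show ?case by simp
   qed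
  qed
  finally show ?thesis .
 qed
 have "G (Suc m) = x 1^Suc m" for m proof (induction m)
  case 0 show ?case using rec[of 1] by (simp add: f)
 next case (Suc m)
  have "0 = (\<Sum>k=1..Suc (Suc m). - G k * F (Suc (Suc m) - k))" using rec[of "Suc (Suc m)"] f[of "Suc (Suc m)"] by simp
  \<comment> \<open>\<open>F\<close> is supported on 0 and 1, so only the last two terms of the
    convolution remain.\<close>
  also have "... = (SUM k:{Suc m, Suc (Suc m)}. - G k * F (Suc (Suc m) - k))" by (rule sum.mono_neutral_right) (auto simp: f)
  also have "... = G (Suc m) * x 1 - G (Suc (Suc m))" by (simp add: f)
  finally show ?case using Suc.IH by (simp add: mult.commute)
 qed
 from this[of "n - 1"] show ?thesis using n by (simp add: G_def)
qed

section \<open>Substitution of k-th powers of the variables\<close>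

text \<open>The exponent vector after each variable has been replaced by its k-th power. Since
  \<open>power_subst k g\<close> is supported on the image of this injective map, the divisions in
  its definition can be avoided.\<close>

definition scale_mon :: "nat => (nat \<Rightarrow>\<^sub>0 nat) => (nat \<Rightarrow>\<^sub>0 nat)" where "scale_mon k a = Poly_Mapping.map ((*) k) a"

lemma lookup_scale_mon [simp]: "lookup (scale_mon k a) i = k * lookup a i" by (simp add: scale_mon_def Poly_Mapping.map.rep_eq when_def)

lemma lookup_div_mon: "lookup (Poly_Mapping.map (%e. e div k) m) i = lookup m i div (k :: nat)" by (simp add: Poly_Mapping.map.rep_eq when_def)

lemma scale_mon_simps: "scale_mon k (a + b) = scale_mon k a + scale_mon k b" "scale_mon k 0 = 0" "scale_mon 1 a = a"
 "scale_mon j (scale_mon k a) = scale_mon (j * k) a" "scale_mon k (Poly_Mapping.single i n) = Poly_Mapping.single i (k * n)"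
 by (rule poly_mapping_eqI; simp add: lookup_add algebra_simps lookup_single when_def)+

lemma scale_mon_inj: "k > 0 ==> scale_mon k a = scale_mon k b \<longleftrightarrow> a = b"
 by (metis lookup_scale_mon mult_left_cancel poly_mapping_eqI gr_implies_not0)

lemma power_subst_scale:
 assumes "k > 0"
 shows "mps_nth (power_subst k g) (scale_mon k a) = mps_nth g a"
proof -
 have "Poly_Mapping.map (%e. e div k) (scale_mon k a) = a" by (rule poly_mapping_eqI) (use assms in \<open>simp add: lookup_div_mon\<close>)
 thus ?thesis by (simp add: power_subst_def)
qed

lemma scale_mon_divides:
 assumes "\<forall>i. k dvd lookup m i"
 shows "\<exists>a. m = scale_mon k a"
proof
 show "m = scale_mon k (Poly_Mapping.map (%e. e div k) m)" by (rule poly_mapping_eqI) (use assms in \<open>simp add: lookup_div_mon\<close>)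
qed

lemma power_subst_nonzero: "mps_nth (power_subst k g) m ~= 0 ==> \<exists>a. m = scale_mon k a"
 by (rule scale_mon_divides) (auto simp: power_subst_def split: if_splits)

lemma power_subst_eqI:
 assumes k: "k > 0" and f: "!!a. mps_nth f (scale_mon k a) = mps_nth g a" and z: "!!m. \<nexists>a. m = scale_mon k a ==> mps_nth f m = 0"
 shows "power_subst k g = f"
proof (rule mps_eqI, goal_cases) case (1 m)
 show ?case proof (cases "\<exists>a. m = scale_mon k a")
  case True
  thus ?thesis using power_subst_scale[OF k] f by auto
 next case False
  thus ?thesis using power_subst_nonzero[of k g m] z[of m] by metis
 qed
qed

lemma scale_mon_splits:
 assumes k: "k > 0"
 shows "{(a, b). a + b = scale_mon k m & (\<exists>c. a = scale_mon k c) & (\<exists>c. b = scale_mon k c)} =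
   (%(a, b). (scale_mon k a, scale_mon k b))`{(a, b). a + b = m}"
proof (rule equalityI; rule subsetI)
 fix x assume "x:{(a, b). a + b = scale_mon k m & (\<exists>c. a = scale_mon k c) & (\<exists>c. b = scale_mon k c)}"
 then obtain c d where x: "x = (scale_mon k c, scale_mon k d)" "scale_mon k c + scale_mon k d = scale_mon k m" by auto
 hence "c + d = m" using scale_mon_inj[OF k, of "c + d" m] by (simp add: scale_mon_simps)
 thus "x:(%(a, b). (scale_mon k a, scale_mon k b))`{(a, b). a + b = m}" using x by auto
qed (auto simp: scale_mon_simps)

text \<open>A splitting of a scaled monomial contributes only if both parts are scaled, and such
  splittings correspond to those of the original monomial.\<close>

lemma power_subst_mult:
 assumes k: "k > 0"
 shows "power_subst k (f * g) = power_subst k f * power_subst k g"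
proof (rule power_subst_eqI[OF k]) fix m :: "nat \<Rightarrow>\<^sub>0 nat"
 let ?S = "{(a, b). a + b = scale_mon k m}" and ?h = "%(a, b). mps_nth (power_subst k f) a * mps_nth (power_subst k g) b"
 have "mps_nth (power_subst k f * power_subst k g) (scale_mon k m) = sum ?h ?S" by (simp add: mps_nth_mult)
 also have "... = sum ?h {(a, b). a + b = scale_mon k m & (\<exists>c. a = scale_mon k c) & (\<exists>c. b = scale_mon k c)}"
  by (rule sum.mono_neutral_right[OF finite_monomial_splits]) (use power_subst_nonzero in \<open>fastforce+\<close>)
 also have "... = (\<Sum>(a, b) | a + b = m. mps_nth f a * mps_nth g b)" unfolding scale_mon_splits[OF k]
  by (subst sum.reindex) (auto simp: inj_on_def scale_mon_inj[OF k] power_subst_scale[OF k] case_prod_unfold)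
 finally show "mps_nth (power_subst k f * power_subst k g) (scale_mon k m) = mps_nth (f * g) m" by (simp add: mps_nth_mult)
next fix m :: "nat \<Rightarrow>\<^sub>0 nat" assume n: "\<nexists>a. m = scale_mon k a"
 have "mps_nth (power_subst k f) a * mps_nth (power_subst k g) b = 0" if "a + b = m" for a b proof (rule ccontr)
  assume "mps_nth (power_subst k f) a * mps_nth (power_subst k g) b ~= 0"
  then obtain c d where "a = scale_mon k c" "b = scale_mon k d" using power_subst_nonzero by (metis mult_zero_left mult_zero_right)
  thus False using n that scale_mon_simps(1)[of k c d] by metis
 qed
 thus "mps_nth (power_subst k f * power_subst k g) m = 0" unfolding mps_nth_mult by (intro sum.neutral) auto
qed

lemma power_subst_simps: "power_subst k (f + g) = power_subst k f + power_subst k g" "power_subst k (- f) = - power_subst k f" "power_subst k 0 = 0"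
 by (rule mps_eqI, simp add: power_subst_def)+

lemma power_subst_const [simp]:
 assumes "k > 0"
 shows "power_subst k (mps_const c) = mps_const c"
proof (rule power_subst_eqI[OF assms]) fix a :: "nat \<Rightarrow>\<^sub>0 nat"
 show "mps_nth (mps_const c) (scale_mon k a) = mps_nth (mps_const c) a"
  using scale_mon_inj[OF assms, of a 0] by (simp add: mps_nth_const scale_mon_simps)
next fix m :: "nat \<Rightarrow>\<^sub>0 nat" assume "\<nexists>a. m = scale_mon k a"
 hence "m ~= 0" using scale_mon_simps(2) by metis
 thus "mps_nth (mps_const c) m = 0" by (simp add: mps_nth_const)
qed

lemma power_subst_one [simp]: "k > 0 ==> power_subst k 1 = 1" using power_subst_const[of k 1] by simp

lemma power_subst_sum: "power_subst k (sum f A) = (SUM a:A. power_subst k (f a))"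
 by (induction A rule: infinite_finite_induct) (simp_all add: power_subst_simps)

lemma power_subst_prod: "k > 0 ==> power_subst k (prod f A) = (PROD a:A. power_subst k (f a))"
 by (induction A rule: infinite_finite_induct) (simp_all add: power_subst_mult)

lemma power_subst_comp:
 assumes "j > 0" "k > 0"
 shows "power_subst j (power_subst k f) = power_subst (j * k) f"
proof (rule power_subst_eqI[OF assms(1)]) fix a :: "nat \<Rightarrow>\<^sub>0 nat"
 show "mps_nth (power_subst (j * k) f) (scale_mon j a) = mps_nth (power_subst k f) a" (is "?l = _") proof (cases "\<exists>c. a = scale_mon k c")
  case True
  then obtain c where c: "a = scale_mon k c" ..
  show ?thesis using assms power_subst_scale[of "j * k" f c] power_subst_scale[of k f c] unfolding c scale_mon_simps(4) by simp
 next case False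
  hence "mps_nth (power_subst k f) a = 0" using power_subst_nonzero by metis
  moreover have "?l = 0" proof (rule ccontr)
   assume "mps_nth (power_subst (j * k) f) (scale_mon j a) ~= 0"
   then obtain c where "scale_mon j a = scale_mon (j * k) c" using power_subst_nonzero by metis
   hence "a = scale_mon k c" using scale_mon_inj[OF assms(1), of a "scale_mon k c"] by (simp add: scale_mon_simps)
   thus False using False by blast
  qed
  ultimately show ?thesis by simp
 qed
next fix m :: "nat \<Rightarrow>\<^sub>0 nat" assume n: "\<nexists>a. m = scale_mon j a"
 show "mps_nth (power_subst (j * k) f) m = 0" proof (rule ccontr)
  assume "mps_nth (power_subst (j * k) f) m ~= 0"
  then obtain c where "m = scale_mon (j * k) c" using power_subst_nonzero by metis
  thus False using n scale_mon_simps(4)[of j k c] by metis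
 qed
qed

lemma power_subst_1: "power_subst 1 f = f"
proof (rule power_subst_eqI)
 show "!!m. \<nexists>a. m = scale_mon 1 a ==> mps_nth f m = 0" using scale_mon_simps(3) by metis
qed (simp_all only: scale_mon_simps zero_less_one)

lemma power_subst_sym_p:
 assumes "j > 0"
 shows "power_subst j (sym_p k) = sym_p (j * k)"
proof (rule power_subst_eqI[OF assms]) fix a :: "nat \<Rightarrow>\<^sub>0 nat"
 have "(\<exists>i. scale_mon j a = Poly_Mapping.single i (j * k)) \<longleftrightarrow> (\<exists>i. a = Poly_Mapping.single i k)"
  using scale_mon_inj[OF assms, of a] scale_mon_simps(5)[of j _ k] by metis
 thus "mps_nth (sym_p (j * k)) (scale_mon j a) = mps_nth (sym_p k) a" by (simp add: sym_p_def)
next fix m :: "nat \<Rightarrow>\<^sub>0 nat" assume n: "\<nexists>a. m = scale_mon j a"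
 have "\<nexists>i. m = Poly_Mapping.single i (j * k)" using n scale_mon_simps(5)[of j _ k] by metis
 thus "mps_nth (sym_p (j * k)) m = 0" by (simp add: sym_p_def)
qed

section \<open>Complete symmetric functions as cycle indices\<close>

lemma sym_p_mult_nth:
 assumes k: "k > 0"
 shows "mps_nth (sym_p k * g) m = (\<Sum>i | k <= lookup m i. mps_nth g (m - Poly_Mapping.single i k))"
proof -
 let ?I = "{i. k <= lookup m i}"
 let ?f = "%i. (Poly_Mapping.single i k, m - Poly_Mapping.single i k)"
 have inj: "inj_on ?f ?I" by (rule inj_onI) (use k in \<open>metis Pair_inject lookup_single_eq lookup_single_not_eq less_irrefl\<close>)
 have split: "Poly_Mapping.single i k + (m - Poly_Mapping.single i k) = m" if "i:?I" for i
  by (rule poly_mapping_eqI) (use that in \<open>auto simp: lookup_add lookup_minus lookup_single when_def\<close>)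
 have "mps_nth (sym_p k * g) m = (SUM (a, b):?f`?I. mps_nth (sym_p k) a * mps_nth g b)" unfolding mps_nth_mult
 proof (rule sum.mono_neutral_right[OF finite_monomial_splits])
  show "?f`?I <= {(a, b). a + b = m}" using split by auto
  show "ALL x:{(a, b). a + b = m} - ?f`?I. (case x of (a, b) => mps_nth (sym_p k) a * mps_nth g b) = 0" proof
   fix x assume x: "x:{(a, b). a + b = m} - ?f`?I" obtain a b where ab: "x = (a, b)" by (cases x)
   have "\<nexists>i. a = Poly_Mapping.single i k" proof
    assume "\<exists>i. a = Poly_Mapping.single i k"
    then obtain i where i: "a = Poly_Mapping.single i k" ..
    have s: "a + b = m" using x ab by simp
    have "k <= lookup m i" unfolding s[symmetric] i by (simp add: lookup_add)
    moreover have "b = m - Poly_Mapping.single i k" unfolding s[symmetric] i by simp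
    ultimately show False using x ab i by auto
   qed
   thus "(case x of (a, b) => mps_nth (sym_p k) a * mps_nth g b) = 0" by (simp add: ab sym_p_def)
  qed
 qed
 also have "... = (SUM i:?I. mps_nth g (m - Poly_Mapping.single i k))" unfolding sum.reindex[OF inj] by (rule sum_eqI) (auto simp: sym_p_def)
 finally show ?thesis .
qed

lemma monomial_degree_superset:
 assumes "finite A" "keys m <= A"
 shows "monomial_degree m = (SUM v:A. lookup m v)" unfolding monomial_degree_def by (rule sum.mono_neutral_left[OF assms]) (simp add: in_keys_iff)

lemma monomial_degree_minus_single:
 assumes "k <= lookup m i"
 shows "monomial_degree (m - Poly_Mapping.single i k) + k = monomial_degree m"
proof -
 let ?A = "insert i (keys m)"
 have sub: "keys (m - Poly_Mapping.single i k) <= ?A" by (auto simp: in_keys_iff lookup_minus)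
 have "monomial_degree (m - Poly_Mapping.single i k) = lookup m i - k + (SUM v:?A - {i}. lookup m v)"
  unfolding monomial_degree_superset[OF _ sub, simplified]
  by (subst sum.remove[of _ i]) (auto simp: lookup_minus lookup_single when_def intro!: sum.cong split: if_splits)
 moreover have "monomial_degree m = lookup m i + (SUM v:?A - {i}. lookup m v)"
  unfolding monomial_degree_superset[of ?A m, simplified, OF subset_insertI] by (subst sum.remove[of _ i]) auto
 ultimately show ?thesis using assms by simp
qed

text \<open>At a monomial of degree n the right side counts the pairs of a variable and a number k
  from 1 to its exponent, and there are as many of these as the degree.\<close>

lemma sym_h_newton: "of_nat n * sym_h n = (\<Sum>k=1..n. sym_p k * sym_h (n - k))"
proof (rule mps_eqI, goal_cases) case (1 m)
 let ?l = "lookup m" and ?K = "keys m"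
 have "mps_nth (\<Sum>k=1..n. sym_p k * sym_h (n - k)) m = (\<Sum>k=1..n. \<Sum>i | k <= ?l i. if monomial_degree (m - Poly_Mapping.single i k) = n - k then 1 else 0)"
  by (simp add: sym_p_mult_nth sym_h_def)
 also have "... = (\<Sum>k=1..n. \<Sum>i | k <= ?l i. if monomial_degree m = n then 1 else 0)" proof (intro sum.cong refl)
  fix k i assume "k:{1..n}" "i:{i. k <= ?l i}"
  thus "(if monomial_degree (m - Poly_Mapping.single i k) = n - k then 1 else 0) = (if monomial_degree m = n then 1 else (0 :: complex))"
   using monomial_degree_minus_single[of k m i] by auto
 qed
 also have "... = (if monomial_degree m = n then of_nat n else 0)" proof (cases "monomial_degree m = n")
  case True
  have le: "?l i <= n" if "i:?K" for i using True member_le_sum[of i ?K ?l] that unfolding monomial_degree_def by simp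
  have "(\<Sum>k=1..n. card {i. k <= ?l i}) = (\<Sum>k=1..n. SUM i:?K. if k <= ?l i then 1 else 0)" proof (rule sum_eqI, goal_cases)
   case k: (1 k)
   hence "{i. k <= ?l i} = {i:?K. k <= ?l i}" by (auto simp: in_keys_iff)
   thus ?case by (simp add: sum.If_cases Int_def)
  qed
  also have "... = (SUM i:?K. \<Sum>k=1..n. if k <= ?l i then 1 else 0)" by (rule sum.swap)
  also have "... = (SUM i:?K. ?l i)" proof (rule sum_eqI, goal_cases)
   case (1 i)
   hence "{1..n} Int {k. k <= ?l i} = {1..?l i}" using le by fastforce
   thus ?case by (simp add: sum.If_cases)
  qed
  finally have "(\<Sum>k=1..n. card {i. k <= ?l i}) = n" using True by (simp add: monomial_degree_def)
  hence "(\<Sum>k=1..n. of_nat (card {i. k <= ?l i})) = (of_nat n :: complex)" by (metis of_nat_sum)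
  thus ?thesis using True by simp
 qed simp
 also have "... = mps_nth (of_nat n * sym_h n) m" by (simp add: mps_const_of_nat[symmetric] sym_h_def)
 finally show ?case ..
qed

lemma mps_of_nat_cancel:
 fixes f g :: "('v, complex) mps"
 assumes "n > 0" "of_nat n * f = of_nat n * g"
 shows "f = g"
proof (rule mps_eqI) fix m
 show "mps_nth f m = mps_nth g m" using arg_cong[OF assms(2), of "%f. mps_nth f m"] assms(1) by (simp add: mps_const_of_nat[symmetric])
qed

lemma sym_h_0: "sym_h 0 = 1"
proof (rule mps_eqI, goal_cases) case (1 m)
 have "monomial_degree m = 0 \<longleftrightarrow> m = 0" by (auto simp: monomial_degree_def in_keys_iff intro!: poly_mapping_eqI)
 thus ?case by (simp add: sym_h_def mps_nth_one)
qed

text \<open>Both sequences start with 1 and satisfy the same Newton recursion, which determines them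
  because n can be cancelled.\<close>

lemma sym_h_cycle_index: "sym_h n = cycle_index n sym_p"
proof (induction n rule: less_induct) case (less n)
 show ?case proof (cases "n = 0")
  case True
  thus ?thesis by (simp add: sym_h_0)
 next case False
  have "(\<Sum>k=1..n. sym_p k * sym_h (n - k)) = (\<Sum>k=1..n. sym_p k * cycle_index (n - k) sym_p)" by (rule sum_eqI) (use less.IH False in simp)
  thus ?thesis using mps_of_nat_cancel[of n "sym_h n"] False sym_h_newton[of n] cycle_index_newton[of n sym_p] by simp
 qed
qed

lemma sym_L_lie_index: "m > 0 ==> sym_L m = lie_index m sym_p" using sym_L_formula[of m] by (simp add: lie_index_def)

section \<open>Plethysm as substitution into power sum polynomials\<close>

text \<open>Polynomials in the power sums, seen as functions of free arguments. Plethysm is defined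
  by unique coordinates; on this class it turns into substitution of \<open>power_subst k g\<close>
  for the k-th argument. The index 0 is excluded since \<open>sym_p 0\<close> is 1 and would spoil
  independence.\<close>

inductive ps_poly :: "((nat => symfun) => symfun) => bool" where const: "ps_poly (%x. mps_const c)"
| var: "k > 0 ==> ps_poly (%x. x k)"
| add: "ps_poly P ==> ps_poly Q ==> ps_poly (%x. P x + Q x)"
| mult: "ps_poly P ==> ps_poly Q ==> ps_poly (%x. P x * Q x)"

lemma ps_poly_uminus: "ps_poly P ==> ps_poly (%x. - P x)" using ps_poly.mult[OF ps_poly.const[of "-1"], of P] by (simp add: mps_const_hom)

lemma ps_poly_sum: "(!!a. a:A ==> ps_poly (P a)) ==> ps_poly (%x. SUM a:A. P a x)" by (induction A rule: infinite_finite_induct)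
  (use ps_poly.const[of 0] ps_poly.add in auto)

lemma ps_poly_prod: "(!!a. a:A ==> ps_poly (P a)) ==> ps_poly (%x. PROD a:A. P a x)" by (induction A rule: infinite_finite_induct)
  (use ps_poly.const[of 1] ps_poly.mult in auto)

lemma ps_poly_cong: "ps_poly P ==> (!!k. k > 0 ==> x k = y k) ==> P x = P y" by (induction rule: ps_poly.induct) auto

lemma ps_poly_subst:
 assumes "ps_poly P" "!!k. k > 0 ==> ps_poly (Q k)"
 shows "ps_poly (%x. P (%k. Q k x))" using assms by (induction rule: ps_poly.induct) (auto intro: ps_poly.intros)

lemma power_subst_ps_poly:
 assumes "r > 0" "ps_poly P"
 shows "power_subst r (P x) = P (%k. power_subst r (x k))"
 using assms(2) by (induction rule: ps_poly.induct) (simp_all add: assms(1) power_subst_simps power_subst_mult)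

lemma ps_poly_cyc_prod:
 fixes t :: "nat => nat"
 assumes "t permutes {1..n}"
 shows "ps_poly (%x. cyc_prod x t {1..n})" unfolding cyc_prod_def
proof (rule ps_poly_prod, rule ps_poly.var) fix c assume "c:orbit t`{1..n}"
 then obtain i where i: "i:{1..n}" "c = orbit t i" by blast
 have "c <= {1..n}" unfolding i(2) by (rule permutes_orbit_subset[OF assms i(1)])
 hence "finite c" by (rule finite_subset) simp
 thus "card c > 0" using i(2) orbit_nonempty[of t i] by (simp add: card_gt_0_iff)
qed

lemma ps_poly_cycle_index: "ps_poly (cycle_index n)" unfolding cycle_index_def[abs_def]
 by (intro ps_poly.mult ps_poly.const ps_poly_sum ps_poly_cyc_prod) simp

lemma ps_poly_lie_index: "ps_poly (lie_index n)" unfolding lie_index_def[abs_def]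
proof (intro ps_poly_uminus ps_poly.mult ps_poly.const ps_poly_sum) fix t assume "t:{t. t permutes {1..n}}"
 hence "t permutes {1..n}" by simp
 hence "ps_poly (%x. cyc_prod x t {1..n})" by (rule ps_poly_cyc_prod)
 thus "ps_poly (%x. cyc_prod (%k. - x k) t {1..n})" by (rule ps_poly_subst[where Q = "%k x. - x k"]) (intro ps_poly_uminus ps_poly.var)
qed

definition ps_eval :: "(nat multiset \<Rightarrow>\<^sub>0 complex) => (nat => symfun) => symfun" where
 "ps_eval c x = (SUM rho:keys c. mps_const (lookup c rho) * (\<Prod>k\<in>#rho. x k))"

lemma ps_eval_superset:
 assumes "finite A" "keys c <= A"
 shows "ps_eval c x = (SUM rho:A. mps_const (lookup c rho) * (\<Prod>k\<in>#rho. x k))"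
 unfolding ps_eval_def by (rule sum.mono_neutral_left[OF assms]) (simp add: in_keys_iff)

lemma ps_eval_single: "ps_eval (Poly_Mapping.single rho a) x = mps_const a * (\<Prod>k\<in>#rho. x k)" by (simp add: ps_eval_superset[of "{rho}"])

lemma ps_eval_add: "ps_eval (c + d) x = ps_eval c x + ps_eval d x"
proof -
 let ?A = "keys c Un keys d"
 have "ps_eval (c + d) x = (SUM rho:?A. mps_const (lookup (c + d) rho) * (\<Prod>k\<in>#rho. x k))"
  by (rule ps_eval_superset) (simp_all add: keys_add)
 thus ?thesis by (simp add: ps_eval_superset[of ?A] lookup_add mps_const_hom distrib_right sum.distrib)
qed

lemma ps_eval_uminus: "ps_eval (- c) x = - ps_eval c x" by (simp add: ps_eval_def mps_const_hom sum_negf)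

lemma ps_eval_sum: "ps_eval (sum f A) x = (SUM a:A. ps_eval (f a) x)"
proof (induction A rule: infinite_finite_induct) case (insert a A)
 thus ?case by (simp add: ps_eval_add)
qed (simp_all add: ps_eval_def)

lemma ps_poly_eval:
 assumes "ps_poly P"
 shows "\<exists>c. keys c <= partitions & (\<forall>x. P x = ps_eval c x)" using assms
proof (induction rule: ps_poly.induct) case (const c)
 show ?case by (rule exI[of _ "Poly_Mapping.single {#} c"]) (auto simp: ps_eval_single partitions_def split: if_splits)
next case (var k)
 thus ?case by (intro exI[of _ "Poly_Mapping.single {#k#} 1"]) (auto simp: ps_eval_single partitions_def split: if_splits)
next case (add P Q)
 then obtain c d where "keys c <= partitions" "\<forall>x. P x = ps_eval c x" "keys d <= partitions" "\<forall>x. Q x = ps_eval d x" by blast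
 thus ?case using keys_add[of c d] by (intro exI[of _ "c + d"]) (auto simp: ps_eval_add)
next case (mult P Q)
 then obtain c d where c: "keys c <= partitions" "\<forall>x. P x = ps_eval c x"
  and d: "keys d <= partitions" "\<forall>x. Q x = ps_eval d x" by blast
 let ?s = "%rho tau. Poly_Mapping.single (rho + tau) (lookup c rho * lookup d tau)"
 define e where "e = (SUM rho:keys c. SUM tau:keys d. ?s rho tau)"
 have "P x * Q x = ps_eval e x" for x
  using c(2) d(2) by (simp add: e_def ps_eval_sum ps_eval_single sum_product ps_eval_def[of c] ps_eval_def[of d] mps_const_hom mult_ac)
 moreover have "keys e <= partitions" proof
  fix sigma assume "sigma:keys e"
  hence "lookup e sigma ~= 0" by (simp add: in_keys_iff)
  hence "(SUM rho:keys c. SUM tau:keys d. lookup (?s rho tau) sigma) ~= 0" by (simp add: e_def lookup_sum_pm)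
  then obtain rho where rho: "rho:keys c" "(SUM tau:keys d. lookup (?s rho tau) sigma) ~= 0" by (rule sum.not_neutral_contains_not_neutral)
  from rho(2) obtain tau where "tau:keys d" "lookup (?s rho tau) sigma ~= 0" by (rule sum.not_neutral_contains_not_neutral)
  hence "sigma = rho + tau" "tau:partitions" "rho:partitions" using rho(1) c(1) d(1) by (auto simp: lookup_single when_def split: if_splits)
  thus "sigma:partitions" by (simp add: partitions_def)
 qed
 ultimately show ?case by blast
qed

definition mon_type :: "(nat \<Rightarrow>\<^sub>0 nat) => nat multiset" where "mon_type m = image_mset (lookup m) (mset_set (keys m))"

lemma mon_type_add_single:
 assumes "k > 0" "i ~: keys b"
 shows "mon_type (b + Poly_Mapping.single i k) = add_mset k (mon_type b)"
proof -
 let ?m = "b + Poly_Mapping.single i k"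
 have keys: "keys ?m = insert i (keys b)" using assms(1) by (auto simp: in_keys_iff lookup_add lookup_single when_def split: if_splits)
 have "image_mset (lookup ?m) (mset_set (keys b)) = mon_type b"
  unfolding mon_type_def by (rule image_mset_cong) (use assms(2) in \<open>auto simp: lookup_add lookup_single when_def\<close>)
 moreover have "lookup ?m i = k" using assms(2) by (simp add: lookup_add in_keys_iff)
 ultimately show ?thesis using assms(2) by (simp add: mon_type_def keys)
qed

text \<open>Each factor contributes one variable, so a monomial of the product has at most as many
  variables as there are factors; if none coincide, its exponents are exactly the parts. This gives
  triangularity with respect to the number of variables.\<close>

lemma power_sum_leading:
 assumes "0 ~:# tau" "mps_nth (\<Prod>k\<in>#tau. sym_p k) m ~= 0"
 shows "card (keys m) <= size tau & (card (keys m) = size tau --> mon_type m = tau)" using assms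
proof (induction tau arbitrary: m) case empty
 thus ?case by (simp add: mps_nth_one mon_type_def split: if_splits)
next case (add k tau)
 have k: "k > 0" using add.prems(1) by (auto intro: Nat.gr0I)
 have "(\<Sum>i | k <= lookup m i. mps_nth (\<Prod>k\<in>#tau. sym_p k) (m - Poly_Mapping.single i k)) ~= 0"
  using add.prems(2) by (simp add: sym_p_mult_nth[OF k])
 then obtain i where i: "i:{i. k <= lookup m i}" and n: "mps_nth (\<Prod>k\<in>#tau. sym_p k) (m - Poly_Mapping.single i k) ~= 0"
  by (rule sum.not_neutral_contains_not_neutral)
 define b where "b = m - Poly_Mapping.single i k"
 have m: "m = b + Poly_Mapping.single i k"
  by (rule poly_mapping_eqI) (use i in \<open>auto simp: b_def lookup_add lookup_minus lookup_single when_def\<close>)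
 have IH: "card (keys b) <= size tau & (card (keys b) = size tau --> mon_type b = tau)"
  by (rule add.IH) (use add.prems(1) n in \<open>simp_all add: b_def\<close>)
 have keys: "keys m = insert i (keys b)" using k by (auto simp: m in_keys_iff lookup_add lookup_single when_def split: if_splits)
 show ?case proof (cases "i:keys b")
  case True
  thus ?thesis using IH by (simp add: keys insert_absorb)
 next case False
  thus ?thesis using IH mon_type_add_single[OF k False] by (simp add: keys m[symmetric])
 qed
qed

text \<open>Natural coefficients rule out cancellation in \<open>power_sum_witness\<close>.\<close>

lemma power_sum_coeff_nat: "0 ~:# tau ==> mps_nth (\<Prod>k\<in>#tau. sym_p k) m:\<nat>"
proof (induction tau arbitrary: m) case (add k tau)
 hence "k > 0" by (auto intro: Nat.gr0I)
 moreover have "sum f A:\<nat>" if "!!i. f i:\<nat>" for f :: "nat => complex" and A by (induction A rule: infinite_finite_induct) (use that in auto)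
 ultimately show ?case using add by (simp add: sym_p_mult_nth)
qed (simp add: mps_nth_one)

lemma power_sum_witness:
 assumes "0 ~:# tau"
 shows "\<exists>m. mon_type m = tau & card (keys m) = size tau & mps_nth (\<Prod>k\<in>#tau. sym_p k) m ~= 0" using assms
proof (induction tau) case empty
 show ?case by (rule exI[of _ 0]) (simp add: mon_type_def mps_nth_one)
next case (add k tau)
 have k: "k > 0" using add.prems by (auto intro: Nat.gr0I)
 obtain b where b: "mon_type b = tau" "card (keys b) = size tau" "mps_nth (\<Prod>k\<in>#tau. sym_p k) b ~= 0" using add by auto
 obtain i :: nat where i: "i ~: keys b" using ex_new_if_finite[OF infinite_UNIV_nat finite_keys] by blast
 define m where "m = b + Poly_Mapping.single i k"
 have t: "mon_type m = add_mset k tau" unfolding m_def by (simp add: mon_type_add_single[OF k i] b)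
 have keys: "keys m = insert i (keys b)" using k by (auto simp: m_def in_keys_iff lookup_add lookup_single when_def split: if_splits)
 let ?I = "{i. k <= lookup m i}" and ?f = "%i. mps_nth (\<Prod>k\<in>#tau. sym_p k) (m - Poly_Mapping.single i k)"
 have fI: "finite ?I" by (rule finite_subset[of _ "keys m"]) (use k in \<open>auto simp: in_keys_iff\<close>)
 have iI: "i:?I" by (simp add: m_def lookup_add)
 have nat: "?f j:\<nat>" for j by (rule power_sum_coeff_nat) (use add.prems in simp)
 have "(SUM i:?I. ?f i) ~= 0" proof
  assume z: "(SUM i:?I. ?f i) = 0"
  have "\<forall>j. \<exists>n :: nat. ?f j = of_nat n" using nat by (auto elim!: Nats_cases)
  then obtain g where g: "!!j. ?f j = of_nat (g j)" by metis
  have "of_nat (SUM j:?I. g j) = (0 :: complex)" using z by (simp add: g)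
  hence "(SUM j:?I. g j) = 0" by (simp only: of_nat_eq_0_iff)
  hence "g i = 0" using fI iI by (simp add: sum_eq_0_iff)
  moreover have "?f i ~= 0" using b(3) by (simp add: m_def)
  ultimately show False using g[of i] by simp
 qed
 hence "mps_nth (\<Prod>k\<in>#add_mset k tau. sym_p k) m ~= 0" by (simp add: sym_p_mult_nth[OF k])
 moreover have "card (keys m) = size (add_mset k tau)" using b(2) i by (simp add: keys)
 ultimately show ?case using t by blast
qed

text \<open>In the support of the difference take a partition with the most parts. Its monomial in
  pairwise different variables occurs in no other term, so its coefficient cannot vanish.\<close>

lemma ps_eval_inj:
 assumes "keys c <= partitions" "keys d <= partitions" "ps_eval c sym_p = ps_eval d sym_p"
 shows "c = d"
proof (rule ccontr)
 assume "c ~= d"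
 define e where "e = c - d"
 have e0: "e ~= 0" using \<open>c \<noteq> d\<close> by (simp add: e_def)
 have ke: "keys e <= partitions" using assms(1,2) unfolding e_def by (auto simp: in_keys_iff lookup_minus subset_eq)
 have "ps_eval e sym_p = 0" using assms(3) ps_eval_add[of c "- d" sym_p] by (simp add: e_def ps_eval_uminus)
 have "keys e ~= {}" using e0 by simp
 then obtain rho where rho: "rho:keys e" "!!tau. tau:keys e ==> size tau <= size rho"
  using Max_in[of "size`keys e"] Max_ge[of "size`keys e"] finite_keys[of e] by fastforce
 have n0: "0 ~:# tau" if "tau:keys e" for tau using that ke by (auto simp: partitions_def)
 let ?t1 = "(\<Prod>k\<in>#rho. sym_p k)"
 obtain m where m: "mon_type m = rho" "card (keys m) = size rho" "mps_nth ?t1 m ~= 0" using power_sum_witness[OF n0[OF rho(1)]] by blast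
 have "mps_nth (\<Prod>k\<in>#tau. sym_p k) m = 0" if tau: "tau:keys e" "tau ~= rho" for tau proof (rule ccontr)
  assume "mps_nth (\<Prod>k\<in>#tau. sym_p k) m ~= 0"
  from power_sum_leading[OF n0[OF tau(1)] this] show False using m(1,2) rho(2)[OF tau(1)] tau(2) by auto
 qed
 hence "mps_nth (ps_eval e sym_p) m = (SUM tau:keys e. if tau = rho then lookup e rho * mps_nth ?t1 m else 0)"
  unfolding ps_eval_def mps_nth_sum by (intro sum.cong) auto
 also have "... = lookup e rho * mps_nth ?t1 m" using rho(1) by (simp add: sum.delta)
 finally show False using \<open>ps_eval e sym_p = 0\<close> m(3) rho(1) by (simp add: in_keys_iff)
qed

lemma power_sum_coords_eval:
 assumes "keys c <= partitions"
 shows "power_sum_coords (ps_eval c sym_p) = c" unfolding power_sum_coords_def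
proof (rule the_equality)
 show "keys c <= partitions & ps_eval c sym_p = (SUM rho:keys c. mps_const (lookup c rho) * (\<Prod>k\<in>#rho. sym_p k))"
  using assms by (simp add: ps_eval_def)
 fix d assume "keys d <= partitions & ps_eval c sym_p = (SUM rho:keys d. mps_const (lookup d rho) * (\<Prod>k\<in>#rho. sym_p k))"
 thus "d = c" using ps_eval_inj[of d c] assms by (simp add: ps_eval_def)
qed

theorem plethysm_ps_poly:
 assumes "ps_poly P"
 shows "plethysm (P sym_p) g = P (%k. power_subst k g)"
proof -
 obtain c where c: "keys c <= partitions" "\<forall>x. P x = ps_eval c x" using ps_poly_eval[OF assms] by blast
 show ?thesis using c power_sum_coords_eval[OF c(1)] by (simp add: plethysm_def ps_eval_def)
qed

lemma plethysm_sym_h: "plethysm (sym_h n) g = cycle_index n (%k. power_subst k g)"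
 unfolding sym_h_cycle_index by (rule plethysm_ps_poly[OF ps_poly_cycle_index])

lemma plethysm_sym_L: "i > 0 ==> plethysm (sym_L i) g = lie_index i (%k. power_subst k g)"
 unfolding sym_L_lie_index by (rule plethysm_ps_poly[OF ps_poly_lie_index])

text \<open>The instance h_m[L_i][g] = h_m[L_i[g]] of associativity: both sides are substitutions
  into the same polynomial, and \<open>power_subst\<close> passes through polynomials in the power
  sums.\<close>

lemma plethysm_sym_L_part:
 assumes "rho:partitions"
 shows "plethysm (sym_L_part rho) g = (PROD i:set_mset rho. cycle_index (count rho i) (%k. power_subst k (plethysm (sym_L i) g)))"
proof -
 let ?P = "%x. PROD i:set_mset rho. cycle_index (count rho i) (%k. lie_index i (%j. x (k * j)))"
 have pos: "i > 0" if "i \<in># rho" for i using that assms by (auto simp: partitions_def intro: Nat.gr0I)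
 have P: "ps_poly ?P" proof (intro ps_poly_prod ps_poly_subst[OF ps_poly_cycle_index] ps_poly_subst[OF ps_poly_lie_index] ps_poly.var)
  show "0 < k * j" if "0 < k" "0 < j" for k j :: nat using that by simp
 qed
 have s: "power_subst k (lie_index i x) = lie_index i (%j. power_subst k (x j))" if "k > 0" for k i x
  by (rule power_subst_ps_poly[OF that ps_poly_lie_index])
 have "sym_L_part rho = ?P sym_p" unfolding sym_L_part_def proof (rule prod.cong[OF refl], goal_cases)
  case (1 i)
  from pos[OF this] show ?case
   unfolding plethysm_sym_h by (intro ps_poly_cong[OF ps_poly_cycle_index]) (simp add: sym_L_lie_index s power_subst_sym_p)
 qed
 hence "plethysm (sym_L_part rho) g = ?P (%k. power_subst k g)" using plethysm_ps_poly[OF P] by simp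
 also have "... = (PROD i:set_mset rho. cycle_index (count rho i) (%k. power_subst k (plethysm (sym_L i) g)))"
 proof (rule prod.cong[OF refl], goal_cases) case (1 i)
  hence i: "i > 0" by (rule pos)
  show ?case proof (rule ps_poly_cong[OF ps_poly_cycle_index])
   fix k :: nat assume k: "k > 0" show "lie_index i (%j. power_subst (k * j) g) = power_subst k (plethysm (sym_L i) g)"
    unfolding plethysm_sym_L[OF i] s[OF k] by (rule ps_poly_cong[OF ps_poly_lie_index]) (simp add: power_subst_comp[OF k])
  qed
 qed
 finally show ?thesis .
qed

theorem sym_L_divisor_sum:
 assumes n: "n > 0"
 shows "(\<Sum>s | s dvd n. of_nat s * power_subst (n div s) (plethysm (sym_L s) g)) = g^n" (is "?l = _")
proof -
 have "?l = (\<Sum>s | s dvd n. of_nat s * lie_index s (%k. power_subst (n div s * k) g))" proof (rule sum_eqI, goal_cases)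
  case (1 s)
  hence s: "s > 0" "n div s > 0" using n by (auto elim!: dvdE)
  have "power_subst (n div s) (plethysm (sym_L s) g) = lie_index s (%k. power_subst (n div s) (power_subst k g))"
   unfolding plethysm_sym_L[OF s(1)] by (rule power_subst_ps_poly[OF s(2) ps_poly_lie_index])
  also have "... = lie_index s (%k. power_subst (n div s * k) g)" by (rule ps_poly_cong[OF ps_poly_lie_index]) (simp add: power_subst_comp[OF s(2)])
  finally show ?case by simp
 qed
 also have "... = power_subst 1 g^n" by (rule lie_index_divisor_sum[OF n])
 finally show ?thesis by (simp only: power_subst_1)
qed

section \<open>Words as rotations of powers of Lyndon words\<close>

definition word_power :: "nat => 'a list => 'a list" where "word_power e w = concat (replicate e w)"

lemma word_power_simps [simp]: "word_power 0 w = []" "word_power (Suc e) w = w @ word_power e w" by (simp_all add: word_power_def)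

lemma length_word_power [simp]: "length (word_power e w) = e * length w" by (induction e) auto

lemma mset_rotate: "mset (rotate k xs) = mset xs" by (metis append_take_drop_id mset_append rotate_drop_take union_commute)

lemma mset_word_power: "mset (word_power e w) = repeat_mset e (mset w)" by (induction e) auto

lemma word_power_append_swap: "word_power e (a @ b) @ a = a @ word_power e (b @ a)" by (induction e) auto

lemma rotate_word_power:
 assumes "k <= length w"
 shows "rotate k (word_power e w) = word_power e (rotate k w)"
proof (cases e) case (Suc e')
 define a b where "a = take k w" and "b = drop k w"
 have w: "w = a @ b" and k: "k = length a" using assms by (auto simp: a_def b_def)
 have "rotate k (word_power e w) = (b @ word_power e' (a @ b)) @ a" using rotate_append[of a "b @ word_power e' (a @ b)"] by (simp add: Suc w k)
 also have "... = word_power e (b @ a)" by (simp add: Suc word_power_append_swap)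
 finally show ?thesis by (simp add: w k rotate_append)
qed simp

lemma word_power_inj: "length v = length w ==> e > 0 ==> word_power e v = word_power e w ==> v = w" by (cases e) auto

lemma commuting_word_power: "v @ r = r @ v ==> length r = e * length v ==> r = word_power e v"
proof (induction e arbitrary: r) case (Suc e)
 define r' where "r' = drop (length v) r"
 have "take (length v) (v @ r) = take (length v) (r @ v)" using Suc.prems(1) by simp
 hence r: "r = v @ r'" using Suc.prems(2) append_take_drop_id[of "length v" r] by (simp add: r'_def)
 have "v @ r' = r' @ v" using Suc.prems(1) by (simp add: r)
 moreover have "length r' = e * length v" using Suc.prems(2) by (simp add: r'_def)
 ultimately show ?case using Suc.IH by (simp add: r)
qed simp

lemma rotate_period_word_power:
 assumes "rotate d u = u" "d dvd length u" "u ~= []"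
 shows "u = word_power (length u div d) (take d u)"
proof -
 have d: "0 < d" "d <= length u" using assms(2,3) by (auto intro: dvd_imp_le Nat.gr0I)
 let ?v = "take d u" and ?r = "drop d u"
 have e: "length u = (length u div d) * d" "length u div d > 0" using assms(2,3) d by (auto simp: div_greater_zero_iff)
 have "?r @ ?v = u" proof -
  have lv: "length ?v = d" using d by simp
  have "rotate d (?v @ ?r) = ?r @ ?v" using rotate_append[of ?v ?r] unfolding lv .
  thus ?thesis using assms(1) by (simp only: append_take_drop_id)
 qed
 hence c: "?v @ ?r = ?r @ ?v" by simp
 have "length ?r = (length u div d - 1) * length ?v" using d e(1) by (simp add: diff_mult_distrib)
 from commuting_word_power[OF c this] have "?r = word_power (length u div d - 1) ?v" .
 hence "u = word_power (Suc (length u div d - 1)) ?v" by (metis append_take_drop_id word_power_simps(2))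
 thus ?thesis using e(2) by simp
qed

text \<open>The least period divides the length, as the remainder of the division would be a smaller
  period.\<close>

lemma least_rotation_period:
 assumes u: "u ~= []"
 shows "\<exists>d>0. d dvd length u & rotate d u = u & (\<forall>k. 0 < k & k < d --> rotate k u ~= u)"
proof -
 let ?P = "%d. 0 < d & rotate d u = u"
 define d where "d = (LEAST d. ?P d)"
 have "?P (length u)" using u by simp
 hence d: "?P d" unfolding d_def by (rule LeastI)
 have min: "rotate k u ~= u" if "0 < k" "k < d" for k using not_less_Least[of k ?P] that unfolding d_def by blast
 have m: "rotate (q * d) u = u" for q by (induction q) (use d in \<open>simp_all add: rotate_rotate[symmetric]\<close>)
 have "length u = length u mod d + length u div d * d" by simp
 hence "rotate (length u mod d) u = u" using m[of "length u div d"] rotate_rotate[of "length u mod d" "length u div d * d" u] by simp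
 hence "length u mod d = 0" using min[of "length u mod d"] d by fastforce
 thus ?thesis using d min by (auto simp: mod_eq_0_iff_dvd)
qed

abbreviation word_less :: "nat list => nat list => bool" where "word_less u v \<equiv> (u, v):lexord less_than"

lemma word_less_irrefl: "\<not> word_less u u" by (rule lexord_irreflexive) simp

lemma word_less_trans: "word_less u v ==> word_less v w ==> word_less u w" by (rule lexord_trans) (simp_all add: trans_less_than)

lemma word_less_power:
 assumes "word_less u v" "length u = length v" "e > 0"
 shows "word_less (word_power e u) (word_power e v)" using assms by (cases e) (auto intro: lexord_sufI)

lemma lyndonD:
 assumes "w:lyndon_words"
 shows "w ~= []" "0 ~: set w" "0 < k ==> k < length w ==> word_less w (rotate k w)" using assms by (auto simp: lyndon_words_def)

text \<open>A rotation of a power is the power of a rotation of the base, and powers of words of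
  equal length compare like their bases.\<close>

lemma lyndon_rotation:
 assumes w: "w:lyndon_words" "e > 0"
 shows "rotate j (word_power e w) = word_power e w | word_less (word_power e w) (rotate j (word_power e w))"
proof -
 have l: "length w > 0" using lyndonD(1)[OF w(1)] by simp
 let ?u = "word_power e w" and ?r = "j mod length w"
 have "rotate (q * length w) ?u = ?u" for q by (induction q) (simp_all add: rotate_rotate[symmetric] rotate_word_power)
 hence "rotate j ?u = rotate ?r ?u" using rotate_rotate[of ?r "j div length w * length w" ?u] by simp
 hence e: "rotate j ?u = word_power e (rotate ?r w)" using l by (simp add: rotate_word_power less_imp_le)
 show ?thesis proof (cases "?r = 0")
  case True
  thus ?thesis using e by simp
 next case False
  hence "word_less w (rotate ?r w)" using lyndonD(3)[OF w(1)] l by simp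
  thus ?thesis using e word_less_power w(2) by simp
 qed
qed

lemma lyndon_rotate_fixed:
 assumes "w:lyndon_words" "e > 0" "k < length w" "rotate k (word_power e w) = word_power e w"
 shows "k = 0"
proof (rule ccontr)
 assume k: "k ~= 0"
 have "word_power e (rotate k w) = word_power e w" using assms(3,4) by (simp add: rotate_word_power)
 hence "rotate k w = w" using word_power_inj[of "rotate k w" w e] assms(2) by simp
 thus False using lyndonD(3)[OF assms(1), of k] k assms(3) word_less_irrefl[of w] by simp
qed

text \<open>If the roots had different lengths, rotation by the shorter length would fix the common
  power, which a longer Lyndon root does not permit.\<close>

lemma lyndon_power_unique:
 assumes w: "w:lyndon_words" "e > 0" and w': "w':lyndon_words" "e' > 0" and eq: "word_power e w = word_power e' w'"
 shows "w = w' & e = e'"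
proof -
 have sym: False if w: "w:lyndon_words" "e > 0" and w': "w':lyndon_words" "e' > 0"
  and eq: "word_power e w = word_power e' w'" and l: "length w < length w'" for w w' e e' proof -
  have "rotate (length w) (word_power e' w') = word_power e' w'" unfolding eq[symmetric] by (simp add: rotate_word_power)
  from lyndon_rotate_fixed[OF w' l this] show False using lyndonD(1)[OF w(1)] by simp
 qed
 have l: "length w = length w'" using sym[OF w w' eq] sym[OF w' w eq[symmetric]] by (metis linorder_neqE_nat)
 have "e * length w = e' * length w'" using arg_cong[OF eq, of length] by simp
 hence e: "e = e'" using l lyndonD(1)[OF w'(1)] by simp
 show ?thesis using word_power_inj[OF l w(2)] eq e by simp
qed

text \<open>Both powers are the least rotation of the same word and hence equal, so the roots and
  exponents agree. Two different shifts below the length of the root would then give a forbidden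
  period.\<close>

lemma lyndon_rotation_unique:
 assumes w: "w:lyndon_words" "e > 0" "k < length w" and w': "w':lyndon_words" "e' > 0" "k' < length w'"
  and eq: "rotate k (word_power e w) = rotate k' (word_power e' w')"
 shows "w = w' & e = e' & k = k'"
proof -
 let ?m = "word_power e w" and ?m' = "word_power e' w'"
 have undo: "rotate (length m - k) (rotate k m) = m" if "k <= length m" for k and m :: "nat list" unfolding rotate_rotate using that by simp
 have conj: "\<exists>j. m' = rotate j m" if "rotate a m = rotate b m'" "b < length m'" for a b and m m' :: "nat list" proof
  have "rotate (length m' - b) (rotate b m') = m'" using that(2) by (intro undo) simp
  thus "m' = rotate (length m' - b + a) m" using that(1) by (simp add: rotate_rotate[symmetric])
 qed
 have kl: "k < length ?m" "k' < length ?m'" using w w' by (auto intro: less_le_trans)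
 obtain j where j: "?m' = rotate j ?m" using conj[OF eq kl(2)] by blast
 obtain j' where j': "?m = rotate j' ?m'" using conj[OF eq[symmetric] kl(1)] by blast
 have m: "?m = ?m'" proof (rule ccontr)
  assume "?m ~= ?m'"
  hence "word_less ?m ?m'" "word_less ?m' ?m" using lyndon_rotation[OF w(1,2), of j] lyndon_rotation[OF w'(1,2), of j'] j j' by metis+
  thus False using word_less_trans word_less_irrefl by blast
 qed
 have we: "w = w' & e = e'" by (rule lyndon_power_unique[OF w(1,2) w'(1,2) m])
 have kk: False if "k < k'" "k' < length w" "rotate k ?m = rotate k' ?m" for k k' proof -
  have "k <= length ?m" using that w(2) by (cases e) simp_all
  hence "rotate (length ?m - k) (rotate k ?m) = ?m" by (rule undo)
  moreover have "rotate (length ?m - k) (rotate k' ?m) = rotate (k' - k) ?m" (is "?l = _") proof -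
   have "k < length ?m" using that(1,2) w(2) by (cases e) simp_all
   hence "length ?m - k + k' = (k' - k) + length ?m" using that(1) by simp
   hence "?l = rotate (k' - k) (rotate (length ?m) ?m)" by (simp only: rotate_rotate)
   thus ?thesis by (simp only: rotate_id mod_self)
  qed
  ultimately have "rotate (k' - k) ?m = ?m" using that(3) by simp
  have "k' - k < length w" using that(1,2) by linarith
  from lyndon_rotate_fixed[OF w(1,2) this] \<open>rotate (k' - k) ?m = ?m\<close> show False using that(1) by simp
 qed
 have "k = k'" using kk[of k k'] kk[of k' k] eq we w(3) w'(3) by (metis linorder_neqE_nat)
 thus ?thesis using we by simp
qed

text \<open>The root is the prefix of least period of the lexicographically least rotation. It is a
  Lyndon word, because a smaller rotation of the root would produce a smaller rotation of the
  whole.\<close>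

lemma lyndon_factorization:
 assumes u: "u ~= []" "0 ~: set u"
 shows "\<exists>w e k. w:lyndon_words & e > 0 & k < length w & u = rotate k (word_power e w)"
proof -
 let ?t1 = "(%k. rotate k u)"
 \<comment> \<open>\<open>lex\<close> compares words of equal length and is well-founded, whereas
   \<open>lexord\<close> is not; on the rotations of one word the two agree.\<close>
 have "wf (lex less_than :: (nat list \<times> nat list) set)" by (rule wf_lex[OF wf_less_than])
 moreover have "u:range ?t1" by (rule range_eqI[of _ _ 0]) simp
 ultimately obtain m where m: "m:range ?t1" "!!v. (v, m):lex less_than ==> v ~: range ?t1" using wfE_min[of "lex less_than" u "range ?t1"] by metis
 obtain j where j: "m = rotate j u" using m(1) by blast
 have m0: "m ~= []" using j u(1) by simp
 have min: "\<not> word_less (rotate k m) m" for k proof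
  assume "word_less (rotate k m) m"
  hence "(rotate k m, m):lex less_than" by (simp add: lexord_lex)
  from m(2)[OF this] show False by (auto simp: j rotate_rotate)
 qed
 obtain d where d: "d > 0" "d dvd length m" "rotate d m = m" "!!k. 0 < k ==> k < d ==> rotate k m ~= m" using least_rotation_period[OF m0] by blast
 define w e where "w = take d m" and "e = length m div d"
 have dl: "d <= length m" using d(2) m0 by (auto intro: dvd_imp_le)
 have lw: "length w = d" using dl by (simp add: w_def)
 have e: "e > 0" using dl d(1) by (simp add: e_def div_greater_zero_iff)
 have mw: "m = word_power e w" unfolding w_def e_def by (rule rotate_period_word_power[OF d(3,2) m0])
 have "word_less w (rotate k w)" if k: "0 < k" "k < length w" for k proof (rule ccontr)
  assume n: "\<not> word_less w (rotate k w)"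
  have r: "rotate k m = word_power e (rotate k w)" using k by (simp add: mw rotate_word_power)
  have "w ~= rotate k w" using d(4)[of k] k lw r mw by auto
  moreover have lin: "\<forall>a b. (a, b):less_than | a = b | (b, a):less_than" by auto
  ultimately have "word_less (rotate k w) w" using n lexord_linear[OF lin, of w "rotate k w"] by blast
  hence "word_less (word_power e (rotate k w)) (word_power e w)" by (rule word_less_power) (use e in simp_all)
  hence "word_less (rotate k m) m" unfolding r mw[symmetric] .
  thus False using min by blast
 qed
 moreover have "set w <= set m" unfolding w_def by (rule set_take_subset)
 ultimately have wl: "w:lyndon_words" using lw d(1) u(2) j by (auto simp: lyndon_words_def)
 have "u = rotate (length u - j mod length u) m"
  by (simp add: j rotate_conv_mod[of j u] rotate_rotate) (use u(1) in \<open>simp add: less_imp_le\<close>)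
 then obtain i where i: "u = rotate i m" by blast
 \<comment> \<open>The period \<open>d\<close> of m allows the shift to be reduced below the length
   of the root.\<close>
 have "rotate (q * d) m = m" for q by (induction q) (use d in \<open>simp_all add: rotate_rotate[symmetric]\<close>)
 hence "u = rotate (i mod d) m" using i rotate_rotate[of "i mod d" "i div d * d" m] by simp
 moreover have "i mod d < length w" using lw d(1) by simp
 ultimately show ?thesis using wl e mw by blast
qed

text \<open>By the factorization these pairs represent the rotation classes of words with content
  \<open>beta\<close>, and a class has as many members as its root has letters.\<close>

definition lyndon_roots :: "nat multiset => (nat list \<times> nat) set" where
 "lyndon_roots beta = {(w, e). w:lyndon_words & e > 0 & repeat_mset e (mset w) = beta}"

lemma finite_words_mset: "finite {u. mset u = beta}"
proof -
 obtain xs where xs: "mset xs = beta" using ex_mset by blast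
 have "{u. mset u = beta} <= {u. set u <= set xs & length u = length xs}" using xs by (auto dest: mset_eq_length mset_eq_setD)
 thus ?thesis by (rule finite_subset) (simp add: finite_lists_length_eq)
qed

lemma repeat_mset_size: "repeat_mset e M = N ==> e * size M = size N" by auto

text \<open>A pair is recovered from the power it generates, so there are no more pairs than words
  with content \<open>beta\<close>.\<close>

lemma finite_lyndon_roots: "finite (lyndon_roots beta)"
proof (rule finite_surj[OF finite_words_mset[of beta]])
 let ?f = "%u. (THE p. p:lyndon_roots beta & word_power (snd p) (fst p) = u)"
 show "lyndon_roots beta <= ?f`{u. mset u = beta}" proof
  fix p assume p: "p:lyndon_roots beta"
  let ?u = "word_power (snd p) (fst p)"
  have "?f ?u = p" proof (rule the_equality)
   fix q assume "q:lyndon_roots beta & word_power (snd q) (fst q) = ?u"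
   thus "q = p" using lyndon_power_unique[of "fst q" "snd q" "fst p" "snd p"] p by (auto simp: lyndon_roots_def)
  qed (use p in simp)
  moreover have "?u:{u. mset u = beta}" using p by (auto simp: lyndon_roots_def mset_word_power)
  ultimately show "p:?f`{u. mset u = beta}" by (intro rev_image_eqI) (assumption, rule sym)
 qed
qed

theorem count_words_lyndon:
 assumes beta: "beta ~= {#}" "0 ~:# beta"
 shows "(SUM (w, e):lyndon_roots beta. length w) = card {u. mset u = beta}"
proof -
 let ?A = "Sigma (lyndon_roots beta) (%(w, e). {..<length w})"
 let ?f = "%((w, e), k). rotate k (word_power e w)"
 let ?t1 = "{u. mset u = beta}"
 have "bij_betw ?f ?A ?t1" unfolding bij_betw_def proof
  show "inj_on ?f ?A" proof (rule inj_onI)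
   fix p q assume a: "p:?A" "q:?A" and eq: "?f p = ?f q" obtain w e k where p: "p = ((w, e), k)" by (metis surj_pair)
   obtain w' e' k' where q: "q = ((w', e'), k')" by (metis surj_pair)
   show "p = q" using lyndon_rotation_unique[of w e k w' e' k'] a eq by (simp add: lyndon_roots_def p q)
  qed
  show "?f`?A = ?t1" proof (rule equalityI; rule subsetI)
   fix u assume "u:?f`?A"
   thus "u:?t1" by (auto simp: lyndon_roots_def mset_word_power mset_rotate)
  next fix u assume "u:?t1"
   hence u: "mset u = beta" by simp
   have "u ~= []" "0 ~: set u" using u beta by auto
   from lyndon_factorization[OF this] obtain w e k where w: "w:lyndon_words" "e > 0" "k < length w" "u = rotate k (word_power e w)" by blast
   have "(w, e):lyndon_roots beta" using w u by (auto simp: lyndon_roots_def mset_word_power mset_rotate)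
   hence "((w, e), k):?A" using w(3) by simp
   thus "u:?f`?A" by (rule rev_image_eqI) (simp add: w(4))
  qed
 qed
 hence "card ?t1 = card ?A" by (rule bij_betw_same_card[symmetric])
 also have "... = (SUM p:lyndon_roots beta. card ((%(w, e). {..<length w}) p))" by (rule card_SigmaI[OF finite_lyndon_roots]) auto
 finally show ?thesis by (simp add: case_prod_unfold)
qed

section \<open>Ordered set partitions fixed block by block, and words\<close>

text \<open>The compositions of n.\<close>

definition words :: "nat => nat list set" where "words n = {u. 0 ~: set u & sum_list u = n}"

text \<open>\<open>faces\<close> over an arbitrary ground set, so that the first block can be
  removed in inductions.\<close>

definition block_lists :: "'a set => 'a set list set" where "block_lists S = {f. distinct f & partition_on S (set f)}"

lemma block_lists_Nil [simp]: "[]:block_lists S \<longleftrightarrow> S = {}" by (auto simp: block_lists_def partition_on_def)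

lemma block_lists_Cons: "B # f:block_lists S \<longleftrightarrow> B <= S & B ~= {} & f:block_lists (S - B)"
proof
 assume a: "B # f:block_lists S"
 hence p: "partition_on S (insert B (set f))" "B ~: set f" "distinct f" by (auto simp: block_lists_def)
 have U: "B Un \<Union>(set f) = S" "B ~= {}" "{} ~: set f" using p(1) by (auto simp: partition_on_def)
 have d: "b Int c = {}" if "b:insert B (set f)" "c:insert B (set f)" "b ~= c" for b c by (rule disjointD[OF partition_onD2[OF p(1)] that])
 have dB: "b Int B = {}" if "b:set f" for b by (rule d) (use that p(2) in auto)
 have "\<Union>(set f) = S - B" using U(1) dB by blast
 moreover have "disjoint (set f)" using d by (simp add: disjoint_def)
 ultimately have "f:block_lists (S - B)" using U(3) p(3) by (simp add: block_lists_def partition_on_def)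
 thus "B <= S & B ~= {} & f:block_lists (S - B)" using U(1,2) by blast
next
 assume a: "B <= S & B ~= {} & f:block_lists (S - B)"
 hence p: "partition_on (S - B) (set f)" "distinct f" by (auto simp: block_lists_def)
 have dB: "b Int B = {}" if "b:set f" for b using p(1) that by (auto simp: partition_on_def)
 hence "B ~: set f" using a by blast
 moreover have "disjoint (insert B (set f))" using p(1) dB by (auto simp: disjoint_def partition_on_def)
 moreover have "\<Union>(insert B (set f)) = S" using p(1) a by (auto simp: partition_on_def)
 ultimately show "B # f:block_lists S" using p a by (auto simp: block_lists_def partition_on_def)
qed

lemma finite_block_lists:
 assumes "finite S" shows "finite (block_lists S)"
proof (rule finite_subset)
 let ?t1 = "{f. distinct f & set f <= Pow S}"
 show "block_lists S <= ?t1" by (auto simp: block_lists_def partition_on_def)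
 show "finite ?t1" using finite_subset_distinct[of "Pow S"] assms by (simp add: conj_commute)
qed

lemma card_block_lists:
 assumes "finite S" "0 ~: set u" "sum_list u = card S"
 shows "card {f:block_lists S. map card f = u} * (\<Prod>i\<leftarrow>u. fact i) = fact (card S)" using assms
proof (induction u arbitrary: S) case Nil
 hence "{f:block_lists S. map card f = []} = {[]}" by auto
 thus ?case using Nil by simp
next case (Cons k u)
 let ?J = "{B. B <= S & card B = k}" and ?F = "%T. {f:block_lists T. map card f = u}"
 have k: "k > 0" using Cons.prems by simp
 have kS: "k <= card S" using Cons.prems(3) by simp
 have fin: "finite ?J" by (rule finite_subset[of _ "Pow S"]) (use Cons.prems(1) in auto)
 let ?t1 = "{f:block_lists S. map card f = k # u}"
 let ?t2 = "(SIGMA B:?J. ?F (S - B))"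
 let ?t3 = "(\<Prod>i\<leftarrow>u. fact i)"
 have "?t1 = (%(B, f). B # f)`?t2" proof (rule equalityI; rule subsetI)
  fix f assume f: "f:?t1"
  then obtain B g where "f = B # g" by (cases f) auto
  thus "f:(%(B, f). B # f)`?t2" using f by (auto simp: block_lists_Cons)
 next fix f assume "f:(%(B, f). B # f)`?t2"
  thus "f:?t1" using k by (auto simp: block_lists_Cons)
 qed
 hence "card ?t1 = card ?t2" by (simp add: card_image inj_on_def)
 also have "... = (SUM B:?J. card (?F (S - B)))" by (rule card_SigmaI[OF fin]) (use finite_block_lists[OF finite_Diff[OF Cons.prems(1)]] in simp)
 finally have "card ?t1 * ?t3 = (SUM B:?J. card (?F (S - B)) * ?t3)" by (simp add: sum_distrib_right)
 also have "... = (SUM B:?J. fact (card S - k))" proof (rule sum_eqI, goal_cases)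
  case B: (1 B)
  hence "finite B" using finite_subset[of B S] Cons.prems(1) by simp
  hence c: "card (S - B) = card S - k" using B by (simp add: card_Diff_subset)
  have "card (?F (S - B)) * ?t3 = fact (card (S - B))" by (rule Cons.IH) (use Cons.prems c in auto)
  thus ?case by (simp add: c)
 qed
 also have "... = (card S choose k) * fact (card S - k)" by (simp add: n_subsets[OF Cons.prems(1)])
 finally have "card ?t1 * (\<Prod>i\<leftarrow>k # u. fact i) = fact k * fact (card S - k) * (card S choose k)" by (simp add: mult_ac)
 thus ?case using binomial_fact_lemma[OF kS] by simp
qed

lemma sum_cyc_prod_card:
 assumes "finite B"
 shows "(\<Sum>t | t permutes B. cyc_prod phi t B) = (\<Sum>t | t permutes {1..card B}. cyc_prod phi t {1..card B})" (is "?l = _")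
proof -
 obtain g where g: "bij_betw g B {1..card B}" using finite_same_card_bij[of B "{1..card B}"] assms by auto
 have inj: "inj_on g B" and im: "g`B = {1..card B}" using g by (auto simp: bij_betw_def)
 have "(\<Sum>t | t permutes {1..card B}. cyc_prod phi t {1..card B}) = (\<Sum>t | t permutes B. cyc_prod phi (map_permutation B g t) {1..card B})"
  by (rule sum.reindex_bij_betw[OF bij_map_permutation[OF g], symmetric])
 also have "... = ?l" proof (rule sum_eqI, goal_cases)
  case (1 t)
  hence p: "t permutes B" by simp
  show ?case unfolding im[symmetric] by (rule cyc_prod_iso[OF assms permutes_bij_betw[OF p] inj]) (simp add: map_permutation_apply[OF inj])
 qed
 finally show ?thesis by simp
qed

lemma cyc_prod_cong:
 assumes S: "finite S" "bij_betw t S S" and c: "!!x. x:S ==> t' x = t x"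
 shows "cyc_prod f t' S = cyc_prod f t S" using cyc_prod_iso[OF S inj_on_id, of t' f] c by simp

text \<open>A permutation that fixes every block of the list is a tuple of permutations of the
  blocks, and cycle products multiply.\<close>

lemma sum_block_fixing:
 fixes f :: "nat set list" and phi :: "nat => 'r::comm_ring_1"
 assumes "finite S" "f:block_lists S"
 shows "(\<Sum>t | t permutes S & (ALL b:set f. t`b = b). cyc_prod phi t S) =
  (\<Prod>b\<leftarrow>f. \<Sum>t | t permutes {1..card b}. cyc_prod phi t {1..card b})" using assms
proof (induction f arbitrary: S) case Nil
 have "{t. t = id} = {id}" by simp
 thus ?case using Nil by simp
next case (Cons B f)
 note Bf = Cons.prems(2)[unfolded block_lists_Cons]
 let ?R = "S - B" and ?Q = "%t. ALL b:set f. t`b = b"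
 have fB: "finite B" "finite ?R" "B <= S" using Cons.prems(1) Bf finite_subset by auto
 have sub: "b <= ?R" if "b:set f" for b using Bf that by (auto simp: block_lists_def partition_on_def)
 have Q: "?Q t \<longleftrightarrow> ?Q t'" if "!!x. x:?R ==> t x = t' x" for t t' proof -
  have "t`b = t' ` b" if b: "b:set f" for b by (rule image_cong[OF refl]) (use \<open>\<And>x. x \<in> ?R \<Longrightarrow> t x = t' x\<close> sub[OF b] in blast)
  thus ?thesis by simp
 qed
 have "(\<Sum>t | t permutes S & (ALL b:set (B # f). t`b = b). cyc_prod phi t S) =
   (SUM (t1, t2):{t. t permutes B} \<times> {t. t permutes ?R & ?Q t}. cyc_prod phi t1 B * cyc_prod phi t2 ?R)"
 proof (rule sum.reindex_bij_witness[where i = "%(t1, t2). t1 \<circ> t2" and j = "%t. (perm_restrict t B, perm_restrict t ?R)"], goal_cases)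
  case (1 t)
  thus ?case using permutes_split(3)[OF _ fB(3)] by auto
 next case (2 t)
  thus ?case using permutes_split(1,2)[OF _ fB(3), of t] Q[of "perm_restrict t ?R" t] by (simp add: perm_restrict_def)
 next case (3 x)
  thus ?case using permutes_join(4,5)[OF fB(3)] by auto
 next case (4 x)
  then obtain t1 t2 where x: "x = (t1, t2)" "t1 permutes B" "t2 permutes ?R" "?Q t2" by auto
  note j = permutes_join[OF fB(3) x(2,3)]
  have q: "?Q (t1 \<circ> t2)" by (rule iffD2[OF Q x(4)]) (rule j(2))
  have "(t1 \<circ> t2)`B = t1`B" by (rule image_cong[OF refl j(1)])
  also have "... = B" by (rule permutes_image[OF x(2)])
  finally show ?case using q j(3) by (simp only: x(1) prod.case mem_Collect_eq list.set ball_simps simp_thms)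
 next case (5 t)
  hence p: "t permutes S" and B: "t`B = B" by auto
  note s = permutes_split[OF p fB(3) B]
  have bB: "bij_betw t B B" "bij_betw t ?R ?R" using B s(4) permutes_inj_on[OF p] by (auto simp: bij_betw_def)
  have un: "B Un ?R = S" using fB by blast
  have "cyc_prod phi (perm_restrict t B) B = cyc_prod phi t B" by (rule cyc_prod_cong[OF fB(1) bB(1)]) (simp add: perm_restrict_def)
  moreover have "cyc_prod phi (perm_restrict t ?R) ?R = cyc_prod phi t ?R" by (rule cyc_prod_cong[OF fB(2) bB(2)]) (simp add: perm_restrict_def)
  ultimately show ?case using cyc_prod_union[OF fB(1,2) _ bB, of phi] unfolding un by simp
 qed
 also have "... = (\<Sum>t | t permutes B. cyc_prod phi t B) * (\<Sum>t | t permutes ?R & ?Q t. cyc_prod phi t ?R)"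
  by (simp only: sum_product sum.cartesian_product)
 also have "(\<Sum>t | t permutes ?R & ?Q t. cyc_prod phi t ?R) = (\<Prod>b\<leftarrow>f. \<Sum>t | t permutes {1..card b}. cyc_prod phi t {1..card b})"
  by (rule Cons.IH[OF fB(2)]) (use Bf in blast)
 finally show ?case by (simp add: sum_cyc_prod_card[OF fB(1)])
qed

lemma finite_words: "finite (words n)"
proof (rule finite_subset)
 let ?t1 = "{u. set u <= {..n} & length u <= n}"
 show "words n <= ?t1" proof
  fix u assume u: "u:words n"
  have "0 ~: set u ==> length u <= sum_list u" by (induction u) auto
  thus "u:?t1" using u member_le_sum_list[of _ u] by (auto simp: words_def)
 qed
 show "finite ?t1" by (rule finite_lists_length_le) simp
qed

lemma prod_list_map_mult:
 "(\<Prod>x\<leftarrow>xs. f x) * (\<Prod>x\<leftarrow>xs. g x) = (\<Prod>x\<leftarrow>xs. f x * (g x :: 'r::comm_monoid_mult))"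
 by (induction xs) (simp_all add: mult_ac)

text \<open>The hypothesis on \<open>w\<close> evaluates the sum over all stable partitions above
  \<open>P\<close> as a number of lists of fixed blocks. After exchanging the sums, each ordered set
  partition contributes one factor per block, and the multinomial number of ordered set partitions
  with given block sizes turns this into a sum over words.\<close>

theorem weight_full_words:
 fixes w :: "(nat => nat) => nat set set => nat set set => 'r::comm_ring_1"
 assumes ifact: "!!n. of_nat (fact n) * ifact n = (1::'r)" and w: "!!t P. t permutes {1..n} ==> P:stab {1..n} t ==>
    (\<Sum>X | X:stab {1..n} t & finer P X. w t P X) = of_nat (card {f. distinct f & set f = P & (ALL b:P. t`b = b)})"
 shows "ifact n * weight_full w phi zeta (%_. 1) n =
  (SUM u:words n. \<Prod>i\<leftarrow>u. zeta i * (ifact i * (\<Sum>t | t permutes {1..i}. cyc_prod phi t {1..i})))" (is "?l = _")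
proof -
 let ?S = "{1..n}"
 let ?C = "%i. \<Sum>t | t permutes {1..i}. cyc_prod phi t {1..i}"
 let ?fx = "%t. {f:block_lists ?S. ALL b:set f. t`b = b}"
 have inner: "(SUM X:stab ?S t. (PROD x:X. 1) * (\<Sum>P | P:stab ?S t & finer P X. w t P X * (PROD y:P. zeta (card y)))) =
   (SUM f:?fx t. \<Prod>b\<leftarrow>f. zeta (card b))" if p: "t permutes ?S" for t proof -
  let ?t1 = "(SUM P:stab ?S t. \<Sum>X | X:stab ?S t & finer P X. w t P X * (PROD y:P. zeta (card y)))"
  have "(SUM X:stab ?S t. (PROD x:X. 1) * (\<Sum>P | P:stab ?S t & finer P X. w t P X * (PROD y:P. zeta (card y)))) = ?t1" (is "?l2 = _") proof -
   have fs: "finite (stab ?S t)" by (rule finite_stab) simp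
   have "?l2 = (SUM X:stab ?S t. \<Sum>P | P:stab ?S t & finer P X. w t P X * (PROD y:P. zeta (card y)))" by (simp only: prod.neutral_const mult_1)
   also have "... = ?t1" by (rule sum.swap_restrict[OF fs fs])
   finally show ?thesis .
  qed
  also have "... = (SUM P:stab ?S t. \<Sum>f | distinct f & set f = P & (ALL b:P. t`b = b). \<Prod>b\<leftarrow>f. zeta (card b))"
  proof (rule sum_eqI, goal_cases) case P: (1 P)
   have "(\<Sum>X | X:stab ?S t & finer P X. w t P X * (PROD y:P. zeta (card y))) =
     of_nat (card {f. distinct f & set f = P & (ALL b:P. t`b = b)}) * (PROD y:P. zeta (card y))"
    by (simp only: sum_distrib_right[symmetric] w[OF p P])
   also have "... = (\<Sum>f | distinct f & set f = P & (ALL b:P. t`b = b). PROD y:P. zeta (card y))" by simp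
   also have "... = (\<Sum>f | distinct f & set f = P & (ALL b:P. t`b = b). \<Prod>b\<leftarrow>f. zeta (card b))"
    by (rule sum_eqI) (auto simp: prod.distinct_set_conv_list)
   finally show ?case .
  qed
  also have "... = (SUM P:stab ?S t. \<Sum>f | f:?fx t & set f = P. \<Prod>b\<leftarrow>f. zeta (card b))"
   by (intro sum.cong refl) (auto simp: block_lists_def stab_def)
  also have "... = (SUM f:?fx t. \<Prod>b\<leftarrow>f. zeta (card b))" proof (rule sum.group)
   show "finite (?fx t)" using finite_block_lists[of ?S] by simp
   show "set`?fx t <= stab ?S t" by (auto simp: block_lists_def stab_def)
  qed simp
  finally show ?thesis .
 qed
 have "weight_full w phi zeta (%_. 1) n = (\<Sum>t | t permutes ?S. \<Sum>f | f:block_lists ?S & (ALL b:set f. t`b = b). cyc_prod phi t ?S * (\<Prod>b\<leftarrow>f. zeta (card b)))"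
  unfolding weight_full_def proof (rule sum_eqI, goal_cases)
  case (1 t)
  hence p: "t permutes ?S" by simp
  show ?case unfolding inner[OF p] by (rule sum_distrib_left)
 qed
 also have "... = (SUM f:block_lists ?S. \<Sum>t | t permutes ?S & (ALL b:set f. t`b = b). cyc_prod phi t ?S * (\<Prod>b\<leftarrow>f. zeta (card b)))"
  using sum.swap_restrict[of "{t. t permutes ?S}" "block_lists ?S" "%t f. cyc_prod phi t ?S * (\<Prod>b\<leftarrow>f. zeta (card b))" "%t f. ALL b:set f. t`b = b"]
   finite_permutations[of ?S] finite_block_lists[of ?S] by simp
 also have "... = (SUM f:block_lists ?S. \<Prod>i\<leftarrow>map card f. zeta i * ?C i)" proof (rule sum_eqI, goal_cases)
  case f: (1 f)
  have "(\<Sum>t | t permutes ?S & (ALL b:set f. t`b = b). cyc_prod phi t ?S * (\<Prod>b\<leftarrow>f. zeta (card b))) =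
    (\<Prod>b\<leftarrow>f. ?C (card b)) * (\<Prod>b\<leftarrow>f. zeta (card b))"
   unfolding sum_distrib_right[symmetric] by (subst sum_block_fixing[OF _ f]) simp_all
  also have "... = (\<Prod>b\<leftarrow>f. ?C (card b) * zeta (card b))" by (rule prod_list_map_mult)
  also have "... = (\<Prod>i\<leftarrow>map card f. zeta i * ?C i)" by (simp add: comp_def mult.commute)
  finally show ?case .
 qed
 also have "... = (SUM u:words n. \<Sum>f | f:block_lists ?S & map card f = u. \<Prod>i\<leftarrow>map card f. zeta i * ?C i)"
 proof (rule sum.group[symmetric])
  show "finite (block_lists ?S)" by (rule finite_block_lists) simp
  show "finite (words n)" by (rule finite_words)
  show "map card`block_lists ?S <= words n" proof
   fix u assume "u:map card`block_lists ?S"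
   then obtain f where f: "distinct f" "partition_on ?S (set f)" "u = map card f" by (auto simp: block_lists_def)
   have fb: "finite b & b ~= {}" if "b:set f" for b proof -
    have "b <= ?S" using f(2) that by (auto simp: partition_on_def)
    thus ?thesis using f(2) that finite_subset[of b ?S] by (auto simp: partition_on_def)
   qed
   have "sum_list u = (SUM b:set f. card b)" using f(1) by (simp add: f(3) sum.distinct_set_conv_list)
   also have "... = card (\<Union>(set f))"
    by (rule card_Union_disjoint[symmetric]) (use f(2) fb in \<open>auto simp: partition_on_def disjoint_def pairwise_def disjnt_def\<close>)
   also have "... = n" using f(2) by (simp add: partition_on_def)
   finally show "u:words n" using fb f(3) by (auto simp: words_def)
  qed
 qed
 also have "... = (SUM u:words n. of_nat (card {f:block_lists ?S. map card f = u}) * (\<Prod>i\<leftarrow>u. zeta i * ?C i))" by (rule sum_eqI) simp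
 finally have "?l = (SUM u:words n. ifact n * (of_nat (card {f:block_lists ?S. map card f = u}) * (\<Prod>i\<leftarrow>u. zeta i * ?C i)))"
  by (simp add: sum_distrib_left)
 also have "... = (SUM u:words n. \<Prod>i\<leftarrow>u. zeta i * (ifact i * ?C i))" proof (rule sum_eqI, goal_cases)
  case u: (1 u)
  let ?N = "card {f:block_lists ?S. map card f = u}"
  have N: "?N * (\<Prod>i\<leftarrow>u. fact i) = fact n" using card_block_lists[of ?S u] u by (simp add: words_def)
  have pf: "(\<Prod>i\<leftarrow>u. zeta i * ?C i) = of_nat (\<Prod>i\<leftarrow>u. fact i) * (\<Prod>i\<leftarrow>u. zeta i * (ifact i * ?C i))" for u
  proof (induction u) case (Cons i u)
   have "zeta i * ?C i = of_nat (fact i) * (zeta i * (ifact i * ?C i))" proof -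
    have "of_nat (fact i) * (zeta i * (ifact i * ?C i)) = (of_nat (fact i) * ifact i) * (zeta i * ?C i)" by (simp only: mult_ac)
    thus ?thesis by (simp only: ifact mult_1)
   qed
   thus ?case by (simp only: list.map prod_list.Cons of_nat_mult Cons.IH) (simp only: mult_ac)
  qed simp
  have "ifact n * (of_nat ?N * (\<Prod>i\<leftarrow>u. zeta i * ?C i)) = (ifact n * of_nat (?N * (\<Prod>i\<leftarrow>u. fact i))) * (\<Prod>i\<leftarrow>u. zeta i * (ifact i * ?C i))"
   unfolding pf[of u] by (simp only: of_nat_mult mult_ac)
  also have "... = (\<Prod>i\<leftarrow>u. zeta i * (ifact i * ?C i))" unfolding N using ifact[of n] by (simp add: mult.commute)
  finally show ?case .
 qed
 finally show ?thesis .
qed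

text \<open>With a single coarse block a compatible family is one list mapped to itself, so each of
  its blocks is fixed.\<close>

lemma order_families_top:
 assumes P: "P:stab S t" and S: "t`S = S"
 shows "card (order_families t P {S}) = card {f. distinct f & set f = P & (ALL b:P. t`b = b)}" (is "_ = card ?O")
proof -
 have b: "below P S = P" using stab_subset_Pow[OF P] by (auto simp: below_def)
 have mf: "map ((`) t) f = f \<longleftrightarrow> (ALL b:set f. t`b = b)" for f by (induction f) auto
 have "bij_betw (%k. k S) (order_families t P {S}) ?O"
 proof (rule bij_betw_byWitness[where f' = "%l. \<lambda>x\<in>{S}. l"]; (intro ballI image_subsetI)?) fix k assume k: "k:order_families t P {S}"
  have "(\<lambda>x\<in>{S}. k S) = restrict k {S}" by (rule restrict_ext) simp
  thus "(\<lambda>x\<in>{S}. k S) = k" unfolding order_families_restrict[OF k] .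
  show "k S:?O" using order_familiesD[OF k, of S] mf[of "k S"] b S by simp
 next fix l assume l: "l:?O"
  hence "map ((`) t) l = l" by (auto simp only: mf)
  thus "(\<lambda>x\<in>{S}. l):order_families t P {S}" using l b S by (intro order_familiesI) simp_all
 qed simp_all
 thus ?thesis by (rule bij_betw_same_card)
qed

section \<open>The generating function of the Peirce components\<close>

lemma finite_partitions_of: "finite (partitions_of n)"
proof (rule finite_surj[OF finite_words[of n]])
 show "partitions_of n <= mset`words n" proof
  fix rho assume rho: "rho:partitions_of n" obtain u where u: "mset u = rho" using ex_mset by blast
  have "u:words n" using rho u by (auto simp: partitions_of_def partitions_def words_def sum_mset_sum_list[symmetric])
  thus "rho:mset`words n" using u by blast
 qed
qed

lemma block_type_partitions_of:
 assumes "partition_on {1..n} X"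
 shows "block_type X:partitions_of n"
proof -
 have fb: "finite b & b ~= {}" if "b:X" for b proof -
  have "b <= {1..n}" using assms that by (auto simp: partition_on_def)
  thus ?thesis using assms that finite_subset[of b "{1..n}"] by (auto simp: partition_on_def)
 qed
 have fX: "finite X" by (rule finite_elements[OF finite_atLeastAtMost assms])
 have "\<Sum>\<^sub># (block_type X) = (SUM b:X. card b)" by (simp add: block_type_def sum_unfold_sum_mset)
 also have "... = card (\<Union>X)"
  by (rule card_Union_disjoint[symmetric]) (use assms fb in \<open>auto simp: partition_on_def disjoint_def pairwise_def disjnt_def\<close>)
 also have "... = n" using assms by (simp add: partition_on_def)
 finally show ?thesis using fb fX by (auto simp: partitions_of_def partitions_def block_type_def)
qed

definition gen_const :: "complex => gen_fun" where "gen_const c = mps_const (mps_const c)"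

lemma gen_const_simps: "gen_const 0 = 0" "gen_const 1 = 1" "gen_const (a + b) = gen_const a + gen_const b"
 "gen_const (a * b) = gen_const a * gen_const b" "gen_const (of_nat n) = of_nat n" by (simp_all add: gen_const_def mps_const_hom mps_const_of_nat)

lemma gen_const_sum: "gen_const (sum f A) = (SUM a:A. gen_const (f a))" by (simp add: gen_const_def mps_const_sum)

lemma gen_ifact: "of_nat (fact n) * gen_const (1 / fact n) = 1" (is "?l = _")
proof -
 have "?l = gen_const (of_nat (fact n) * (1 / fact n))" by (simp only: gen_const_simps)
 thus ?thesis by (simp add: gen_const_simps)
qed

abbreviation gen_p :: "nat => gen_fun" where "gen_p k \<equiv> mps_const (sym_p k)"
abbreviation gen_z :: "nat => gen_fun" where "gen_z k \<equiv> mps_var (Z k)"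
abbreviation gen_y :: "nat => gen_fun" where "gen_y k \<equiv> mps_var (Y k)"
abbreviation gen_weight :: "(nat => nat) => nat set set => nat set set => gen_fun" where
 "gen_weight t P X \<equiv> gen_const (minv order_weight t P X)"

lemma natural_gen_weight: "natural_weight gen_weight" by (rule natural_weight_hom[OF natural_weight.minv_natural[OF natural_weight_order]])
  (simp_all add: gen_const_simps)

lemma mps_const_cyc_prod: "mps_const (cyc_prod f t S) = cyc_prod (%k. mps_const (f k)) t S" by (simp add: cyc_prod_def mps_const_prod)

lemma y_mon_block_type: "y_mon (block_type X) = (PROD x:X. gen_y (card x))"
 by (simp add: y_mon_def block_type_def prod_unfold_prod_mset multiset.map_comp comp_def)

lemma z_mon_block_type: "z_mon (block_type X) = (PROD x:X. gen_z (card x))"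
 by (simp add: z_mon_def block_type_def prod_unfold_prod_mset multiset.map_comp comp_def)

lemma sum_by_block_type:
 fixes h :: "nat set set => gen_fun"
 assumes "t permutes {1..n}"
 shows "(SUM rho:partitions_of n. g rho * (\<Sum>X | X:stab {1..n} t & block_type X = rho. h X)) =
  (SUM X:stab {1..n} t. g (block_type X) * h X)" (is "?l = _")
proof -
 have "?l = (SUM rho:partitions_of n. \<Sum>X | X:stab {1..n} t & block_type X = rho. g (block_type X) * h X)" by (simp add: sum_distrib_left)
 also have "... = (SUM X:stab {1..n} t. g (block_type X) * h X)" proof (rule sum.group[OF _ finite_partitions_of])
  show "finite (stab {1..n} t)" by (rule finite_stab) simp
  show "block_type`stab {1..n} t <= partitions_of n" using block_type_partitions_of by (auto simp: stab_def)
 qed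
 finally show ?thesis .
qed

text \<open>Depends on n alone; by \<open>peirce_term_series\<close> no trace of the chosen
  idempotents remains.\<close>

definition peirce_series :: "nat => gen_fun" where "peirce_series n = gen_const (1 / fact n) * weight_full gen_weight gen_p gen_z gen_y n"

text \<open>Summation over the types of both indices merges the coefficients into one sum over pairs
  of stable partitions, in which the y- and z-monomials become block markers.\<close>

theorem peirce_term_series:
 assumes sal: "saliola_family n eh" and u: "u:Units (invariant_algebra n)"
  and E: "!!rho. rho:partitions_of n ==> E rho = u \<otimes>\<^bsub>invariant_algebra n\<^esub>
   (\<Sum>X | X:set_partitions n & block_type X = rho. eh X) \<otimes>\<^bsub>invariant_algebra n\<^esub> inv\<^bsub>invariant_algebra n\<^esub> u"
 shows "peirce_term E n = peirce_series n"
proof -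
 let ?S = "{1..n}" and ?C = "%t. cyc_prod gen_p t {1..n}"
 let ?g = "%t X P. gen_const (order_coeff t P X)"
 let ?a = "%t rho mu. \<Sum>X | X:stab ?S t & block_type X = rho. \<Sum>P | P:stab ?S t & block_type P = mu. ?g t X P"
 have ch: "mps_const (frobenius_ch n (peirce_part (face_algebra n) (E rho) (E mu)) {0} face_act) =
   gen_const (1 / fact n) * (\<Sum>t | t permutes ?S. ?C t * ?a t rho mu)" if "rho:partitions_of n" "mu:partitions_of n" for rho mu
  unfolding E[OF that(1)] E[OF that(2)] peirce_frobenius_ch[OF sal u]
  by (simp add: mps_const_hom mps_const_sum mps_const_cyc_prod gen_const_def mult.commute)
 have "peirce_term E n = (SUM rho:partitions_of n. SUM mu:partitions_of n. y_mon rho * z_mon mu *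
   (gen_const (1 / fact n) * (\<Sum>t | t permutes ?S. ?C t * ?a t rho mu)))"
  unfolding peirce_term_def by (intro sum.cong refl arg_cong2[where f = "(*)"]) (simp only: ch)
 also have "... = (SUM rho:partitions_of n. SUM mu:partitions_of n. \<Sum>t | t permutes ?S. gen_const (1 / fact n) * (?C t * (y_mon rho * (z_mon mu * ?a t rho mu))))"
  by (simp only: sum_distrib_left mult_ac)
 also have "... = (\<Sum>t | t permutes ?S. SUM rho:partitions_of n. SUM mu:partitions_of n. gen_const (1 / fact n) * (?C t * (y_mon rho * (z_mon mu * ?a t rho mu))))"
  by (subst sum.swap[where B = "{t. t permutes ?S}"], subst sum.swap[where B = "{t. t permutes ?S}"]) (rule refl)
 also have "... = (\<Sum>t | t permutes ?S. gen_const (1 / fact n) * (?C t *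
   (SUM X:stab ?S t. (PROD x:X. gen_y (card x)) * (\<Sum>P | P:stab ?S t & finer P X. gen_weight t P X * (PROD y:P. gen_z (card y))))))"
 proof (rule sum_eqI, goal_cases) case (1 t)
  hence p: "t permutes ?S" by simp
  have "(SUM rho:partitions_of n. SUM mu:partitions_of n. y_mon rho * (z_mon mu * ?a t rho mu)) =
    (SUM rho:partitions_of n. y_mon rho * (\<Sum>X | X:stab ?S t & block_type X = rho.
      SUM mu:partitions_of n. z_mon mu * (\<Sum>P | P:stab ?S t & block_type P = mu. ?g t X P)))" proof (rule sum_eqI, goal_cases)
   case (1 rho)
   have "(\<Sum>X | X:stab ?S t & block_type X = rho. SUM mu:partitions_of n. z_mon mu * (\<Sum>P | P:stab ?S t & block_type P = mu. ?g t X P)) =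
     (SUM mu:partitions_of n. z_mon mu * ?a t rho mu)" by (subst sum.swap) (simp only: sum_distrib_left)
   thus ?case by (simp only: sum_distrib_left[symmetric])
  qed
  also have "... = (SUM X:stab ?S t. y_mon (block_type X) * (SUM P:stab ?S t. z_mon (block_type P) * ?g t X P))" unfolding sum_by_block_type[OF p] ..
  also have "... = (SUM X:stab ?S t. (PROD x:X. gen_y (card x)) * (\<Sum>P | P:stab ?S t & finer P X. gen_weight t P X * (PROD y:P. gen_z (card y))))"
  proof (rule sum_eqI, goal_cases) case (1 X)
   have "(SUM P:stab ?S t. z_mon (block_type P) * ?g t X P) = (\<Sum>P | P:stab ?S t & finer P X. gen_weight t P X * (PROD y:P. gen_z (card y)))"
   proof (rule sum.mono_neutral_cong_right)
    show "ALL P:stab ?S t - {P:stab ?S t. finer P X}. z_mon (block_type P) * ?g t X P = 0" by (simp add: order_coeff_def gen_const_simps)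
    show "z_mon (block_type P) * ?g t X P = gen_weight t P X * (PROD y:P. gen_z (card y))" if "P:{P:stab ?S t. finer P X}" for P
     using that by (simp add: order_coeff_def z_mon_block_type mult.commute)
   qed simp_all
   thus ?case by (simp add: y_mon_block_type)
  qed
  finally show ?case by (simp only: sum_distrib_left[symmetric])
 qed
 also have "... = peirce_series n" unfolding peirce_series_def weight_full_def by (simp only: sum_distrib_left)
 finally show ?thesis .
qed

text \<open>The coefficient of the r-th power of the z-monomial of \<open>alpha\<close> in the
  normalised core. Enlarging r only substitutes r-th powers, by \<open>core_sym_power_subst\<close>,
  so r = 1 is the essential case.\<close>

definition core_sym :: "nat => nat multiset => symfun" where
 "core_sym r alpha = mps_const (1 / fact (\<Sum>\<^sub># alpha)) * (\<Sum>sigma | sigma permutes {1..\<Sum>\<^sub># alpha}.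
   cyc_prod (%k. sym_p (r * k)) sigma {1..\<Sum>\<^sub># alpha} *
   mps_const (\<Sum>P | P:stab {1..\<Sum>\<^sub># alpha} sigma & block_type P = alpha. minv order_weight sigma P {{1..\<Sum>\<^sub># alpha}}))"

lemma core_sym_power_subst: "r > 0 ==> core_sym r alpha = power_subst r (core_sym 1 alpha)" unfolding core_sym_def cyc_prod_def
 by (simp add: power_subst_mult power_subst_sum power_subst_prod power_subst_sym_p)

lemma weight_core_sym:
 "gen_const (1 / fact s) * weight_core gen_weight gen_p gen_z r s = (SUM alpha:partitions_of s. z_mon alpha^r * mps_const (core_sym r alpha))" (is "?l = _")
proof -
 let ?S = "{1..s}" and ?C = "%sigma. cyc_prod (%k. gen_p (r * k)) sigma {1..s}"
 let ?h = "%sigma alpha. \<Sum>P | P:stab ?S sigma & block_type P = alpha. gen_weight sigma P {?S}"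
 have "?l = gen_const (1 / fact s) * (\<Sum>sigma | sigma permutes ?S. ?C sigma * (SUM alpha:partitions_of s. z_mon alpha^r * ?h sigma alpha))"
  unfolding weight_core_def proof (rule arg_cong[where f = "%x. gen_const (1 / fact s) * x"], rule sum_eqI, goal_cases)
  case (1 sigma)
  hence p: "sigma permutes ?S" by simp
  show ?case unfolding sum_by_block_type[OF p] z_mon_block_type by (simp only: prod_power_distrib mult.commute)
 qed
 also have "... = (\<Sum>sigma | sigma permutes ?S. SUM alpha:partitions_of s. z_mon alpha^r * (gen_const (1 / fact s) * (?C sigma * ?h sigma alpha)))"
  by (simp only: sum_distrib_left mult_ac)
 also have "... = (SUM alpha:partitions_of s. \<Sum>sigma | sigma permutes ?S. z_mon alpha^r * (gen_const (1 / fact s) * (?C sigma * ?h sigma alpha)))"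
  by (rule sum.swap)
 also have "... = (SUM alpha:partitions_of s. z_mon alpha^r * mps_const (core_sym r alpha))" proof (rule sum_eqI, goal_cases)
  case (1 alpha)
  hence "\<Sum>\<^sub># alpha = s" by (simp add: partitions_of_def)
  hence "mps_const (core_sym r alpha) = gen_const (1 / fact s) * (\<Sum>sigma | sigma permutes ?S. ?C sigma * ?h sigma alpha)"
   by (simp add: core_sym_def mps_const_hom mps_const_sum mps_const_cyc_prod gen_const_def)
  thus ?case by (simp only: sum_distrib_left)
 qed
 finally show ?thesis .
qed

lemma peirce_series_0: "peirce_series 0 = 1"
proof -
 have "{P. P = {} & finer P {}} = {{} :: nat set set}" by auto
 thus ?thesis using natural_weight.empty[OF natural_gen_weight] by (simp add: peirce_series_def weight_full_def gen_const_simps)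
qed

lemma peirce_series_recursion: "of_nat n * peirce_series n = (\<Sum>k=1..n. (\<Sum>s | s dvd k. of_nat s * (gen_y s^(k div s) *
   (SUM alpha:partitions_of s. z_mon alpha^(k div s) * mps_const (core_sym (k div s) alpha)))) * peirce_series (n - k))"
proof -
 have "of_nat n * peirce_series n = (\<Sum>k=1..n. (\<Sum>s | s dvd k. of_nat s * (gen_const (1 / fact s) * (gen_y s^(k div s) * weight_core gen_weight gen_p gen_z (k div s) s))) * peirce_series (n - k))"
  using weight_recursion[OF natural_gen_weight gen_ifact, of n gen_p gen_z gen_y] unfolding peirce_series_def .
 moreover have "gen_const (1 / fact s) * (gen_y s^r * weight_core gen_weight gen_p gen_z r s) =
   gen_y s^r * (SUM alpha:partitions_of s. z_mon alpha^r * mps_const (core_sym r alpha))" for r s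
  unfolding weight_core_sym[symmetric] by (simp only: mult_ac)
 ultimately show ?thesis by (simp only:)
qed

definition word_term :: "nat list => gen_fun" where "word_term u = z_mon (mset u) * mps_const (sym_h_word u)"

text \<open>The cores are those of \<open>peirce_series_recursion\<close>, but the marker of the
  coarse blocks is set to 1. The sum over coarse partitions then undoes \<open>minv\<close> and
  leaves orders under the one-block partition, so the full sums are sums over words.\<close>

lemma word_series_recursion: "of_nat n * (SUM u:words n. word_term u) = (\<Sum>k=1..n. (\<Sum>s | s dvd k. of_nat s *
   (SUM alpha:partitions_of s. z_mon alpha^(k div s) * mps_const (core_sym (k div s) alpha))) * (SUM u:words (n - k). word_term u))"
proof -
 let ?W = "%n. gen_const (1 / fact n) * weight_full gen_weight gen_p gen_z (%_. 1) n"
 have W: "?W n = (SUM u:words n. word_term u)" for n proof -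
  have "?W n = (SUM u:words n. \<Prod>i\<leftarrow>u. gen_z i * (gen_const (1 / fact i) * (\<Sum>t | t permutes {1..i}. cyc_prod gen_p t {1..i})))"
  proof (rule weight_full_words[OF gen_ifact]) fix t P assume p: "t permutes {1..n}" and P: "P:stab {1..n} t"
   let ?t1 = "(card {f. distinct f & set f = P & (ALL b:P. t`b = b)})"
   \<comment> \<open>The empty ground set is treated apart: \<open>{{}}\<close> is not a partition,
     so there is no one-block partition above P.\<close>
   show "(\<Sum>X | X:stab {1..n} t & finer P X. gen_weight t P X) = of_nat ?t1" (is "?l = _") proof (cases "n = 0")
    case True
    hence "P = {}" using P by simp
    moreover have "{X. X = {} & finer {} X} = {{} :: nat set set}" by auto
    moreover have "{f. f = [] & distinct f} = {[] :: nat set list}" by auto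
    ultimately show ?thesis using True natural_weight.empty[OF natural_gen_weight] by simp
   next case False
    have top: "{{1..n}}:stab {1..n} t" using stab_one_block[OF permutes_imp_bij[OF p]] False by simp
    have f: "finer X {{1..n}}" if "X:stab {1..n} t" for X by (rule finer_one_block) (use stabD(3)[OF that] in simp)
    let ?t2 = "(SUM X:interval t P {{1..n}}. minv order_weight t P X)"
    have "{X. X:stab {1..n} t & finer P X} = interval t P {{1..n}}" using f by (auto simp: interval_def)
    hence "?l = gen_const ?t2" by (simp add: gen_const_sum)
    also have "?t2 = order_weight t P {{1..n}}" by (rule minv_sum[OF _ top f[OF P]]) simp
    also have "gen_const (order_weight t P {{1..n}}) = of_nat ?t1"
     unfolding order_weight_def order_families_top[OF P permutes_image[OF p]] by (rule gen_const_simps)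
    finally show ?thesis .
   qed
  qed
  also have "... = (SUM u:words n. word_term u)" proof (rule sum_eqI, goal_cases)
   case (1 u)
   have h: "gen_const (1 / fact i) * (\<Sum>t | t permutes {1..i}. cyc_prod gen_p t {1..i}) = mps_const (sym_h i)" for i
    by (simp add: sym_h_cycle_index cycle_index_def gen_const_def mps_const_hom mps_const_sum mps_const_cyc_prod)
   show ?case unfolding h by (induction u) (simp_all add: word_term_def z_mon_def sym_h_word_def mps_const_hom mult_ac)
  qed
  finally show ?thesis .
 qed
 have "of_nat n * ?W n = (\<Sum>k=1..n. (\<Sum>s | s dvd k. of_nat s * (gen_const (1 / fact s) * (1^(k div s) * weight_core gen_weight gen_p gen_z (k div s) s))) * ?W (n - k))"
  by (rule weight_recursion[OF natural_gen_weight gen_ifact])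
 thus ?thesis unfolding W by (simp only: power_one mult_1 weight_core_sym)
qed

section \<open>The logarithmic derivative of the series of words\<close>

lemma fps_X_deriv_nth: "fps_nth (fps_X * fps_deriv f) n = of_nat n * fps_nth (f :: 'r::comm_ring_1 fps) n" by (cases n) simp_all

text \<open>The power series variable marks the size of a word and is introduced in order to
  differentiate.\<close>

definition letter_fps :: "gen_fun fps" where "letter_fps = Abs_fps (%m. if m = 0 then 0 else word_term [m])"

definition word_fps :: "gen_fun fps" where "word_fps = Abs_fps (%n. SUM u:words n. word_term u)"

lemma word_term_Nil [simp]: "word_term [] = 1" by (simp add: word_term_def z_mon_def sym_h_word_def)

lemma word_term_Cons: "word_term (i # u) = word_term [i] * word_term u" by (simp add: word_term_def z_mon_def sym_h_word_def mps_const_hom mult_ac)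

lemma words_0 [simp]: "words 0 = {[]}"
proof -
 have "u = []" if "0 ~: set u" "sum_list u = 0" for u :: "nat list" using that by (cases u) auto
 thus ?thesis by (auto simp: words_def)
qed

lemma sum_words_Cons:
 fixes F :: "nat list => 'r::comm_ring_1"
 shows "(\<Sum>u | u:words n & u ~= [] & P (tl u). F u) = (\<Sum>i=1..n. \<Sum>u | u:words (n - i) & P u. F (i # u))" (is "?l = _")
proof -
 have "(\<Sum>i=1..n. \<Sum>u | u:words (n - i) & P u. F (i # u)) = (SUM (i, u):(SIGMA i:{1..n}. {u. u:words (n - i) & P u}). F (i # u))"
  by (rule sum.Sigma) (use finite_words in auto)
 also have "... = ?l" proof (rule sum.reindex_bij_witness[where i = "%u. (hd u, tl u)" and j = "%(i, u). i # u"])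
  fix u assume u: "u:{u. u:words n & u ~= [] & P (tl u)}"
  then obtain i v where "u = i # v" by (cases u) auto
  thus "(hd u, tl u):(SIGMA i:{1..n}. {u. u:words (n - i) & P u})" "(case (hd u, tl u) of (i, u) => i # u) = u" using u by (auto simp: words_def)
 qed (auto simp: words_def)
 finally show ?thesis by simp
qed

lemma letter_fps_power: "fps_nth (letter_fps^l) n = (\<Sum>u | u:words n & length u = l. word_term u)"
proof (induction l arbitrary: n) case 0
 have "{u:words n. u = []} = (if n = 0 then {[]} else {})" by (auto simp: words_def)
 thus ?case by simp
next case (Suc l)
 have "fps_nth (letter_fps^Suc l) n = (\<Sum>i=0..n. fps_nth letter_fps i * fps_nth (letter_fps^l) (n - i))" by (simp add: fps_mult_nth)
 also have "... = (\<Sum>i=1..n. fps_nth letter_fps i * fps_nth (letter_fps^l) (n - i))" by (rule sum.mono_neutral_right) (auto simp: letter_fps_def)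
 also have "... = (\<Sum>i=1..n. \<Sum>u | u:words (n - i) & length u = l. word_term (i # u))" proof (rule sum_eqI, goal_cases)
  case (1 i)
  hence l: "fps_nth letter_fps i = word_term [i]" by (simp add: letter_fps_def)
  show ?case unfolding l Suc.IH sum_distrib_left by (rule sum_eqI) (rule word_term_Cons[symmetric])
 qed
 also have "... = (\<Sum>u | u:words n & u ~= [] & length (tl u) = l. word_term u)" by (rule sum_words_Cons[symmetric])
 also have "{u. u:words n & u ~= [] & length (tl u) = l} = {u. u:words n & length u = Suc l}" by auto
 finally show ?case .
qed

lemma word_length_le: "u:words n ==> length u <= n"
proof -
 have "0 ~: set u ==> length u <= sum_list u" for u :: "nat list" by (induction u) auto
 thus "u:words n ==> length u <= n" by (auto simp: words_def)
qed

lemma word_fps_eq: "word_fps = 1 + letter_fps * word_fps"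
proof (rule fps_ext, goal_cases) case (1 n)
 show ?case proof (cases "n = 0")
  case True
  thus ?thesis by (simp add: word_fps_def letter_fps_def)
 next case False
  have "fps_nth (letter_fps * word_fps) n = (\<Sum>i=1..n. fps_nth letter_fps i * fps_nth word_fps (n - i))"
   unfolding fps_mult_nth by (rule sum.mono_neutral_right) (auto simp: letter_fps_def)
  also have "... = (\<Sum>i=1..n. \<Sum>u | u:words (n - i) & True. word_term (i # u))" proof (rule sum_eqI, goal_cases)
   case (1 i)
   hence l: "fps_nth letter_fps i = word_term [i]" by (simp add: letter_fps_def)
   show ?case unfolding l word_fps_def fps_nth_Abs_fps sum_distrib_left by (rule sum.cong) (auto intro: word_term_Cons[symmetric])
  qed
  also have "... = (\<Sum>u | u:words n & u ~= [] & True. word_term u)" by (rule sum_words_Cons[symmetric])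
  also have "{u. u:words n & u ~= [] & True} = words n" using False by (auto simp: words_def)
  finally show ?thesis using False by (simp add: word_fps_def)
 qed
qed

text \<open>The coefficient of X d/dX log (1 / (1 - L)) with L the letter series. The logarithm
  weights a word of length l by 1 / l, and the derivative multiplies by the size n.\<close>

definition word_log :: "nat => gen_fun" where "word_log n = (\<Sum>u | u:words n & u ~= []. gen_const (of_nat n / of_nat (length u)) * word_term u)"

text \<open>The geometric series is multiplied out term by term: the product of L^l with X L' is X
  times the derivative of L^(l + 1), divided by l + 1.\<close>

lemma word_log_fps: "fps_nth (word_fps * (fps_X * fps_deriv letter_fps)) n = word_log n"
proof -
 let ?D = "fps_X * fps_deriv letter_fps"
 \<comment> \<open>A word of size at most n has at most n letters, so up to this degree the
   geometric series may be cut off at l = n.\<close>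
 have W: "fps_nth word_fps k = (SUM l<=n. fps_nth (letter_fps^l) k)" if "k <= n" for k proof -
  have "fps_nth word_fps k = (SUM l<=n. \<Sum>u | u:words k & length u = l. word_term u)" unfolding word_fps_def fps_nth_Abs_fps
   by (rule sum.group[symmetric]) (use finite_words word_length_le that in \<open>force+\<close>)
  thus ?thesis by (simp only: letter_fps_power)
 qed
 have D: "fps_nth (letter_fps^l * ?D) n = gen_const (of_nat n / of_nat (Suc l)) * fps_nth (letter_fps^Suc l) n" for l proof -
  let ?t2 = "(1 / of_nat (Suc l))"
  have "fps_X * fps_deriv (letter_fps^Suc l) = of_nat (Suc l) * (letter_fps^l * ?D)"
   by (subst fps_deriv_power) (simp only: fps_of_nat diff_Suc_1 mult_ac)
  hence "of_nat n * fps_nth (letter_fps^Suc l) n = of_nat (Suc l) * fps_nth (letter_fps^l * ?D) n" by (metis fps_X_deriv_nth fps_mult_of_nat_nth(1))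
  hence "gen_const ?t2 * (of_nat n * fps_nth (letter_fps^Suc l) n) = gen_const ?t2 * of_nat (Suc l) * fps_nth (letter_fps^l * ?D) n"
   by (simp only: mult.assoc)
  moreover have "gen_const ?t2 * of_nat (Suc l) = 1"
   unfolding gen_const_simps(5)[symmetric] gen_const_simps(4)[symmetric] by (simp add: gen_const_simps del: of_nat_Suc)
  moreover have "gen_const ?t2 * of_nat n = gen_const (of_nat n / of_nat (Suc l))"
   unfolding gen_const_simps(5)[symmetric] gen_const_simps(4)[symmetric] by simp
  ultimately show ?thesis by (simp only: mult.assoc[symmetric] mult_1)
 qed
 let ?t1 = "{u. u:words n & u ~= []}"
 have "fps_nth (word_fps * ?D) n = (\<Sum>k=0..n. (SUM l<=n. fps_nth (letter_fps^l) k) * fps_nth ?D (n - k))"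
  unfolding fps_mult_nth[of word_fps] by (rule sum_eqI) (simp only: W atLeastAtMost_iff)
 also have "... = (SUM l<=n. fps_nth (letter_fps^l * ?D) n)" unfolding fps_mult_nth[of "letter_fps^_"] sum_distrib_right by (rule sum.swap)
 also have "... = (SUM l<=n. \<Sum>u | u:?t1 & length u - 1 = l. gen_const (of_nat n / of_nat (length u)) * word_term u)"
 proof (rule sum_eqI, goal_cases) case (1 l)
  have "{u. u:?t1 & length u - 1 = l} = {u. u:words n & length u = Suc l}" by (auto simp: Suc_diff_1[OF length_greater_0_conv[THEN iffD2]])
  thus ?case unfolding D letter_fps_power sum_distrib_left by simp
 qed
 also have "... = word_log n" unfolding word_log_def proof (rule sum.group)
  show "finite ?t1" using finite_words by simp
  show "(%u. length u - 1)`?t1 <= {..n}" using word_length_le by force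
 qed simp
 finally show ?thesis .
qed

text \<open>The recursion says X W' = G W for the word series W, while W (1 - L) = 1 gives W' (1 -
  L) = W L'. Multiplying the first equation by 1 - L therefore isolates G as W X L'.\<close>

lemma word_log_core:
 assumes "n > 0"
 shows "(\<Sum>s | s dvd n. of_nat s * (SUM alpha:partitions_of s. z_mon alpha^(n div s) * mps_const (core_sym (n div s) alpha))) = word_log n"
proof -
 let ?G = "%k. \<Sum>s | s dvd k. of_nat s * (SUM alpha:partitions_of s. z_mon alpha^(k div s) * mps_const (core_sym (k div s) alpha))"
 let ?D = "fps_X * fps_deriv letter_fps"
 define G where "G = Abs_fps (%k. if k = 0 then 0 else ?G k)"
 have e: "fps_X * fps_deriv word_fps = G * word_fps" proof (rule fps_ext, goal_cases)
  case (1 n)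
  have "fps_nth (G * word_fps) n = (\<Sum>k=1..n. fps_nth G k * fps_nth word_fps (n - k))"
   unfolding fps_mult_nth by (rule sum.mono_neutral_right) (auto simp: G_def)
  also have "... = (\<Sum>k=1..n. ?G k * fps_nth word_fps (n - k))" by (rule sum_eqI) (simp add: G_def)
  finally show ?case using word_series_recursion[of n] by (simp add: fps_X_deriv_nth word_fps_def)
 qed
 have inv: "word_fps * (1 - letter_fps) = 1" using word_fps_eq by (simp add: algebra_simps)
 have d: "fps_deriv word_fps * (1 - letter_fps) = word_fps * fps_deriv letter_fps" using arg_cong[OF inv, of fps_deriv] by (simp add: add_eq_0_iff)
 have "G = G * (word_fps * (1 - letter_fps))" by (simp only: inv mult_1_right)
 also have "... = fps_X * (fps_deriv word_fps * (1 - letter_fps))" by (simp only: mult.assoc[symmetric] e[symmetric])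
 also have "... = word_fps * ?D" unfolding d by (rule mult.left_commute)
 finally have "G = word_fps * ?D" .
 hence "fps_nth G n = word_log n" by (simp only: word_log_fps)
 thus ?thesis using assms by (simp add: G_def)
qed

section \<open>Identification of the cores with sums over Lyndon roots\<close>

definition mps_mon :: "('v \<Rightarrow>\<^sub>0 nat) => ('v, 'a::comm_ring_1) mps" where "mps_mon m = Abs_mps (%m'. if m' = m then 1 else 0)"

lemma mps_nth_mon: "mps_nth (mps_mon a) m = (if m = a then 1 else 0)" by (simp add: mps_mon_def)

lemma mps_mon_mult:
 fixes a b :: "'v \<Rightarrow>\<^sub>0 nat"
 shows "mps_mon a * mps_mon b = (mps_mon (a + b) :: ('v, 'r::comm_ring_1) mps)"
proof (rule mps_eqI, goal_cases) case (1 m)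
 have "mps_nth (mps_mon a * mps_mon b :: ('v, 'r) mps) m = (SUM p:{(x, y). x + y = m}. if p = (a, b) then 1 else 0)" unfolding mps_nth_mult
 proof (rule sum_eqI, clarify) fix x y :: "'v \<Rightarrow>\<^sub>0 nat"
  show "mps_nth (mps_mon a) x * mps_nth (mps_mon b) y = (if (x, y) = (a, b) then 1 else (0 :: 'r))" by (cases "x = a") (simp_all add: mps_nth_mon)
 qed
 also have "... = (if a + b = m then 1 else 0)" by (simp add: sum.delta[OF finite_monomial_splits])
 finally show ?case by (auto simp: mps_nth_mon)
qed

lemma mps_mon_simps: "mps_mon 0 = 1" "mps_var v = mps_mon (Poly_Mapping.single v 1)" by (simp_all add: mps_mon_def one_mps_def mps_var_def)

lemma mps_nth_mon_const: "mps_nth (mps_mon a * mps_const c) m = (if m = a then c else 0)" by (simp add: mult.commute[of "mps_mon a"] mps_nth_mon)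

definition z_exp :: "nat multiset => (yz_var \<Rightarrow>\<^sub>0 nat)" where "z_exp alpha = (\<Sum>i\<in>#alpha. Poly_Mapping.single (Z i) 1)"

lemma z_mon_mon: "z_mon alpha = mps_mon (z_exp alpha)" unfolding z_mon_def z_exp_def by (induction alpha) (simp_all add: mps_mon_simps mps_mon_mult)

lemma lookup_z_exp: "lookup (z_exp alpha) (Z i) = count alpha i"
 unfolding z_exp_def by (induction alpha) (simp_all add: lookup_add lookup_single when_def)

lemma z_exp_inj: "z_exp alpha = z_exp beta \<longleftrightarrow> alpha = beta" by (metis lookup_z_exp multiset_eqI)

lemma z_mon_add: "z_mon (alpha + beta) = z_mon alpha * z_mon beta" by (simp add: z_mon_def)

lemma z_mon_power: "z_mon alpha^r = z_mon (repeat_mset r alpha)" by (induction r) (simp_all add: z_mon_add, simp add: z_mon_def)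

abbreviation "h_mset beta \<equiv> (\<Prod>i\<in>#beta. sym_h i)"

lemma sym_h_word_mset: "sym_h_word u = h_mset (mset u)" unfolding sym_h_word_def by (induction u) simp_all

text \<open>The coefficient of a single z-monomial in \<open>word_log_core\<close>. Every word with
  content \<open>beta\<close> contributes the same term, n / size beta times h_beta.\<close>

theorem core_sym_identity:
 assumes beta: "beta:partitions_of n" "n > 0"
 shows "(\<Sum>s | s dvd n. \<Sum>alpha | alpha:partitions_of s & repeat_mset (n div s) alpha = beta. of_nat s * power_subst (n div s) (core_sym 1 alpha)) =
  mps_const (of_nat n / of_nat (size beta)) * of_nat (card {u. mset u = beta}) * h_mset beta" (is "?l = _")
proof -
 have "mps_nth (\<Sum>s | s dvd n. of_nat s * (SUM alpha:partitions_of s. z_mon alpha^(n div s) * mps_const (core_sym (n div s) alpha))) (z_exp beta) =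
   (\<Sum>s | s dvd n. of_nat s * (SUM alpha:partitions_of s. if repeat_mset (n div s) alpha = beta then core_sym (n div s) alpha else 0))" proof -
  have "mps_nth (of_nat s * f) m = of_nat s * mps_nth f m" for s and f :: gen_fun and m by (simp add: mps_const_of_nat[symmetric])
  moreover have "mps_nth (z_mon alpha^r * mps_const c) (z_exp beta) = (if repeat_mset r alpha = beta then c else 0)" for r alpha and c :: symfun
   unfolding z_mon_power unfolding z_mon_mon mps_nth_mon_const z_exp_inj by auto
  ultimately show ?thesis by (simp only: mps_nth_sum)
 qed
 also have "... = ?l" proof (rule sum_eqI, goal_cases)
  case (1 s)
  hence "n div s > 0" using beta(2) by (auto elim!: dvdE)
  thus ?case using finite_partitions_of[of s] by (simp add: sum.inter_filter[symmetric] sum_distrib_left core_sym_power_subst[of "n div s"])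
 qed
 finally have L: "mps_nth (word_log n) (z_exp beta) = ..." unfolding word_log_core[OF beta(2)] .
 have beta0: "beta ~= {#}" using beta by (auto simp: partitions_of_def)
 let ?t2 = "(of_nat n / of_nat (size beta))"
 have "mps_nth (word_log n) (z_exp beta) = (\<Sum>u | u:words n & u ~= []. if mset u = beta then mps_const ?t2 * h_mset beta else 0)"
  unfolding word_log_def mps_nth_sum proof (rule sum_eqI, goal_cases)
  case (1 u)
  have "mps_nth (word_term u) (z_exp beta) = (if mset u = beta then h_mset beta else 0)"
   unfolding word_term_def z_mon_mon mps_nth_mon_const z_exp_inj sym_h_word_mset by auto
  thus ?case by (auto simp: gen_const_def)
 qed
 also have "... = (\<Sum>u | mset u = beta. mps_const ?t2 * h_mset beta)" proof (rule sum.mono_neutral_cong_right)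
  let ?t1 = "{u. u:words n & u ~= []}"
  show "finite ?t1" using finite_words by simp
  show "{u. mset u = beta} <= ?t1" proof
   fix u assume "u:{u. mset u = beta}"
   hence u: "mset u = beta" by simp
   have "sum_list u = n" "0 ~: set u" using beta(1) u by (auto simp: partitions_of_def partitions_def sum_mset_sum_list)
   thus "u:?t1" using u beta0 by (auto simp: words_def)
  qed
 qed auto
 finally have R: "mps_nth (word_log n) (z_exp beta) = mps_const ?t2 * of_nat (card {u. mset u = beta}) * h_mset beta" by (simp add: mult_ac)
 show ?thesis using L R by simp
qed

abbreviation lie_h :: "nat => nat list => symfun" where "lie_h i w \<equiv> plethysm (sym_L i) (sym_h_word w)"

text \<open>The closed form that \<open>core_sym 1 alpha\<close> turns out to have.\<close>

definition lyndon_sym :: "nat multiset => symfun" where "lyndon_sym alpha = (SUM (w, i):lyndon_roots alpha. lie_h i w)"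

lemma repeat_mset_sum: "\<Sum>\<^sub># (repeat_mset e M) = e * \<Sum>\<^sub># (M :: nat multiset)" by (induction e) (simp_all add: algebra_simps)

lemma lyndon_rootsD:
 assumes "(w, e):lyndon_roots beta"
 shows "w:lyndon_words" "e > 0" "repeat_mset e (mset w) = beta" "e * sum_list w = \<Sum>\<^sub># beta" "e * length w = size beta"
  "sum_list w > 0" "length w > 0"
proof -
 show w: "w:lyndon_words" "e > 0" "repeat_mset e (mset w) = beta" using assms by (auto simp: lyndon_roots_def)
 show "e * sum_list w = \<Sum>\<^sub># beta" "e * length w = size beta" using w(3) by (auto simp: repeat_mset_sum sum_mset_sum_list)
 show "length w > 0" using lyndonD(1)[OF w(1)] by simp
 thus "sum_list w > 0" using lyndonD(2)[OF w(1)] by (cases w) auto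
qed

lemma lyndon_word_sum: "w:lyndon_words ==> sum_list w > 0" using lyndonD(1,2)[of w] by (cases w) auto

lemma in_repeat_mset: "x \<in># repeat_mset i M \<longleftrightarrow> i > 0 & x \<in># M" unfolding count_greater_zero_iff[symmetric] by simp

lemma lyndon_roots_repeat:
 assumes "w:lyndon_words" "i > 0"
 shows "(w, i):lyndon_roots (repeat_mset i (mset w))" "repeat_mset i (mset w):partitions_of (i * sum_list w)" using assms lyndonD(2)[OF assms(1)]
 by (auto simp: lyndon_roots_def partitions_of_def partitions_def repeat_mset_sum sum_mset_sum_list in_repeat_mset)

text \<open>The sum is regrouped by the roots (w, e) of \<open>beta\<close>; the choices of s, alpha
  and a root of alpha over w correspond to the divisors i of e. For fixed (w, e),
  \<open>sym_L_divisor_sum\<close> collapses the sum to h_w^e = h_beta, and the roots counted with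
  their lengths give the number of words.\<close>

theorem lyndon_sym_identity:
 assumes beta: "beta:partitions_of n" "n > 0"
 shows "(\<Sum>s | s dvd n. \<Sum>alpha | alpha:partitions_of s & repeat_mset (n div s) alpha = beta. of_nat s * power_subst (n div s) (lyndon_sym alpha)) =
  mps_const (of_nat n / of_nat (size beta)) * of_nat (card {u. mset u = beta}) * h_mset beta"
proof -
 let ?A = "%s. {alpha. alpha:partitions_of s & repeat_mset (n div s) alpha = beta}"
 let ?g = "%s w i. of_nat s * power_subst (n div s) (lie_h i w)"
 let ?h = "%((w, e), i). of_nat (i * sum_list w) * power_subst (e div i) (lie_h i w)"
 define J :: "nat \<times> nat multiset \<times> nat list \<times> nat => (nat list \<times> nat) \<times> nat"
  where "J = (%(s, alpha, w, i). ((w, (n div s) * i), i))"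
 define I :: "(nat list \<times> nat) \<times> nat => nat \<times> nat multiset \<times> nat list \<times> nat"
  where "I = (%((w, e), i). (i * sum_list w, repeat_mset i (mset w), w, i))"
 have sn: "\<Sum>\<^sub># beta = n" using beta(1) by (simp add: partitions_of_def)
 have beta0: "beta ~= {#}" "0 ~:# beta" using beta by (auto simp: partitions_of_def partitions_def)
 have finA: "finite (?A s)" for s using finite_partitions_of[of s] by simp
 let ?t1 = "(of_nat n / of_nat (size beta))"
 let ?t2 = "(SIGMA (w, e):lyndon_roots beta. {i. i dvd e})"
 have "(\<Sum>s | s dvd n. SUM alpha:?A s. of_nat s * power_subst (n div s) (lyndon_sym alpha)) =
   (\<Sum>s | s dvd n. SUM alpha:?A s. SUM (w, i):lyndon_roots alpha. ?g s w i)"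
  by (simp add: lyndon_sym_def power_subst_sum sum_distrib_left case_prod_unfold)
 also have "... = (SUM (s, alpha, w, i):(SIGMA s:{s. s dvd n}. SIGMA alpha:?A s. lyndon_roots alpha). ?g s w i)"
  using beta(2) by (simp add: sum.Sigma finA finite_lyndon_roots case_prod_unfold)
 also have "... = sum ?h ?t2" proof (rule sum.reindex_bij_witness[where j = J and i = I])
  fix x assume x: "x:(SIGMA s:{s. s dvd n}. SIGMA alpha:?A s. lyndon_roots alpha)"
  obtain s alpha w i where xe: "x = (s, alpha, w, i)" by (metis surj_pair)
  have s: "s dvd n" and alpha: "alpha:partitions_of s" "repeat_mset (n div s) alpha = beta" and wi: "(w, i):lyndon_roots alpha" using x by (auto simp: xe)
  note r = lyndon_rootsD[OF wi]
  have si: "i * sum_list w = s" using r(4) alpha(1) by (simp add: partitions_of_def)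
  have d: "n div s > 0" using s beta(2) by (auto elim!: dvdE)
  show "I (J x) = x" using r(3) si by (simp add: xe I_def J_def)
  have "repeat_mset (n div s * i) (mset w) = beta" using r(3) alpha(2) by (metis repeat_mset_right)
  thus "J x:?t2" using r(1,2) d by (simp add: xe J_def lyndon_roots_def)
  show "?h (J x) = (case x of (s, alpha, w, i) => ?g s w i)" using si r(2) by (simp add: xe J_def del: of_nat_mult)
 next fix y assume y: "y:?t2"
  obtain w e i where ye: "y = ((w, e), i)" by (metis surj_pair)
  have we: "(w, e):lyndon_roots beta" and i: "i dvd e" using y by (auto simp: ye)
  note r = lyndon_rootsD[OF we]
  obtain q where q: "e = i * q" using i by blast
  have n: "n = q * (i * sum_list w)" using r(4) sn by (simp add: q mult_ac)
  have i0: "i > 0" "q > 0" using r(2) q by (auto intro: Nat.gr0I)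
  have d: "n div (i * sum_list w) = q" using n i0 r(6) by simp
  have "repeat_mset q (repeat_mset i (mset w)) = beta" using r(3) by (simp add: q mult.commute)
  moreover have "i * sum_list w dvd n" unfolding n by simp
  ultimately show "I y:(SIGMA s:{s. s dvd n}. SIGMA alpha:?A s. lyndon_roots alpha)"
   using lyndon_roots_repeat[OF r(1) i0(1)] d by (simp add: ye I_def)
  show "J (I y) = y" using d by (simp add: ye q I_def J_def)
 qed
 also have "... = (SUM (w, e):lyndon_roots beta. \<Sum>i | i dvd e. of_nat (i * sum_list w) * power_subst (e div i) (lie_h i w))" proof -
  have f: "finite {i. i dvd e}" if "(w, e):lyndon_roots beta" for w e using lyndon_rootsD(2)[OF that] by simp
  have "(SUM p:lyndon_roots beta. SUM i:(%(w, e). {i. i dvd e}) p. ?h (p, i)) = (SUM (p, i):(SIGMA (w, e):lyndon_roots beta. {i. i dvd e}). ?h (p, i))"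
   by (rule sum.Sigma[OF finite_lyndon_roots]) (use f in auto)
  thus ?thesis by (simp add: case_prod_unfold)
 qed
 also have "... = (SUM (w, e):lyndon_roots beta. mps_const ?t1 * h_mset beta * of_nat (length w))" proof (rule sum_eqI, clarify)
  fix w e assume we: "(w, e):lyndon_roots beta"
  note r = lyndon_rootsD[OF we]
  let ?t3 = "(\<Sum>i | i dvd e. of_nat (i * sum_list w) * power_subst (e div i) (lie_h i w))"
  have "?t3 = of_nat (sum_list w) * sym_h_word w^e" unfolding sym_L_divisor_sum[OF r(2), symmetric] sum_distrib_left by (simp add: mult_ac)
  also have "sym_h_word w^e = h_mset beta" unfolding sym_h_word_mset r(3)[symmetric] by (induction e) simp_all
  \<comment> \<open>The exponent e times the sum of w is n, and e times the length of w is size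
    beta, so sum and length of w are in the ratio n / size beta.\<close>
  also have "of_nat (sum_list w) = (mps_const ?t1 * of_nat (length w) :: symfun)" proof -
   have "of_nat n / of_nat (size beta) * of_nat (length w) = (of_nat (sum_list w) :: complex)"
    using r sn by (simp add: field_simps flip: r(5) r(4)[unfolded sn])
   hence "(mps_const (of_nat (sum_list w)) :: symfun) = mps_const ?t1 * mps_const (of_nat (length w))" by (simp only: mps_const_hom(4)[symmetric])
   thus ?thesis by (simp only: mps_const_of_nat)
  qed
  finally show "?t3 = mps_const ?t1 * h_mset beta * of_nat (length w)" by (simp only: mult_ac)
 qed
 also have "... = mps_const ?t1 * h_mset beta * of_nat (SUM (w, e):lyndon_roots beta. length w)" by (simp add: sum_distrib_left case_prod_unfold)
 finally show ?thesis unfolding count_words_lyndon[OF beta0] by (simp only: mult_ac)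
qed

text \<open>\<open>core_sym_identity\<close> and \<open>lyndon_sym_identity\<close> are the same
  triangular system over the divisors of n: the right sides agree, the divisor s = n contributes n
  times the value at \<open>alpha\<close>, and the smaller divisors are covered by
  induction.\<close>

theorem core_sym_lyndon:
 assumes "alpha:partitions_of n" "n > 0"
 shows "core_sym 1 alpha = lyndon_sym alpha" using assms
proof (induction n arbitrary: alpha rule: less_induct) case (less n)
 let ?A = "%s. {gamma. gamma:partitions_of s & repeat_mset (n div s) gamma = alpha}"
 have split: "(\<Sum>s | s dvd n. SUM gamma:?A s. of_nat s * power_subst (n div s) (f gamma)) =
   of_nat n * f alpha + (SUM s:{s. s dvd n} - {n}. SUM gamma:?A s. of_nat s * power_subst (n div s) (f gamma))" for f proof -
  have "?A n = {alpha}" using less.prems by auto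
  hence "(SUM gamma:?A n. of_nat n * power_subst (n div n) (f gamma)) = of_nat n * f alpha" using less.prems(2) power_subst_1[of "f alpha"] by simp
  thus ?thesis using less.prems(2) by (subst sum.remove[of _ n]) auto
 qed
 have "(SUM s:{s. s dvd n} - {n}. SUM gamma:?A s. of_nat s * power_subst (n div s) (core_sym 1 gamma)) =
   (SUM s:{s. s dvd n} - {n}. SUM gamma:?A s. of_nat s * power_subst (n div s) (lyndon_sym gamma))" proof (intro sum.cong refl)
  fix s gamma assume s: "s:{s. s dvd n} - {n}" and gamma: "gamma:?A s"
  have "s < n" "s > 0" using s less.prems(2) by (auto dest: dvd_imp_le intro: Nat.gr0I)
  thus "of_nat s * power_subst (n div s) (core_sym 1 gamma) = of_nat s * power_subst (n div s) (lyndon_sym gamma)"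
   using less.IH[of s gamma] gamma by simp
 qed
 moreover have "of_nat n * core_sym 1 alpha + (SUM s:{s. s dvd n} - {n}. SUM gamma:?A s. of_nat s * power_subst (n div s) (core_sym 1 gamma)) =
   of_nat n * lyndon_sym alpha + (SUM s:{s. s dvd n} - {n}. SUM gamma:?A s. of_nat s * power_subst (n div s) (lyndon_sym gamma))"
  unfolding split[symmetric] core_sym_identity[OF less.prems] lyndon_sym_identity[OF less.prems] ..
 ultimately have "of_nat n * core_sym 1 alpha = of_nat n * lyndon_sym alpha" by (simp only: add_right_cancel)
 thus ?case by (rule mps_of_nat_cancel[OF less.prems(2)])
qed

section \<open>The logarithmic derivative of the Lyndon product\<close>

text \<open>One Newton term of the factor belonging to \<open>w\<close>: the removal of k parts
  equal to i. The factor i * |w| is the size carried by one such part.\<close>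

definition lyndon_coeff :: "nat list => nat => nat => gen_fun" where "lyndon_coeff w i k = of_nat (i * sum_list w) * (gen_y (i * sum_list w)^k *
   (z_mon (mset w)^(i * k) * mps_const (power_subst k (lie_h i w))))"

definition lyndon_log :: "nat list => nat => gen_fun" where
 "lyndon_log w n = (\<Sum>i | i > 0 & i * sum_list w dvd n. lyndon_coeff w i (n div (i * sum_list w)))"

lemma finite_lyndon_log_index:
 fixes n :: nat
 assumes n: "n > 0"
 shows "finite {i. i > 0 & i * sum_list w dvd n}"
proof (rule finite_subset)
 show "{i. i > 0 & i * sum_list w dvd n} <= {..n}" proof
  fix i assume "i:{i. i > 0 & i * sum_list w dvd n}"
  hence "i dvd n" using dvd_mult_left[of i "sum_list w" n] by simp
  thus "i:{..n}" using n by (auto dest: dvd_imp_le)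
 qed
qed simp

text \<open>The closed form of the cores is inserted and the sum is regrouped by Lyndon words. A
  finite set \<open>W\<close> suffices, because a Lyndon word of size greater than n contributes
  nothing in degree n.\<close>

lemma peirce_log_lyndon:
 assumes n: "n > 0" and W: "finite W" "W <= lyndon_words" "!!w. w:lyndon_words ==> sum_list w <= n ==> w:W"
 shows "(\<Sum>s | s dvd n. of_nat s * (gen_y s^(n div s) * (SUM alpha:partitions_of s. z_mon alpha^(n div s) * mps_const (core_sym (n div s) alpha)))) =
  (SUM w:W. lyndon_log w n)" (is "?l = _")
proof -
 have "?l = (\<Sum>s | s dvd n. SUM alpha:partitions_of s. SUM (w, i):lyndon_roots alpha. lyndon_coeff w i (n div s))"
 proof (rule sum_eqI, goal_cases) case (1 s)
  hence s: "s > 0" "n div s > 0" using n by (auto elim!: dvdE)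
  show ?case unfolding sum_distrib_left proof (rule sum_eqI, goal_cases)
   case alpha: (1 alpha)
   have "of_nat s * (gen_y s^(n div s) * (z_mon alpha^(n div s) * mps_const (core_sym (n div s) alpha))) =
     (SUM (w, i):lyndon_roots alpha. of_nat s * (gen_y s^(n div s) * (z_mon alpha^(n div s) * mps_const (power_subst (n div s) (lie_h i w)))))"
    unfolding core_sym_power_subst[OF s(2)] core_sym_lyndon[OF alpha s(1)] lyndon_sym_def
    by (simp add: power_subst_sum mps_const_sum sum_distrib_left case_prod_unfold)
   also have "... = (SUM (w, i):lyndon_roots alpha. lyndon_coeff w i (n div s))" proof (rule sum_eqI, clarify)
    fix w i assume wi: "(w, i):lyndon_roots alpha"
    have si: "i * sum_list w = s" using lyndon_rootsD(4)[OF wi] alpha by (simp add: partitions_of_def)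
    have "z_mon alpha = z_mon (mset w)^i" unfolding z_mon_power lyndon_rootsD(3)[OF wi] ..
    thus "of_nat s * (gen_y s^(n div s) * (z_mon alpha^(n div s) * mps_const (power_subst (n div s) (lie_h i w)))) = lyndon_coeff w i (n div s)"
     unfolding lyndon_coeff_def si by (simp only: power_mult)
   qed
   finally show ?case .
  qed
 qed
 also have "... = (SUM (s, alpha, w, i):(SIGMA s:{s. s dvd n}. SIGMA alpha:partitions_of s. lyndon_roots alpha). lyndon_coeff w i (n div s))"
  using n by (simp add: sum.Sigma finite_partitions_of finite_lyndon_roots case_prod_unfold)
 also have "... = (SUM (w, i):(SIGMA w:W. {i. i > 0 & i * sum_list w dvd n}). lyndon_coeff w i (n div (i * sum_list w)))"
 proof (rule sum.reindex_bij_witness[where j = "%(s, alpha, w, i). (w, i)" and i = "%(w, i). (i * sum_list w, repeat_mset i (mset w), w, i)"])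
  fix x assume x: "x:(SIGMA s:{s. s dvd n}. SIGMA alpha:partitions_of s. lyndon_roots alpha)"
  obtain s alpha w i where xe: "x = (s, alpha, w, i)" by (metis surj_pair)
  have s: "s dvd n" and alpha: "alpha:partitions_of s" and wi: "(w, i):lyndon_roots alpha" using x by (auto simp: xe)
  note r = lyndon_rootsD[OF wi]
  have si: "i * sum_list w = s" using r(4) alpha(1) by (simp add: partitions_of_def)
  show "(case case x of (s, alpha, w, i) => (w, i) of (w, i) => (i * sum_list w, repeat_mset i (mset w), w, i)) = x" using r(3) si by (simp add: xe)
  have "sum_list w <= i * sum_list w" using r(2) by simp
  also have "... <= n" using s n unfolding si by (rule dvd_imp_le)
  finally have "w:W" by (rule W(3)[OF r(1)])
  thus "(case x of (s, alpha, w, i) => (w, i)):(SIGMA w:W. {i. i > 0 & i * sum_list w dvd n})" using r(2) si s by (simp add: xe)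
  show "(case case x of (s, alpha, w, i) => (w, i) of (w, i) => lyndon_coeff w i (n div (i * sum_list w))) = (case x of (s, alpha, w, i) => lyndon_coeff w i (n div s))"
   using si by (simp add: xe)
 next fix y assume y: "y:(SIGMA w:W. {i. i > 0 & i * sum_list w dvd n})"
  obtain w i where ye: "y = (w, i)" by (cases y)
  have w: "w:lyndon_words" "i > 0" "i * sum_list w dvd n" using y W(2) by (auto simp: ye)
  show "(case y of (w, i) => (i * sum_list w, repeat_mset i (mset w), w, i)):(SIGMA s:{s. s dvd n}. SIGMA alpha:partitions_of s. lyndon_roots alpha)"
   using lyndon_roots_repeat[OF w(1,2)] w(3) by (simp add: ye)
  show "(case case y of (w, i) => (i * sum_list w, repeat_mset i (mset w), w, i) of (s, alpha, w, i) => (w, i)) = y" by (simp add: ye)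
 qed
 also have "... = (SUM w:W. lyndon_log w n)" unfolding lyndon_log_def using finite_lyndon_log_index[OF n] W(2) lyndon_word_sum
  by (subst sum.Sigma[OF W(1)]) (auto simp: case_prod_unfold)
 finally show ?thesis .
qed

definition scaled_partitions :: "nat => nat => nat multiset set" where "scaled_partitions d n = {rho:partitions. \<Sum>\<^sub># rho * d = n}"

lemma finite_scaled_partitions:
 assumes "d > 0" shows "finite (scaled_partitions d n)"
proof (rule finite_subset[OF _ finite_partitions_of[of "n div d"]])
 show "scaled_partitions d n <= partitions_of (n div d)" using assms by (auto simp: scaled_partitions_def partitions_of_def)
qed

lemma sum_mset_count:
 assumes "finite A" "set_mset rho <= A"
 shows "(SUM i:A. i * count rho i) = \<Sum>\<^sub># (rho :: nat multiset)" using assms(2)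
proof (induction rho) case (add x rho)
 have "(SUM i:A. i * count (add_mset x rho) i) = (SUM i:A. i * count rho i + (if i = x then x else 0))" by (rule sum_eqI) simp
 thus ?case using add assms(1) by (simp add: sum.distrib sum.delta)
qed simp

text \<open>Newton's identity is applied to one part size i at a time, with weight i; lowering the
  multiplicity of i by k means removing k copies of i from \<open>rho\<close>.\<close>

lemma cycle_index_part_newton:
 fixes x :: "nat => nat => symfun"
 defines "C \<equiv> %rho. PROD i:set_mset rho. cycle_index (count rho i) (x i)"
 shows "of_nat (\<Sum>\<^sub># rho) * C rho = (SUM (i, k):(SIGMA i:set_mset rho. {1..count rho i}). of_nat i * (x i k * C (rho - replicate_mset k i)))" (is "?l = _")
proof -
 have C: "C tau = (PROD i:A. cycle_index (count tau i) (x i))" if "finite A" "set_mset tau <= A" for tau A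
  unfolding C_def by (rule prod.mono_neutral_left[OF that]) (simp add: not_in_iff)
 have i: "of_nat (count rho i) * C rho = (\<Sum>k=1..count rho i. x i k * C (rho - replicate_mset k i))" if i: "i \<in># rho" for i proof -
  let ?R = "PROD j:set_mset rho - {i}. cycle_index (count rho j) (x j)"
  have "of_nat (count rho i) * C rho = (of_nat (count rho i) * cycle_index (count rho i) (x i)) * ?R"
   unfolding C_def using i by (subst prod.remove[of _ i]) (simp_all add: mult_ac)
  also have "... = (\<Sum>k=1..count rho i. x i k * (cycle_index (count rho i - k) (x i) * ?R))"
   unfolding cycle_index_newton by (simp add: sum_distrib_right mult.assoc)
  also have "... = (\<Sum>k=1..count rho i. x i k * C (rho - replicate_mset k i))" proof (rule sum_eqI, goal_cases)
   case (1 k)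
   let ?t1 = "(PROD j:set_mset rho - {i}. cycle_index (count (rho - replicate_mset k i) j) (x j))"
   have "C (rho - replicate_mset k i) = (PROD j:set_mset rho. cycle_index (count (rho - replicate_mset k i) j) (x j))"
    by (rule C) (auto dest: in_diffD)
   also have "... = cycle_index (count rho i - k) (x i) * ?t1" using i by (subst prod.remove[of _ i]) simp_all
   also have "?t1 = ?R" by (rule prod.cong[OF refl]) simp
   finally show ?case by simp
  qed
  finally show ?thesis .
 qed
 have "\<Sum>\<^sub># rho = (SUM i:set_mset rho. i * count rho i)" by (simp add: sum_mset_count)
 hence "?l = (SUM i:set_mset rho. of_nat i * (of_nat (count rho i) * C rho))" by (simp add: sum_distrib_right mult.assoc)
 also have "... = (SUM i:set_mset rho. \<Sum>k=1..count rho i. of_nat i * (x i k * C (rho - replicate_mset k i)))"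
  by (rule sum_eqI) (simp only: i sum_distrib_left)
 finally show ?thesis by (simp add: sum.Sigma)
qed

lemma lyndon_term_eq:
 assumes "rho:partitions"
 shows "lyndon_term w rho = y_mon (image_mset (%i. i * sum_list w) rho) * (z_mon (mset w)^(\<Sum>\<^sub># rho) *
  mps_const (PROD i:set_mset rho. cycle_index (count rho i) (%k. power_subst k (lie_h i w))))"
proof -
 have "mset (concat (replicate n w)) = repeat_mset n (mset w)" for n using mset_word_power[of n w] by (simp add: word_power_def)
 thus ?thesis by (simp add: lyndon_term_def z_mon_power plethysm_sym_L_part[OF assms] mult.assoc)
qed

lemma y_mon_add: "y_mon (alpha + beta) = y_mon alpha * y_mon beta" by (simp add: y_mon_def)

lemma y_mon_replicate: "y_mon (replicate_mset k i) = gen_y i^k" by (induction k) (simp_all add: y_mon_def)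

lemma lyndon_term_newton:
 assumes rho: "rho:partitions"
 shows "of_nat (\<Sum>\<^sub># rho * sum_list w) * lyndon_term w rho =
  (SUM (i, k):(SIGMA i:set_mset rho. {1..count rho i}). lyndon_coeff w i k * lyndon_term w (rho - replicate_mset k i))"
proof -
 let ?x = "%i k. power_subst k (lie_h i w)"
 let ?C = "%rho. PROD i:set_mset rho. cycle_index (count rho i) (?x i)"
 let ?d = "sum_list w"
 let ?y = "%rho. y_mon (image_mset (%i. i * ?d) rho)" and ?z = "%rho. z_mon (mset w)^(\<Sum>\<^sub># rho)"
 have "of_nat (\<Sum>\<^sub># rho * ?d) * lyndon_term w rho = of_nat ?d * (?y rho * (?z rho * mps_const (of_nat (\<Sum>\<^sub># rho) * ?C rho)))"
  by (simp only: lyndon_term_eq[OF rho] mps_const_hom mps_const_of_nat of_nat_mult mult_ac)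
 also have "... = (SUM (i, k):(SIGMA i:set_mset rho. {1..count rho i}). of_nat ?d * (?y rho * (?z rho * mps_const (of_nat i * (?x i k * ?C (rho - replicate_mset k i))))))"
  unfolding cycle_index_part_newton by (simp add: mps_const_sum sum_distrib_left case_prod_unfold)
 also have "... = (SUM (i, k):(SIGMA i:set_mset rho. {1..count rho i}). lyndon_coeff w i k * lyndon_term w (rho - replicate_mset k i))"
 proof (rule sum_eqI, clarify) fix i k assume i: "i \<in># rho" and k: "k:{1..count rho i}"
  define tau where "tau = rho - replicate_mset k i"
  have "replicate_mset k i \<subseteq># rho" using k by (simp add: count_le_replicate_mset_subset_eq[symmetric])
  hence r: "rho = tau + replicate_mset k i" by (simp add: tau_def)
  have t: "tau:partitions" using rho by (auto simp: tau_def partitions_def dest: in_diffD)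
  have y: "?y rho = ?y tau * gen_y (i * ?d)^k" unfolding r by (simp add: y_mon_add y_mon_replicate)
  have z: "?z rho = ?z tau * z_mon (mset w)^(i * k)" unfolding r by (simp add: power_add mult.commute)
  show "of_nat ?d * (?y rho * (?z rho * mps_const (of_nat i * (?x i k * ?C (rho - replicate_mset k i))))) =
    lyndon_coeff w i k * lyndon_term w (rho - replicate_mset k i)" unfolding tau_def[symmetric] y z lyndon_term_eq[OF t] lyndon_coeff_def
   by (simp only: mps_const_hom mps_const_of_nat of_nat_mult mult_ac)
 qed
 finally show ?thesis .
qed

definition lyndon_fps :: "nat list => gen_fun fps" where "lyndon_fps w = Abs_fps (%n. SUM rho:scaled_partitions (sum_list w) n. lyndon_term w rho)"

lemma lyndon_fps_0:
 assumes "sum_list w > 0"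
 shows "fps_nth (lyndon_fps w) 0 = 1"
proof -
 have "scaled_partitions (sum_list w) 0 = {{#}}" proof -
  have "rho = {#}" if rho: "rho:scaled_partitions (sum_list w) 0" for rho proof -
   have "rho:partitions" "\<Sum>\<^sub># rho * sum_list w = 0" using rho by (auto simp: scaled_partitions_def)
   moreover from this have "\<Sum>\<^sub># rho = 0" using assms by (metis mult_eq_0_iff less_irrefl)
   ultimately show ?thesis by (cases rho) (auto simp: partitions_def)
  qed
  thus ?thesis by (auto simp: scaled_partitions_def partitions_def)
 qed
 moreover have "{#}:partitions" by (simp add: partitions_def)
 ultimately show ?thesis by (simp add: lyndon_fps_def lyndon_term_eq y_mon_def)
qed

text \<open>A partition with a chosen part i and a number k of copies to be removed is traded for
  the degree j = i * k * |w| of the removed piece together with the remaining partition.\<close>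

lemma lyndon_fps_recursion:
 assumes d: "sum_list w > 0"
 shows "of_nat n * fps_nth (lyndon_fps w) n = (\<Sum>j=1..n. lyndon_log w j * fps_nth (lyndon_fps w) (n - j))" (is "?l = _")
proof -
 let ?d = "sum_list w" and ?SP = "scaled_partitions (sum_list w)"
 let ?f = "%(rho, i, k). lyndon_coeff w i k * lyndon_term w (rho - replicate_mset k i)"
 let ?g = "%(j, i, tau). lyndon_coeff w i (j div (i * ?d)) * lyndon_term w tau"
 let ?A = "SIGMA rho:?SP n. SIGMA i:set_mset rho. {1..count rho i}"
 let ?B = "SIGMA j:{1..n}. SIGMA i:{i. i > 0 & i * ?d dvd j}. ?SP (n - j)"
 define J :: "nat multiset \<times> nat \<times> nat => nat \<times> nat \<times> nat multiset"
  where "J = (%(rho, i, k). (i * k * ?d, i, rho - replicate_mset k i))"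
 define I :: "nat \<times> nat \<times> nat multiset => nat multiset \<times> nat \<times> nat"
  where "I = (%(j, i, tau). (tau + replicate_mset (j div (i * ?d)) i, i, j div (i * ?d)))"
 have "?l = (SUM rho:?SP n. of_nat (\<Sum>\<^sub># rho * ?d) * lyndon_term w rho)" unfolding lyndon_fps_def fps_nth_Abs_fps sum_distrib_left
  by (rule sum_eqI) (simp add: scaled_partitions_def del: of_nat_mult)
 also have "... = (SUM rho:?SP n. SUM (i, k):(SIGMA i:set_mset rho. {1..count rho i}). ?f (rho, i, k))" proof (rule sum_eqI, goal_cases)
  case (1 rho)
  hence "rho:partitions" by (simp add: scaled_partitions_def)
  thus ?case by (simp only: lyndon_term_newton prod.case)
 qed
 also have "... = sum ?f ?A" by (simp add: sum.Sigma finite_scaled_partitions[OF d] case_prod_unfold)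
 also have "... = sum ?g ?B" proof (rule sum.reindex_bij_witness[where j = J and i = I])
  fix x assume x: "x:?A" obtain rho i k where xe: "x = (rho, i, k)" by (cases x)
  have rho: "rho:partitions" "\<Sum>\<^sub># rho * ?d = n" and i: "i \<in># rho" and k: "1 <= k" "k <= count rho i"
   using x by (auto simp: xe scaled_partitions_def)
  have i0: "i > 0" using i rho(1) by (auto simp: partitions_def intro: Nat.gr0I)
  define tau where "tau = rho - replicate_mset k i"
  have "replicate_mset k i \<subseteq># rho" using k by (simp add: count_le_replicate_mset_subset_eq[symmetric])
  hence r: "rho = tau + replicate_mset k i" by (simp add: tau_def)
  have t: "tau:partitions" using rho by (auto simp: tau_def partitions_def dest: in_diffD)
  have kd: "i * k * ?d div (i * ?d) = k" using i0 d by simp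
  have n: "n = \<Sum>\<^sub># tau * ?d + i * k * ?d" using rho(2) unfolding r by (simp add: algebra_simps)
  show "I (J x) = x" by (simp only: I_def J_def xe prod.case kd tau_def[symmetric] r[symmetric])
  have "i * k * ?d \<ge> 1" using i0 k d by (simp add: Suc_le_eq)
  thus "J x:?B" using t n i0 by (simp add: J_def xe scaled_partitions_def flip: tau_def)
  show "?g (J x) = ?f x" by (simp only: J_def xe prod.case kd)
 next fix y assume y: "y:?B"
  obtain j i tau where ye: "y = (j, i, tau)" by (cases y)
  have j: "1 <= j" "j <= n" and i: "i > 0" "i * ?d dvd j" and tau: "tau:partitions" "\<Sum>\<^sub># tau * ?d = n - j"
   using y by (auto simp: ye scaled_partitions_def)
  obtain k where k: "j = i * ?d * k" using i(2) by blast
  have kd: "j div (i * ?d) = k" unfolding k using i(1) d by simp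
  have k0: "k > 0" using j(1) k by (auto intro: Nat.gr0I)
  show "J (I y) = y" using k kd by (simp add: I_def J_def ye mult_ac)
  have "(\<Sum>\<^sub># tau + k * i) * ?d = n" using tau(2) j(2) k by (simp add: algebra_simps)
  thus "I y:?A" using tau(1) k0 i(1) kd by (auto simp: I_def ye scaled_partitions_def partitions_def in_replicate_mset)
 qed
 also have "... = (\<Sum>j=1..n. \<Sum>i | i > 0 & i * ?d dvd j. SUM tau:?SP (n - j). lyndon_coeff w i (j div (i * ?d)) * lyndon_term w tau)" proof -
  have "finite {i. i > 0 & i * ?d dvd j}" if "j:{1..n}" for j using that by (intro finite_lyndon_log_index) simp
  thus ?thesis by (simp add: sum.Sigma finite_scaled_partitions[OF d] case_prod_unfold)
 qed
 also have "... = (\<Sum>j=1..n. lyndon_log w j * fps_nth (lyndon_fps w) (n - j))" by (simp add: lyndon_log_def lyndon_fps_def sum_product)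
 finally show ?thesis .
qed

definition log_fps :: "nat list => gen_fun fps" where "log_fps w = Abs_fps (%n. if n = 0 then 0 else lyndon_log w n)"

lemma lyndon_fps_deriv:
 assumes "sum_list w > 0"
 shows "fps_X * fps_deriv (lyndon_fps w) = log_fps w * lyndon_fps w"
proof (rule fps_ext, goal_cases) case (1 n)
 have "fps_nth (log_fps w * lyndon_fps w) n = (\<Sum>j=1..n. lyndon_log w j * fps_nth (lyndon_fps w) (n - j))"
  unfolding fps_mult_nth by (rule sum.mono_neutral_cong_right) (auto simp: log_fps_def Suc_le_eq)
 thus ?case unfolding fps_X_deriv_nth lyndon_fps_recursion[OF assms] by simp
qed

lemma lyndon_product_deriv:
 assumes "finite W" "!!w. w:W ==> sum_list w > 0"
 shows "fps_X * fps_deriv (PROD w:W. lyndon_fps w) = (SUM w:W. log_fps w) * (PROD w:W. lyndon_fps w)" using assms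
proof (induction W rule: finite_induct) case empty
 thus ?case by simp
next case (insert w W)
 let ?P = "PROD w:W. lyndon_fps w"
 have IH: "fps_X * fps_deriv ?P = (SUM w:W. log_fps w) * ?P" by (rule insert.IH) (use insert.prems in simp)
 have D: "fps_X * fps_deriv (lyndon_fps w) = log_fps w * lyndon_fps w" by (rule lyndon_fps_deriv) (use insert.prems in simp)
 have "fps_X * fps_deriv (lyndon_fps w * ?P) = lyndon_fps w * (fps_X * fps_deriv ?P) + (fps_X * fps_deriv (lyndon_fps w)) * ?P"
  by (simp add: algebra_simps)
 also have "... = (log_fps w + (SUM w:W. log_fps w)) * (lyndon_fps w * ?P)" unfolding IH D by (simp only: distrib_left distrib_right mult_ac add_ac)
 finally show ?case using insert.hyps by simp
qed

lemma fps_nth_0_prod: "fps_nth (PROD w:W. f w) 0 = (PROD w:W. fps_nth (f w :: 'r::comm_ring_1 fps) 0)"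
 by (induction W rule: infinite_finite_induct) simp_all

text \<open>Up to degree N the finite product has the same logarithmic derivative as the Peirce
  series, and both start with 1, so the recursion makes them equal there.\<close>

theorem lyndon_product_peirce:
 assumes W: "finite W" "W <= lyndon_words" "!!w. w:lyndon_words ==> sum_list w <= N ==> w:W"
 shows "n <= N ==> fps_nth (PROD w:W. lyndon_fps w) n = peirce_series n"
proof (induction n rule: less_induct) case (less n)
 let ?G = "PROD w:W. lyndon_fps w"
 have pos: "sum_list w > 0" if "w:W" for w using that W(2) lyndon_word_sum by blast
 show ?case proof (cases "n = 0")
  case True
  have "fps_nth ?G 0 = 1" unfolding fps_nth_0_prod using lyndon_fps_0[OF pos] by (intro prod.neutral) simp
  thus ?thesis using True peirce_series_0 by simp
 next case False
  have "of_nat n * fps_nth ?G n = fps_nth ((SUM w:W. log_fps w) * ?G) n"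
   using arg_cong[OF lyndon_product_deriv[OF W(1) pos], of "%f. fps_nth f n"] by (simp only: fps_X_deriv_nth)
  also have "... = (\<Sum>k=1..n. (SUM w:W. lyndon_log w k) * fps_nth ?G (n - k))"
   unfolding fps_mult_nth by (rule sum.mono_neutral_cong_right) (auto simp: log_fps_def Suc_le_eq fps_sum_nth)
  also have "... = (\<Sum>k=1..n. (\<Sum>s | s dvd k. of_nat s * (gen_y s^(k div s) *
    (SUM alpha:partitions_of s. z_mon alpha^(k div s) * mps_const (core_sym (k div s) alpha)))) * peirce_series (n - k))"
  proof (rule sum_eqI, goal_cases) case k: (1 k)
   have "fps_nth ?G (n - k) = peirce_series (n - k)" using less.IH[of "n - k"] k less.prems by simp
   moreover have "(\<Sum>s | s dvd k. of_nat s * (gen_y s^(k div s) * (SUM alpha:partitions_of s. z_mon alpha^(k div s) * mps_const (core_sym (k div s) alpha)))) =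
     (SUM w:W. lyndon_log w k)" by (rule peirce_log_lyndon[OF _ W(1,2)]) (use k less.prems W(3) in auto)
   ultimately show ?case by simp
  qed
  also have "... = of_nat n * peirce_series n" by (rule peirce_series_recursion[symmetric])
  finally have e: "of_nat n * fps_nth ?G n = of_nat n * peirce_series n" .
  \<comment> \<open>The coefficients contain the rational numbers, so n can be cancelled.\<close>
  have "gen_const (1 / of_nat n) * of_nat n = 1"
   unfolding gen_const_simps(5)[symmetric] gen_const_simps(4)[symmetric] using False by (simp add: gen_const_simps)
  thus ?thesis using arg_cong[OF e, of "%x. gen_const (1 / of_nat n) * x"] by (simp add: mult.assoc[symmetric])
 qed
qed

section \<open>Weighted degree and removal of the auxiliary variable\<close>

text \<open>The z-monomials occurring in degree n have index sum n, so the z-exponents alone recover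
  the degree; y-variables get weight 0.\<close>

definition z_weight :: "(yz_var \<Rightarrow>\<^sub>0 nat) => nat" where "z_weight m = (SUM v:keys m. (case v of Y i => 0 | Z i => i) * lookup m v)"

lemma z_weight_superset:
 assumes "finite A" "keys m <= A"
 shows "z_weight m = (SUM v:A. (case v of Y i => 0 | Z i => i) * lookup m v)"
 unfolding z_weight_def by (rule sum.mono_neutral_left[OF assms]) (simp add: in_keys_iff)

lemma z_weight_add: "z_weight (a + b) = z_weight a + z_weight b"
proof -
 let ?A = "keys a Un keys b"
 have "z_weight (a + b) = (SUM v:?A. (case v of Y i => 0 | Z i => i) * lookup (a + b) v)" by (rule z_weight_superset) (simp_all add: keys_add)
 thus ?thesis by (simp add: z_weight_superset[of ?A] lookup_add distrib_left sum.distrib)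
qed

lemma z_weight_simps: "z_weight 0 = 0" "z_weight (Poly_Mapping.single (Y i) 1) = 0" "z_weight (Poly_Mapping.single (Z i) 1) = i"
 by (simp_all add: z_weight_def)

definition homogeneous :: "nat => gen_fun => bool" where "homogeneous n f \<longleftrightarrow> (\<forall>m. mps_nth f m ~= 0 --> z_weight m = n)"

lemma homogeneous_mult:
 assumes "homogeneous i f" "homogeneous j g"
 shows "homogeneous (i + j) (f * g)" unfolding homogeneous_def
proof (intro allI impI) fix m assume "mps_nth (f * g) m ~= 0"
 hence "(\<Sum>(a, b) | a + b = m. mps_nth f a * mps_nth g b) ~= 0" by (simp add: mps_nth_mult)
 then obtain p where "p:{(a, b). a + b = m}" "(case p of (a, b) => mps_nth f a * mps_nth g b) ~= 0" by (rule sum.not_neutral_contains_not_neutral)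
 then obtain a b where ab: "a + b = m" "mps_nth f a * mps_nth g b ~= 0" by auto
 hence "mps_nth f a ~= 0" "mps_nth g b ~= 0" by (metis mult_zero_left, metis mult_zero_right)
 with ab(1) show "z_weight m = i + j" using assms z_weight_add[of a b] by (auto simp: homogeneous_def)
qed

lemma homogeneous_sum: "(!!a. a:A ==> homogeneous n (f a)) ==> homogeneous n (sum f A)"
 unfolding homogeneous_def mps_nth_sum by (metis sum.not_neutral_contains_not_neutral)

lemma homogeneous_const: "homogeneous 0 (mps_const c)" by (auto simp: homogeneous_def mps_nth_const z_weight_simps)

lemma homogeneous_y_mon: "homogeneous 0 (y_mon alpha)"
proof (induction alpha) case empty
 show ?case using homogeneous_const[of 1] by (simp add: y_mon_def)
next case (add i alpha)
 have "homogeneous 0 (gen_y i)" by (auto simp: homogeneous_def mps_var_def z_weight_simps[simplified])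
 from homogeneous_mult[OF this add] show ?case by (simp add: y_mon_def)
qed

lemma homogeneous_z_mon: "homogeneous (\<Sum>\<^sub># alpha) (z_mon alpha)"
proof (induction alpha) case empty
 show ?case using homogeneous_const[of 1] by (simp add: z_mon_def)
next case (add i alpha)
 have "homogeneous i (gen_z i)" by (auto simp: homogeneous_def mps_var_def z_weight_simps[simplified])
 from homogeneous_mult[OF this add] show ?case by (simp add: z_mon_def)
qed

lemma homogeneous_lyndon_term:
 assumes "rho:partitions"
 shows "homogeneous (\<Sum>\<^sub># rho * sum_list w) (lyndon_term w rho)"
proof -
 have "homogeneous (\<Sum>\<^sub># rho * sum_list w) (z_mon (mset w)^(\<Sum>\<^sub># rho))"
  unfolding z_mon_power using homogeneous_z_mon[of "repeat_mset (\<Sum>\<^sub># rho) (mset w)"] by (simp add: repeat_mset_sum sum_mset_sum_list)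
 from homogeneous_mult[OF homogeneous_y_mon homogeneous_mult[OF this homogeneous_const]]
 show ?thesis unfolding lyndon_term_eq[OF assms] by simp
qed

definition graded :: "gen_fun fps => bool" where "graded f \<longleftrightarrow> (\<forall>n. homogeneous n (fps_nth f n))"

text \<open>The auxiliary variable is set to 1. In a graded series a monomial can occur only in the
  degree given by its weight, so what would be an infinite sum has a single term.\<close>

definition specialize :: "gen_fun fps => gen_fun" where "specialize f = Abs_mps (%m. mps_nth (fps_nth f (z_weight m)) m)"

lemma graded_lyndon_fps: "graded (lyndon_fps w)" unfolding graded_def lyndon_fps_def fps_nth_Abs_fps
 by (intro allI homogeneous_sum) (use homogeneous_lyndon_term in \<open>auto simp: scaled_partitions_def\<close>)

lemma graded_mult:
 assumes "graded f" "graded g"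
 shows "graded (f * g)" unfolding graded_def fps_mult_nth
proof (intro allI homogeneous_sum) fix n i :: nat assume "i:{0..n}"
 thus "homogeneous n (fps_nth f i * fps_nth g (n - i))"
  using homogeneous_mult[of i "fps_nth f i" "n - i" "fps_nth g (n - i)"] assms by (simp add: graded_def)
qed

lemma graded_one: "graded 1" unfolding graded_def
proof
 show "homogeneous n (fps_nth 1 n)" for n using homogeneous_const[of 1] by (cases n) (simp_all add: homogeneous_def)
qed

text \<open>For a monomial a of the first factor only the degree \<open>z_weight a\<close> counts,
  and additivity of the weight places the other factor in its matching degree.\<close>

lemma specialize_mult:
 assumes f: "graded f"
 shows "specialize (f * g) = specialize f * specialize g"
proof (rule mps_eqI, goal_cases) case (1 m)
 let ?n = "z_weight m"
 have "mps_nth (specialize (f * g)) m = (\<Sum>k=0..?n. \<Sum>(a, b) | a + b = m. mps_nth (fps_nth f k) a * mps_nth (fps_nth g (?n - k)) b)"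
  by (simp add: specialize_def fps_mult_nth mps_nth_mult)
 also have "... = (\<Sum>(a, b) | a + b = m. \<Sum>k=0..?n. mps_nth (fps_nth f k) a * mps_nth (fps_nth g (?n - k)) b)"
  by (subst sum.swap) (simp add: case_prod_unfold)
 also have "... = (\<Sum>(a, b) | a + b = m. mps_nth (specialize f) a * mps_nth (specialize g) b)" proof (rule sum_eqI, clarify)
  fix a b :: "yz_var \<Rightarrow>\<^sub>0 nat" assume m: "m = a + b"
  have "mps_nth (fps_nth f k) a = 0" if "k ~= z_weight a" for k using f that by (auto simp: graded_def homogeneous_def)
  hence "(\<Sum>k=0..z_weight (a + b). mps_nth (fps_nth f k) a * mps_nth (fps_nth g (z_weight (a + b) - k)) b) =
    (\<Sum>k=0..z_weight (a + b). if k = z_weight a then mps_nth (fps_nth f (z_weight a)) a * mps_nth (fps_nth g (z_weight (a + b) - z_weight a)) b else 0)"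
   by (intro sum.cong refl) simp
  also have "... = mps_nth (specialize f) a * mps_nth (specialize g) b" by (simp add: z_weight_add sum.delta specialize_def)
  finally show "(\<Sum>k=0..z_weight (a + b). mps_nth (fps_nth f k) a * mps_nth (fps_nth g (z_weight (a + b) - k)) b) =
    mps_nth (specialize f) a * mps_nth (specialize g) b" .
 qed
 also have "... = mps_nth (specialize f * specialize g) m" by (simp add: mps_nth_mult)
 finally show ?case .
qed

lemma specialize_one: "specialize 1 = 1"
proof (rule mps_eqI, goal_cases) case (1 m)
 show ?case by (cases "z_weight m") (auto simp: specialize_def mps_nth_one z_weight_simps)
qed

lemma specialize_prod:
 assumes "finite W"
 shows "specialize (PROD w:W. lyndon_fps w) = (PROD w:W. specialize (lyndon_fps w))"
 using assms by (induction W rule: finite_induct) (simp_all add: specialize_one specialize_mult graded_lyndon_fps)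

section \<open>Convergence of the infinite sums and of the product\<close>

lemma mps_tendstoI:
 assumes "!!m. \<forall>\<^sub>F x in F. mps_nth (f x) m = mps_nth l m"
 shows "(f \<longlongrightarrow> l) F"
proof (rule topological_tendstoI) fix U assume "open U" "l:U"
 then obtain M where M: "finite M" "!!g. (ALL m:M. mps_nth g m = mps_nth l m) ==> g:U" unfolding open_mps_def by metis
 have "\<forall>\<^sub>F x in F. ALL m:M. mps_nth (f x) m = mps_nth l m" using M(1) assms by (simp add: eventually_ball_finite_distrib)
 thus "\<forall>\<^sub>F x in F. f x:U" by (rule eventually_mono) (rule M(2))
qed

lemma eventually_finite_superset: "finite B ==> B <= A ==> \<forall>\<^sub>F F in finite_subsets_at_top A. finite F & B <= F & F <= A"
 unfolding eventually_finite_subsets_at_top by blast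

text \<open>Each coefficient is affected by the finite index set \<open>B m\<close> only, so it is
  constant along all larger partial sums.\<close>

lemma mps_has_sum:
 assumes B: "!!m. finite (B m)" "!!m. B m <= A" "!!m a. a:A ==> a ~: B m ==> mps_nth (f a) m = 0"
  and S: "!!m. mps_nth S m = (SUM a:B m. mps_nth (f a) m)"
 shows "(f has_sum S) A" unfolding has_sum_def
proof (rule mps_tendstoI) fix m
 have "\<forall>\<^sub>F F in finite_subsets_at_top A. finite F & B m <= F & F <= A" by (rule eventually_finite_superset[OF B(1,2)])
 thus "\<forall>\<^sub>F F in finite_subsets_at_top A. mps_nth (sum f F) m = mps_nth S m" proof (rule eventually_mono)
  fix F assume F: "finite F & B m <= F & F <= A"
  thus "mps_nth (sum f F) m = mps_nth S m" unfolding mps_nth_sum S by (intro sum.mono_neutral_right) (use B(3) in auto)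
 qed
qed

lemma lyndon_term_has_sum:
 assumes "w:lyndon_words"
 shows "(lyndon_term w has_sum specialize (lyndon_fps w)) partitions"
proof (rule mps_has_sum[where B = "%m. scaled_partitions (sum_list w) (z_weight m)"]) fix m
 show "finite (scaled_partitions (sum_list w) (z_weight m))" by (rule finite_scaled_partitions[OF lyndon_word_sum[OF assms]])
 show "scaled_partitions (sum_list w) (z_weight m) <= partitions" by (auto simp: scaled_partitions_def)
 show "mps_nth (lyndon_term w rho) m = 0" if "rho:partitions" "rho ~: scaled_partitions (sum_list w) (z_weight m)" for rho
  using homogeneous_lyndon_term[OF that(1), of w] that by (auto simp: homogeneous_def scaled_partitions_def)
 show "mps_nth (specialize (lyndon_fps w)) m = (SUM rho:scaled_partitions (sum_list w) (z_weight m). mps_nth (lyndon_term w rho) m)"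
  by (simp add: specialize_def lyndon_fps_def)
qed

definition short_lyndon :: "nat => nat list set" where "short_lyndon N = {w:lyndon_words. sum_list w <= N}"

lemma finite_short_lyndon: "finite (short_lyndon N)"
proof (rule finite_subset)
 show "short_lyndon N <= (UN n<=N. words n)" by (auto simp: short_lyndon_def words_def lyndon_words_def)
qed (simp add: finite_words)

text \<open>Homogeneity is read off from the finite Lyndon product, whose factors are visibly
  graded.\<close>

lemma homogeneous_peirce_series: "homogeneous n (peirce_series n)"
proof -
 have "graded (PROD w:W. lyndon_fps w)" if "finite W" for W
  using that by (induction W rule: finite_induct) (simp_all add: graded_one graded_mult graded_lyndon_fps)
 hence "graded (PROD w:short_lyndon n. lyndon_fps w)" using finite_short_lyndon by blast
 moreover have "fps_nth (PROD w:short_lyndon n. lyndon_fps w) n = peirce_series n"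
  by (rule lyndon_product_peirce[OF finite_short_lyndon _ _ order_refl]) (auto simp: short_lyndon_def)
 ultimately show ?thesis unfolding graded_def by metis
qed

lemma peirce_series_has_sum: "(peirce_series has_sum specialize (Abs_fps peirce_series)) UNIV"
proof (rule mps_has_sum[where B = "%m. {z_weight m}"])
 show "mps_nth (peirce_series n) m = 0" if "n ~: {z_weight m}" for n m using homogeneous_peirce_series[of n] that by (auto simp: homogeneous_def)
qed (simp_all add: specialize_def)

text \<open>A coefficient of weight N is final as soon as \<open>W\<close> contains the finitely
  many Lyndon words of size at most N.\<close>

lemma lyndon_product_limit:
 "((%W. PROD w:W. specialize (lyndon_fps w)) \<longlongrightarrow> specialize (Abs_fps peirce_series)) (finite_subsets_at_top lyndon_words)"
proof (rule mps_tendstoI) fix m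
 let ?N = "z_weight m"
 have "\<forall>\<^sub>F W in finite_subsets_at_top lyndon_words. finite W & short_lyndon ?N <= W & W <= lyndon_words"
  by (rule eventually_finite_superset[OF finite_short_lyndon]) (auto simp: short_lyndon_def)
 thus "\<forall>\<^sub>F W in finite_subsets_at_top lyndon_words. mps_nth (PROD w:W. specialize (lyndon_fps w)) m = mps_nth (specialize (Abs_fps peirce_series)) m"
 proof (rule eventually_mono) fix W assume W: "finite W & short_lyndon ?N <= W & W <= lyndon_words"
  hence "fps_nth (PROD w:W. lyndon_fps w) ?N = peirce_series ?N" by (intro lyndon_product_peirce[of W ?N ?N]) (auto simp: short_lyndon_def)
  moreover have "(PROD w:W. specialize (lyndon_fps w)) = specialize (PROD w:W. lyndon_fps w)" using W by (simp add: specialize_prod)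
  ultimately show "mps_nth (PROD w:W. specialize (lyndon_fps w)) m = mps_nth (specialize (Abs_fps peirce_series)) m" by (simp add: specialize_def)
 qed
qed

theorem theorem5p39:
  fixes Ehat :: "nat \<Rightarrow> nat set set \<Rightarrow> (nat set list \<Rightarrow>\<^sub>0 complex)"
    and E :: "nat \<Rightarrow> nat multiset \<Rightarrow> (nat set list \<Rightarrow>\<^sub>0 complex)"
  assumes Ehat: "\<And>n. saliola_family n (Ehat n)"
    and E: "\<And>n. cfpoi (invariant_algebra n) (partitions_of n) (E n)"
    and E_conj: "\<And>n. \<exists>u\<in>Units (invariant_algebra n). \<forall>\<rho>\<in>partitions_of n.
      E n \<rho> = u \<otimes>\<^bsub>invariant_algebra n\<^esub>
        (\<Sum>X | X \<in> set_partitions n \<and> block_type X = \<rho>. Ehat n X)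
        \<otimes>\<^bsub>invariant_algebra n\<^esub> inv\<^bsub>invariant_algebra n\<^esub> u"
  shows "(\<lambda>n. peirce_term (E n) n) summable_on UNIV \<and>
    (\<forall>w\<in>lyndon_words. lyndon_term w summable_on partitions) \<and>
    ((\<lambda>W. \<Prod>w\<in>W. \<Sum>\<^sub>\<infinity>\<rho>\<in>partitions. lyndon_term w \<rho>)
       \<longlongrightarrow> (\<Sum>\<^sub>\<infinity>n\<in>UNIV. peirce_term (E n) n)) (finite_subsets_at_top lyndon_words)"
proof -
 have "peirce_term (E n) n = peirce_series n" for n proof -
  obtain u where u: "u:Units (invariant_algebra n)" "!!rho. rho:partitions_of n ==> E n rho = u \<otimes>\<^bsub>invariant_algebra n\<^esub>
    (\<Sum>X | X:set_partitions n & block_type X = rho. Ehat n X)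
    \<otimes>\<^bsub>invariant_algebra n\<^esub> inv\<^bsub>invariant_algebra n\<^esub> u" using E_conj[of n] by blast
  show ?thesis by (rule peirce_term_series[OF Ehat u])
 qed
 hence p: "(%n. peirce_term (E n) n) = peirce_series" by (rule ext)
 have l: "infsum (lyndon_term w) partitions = specialize (lyndon_fps w)" if "w:lyndon_words" for w by (rule infsumI[OF lyndon_term_has_sum[OF that]])
 have "((%W. PROD w:W. infsum (lyndon_term w) partitions) \<longlongrightarrow> infsum peirce_series UNIV) (finite_subsets_at_top lyndon_words)"
 proof (rule Lim_transform_eventually)
  show "((%W. PROD w:W. specialize (lyndon_fps w)) \<longlongrightarrow> infsum peirce_series UNIV) (finite_subsets_at_top lyndon_words)"
   unfolding infsumI[OF peirce_series_has_sum] by (rule lyndon_product_limit)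
  \<comment> \<open>Along the filter \<open>W\<close> consists of Lyndon words, for which the inner
    infinite sums have been evaluated.\<close>
  have "\<forall>\<^sub>F W in finite_subsets_at_top lyndon_words. finite W & W <= lyndon_words" by (rule eventually_finite_subsets_at_top_weakI) simp
  thus "\<forall>\<^sub>F W in finite_subsets_at_top lyndon_words. (PROD w:W. specialize (lyndon_fps w)) = (PROD w:W. infsum (lyndon_term w) partitions)"
   by (rule eventually_mono) (use l in \<open>auto intro!: prod.cong\<close>)
 qed
 thus ?thesis unfolding p using has_sum_imp_summable[OF peirce_series_has_sum] has_sum_imp_summable[OF lyndon_term_has_sum] by blast
qed

end
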